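(* (a) Let $N\in\mathbb Z_{\ge0}$ and suppose $H_{r,s}(N):=H^{\mathbb C(q)}_{r,s}(q,q^N)$ is semisimple. Then the center of $H_{r,s}(N)$ is generated (as a $\mathbb C(q)$-algebra, indeed equals the set) by the elements $p(\mathcal L_1,\dots,\mathcal L_{r+s})$, $p$ a supersymmetric polynomial with coefficients in $\mathbb C(q)$. (b) The center of $H_{r,s}(q,\rho):=H^{\mathbb C(q,\rho)}_{r,s}(q,\rho)$ (with $q,\rho$ independent indeterminates) is generated by the elements $p(\mathcal L_1,\dots,\mathcal L_{r+s})$, $p$ a supersymmetric polynomial with coefficients in $\mathbb C(q,\rho)$.
   Context: For an integral domain $R$ and $q,\rho\in R$ with $q^{-1},\rho^{-1}\in R$, $q\ne q^{-1}$, $\delta=\frac{\rho-\rho^{-1}}{q-q^{-1}}\in R$, $H^R_{r,s}(q,\rho)$ is the unital $R$-algebra generated by $S_1,\dots,S_{r-1},S_{r+1},\dots,S_{r+s-1},E_{r,r+1}$ with relations: $(S_i-q)(S_i+q^{-1})=0$; $S_iS_{i+1}S_i=S_{i+1}S_iS_{i+1}$; $S_iS_j=S_jS_i$ ($|i-j|>1$); $E_{r,r+1}^2=\delta E_{r,r+1}$; $E_{r,r+1}S_j=S_jE_{r,r+1}$ ($j\ne r\pm1$); $\rho E_{r,r+1}=E_{r,r+1}S_{r-1}E_{r,r+1}=E_{r,r+1}S_{r+1}E_{r,r+1}$; $E_{r,r+1}S_{r-1}^{-1}S_{r+1}E_{r,r+1}S_{r-1}=E_{r,r+1}S_{r-1}^{-1}S_{r+1}E_{r,r+1}S_{r+1}$;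 $S_{r-1}E_{r,r+1}S_{r-1}^{-1}S_{r+1}E_{r,r+1}=S_{r+1}E_{r,r+1}S_{r-1}^{-1}S_{r+1}E_{r,r+1}$, with $S_i^{-1}=S_i-(q-q^{-1})$. For $j\le r<k$: $E_{j,k}=(S_{k-1}\cdots S_{r+1})(S_j^{-1}\cdots S_{r-1}^{-1})E_{r,r+1}(S_{r-1}^{-1}\cdots S_j^{-1})(S_{r+1}\cdots S_{k-1})$. Jucys-Murphy elements: $\mathcal L_1=0$; $\mathcal L_k=S_{k-1}^{-1}\mathcal L_{k-1}S_{k-1}^{-1}+S_{k-1}^{-1}$ ($2\le k\le r$); $\mathcal L_{r+1}=\rho(-\sum_{j=1}^rE_{j,r+1}+\delta)$; $\mathcal L_k=S_{k-1}\mathcal L_{k-1}S_{k-1}+S_{k-1}$ ($r+2\le k\le r+s$). A polynomial in $x_1,\dots,x_r,y_1,\dots,y_s$ is supersymmetric if symmetric in the $x$'s and separately in the $y$'s and the substitution $x_r=-y_1=t$ yields a polynomial independent of $t$; evaluation is $x_i\mapsto\mathcal L_i$, $y_j\mapsto\mathcal L_{r+j}$. *)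

theory Defs
  imports Complex_Main "HOL-Computational_Algebra.Polynomial"
    "HOL-Computational_Algebra.Fraction_Field" "HOL-Combinatorics.Permutations"
begin

datatype gen = S nat | E

datatype 'k hexp = Gen gen | Sc 'k | Pl "'k hexp" "'k hexp" | Tm "'k hexp" "'k hexp"

definition hprod :: "'k::field hexp list \<Rightarrow> 'k hexp" where
  "hprod xs = foldr Tm xs (Sc 1)"

definition hsum :: "'k::field hexp list \<Rightarrow> 'k hexp" where
  "hsum xs = foldr Pl xs (Sc 0)"

fun hpow :: "'k::field hexp \<Rightarrow> nat \<Rightarrow> 'k hexp" where
  "hpow x 0 = Sc 1"
| "hpow x (Suc n) = Tm x (hpow x n)"

definition validS :: "nat \<Rightarrow> nat \<Rightarrow> nat \<Rightarrow> bool" where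
  "validS r s i \<longleftrightarrow> 1 \<le> i \<and> i < r + s \<and> i \<noteq> r"

fun valid_gen :: "nat \<Rightarrow> nat \<Rightarrow> gen \<Rightarrow> bool" where
  "valid_gen r s (S i) = validS r s i"
| "valid_gen r s E = True"

fun wf :: "nat \<Rightarrow> nat \<Rightarrow> 'k hexp \<Rightarrow> bool" where
  "wf r s (Gen g) = valid_gen r s g"
| "wf r s (Sc a) = True"
| "wf r s (Pl x y) = (wf r s x \<and> wf r s y)"
| "wf r s (Tm x y) = (wf r s x \<and> wf r s y)"

definition Sg :: "nat \<Rightarrow> 'k hexp" where "Sg i = Gen (S i)"
definition Eg :: "'k hexp" where "Eg = Gen E"

definition minus_h :: "'k::field hexp \<Rightarrow> 'k hexp \<Rightarrow> 'k hexp" where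
  "minus_h x y = Pl x (Tm (Sc (-1)) y)"

definition Sinv :: "'k::field \<Rightarrow> nat \<Rightarrow> 'k hexp" where
  "Sinv q i = Pl (Sg i) (Sc (- (q - inverse q)))"

definition delta :: "'k::field \<Rightarrow> 'k \<Rightarrow> 'k" where
  "delta q \<rho> = (\<rho> - inverse \<rho>) / (q - inverse q)"

inductive hrel :: "nat \<Rightarrow> nat \<Rightarrow> 'k::field \<Rightarrow> 'k \<Rightarrow> 'k hexp \<Rightarrow> 'k hexp \<Rightarrow> bool"
  for r s q \<rho> where
  quad: "validS r s i \<Longrightarrow>
     hrel r s q \<rho> (Tm (Pl (Sg i) (Sc (-q))) (Pl (Sg i) (Sc (inverse q)))) (Sc 0)"
| braid: "validS r s i \<Longrightarrow> validS r s (i+1) \<Longrightarrow>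
     hrel r s q \<rho> (hprod [Sg i, Sg (i+1), Sg i]) (hprod [Sg (i+1), Sg i, Sg (i+1)])"
| comm: "validS r s i \<Longrightarrow> validS r s j \<Longrightarrow> i + 1 < j \<Longrightarrow>
     hrel r s q \<rho> (Tm (Sg i) (Sg j)) (Tm (Sg j) (Sg i))"
| Esq: "hrel r s q \<rho> (Tm Eg Eg) (Tm (Sc (delta q \<rho>)) Eg)"
| ES: "validS r s j \<Longrightarrow> j + 1 \<noteq> r \<Longrightarrow> j \<noteq> r + 1 \<Longrightarrow>
     hrel r s q \<rho> (Tm Eg (Sg j)) (Tm (Sg j) Eg)"
| ESE1: "validS r s (r - 1) \<Longrightarrow>
     hrel r s q \<rho> (Tm (Sc \<rho>) Eg) (hprod [Eg, Sg (r - 1), Eg])"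
| ESE2: "validS r s (r + 1) \<Longrightarrow>
     hrel r s q \<rho> (Tm (Sc \<rho>) Eg) (hprod [Eg, Sg (r + 1), Eg])"
| R7: "validS r s (r - 1) \<Longrightarrow> validS r s (r + 1) \<Longrightarrow>
     hrel r s q \<rho> (hprod [Eg, Sinv q (r - 1), Sg (r + 1), Eg, Sg (r - 1)])
                  (hprod [Eg, Sinv q (r - 1), Sg (r + 1), Eg, Sg (r + 1)])"
| R8: "validS r s (r - 1) \<Longrightarrow> validS r s (r + 1) \<Longrightarrow>
     hrel r s q \<rho> (hprod [Sg (r - 1), Eg, Sinv q (r - 1), Sg (r + 1), Eg])
                  (hprod [Sg (r + 1), Eg, Sinv q (r - 1), Sg (r + 1), Eg])"

inductive heq :: "nat \<Rightarrow> nat \<Rightarrow> 'k::field \<Rightarrow> 'k \<Rightarrow> 'k hexp \<Rightarrow> 'k hexp \<Rightarrow> bool"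
  for r s q \<rho> where
  rel: "hrel r s q \<rho> x y \<Longrightarrow> heq r s q \<rho> x y"
| refl: "heq r s q \<rho> x x"
| sym: "heq r s q \<rho> x y \<Longrightarrow> heq r s q \<rho> y x"
| trans: "heq r s q \<rho> x y \<Longrightarrow> heq r s q \<rho> y z \<Longrightarrow> heq r s q \<rho> x z"
| cong_Pl: "heq r s q \<rho> a a' \<Longrightarrow> heq r s q \<rho> b b' \<Longrightarrow> heq r s q \<rho> (Pl a b) (Pl a' b')"
| cong_Tm: "heq r s q \<rho> a a' \<Longrightarrow> heq r s q \<rho> b b' \<Longrightarrow> heq r s q \<rho> (Tm a b) (Tm a' b')"
| add_assoc: "heq r s q \<rho> (Pl (Pl x y) z) (Pl x (Pl y z))"
| add_comm: "heq r s q \<rho> (Pl x y) (Pl y x)"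
| add_zero: "heq r s q \<rho> (Pl x (Sc 0)) x"
| add_neg: "heq r s q \<rho> (Pl x (Tm (Sc (-1)) x)) (Sc 0)"
| mul_assoc: "heq r s q \<rho> (Tm (Tm x y) z) (Tm x (Tm y z))"
| mul_one_l: "heq r s q \<rho> (Tm (Sc 1) x) x"
| mul_one_r: "heq r s q \<rho> (Tm x (Sc 1)) x"
| distrib_l: "heq r s q \<rho> (Tm x (Pl y z)) (Pl (Tm x y) (Tm x z))"
| distrib_r: "heq r s q \<rho> (Tm (Pl x y) z) (Pl (Tm x z) (Tm y z))"
| sc_add: "heq r s q \<rho> (Pl (Sc a) (Sc b)) (Sc (a + b))"
| sc_mul: "heq r s q \<rho> (Tm (Sc a) (Sc b)) (Sc (a * b))"
| sc_central: "heq r s q \<rho> (Tm (Sc a) x) (Tm x (Sc a))"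

definition in_center :: "nat \<Rightarrow> nat \<Rightarrow> 'k::field \<Rightarrow> 'k \<Rightarrow> 'k hexp \<Rightarrow> bool" where
  "in_center r s q \<rho> x \<longleftrightarrow> wf r s x \<and>
     (\<forall>y. wf r s y \<longrightarrow> heq r s q \<rho> (Tm x y) (Tm y x))"

definition left_ideal :: "nat \<Rightarrow> nat \<Rightarrow> 'k::field \<Rightarrow> 'k \<Rightarrow> 'k hexp set \<Rightarrow> bool" where
  "left_ideal r s q \<rho> L \<longleftrightarrow>
     (\<forall>x\<in>L. wf r s x) \<and> Sc 0 \<in> L \<and>
     (\<forall>x\<in>L. \<forall>y. wf r s y \<longrightarrow> heq r s q \<rho> x y \<longrightarrow> y \<in> L) \<and>
     (\<forall>x\<in>L. \<forall>y\<in>L. Pl x y \<in> L) \<and>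
     (\<forall>x\<in>L. \<forall>a. wf r s a \<longrightarrow> Tm a x \<in> L)"

definition semisimple :: "nat \<Rightarrow> nat \<Rightarrow> 'k::field \<Rightarrow> 'k \<Rightarrow> bool" where
  "semisimple r s q \<rho> \<longleftrightarrow>
     (\<forall>L. left_ideal r s q \<rho> L \<longrightarrow>
        (\<exists>L'. left_ideal r s q \<rho> L' \<and>
           (\<forall>x. wf r s x \<longrightarrow> (\<exists>u\<in>L. \<exists>v\<in>L'. heq r s q \<rho> x (Pl u v))) \<and>
           (\<forall>x. x \<in> L \<longrightarrow> x \<in> L' \<longrightarrow> heq r s q \<rho> x (Sc 0))))"

definition Ejr :: "nat \<Rightarrow> 'k::field \<Rightarrow> nat \<Rightarrow> 'k hexp" where
  "Ejr r q j = hprod (map (Sinv q) [j..<r] @ [Eg] @ map (Sinv q) (rev [j..<r]))"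

fun JM :: "nat \<Rightarrow> 'k::field \<Rightarrow> 'k \<Rightarrow> nat \<Rightarrow> 'k hexp" where
  "JM r q \<rho> 0 = Sc 0"
| "JM r q \<rho> (Suc 0) = Sc 0"
| "JM r q \<rho> (Suc (Suc n)) =
     (if Suc (Suc n) \<le> r then
        Pl (hprod [Sinv q (Suc n), JM r q \<rho> (Suc n), Sinv q (Suc n)]) (Sinv q (Suc n))
      else if Suc (Suc n) = r + 1 then
        Tm (Sc \<rho>) (Pl (Tm (Sc (-1)) (hsum (map (Ejr r q) [1..<r+1]))) (Sc (delta q \<rho>)))
      else
        Pl (hprod [Sg (Suc n), JM r q \<rho> (Suc n), Sg (Suc n)]) (Sg (Suc n)))"

text \<open>A polynomial is given as a finite list of terms (c, m): coefficient c times the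
  monomial with exponent m i on variable i, where variable i (1 \<le> i \<le> r) is x_i and
  variable r+j (1 \<le> j \<le> s) is y_j.\<close>
type_synonym 'k mpoly = "('k \<times> (nat \<Rightarrow> nat)) list"

definition pvars_ok :: "nat \<Rightarrow> nat \<Rightarrow> 'k mpoly \<Rightarrow> bool" where
  "pvars_ok r s p \<longleftrightarrow> (\<forall>(c, m) \<in> set p. \<forall>i. i \<notin> {1..r+s} \<longrightarrow> m i = 0)"

definition pcoeff :: "'k::comm_ring_1 mpoly \<Rightarrow> (nat \<Rightarrow> nat) \<Rightarrow> 'k" where
  "pcoeff p m = sum_list (map fst (filter (\<lambda>(c, m'). m' = m) p))"

definition supersymmetric :: "nat \<Rightarrow> nat \<Rightarrow> 'k::comm_ring_1 mpoly \<Rightarrow> bool" where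
  "supersymmetric r s p \<longleftrightarrow> pvars_ok r s p \<and>
     (\<forall>\<sigma>. \<sigma> permutes {1..r} \<longrightarrow> (\<forall>m. pcoeff p (m \<circ> \<sigma>) = pcoeff p m)) \<and>
     (\<forall>\<sigma>. \<sigma> permutes {r+1..r+s} \<longrightarrow> (\<forall>m. pcoeff p (m \<circ> \<sigma>) = pcoeff p m)) \<and>
     \<comment> \<open>substituting x_r = t, y_1 = -t: the coefficient of t^k n is zero for k \<ge> 1\<close>
     (\<forall>n k. n r = 0 \<longrightarrow> n (r+1) = 0 \<longrightarrow> 1 \<le> k \<longrightarrow>
        (\<Sum>a\<le>k. (-1) ^ (k - a) * pcoeff p (n(r := a, r+1 := k - a))) = 0)"

definition eval_JM :: "nat \<Rightarrow> nat \<Rightarrow> 'k::field \<Rightarrow> 'k \<Rightarrow> 'k mpoly \<Rightarrow> 'k hexp" where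
  "eval_JM r s q \<rho> p =
     hsum (map (\<lambda>(c, m). Tm (Sc c)
        (hprod (map (\<lambda>i. hpow (JM r q \<rho> i) (m i)) [1..<r+s+1]))) p)"

definition qC :: "complex poly fract" where "qC = Fract [:0, 1:] 1"

definition qCC :: "complex poly poly fract" where "qCC = Fract [:[:0, 1:]:] 1"
definition rhoCC :: "complex poly poly fract" where "rhoCC = Fract [:0, 1:] 1"

end

theory Submission
  imports Defs "HOL-Library.Multiset"
begin

text \<open>
  In multiplicative form the Jucys-Murphy elements are \<open>X\<^sub>i = 1 - (q - q\<^sup>-\<^sup>1) L\<^sub>i\<close> on the left of the wall and
  \<open>Y\<^sub>j = 1 + (q - q\<^sup>-\<^sup>1) L\<^sub>r\<^sub>+\<^sub>j\<close> on its right, and supersymmetric polynomials in the \<open>L\<close>s are polynomials in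
  the central power sums \<open>Z\<^sub>p = \<Sum> X\<^sub>i\<^sup>p - \<Sum> Y\<^sub>j\<^sup>p\<close>. The key relation is \<open>E Y\<^sub>1 = E X\<^sub>r\<close>, by which \<open>E Z\<^sub>p\<close> is the
  power sum of the inner algebra on \<open>(r - 1, s - 1)\<close> strands, which is the corner of \<open>E / \<delta>\<close>. If
  \<open>\<rho>\<^sup>2 q\<^sup>2\<^sup>m \<noteq> 1\<close> for \<open>|m| < r + s - 1\<close>, the joint spectrum of the \<open>Z\<^sub>p\<close> on the ideal generated by \<open>E\<close> is disjoint
  from that on the quotient by this ideal, a tensor product of two Hecke algebras; by induction on \<open>r\<close> the
  centre is then spanned by idempotents which the \<open>Z\<^sub>p\<close> separate, and these are Lagrange polynomials in the
  \<open>Z\<^sub>p\<close>. This covers independent \<open>q\<close>, \<open>\<rho>\<close>, and \<open>\<rho> = q\<^sup>N\<close> with \<open>N \<ge> r + s - 1\<close>.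

  For \<open>N \<le> r + s - 2\<close> the algebra is not semisimple unless \<open>N = 0\<close> and \<open>(r, s)\<close> is one of \<open>(1, 2)\<close>, \<open>(1, 3)\<close>,
  \<open>(2, 1)\<close>, \<open>(3, 1)\<close>. The product of the two regular representations becomes a module generated by the image
  of \<open>E\<close> when \<open>E\<close> acts by a twisted conditional expectation, and an eigenvector of the last Jucys-Murphy elements with
  contents adding up to \<open>- N\<close> spans a submodule killed by \<open>E\<close>. The four exceptional algebras are treated
  directly.
\<close>

text \<open>The condition on \<rho> excludes cancellation. Modulo the ideal of \<open>E\<close> the
  \<open>X\<close>s have eigenvalues q^(-2a) and the \<open>Y\<close>s have eigenvalues \<rho>^2
  q^(2b), with contents |a| < r and |b| < s, and a difference of power sums cannot see a value
  common to both. Without such a coincidence a joint eigenvalue determines two disjoint multisets,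
  hence the number of \<open>X\<close>-values: it is r on the quotient and at most r - 1 on the
  ideal. This count separates the two spectra.

  The exceptions come from last boxes: a tableau with n boxes can end in content 0 only for n = 1 or
  n >= 4, the 2 by 2 square being the first shape with a second such box. So for N = 0 and r = 1,
  where both contents should be 0, s = 2 and s = 3 offer no eigenvector. There \<delta> = 0 and
  \<open>E / \<delta>\<close> does not exist; the relation that \<open>E g E\<close> is a nonzero
  multiple of \<open>E\<close> takes its place.

  For the non-semisimple parameters the obstacle is to show that the eigenvector is nonzero, since a
  presentation alone does not exclude that idempotents collapse. The conditional expectations
  provide this.\<close>

section \<open>Content lists\<close>

text \<open>A content list records the contents of the boxes of a standard tableau, in reverse order: the head
  is the box added last.\<close>

definition addable :: "int list => int => bool" where
  "addable \<eta> a \<longleftrightarrow> (if a \<in> set \<eta>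
     then a + 1 \<in> set (takeWhile (\<lambda>x. x \<noteq> a) \<eta>) \<and> a - 1 \<in> set (takeWhile (\<lambda>x. x \<noteq> a) \<eta>)
     else (\<eta> = [] \<and> a = 0) \<or> (a > 0 \<and> a - 1 \<in> set \<eta>) \<or> (a < 0 \<and> a + 1 \<in> set \<eta>))"

fun content_list :: "int list => bool" where
  "content_list [] = True"
| "content_list (a # \<eta>) = (addable \<eta> a \<and> content_list \<eta>)"

lemma in_takeWhile_order:
  assumes "x \<in> set (takeWhile (\<lambda>w. w \<noteq> y) \<eta>)"
  shows "y \<notin> set (takeWhile (\<lambda>w. w \<noteq> x) \<eta>)"
  using assms by (induction \<eta>) (simp, metis (full_types) list.set_intros set_ConsD takeWhile.simps(2) emptyE list.set(1))

text \<open>A letter that already occurs is addable only if both neighbours were added after its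
  last occurrence, so two adjacent addable letters would each have to be more recent than the
  other.\<close>

lemma not_both_addable:
  assumes "addable \<eta> b" "addable \<eta> (b + 1)"
  shows False
proof (cases "b \<in> set \<eta>")
  case True
  then have "b + 1 \<in> set (takeWhile (\<lambda>x. x \<noteq> b) \<eta>)" using assms(1) by (simp add: addable_def)
  moreover then have "b + 1 \<in> set \<eta>" by (meson set_takeWhileD)
  ultimately show False using assms(2) in_takeWhile_order[of "b+1" b \<eta>] by (auto simp: addable_def)
next
  case False
  show False
  proof (cases "b + 1 \<in> set \<eta>")
    case True
    then have "b \<in> set (takeWhile (\<lambda>x. x \<noteq> b + 1) \<eta>)" using assms(2) by (simp add: addable_def)
    then show False using False by (meson set_takeWhileD)
  next
    case F2: False
    then show False using False assms by (auto simp: addable_def)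
  qed
qed

lemma not_both_addable':
  assumes "addable \<eta> b" "addable \<eta> (b + \<sigma>)" "\<sigma> = 1 \<or> \<sigma> = -1"
  shows False
  using assms not_both_addable[of \<eta> b] not_both_addable[of \<eta> "b - 1"] by auto

lemma addable_Cons_other:
  assumes "addable \<eta> b" "addable \<eta> c" "c \<noteq> b"
  shows "addable (b # \<eta>) c"
  using assms by (auto simp: addable_def split: if_splits)

text \<open>If \<sigma> = 1 or -1 and \<open>b + \<sigma>\<close> cannot follow b, then it occurred
  before, and since then neither b nor b + 2\<sigma> was added apart from the final b. This is the
  pattern that the braid relation excludes in \<open>repeated_weight\<close>.\<close>

lemma not_addable_next:
  assumes "content_list (b # \<eta>)" "\<sigma> = 1 \<or> \<sigma> = -1" "\<not> addable (b # \<eta>) (b + \<sigma>)"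
  shows "b + \<sigma> \<in> set \<eta>" "b + 2 * \<sigma> \<notin> set (takeWhile (\<lambda>x. x \<noteq> b + \<sigma>) \<eta>)"
    "b \<notin> set (takeWhile (\<lambda>x. x \<noteq> b + \<sigma>) \<eta>)"
proof -
  have ab: "addable \<eta> b" using assms(1) by simp
  show 1: "b + \<sigma> \<in> set \<eta>"
  proof (rule ccontr)
    assume n: "b + \<sigma> \<notin> set \<eta>"
    have "b \<notin> set \<eta> \<or> b \<noteq> 0 \<or> \<eta> \<noteq> []" by auto
    show False using assms(2,3) ab n
      by (auto simp: addable_def split: if_splits dest: set_takeWhileD)
  qed
  show 2: "b + 2 * \<sigma> \<notin> set (takeWhile (\<lambda>x. x \<noteq> b + \<sigma>) \<eta>)"
  proof
    assume "b + 2 * \<sigma> \<in> set (takeWhile (\<lambda>x. x \<noteq> b + \<sigma>) \<eta>)"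
    then show False using assms(2,3) 1 by (auto simp: addable_def add.commute split: if_splits)
  qed
  show "b \<notin> set (takeWhile (\<lambda>x. x \<noteq> b + \<sigma>) \<eta>)"
  proof
    assume a: "b \<in> set (takeWhile (\<lambda>x. x \<noteq> b + \<sigma>) \<eta>)"
    then have "b \<in> set \<eta>" by (meson set_takeWhileD)
    then have "b + \<sigma> \<in> set (takeWhile (\<lambda>x. x \<noteq> b) \<eta>)" using ab assms(2) by (auto simp: addable_def)
    then show False using a in_takeWhile_order[of b "b + \<sigma>" \<eta>] by blast
  qed
qed

lemma addable_swap_suffix:
  assumes "x \<noteq> y" "x \<noteq> y + 1" "x \<noteq> y - 1" "addable (pre @ x # y # suf) z"
  shows "addable (pre @ y # x # suf) z"
proof -
  show ?thesis
  proof (cases "z \<in> set pre")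
    case True
    then show ?thesis using assms(4) by (simp add: addable_def takeWhile_append1)
  next
    case False
    then have t: "takeWhile (\<lambda>w. w \<noteq> z) (pre @ l) = pre @ takeWhile (\<lambda>w. w \<noteq> z) l" for l
      by (induction pre) auto
    consider "z = x" | "z = y" | "z \<noteq> x" "z \<noteq> y" by blast
    then show ?thesis
    proof cases
      case 1
      then show ?thesis using assms(1,4) False t[unfolded 1] by (simp add: addable_def)
    next
      case 2
      then show ?thesis using assms False t[unfolded 2] by (auto simp: addable_def)
    next
      case 3
      then show ?thesis using assms(4) False by (cases "z \<in> set suf") (auto simp: addable_def t)
    qed
  qed
qed

text \<open>Boxes whose contents differ by more than one do not touch, so their entries in a
  standard tableau may be exchanged.\<close>

lemma content_list_swap:
  assumes "x \<noteq> y" "x \<noteq> y + 1" "x \<noteq> y - 1" "content_list (pre @ x # y # suf)"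
  shows "content_list (pre @ y # x # suf)"
  using assms(4)
proof (induction pre)
  case Nil
  then have h: "addable suf y" "addable (y # suf) x" "content_list suf" by auto
  have "addable suf x" using h(1,2) assms(1-3)
    by (auto simp: addable_def split: if_splits dest: set_takeWhileD)
  then show ?case using h addable_Cons_other[of suf x y] assms by auto
next
  case (Cons a pre)
  then show ?case using addable_swap_suffix[OF assms(1-3)] by auto
qed

lemma content_list_bound: "content_list \<alpha> ==> a \<in> set \<alpha> ==> \<bar>a\<bar> < int (length \<alpha>)"
proof (induction \<alpha> arbitrary: a)
  case (Cons b \<eta>)
  have IH: "\<And>x. x \<in> set \<eta> ==> \<bar>x\<bar> < int (length \<eta>)" using Cons by auto
  have "\<bar>b\<bar> < int (length (b # \<eta>))"
    using Cons.prems(1) IH[of b] IH[of "b+1"] IH[of "b-1"] by (auto simp: addable_def split: if_splits)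
  then show ?case using Cons.prems IH[of a] by auto
qed simp

definition contents :: "nat => int list set" where
  "contents m = {\<alpha>. length \<alpha> = m \<and> content_list \<alpha>}"

lemma finite_contents [simp]: "finite (contents m)"
proof (rule finite_subset)
  show "contents m \<subseteq> {xs. set xs \<subseteq> {- int m..int m} \<and> length xs = m}"
    unfolding contents_def using content_list_bound by fastforce
qed (rule finite_lists_length_eq, simp)

lemma finite_addable: "content_list \<alpha> ==> finite {a. addable \<alpha> a}"
proof (rule finite_subset)
  assume c: "content_list \<alpha>"
  show "{a. addable \<alpha> a} \<subseteq> {- int (length \<alpha>)..int (length \<alpha>)}"
    using content_list_bound[of "_ # \<alpha>"] c by fastforce
qed simp

lemma contents_0: "contents 0 = {[]}"
  by (auto simp: contents_def)

lemma contents_Suc: "contents (Suc m) = (\<lambda>(\<alpha>, a). a # \<alpha>) ` (SIGMA \<alpha>:contents m. {a. addable \<alpha> a})"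
  by (auto simp: contents_def length_Suc_conv image_iff)

lemma contents_1: "contents (Suc 0) = {[0]}"
  by (auto simp: contents_def length_Suc_conv addable_def)

lemma sum_contents_Suc:
  "(\<Sum>\<alpha>\<in>contents (Suc m). f \<alpha>) = (\<Sum>\<alpha>\<in>contents m. \<Sum>a\<in>{a. addable \<alpha> a}. f (a # \<alpha>))"
proof -
  have inj: "inj_on (\<lambda>(\<alpha>, a). a # \<alpha>) (SIGMA \<alpha>:contents m. {a. addable \<alpha> a})"
    by (auto simp: inj_on_def)
  show ?thesis unfolding contents_Suc
    by (subst sum.reindex[OF inj], subst sum.Sigma) (auto simp: contents_def finite_addable
        intro!: sum.cong finite_contents[unfolded contents_def])
qed

section \<open>Algebras over a field\<close>

locale alg_over = vector_space scale
  for scale :: "'k::field => 'b::ring_1 => 'b" (infixr "*s" 75) +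
  assumes mult_scale_left [simp]: "(a *s x) * y = a *s (x * y)"
    and mult_scale_right [simp]: "x * (a *s y) = a *s (x * y)"
begin

text \<open>Every element is reached from u by left multiplication with generators; closure under
  products is then derived. The unit is an arbitrary u, so that corners of one ambient ring are
  covered.\<close>

inductive_set alg :: "'b set => 'b => 'b set" for G :: "'b set" and u :: 'b where
  alg_unit: "u \<in> alg G u"
| alg_add: "x \<in> alg G u ==> y \<in> alg G u ==> x + y \<in> alg G u"
| alg_scale: "x \<in> alg G u ==> a *s x \<in> alg G u"
| alg_gen: "g \<in> G ==> x \<in> alg G u ==> g * x \<in> alg G u"

lemma alg_zero: "0 \<in> alg G u"
  using alg_scale[OF alg_unit, where a=0] by simp

lemma alg_uminus: "x \<in> alg G u ==> - x \<in> alg G u"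
  using alg_scale[where a="-1"] by fastforce

lemma alg_diff: "x \<in> alg G u ==> y \<in> alg G u ==> x - y \<in> alg G u"
  using alg_add[of x G u "-y"] alg_uminus by simp

lemma alg_sum: "(\<And>i. i \<in> I ==> f i \<in> alg G u) ==> sum f I \<in> alg G u"
  by (induction I rule: infinite_finite_induct) (auto simp: alg_zero alg_add)

lemma alg_unit_left:
  assumes "u * u = u" "\<And>g. g \<in> G ==> u * g = g" "x \<in> alg G u"
  shows "u * x = x"
  using assms(3) by induction (auto simp: assms(1) distrib_left mult.assoc[symmetric] assms(2))

lemma alg_unit_right:
  assumes "u * u = u" "x \<in> alg G u"
  shows "x * u = x"
  using assms(2) by induction (auto simp: assms(1) distrib_right mult.assoc)

lemma alg_mult:
  assumes "u * u = u" "\<And>g. g \<in> G ==> u * g = g" "x \<in> alg G u" "y \<in> alg G u"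
  shows "x * y \<in> alg G u"
  using assms(3)
  by induction (auto simp: alg_unit_left[OF assms(1,2,4)] assms(4) distrib_right mult.assoc
      intro: alg_add alg_scale alg_gen)

lemma alg_genI:
  assumes "g \<in> G" "g * u = g"
  shows "g \<in> alg G u"
  using alg_gen[OF assms(1) alg_unit, of u] assms(2) by simp

lemma alg_mono: "G \<subseteq> G' ==> x \<in> alg G u ==> x \<in> alg G' u"
  by (rotate_tac 1, induction rule: alg.induct) (auto intro: alg.intros)

lemma alg_commute:
  assumes "u * y = y" "y * u = y" "\<And>g. g \<in> G ==> g * y = y * g" "x \<in> alg G u"
  shows "x * y = y * x"
  using assms(4)
proof induction
  case (alg_gen g x)
  have "g * x * y = g * y * x" using alg_gen by (simp add: mult.assoc)
  also have "\<dots> = y * (g * x)" using assms(3)[OF alg_gen(1)] by (simp add: mult.assoc)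
  finally show ?case .
qed (auto simp: assms distrib_left distrib_right)

primrec eig_prod :: "'b => 'k list => 'b => 'b" where
  "eig_prod y [] v = v"
| "eig_prod y (c # cs) v = y * eig_prod y cs v - c *s eig_prod y cs v"

lemma eig_prod_diff: "eig_prod y cs (v - w) = eig_prod y cs v - eig_prod y cs w"
  by (induction cs) (simp_all add: right_diff_distrib scale_right_diff_distrib)

lemma eig_prod_add: "eig_prod y cs (v + w) = eig_prod y cs v + eig_prod y cs w"
  by (induction cs) (simp_all add: distrib_left scale_right_distrib)

lemma eig_prod_scale: "eig_prod y cs (a *s v) = a *s eig_prod y cs v"
  by (induction cs) (auto simp: scale_right_diff_distrib mult.commute)

lemma eig_prod_sum: "eig_prod y cs (sum f A) = (\<Sum>i\<in>A. eig_prod y cs (f i))"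
proof (induction A rule: infinite_finite_induct)
  have z: "eig_prod y cs 0 = 0" using eig_prod_scale[of y cs 0 0] by simp
  { case (infinite A) then show ?case by (simp add: z) }
  { case empty then show ?case by (simp add: z) }
  { case (insert x F) then show ?case by (simp add: eig_prod_add) }
qed

lemma eig_prod_eigen:
  "y * w = c *s w ==> eig_prod y cs w = (\<Prod>d\<leftarrow>cs. c - d) *s w"
  by (induction cs) (auto simp: scale_left_diff_distrib algebra_simps)

lemma eig_prod_mem:
  assumes "P v" "\<And>w. P w ==> P (y * w)" "\<And>w a. P w ==> P (a *s w)"
    "\<And>w w'. P w ==> P w' ==> P (w + w')"
  shows "P (eig_prod y cs v)"
proof (induction cs)
  case (Cons c cs)
  then have "P (y * eig_prod y cs v + (-c) *s eig_prod y cs v)" using assms by blast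
  then show ?case by simp
qed (simp add: assms)

text \<open>Partial fractions: the product of the factors other than y - c, divided by its value at
  c, projects onto the eigenvalue c. The predicate P carries along whatever linear properties stable
  under y the components must inherit.\<close>

lemma spectral_split:
  assumes "eig_prod y cs v = 0" "distinct cs"
    and "P v" "\<And>w. P w ==> P (y * w)" "\<And>w a. P w ==> P (a *s w)"
    "\<And>w w'. P w ==> P w' ==> P (w + w')"
  shows "\<exists>f. v = (\<Sum>c\<in>set cs. f c) \<and> (\<forall>c\<in>set cs. y * f c = c *s f c \<and> P (f c))"
  using assms(1-3)
proof (induction cs arbitrary: v)
  case Nil
  then show ?case by auto
next
  case (Cons c cs)
  define w where "w = eig_prod y cs v"
  define k where "k = (\<Prod>d\<leftarrow>cs. c - d)"
  define g where "g = inverse k *s w"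
  have yw: "y * w = c *s w" using Cons.prems(1) by (simp add: w_def)
  have k0: "k \<noteq> 0" using Cons.prems(2) by (auto simp: k_def prod_list_zero_iff)
  have Pw: "P w" unfolding w_def by (rule eig_prod_mem[of P]) (use Cons.prems assms in auto)
  have yg: "y * g = c *s g" by (simp add: g_def yw mult.commute)
  have Pg: "P g" using Pw assms by (auto simp: g_def)
  have z: "eig_prod y cs (v - g) = 0"
    using eig_prod_eigen[OF yg, of cs] k0
    by (simp add: eig_prod_diff w_def[symmetric] k_def[symmetric]) (simp add: g_def)
  have "P (v + (-1) *s g)" using Cons.prems(3) Pg assms by blast
  then have Pd: "P (v - g)" by simp
  obtain f where f: "v - g = (\<Sum>c\<in>set cs. f c)" "\<forall>c\<in>set cs. y * f c = c *s f c \<and> P (f c)"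
    using Cons.IH[OF z _ Pd] Cons.prems(2) by auto
  have "v = (\<Sum>d\<in>set (c # cs). (f(c := g)) d)"
  proof -
    have "(\<Sum>d\<in>set cs. (f(c := g)) d) = (\<Sum>d\<in>set cs. f d)"
      using Cons.prems(2) by (intro sum.cong) auto
    then show ?thesis using f(1) Cons.prems(2) by (simp add: algebra_simps)
  qed
  then show ?case using f(2) yg Pg by (intro exI[of _ "f(c := g)"]) auto
qed

end

section \<open>Hecke algebras and their Jucys-Murphy elements\<close>

lemma power_int_generic_inj:
  fixes t :: "'k::field"
  assumes "t \<noteq> 0" "\<And>m::nat. 0 < m ==> t ^ m \<noteq> 1" "power_int t a = power_int t b"
  shows "a = b"
proof (rule ccontr)
  assume "a \<noteq> b"
  have *: False if "a' < b'" "power_int t a' = power_int t b'" for a' b'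
  proof -
    have "power_int t (b' - a') = 1" using that assms(1) by (simp add: power_int_diff)
    then have "t ^ nat (b' - a') = 1" using that by (simp add: power_int_def)
    then show False using assms(2)[of "nat (b' - a')"] that by simp
  qed
  show False using *[of a b] *[of b a] \<open>a \<noteq> b\<close> assms(3) by force
qed

text \<open>Here n is the number of strands, so the generators are \<open>S 0\<close> to
  \<open>S (n - 2)\<close>. All relations have u as unit, and q is not a root of unity.\<close>

locale hecke = alg_over scale
  for scale :: "'k::field => 'b::ring_1 => 'b" (infixr "*s" 75) +
  fixes u :: 'b and q :: 'k and S :: "nat => 'b" and n :: nat
  assumes uu [simp]: "u * u = u"
    and uS [simp]: "Suc k < n ==> u * S k = S k"
    and Su [simp]: "Suc k < n ==> S k * u = S k"
    and quad: "Suc k < n ==> S k * S k = u + (q - inverse q) *s S k"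
    and braid: "Suc (Suc k) < n ==> S k * (S (Suc k) * S k) = S (Suc k) * (S k * S (Suc k))"
    and comm: "Suc j < n ==> Suc i < j ==> S i * S j = S j * S i"
    and q0: "q \<noteq> 0"
    and generic: "0 < m ==> q ^ m \<noteq> 1"
begin

definition zq :: 'k where "zq = q - inverse q"

lemma quadz: "Suc k < n ==> S k * S k = u + zq *s S k"
  using quad by (simp add: zq_def)

lemma z0: "zq \<noteq> 0"
  using generic[of 2] q0 by (auto simp: zq_def field_simps power2_eq_square)

text \<open>The eigenvalue of a multiplicative Jucys-Murphy element at a box of content a.\<close>

definition qe :: "int => 'k" where "qe a = power_int (q ^ 2) a"

lemma qe0 [simp]: "qe 0 = 1" by (simp add: qe_def)
lemma qe_nz [simp]: "qe a \<noteq> 0" using q0 by (simp add: qe_def)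
lemma qe_add: "qe (a + b) = qe a * qe b" using q0 by (simp add: qe_def power_int_add)
lemma qe1: "qe 1 = q ^ 2" by (simp add: qe_def)
lemma qe_m1: "qe (-1) = inverse (q ^ 2)" by (simp add: qe_def)
lemma qe_inj [simp]: "qe a = qe b \<longleftrightarrow> a = b"
proof -
  have "(q ^ 2) ^ m \<noteq> 1" if "0 < m" for m using generic[of "2 * m"] that by (simp add: power_mult)
  then show ?thesis using power_int_generic_inj[of "q^2" a b] q0 by (auto simp: qe_def)
qed

lemma qe_sum: "qe 1 + qe (-1) = zq * zq + 2"
  using q0 by (simp add: qe1 qe_m1 zq_def field_simps power2_eq_square)

primrec X :: "nat => 'b" where
  "X 0 = u"
| "X (Suc k) = S k * (X k * S k)"

declare X.simps(2) [simp del]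

lemma uX [simp]: "k < n ==> u * X k = X k"
  by (cases k) (auto simp: X.simps mult.assoc[symmetric])

lemma Xu [simp]: "k < n ==> X k * u = X k"
  by (cases k) (auto simp: X.simps mult.assoc)

lemma uX' [simp]: "k < n ==> u * (X k * y) = X k * y"
  by (simp add: mult.assoc[symmetric])

lemma uS' [simp]: "Suc k < n ==> u * (S k * y) = S k * y"
  by (simp add: mult.assoc[symmetric])

lemma SSx: "Suc k < n ==> S k * (S k * x) = u * x + zq *s (S k * x)"
  using quadz[of k] by (simp add: mult.assoc[symmetric] distrib_right)

lemma XS: "Suc k < n ==> X (Suc k) * S k = S k * X k + zq *s X (Suc k)"
  by (simp add: X.simps(2) mult.assoc quadz distrib_left)

lemma SX: "Suc k < n ==> S k * X (Suc k) = X k * S k + zq *s X (Suc k)"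
  by (simp add: X.simps(2) SSx)

lemma S_X_comm_far: "Suc j < n ==> k < j ==> S j * X k = X k * S j"
proof (induction k)
  case (Suc k)
  have c: "S j * S k = S k * S j" using comm[of j k] Suc.prems by simp
  have "S j * X (Suc k) = (S j * S k) * (X k * S k)" by (simp add: X.simps(2) mult.assoc)
  also have "\<dots> = S k * ((S j * X k) * S k)" by (simp add: c mult.assoc)
  also have "\<dots> = S k * (X k * (S j * S k))" using Suc by (simp add: mult.assoc)
  also have "\<dots> = X (Suc k) * S j" by (simp add: c X.simps(2) mult.assoc)
  finally show ?case .
qed simp

lemma S_X_comm_near: "k < n ==> Suc j < k ==> S j * X k = X k * S j"
proof (induction k)
  case (Suc k)
  show ?case
  proof (cases "Suc j = k")
    case True
    let ?t = "S (Suc j)"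
    have b: "S j * (?t * S j) = ?t * (S j * ?t)" using braid[of j] Suc.prems True by simp
    have c: "?t * X j = X j * ?t" using S_X_comm_far[of "Suc j" j] Suc.prems True by simp
    have Xk: "X (Suc k) = ?t * (S j * (X j * (S j * ?t)))"
      using True by (simp add: X.simps(2) mult.assoc flip: True)
    have "S j * X (Suc k) = (S j * (?t * S j)) * (X j * (S j * ?t))" by (simp add: Xk mult.assoc)
    also have "\<dots> = ?t * (S j * ((?t * X j) * (S j * ?t)))" by (simp add: b mult.assoc)
    also have "\<dots> = ?t * (S j * (X j * (?t * (S j * ?t))))" by (simp only: c mult.assoc)
    also have "\<dots> = X (Suc k) * S j" by (simp add: b[symmetric] Xk mult.assoc)
    finally show ?thesis .
  next
    case False
    have c: "S j * S k = S k * S j" using comm[of k j] Suc.prems False by simp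
    have IH: "S j * X k = X k * S j" using Suc False by simp
    have "S j * X (Suc k) = (S j * S k) * (X k * S k)" by (simp add: X.simps(2) mult.assoc)
    also have "\<dots> = S k * ((S j * X k) * S k)" by (simp add: c mult.assoc)
    also have "\<dots> = S k * (X k * (S j * S k))" by (simp only: IH mult.assoc)
    also have "\<dots> = X (Suc k) * S j" by (simp add: c X.simps(2) mult.assoc)
    finally show ?thesis .
  qed
qed simp

lemma S_X_comm: "Suc j < n ==> k < n ==> k \<noteq> j ==> k \<noteq> Suc j ==> S j * X k = X k * S j"
  using S_X_comm_far[of j k] S_X_comm_near[of k j] by linarith

lemma X_comm_less: "l < n ==> k < l ==> X k * X l = X l * X k"
proof (induction k)
  case (Suc k)
  have c: "S k * X l = X l * S k" using S_X_comm_near[of l k] Suc.prems by simp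
  have IH: "X k * X l = X l * X k" using Suc by simp
  have "X (Suc k) * X l = S k * (X k * (S k * X l))" by (simp add: X.simps(2) mult.assoc)
  also have "\<dots> = S k * ((X k * X l) * S k)" by (simp only: c mult.assoc)
  also have "\<dots> = (S k * X l) * (X k * S k)" by (simp only: IH mult.assoc)
  also have "\<dots> = X l * X (Suc k)" by (simp add: c X.simps(2) mult.assoc)
  finally show ?case .
qed simp

lemma X_comm: "k < n ==> l < n ==> X k * X l = X l * X k"
  using X_comm_less[of l k] X_comm_less[of k l] by (cases k l rule: linorder_cases) auto

definition H :: "nat => 'b set" where "H m = alg (S ` {k. Suc k < m}) u"

lemma H_mono: "m \<le> m' ==> x \<in> H m ==> x \<in> H m'"
  unfolding H_def by (rule alg_mono) auto

lemma H_mult: "m \<le> n ==> x \<in> H m ==> y \<in> H m ==> x * y \<in> H m"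
  unfolding H_def by (rule alg_mult) auto

lemma H_S: "Suc k < m ==> m \<le> n ==> S k \<in> H m"
  unfolding H_def by (rule alg_genI) auto

lemma H_u: "u \<in> H m" unfolding H_def by (rule alg_unit)

lemma H_X: "k < m ==> m \<le> n ==> X k \<in> H m"
proof (induction k)
  case (Suc k)
  then show ?case by (auto simp: X.simps(2) intro!: H_mult H_S)
qed (simp add: H_u)

lemma H_u_left: "m \<le> n ==> x \<in> H m ==> u * x = x"
  unfolding H_def by (rule alg_unit_left) auto

lemma H_u_right: "x \<in> H m ==> x * u = x"
  unfolding H_def by (rule alg_unit_right) auto

lemma H_commute:
  assumes "u * y = y" "y * u = y" "\<And>k. Suc k < m ==> S k * y = y * S k" "x \<in> H m"
  shows "x * y = y * x"
  using alg_commute[of u y "S ` {k. Suc k < m}" x] assms unfolding H_def by auto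

lemma H_X_commute: "x \<in> H m ==> m \<le> k ==> k < n ==> x * X k = X k * x"
  by (rule H_commute) (auto simp: S_X_comm_near)

lemma H_S_commute: "x \<in> H m ==> m \<le> k ==> Suc k < n ==> x * S k = S k * x"
  by (rule H_commute) (auto intro!: comm)

section \<open>Weight vectors and intertwiners\<close>

text \<open>The intertwiner: it exchanges \<open>X k\<close> and \<open>X (Suc k)\<close>, hence
  carries a weight space to the one with two letters swapped. Its square is a polynomial in these
  two elements, so that its invertibility can be read off from the weight.\<close>

definition Phi :: "nat => 'b" where "Phi k = S k * X k - X k * S k"

lemma X_Suc_Phi: assumes "Suc k < n" shows "X (Suc k) * Phi k = Phi k * X k"
proof -
  have c: "X (Suc k) * X k = X k * X (Suc k)" using X_comm assms by simp
  have "X (Suc k) * Phi k = (X (Suc k) * S k) * X k - X k * (X (Suc k) * S k)"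
    by (simp add: Phi_def right_diff_distrib mult.assoc[symmetric] c)
  also have "\<dots> = Phi k * X k"
    using assms by (simp add: XS Phi_def algebra_simps c)
  finally show ?thesis .
qed

lemma X_Phi: assumes "Suc k < n" shows "X k * Phi k = Phi k * X (Suc k)"
proof -
  have c: "X (Suc k) * X k = X k * X (Suc k)" using X_comm assms by simp
  have "Phi k * X (Suc k) = S k * X (Suc k) * X k - X k * (S k * X (Suc k))"
    by (simp add: Phi_def left_diff_distrib mult.assoc c)
  also have "\<dots> = X k * Phi k"
    using assms by (simp add: SX Phi_def algebra_simps c)
  finally show ?thesis ..
qed

lemma Phi_sq:
  assumes "Suc k < n"
  shows "Phi k * Phi k = (zq * zq + 2) *s (X (Suc k) * X k) - X k * X k - X (Suc k) * X (Suc k)"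
proof -
  let ?x = "X k" and ?y = "X (Suc k)" and ?s = "S k"
  have c: "?y * ?x = ?x * ?y" using X_comm assms by simp
  have sP: "?s * Phi k = ?x + zq *s (?s * ?x) - ?y"
    using assms by (simp add: Phi_def right_diff_distrib SSx X.simps(2))
  have "Phi k * Phi k = ?s * (?x * Phi k) - ?x * (?s * Phi k)"
    by (simp add: Phi_def left_diff_distrib mult.assoc)
  also have "\<dots> = (?s * Phi k) * ?y - ?x * (?s * Phi k)"
    using X_Phi[OF assms] by (simp add: mult.assoc)
  also have "\<dots> = (?x + zq *s (?s * ?x) - ?y) * ?y - ?x * (?x + zq *s (?s * ?x) - ?y)"
    by (simp only: sP)
  also have "\<dots> = ?x * ?y + zq *s ((?s * ?y) * ?x) - ?y * ?y - (?x * ?x + zq *s (?x * (?s * ?x)) - ?x * ?y)"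
    by (simp add: left_diff_distrib right_diff_distrib distrib_left distrib_right mult.assoc c)
  also have "zq *s ((?s * ?y) * ?x) = zq *s (?x * (?s * ?x)) + (zq * zq) *s (?y * ?x)"
    using assms by (simp add: SX distrib_right mult.assoc scale_right_distrib)
  moreover have "2 *s w = w + w" for w using scale_left_distrib[of 1 1 w] by simp
  ultimately show ?thesis by (simp add: c scale_left_distrib)
qed

lemma Phi_X_comm:
  assumes "Suc k < n" "j < n" "j \<noteq> k" "j \<noteq> Suc k" shows "Phi k * X j = X j * Phi k"
proof -
  have a: "S k * X j = X j * S k" and b: "X k * X j = X j * X k"
    using S_X_comm[of k j] X_comm[of k j] assms by auto
  have "S k * X k * X j = X j * (S k * X k)" by (metis a b mult.assoc)
  moreover have "X k * S k * X j = X j * (X k * S k)" by (metis a b mult.assoc)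
  ultimately show ?thesis by (simp add: Phi_def left_diff_distrib right_diff_distrib)
qed

lemma uPhi [simp]: "Suc k < n ==> u * Phi k = Phi k"
  by (simp add: Phi_def right_diff_distrib mult.assoc[symmetric])

text \<open>Joint eigenvectors of the Jucys-Murphy elements. As the head of a content list is the
  newest box, it belongs to the element with the largest index.\<close>

fun wt :: "int list => 'b => bool" where
  "wt [] v \<longleftrightarrow> u * v = v"
| "wt (a # \<eta>) v \<longleftrightarrow> X (length \<eta>) * v = qe a *s v \<and> wt \<eta> v"

fun wtR :: "int list => 'b => bool" where
  "wtR [] v \<longleftrightarrow> v * u = v"
| "wtR (a # \<eta>) v \<longleftrightarrow> v * X (length \<eta>) = qe a *s v \<and> wtR \<eta> v"

lemma wt_u: "wt \<alpha> v ==> u * v = v" by (induction \<alpha>) auto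
lemma wtR_u: "wtR \<alpha> v ==> v * u = v" by (induction \<alpha>) auto

lemma wt_0 [simp]: "wt \<alpha> 0" by (induction \<alpha>) auto
lemma wtR_0 [simp]: "wtR \<alpha> 0" by (induction \<alpha>) auto

lemma wt_add: "wt \<alpha> v ==> wt \<alpha> w ==> wt \<alpha> (v + w)"
  by (induction \<alpha>) (auto simp: distrib_left scale_right_distrib)
lemma wt_scale: "wt \<alpha> v ==> wt \<alpha> (a *s v)"
  by (induction \<alpha>) (auto simp: mult.commute)
lemma wt_mult: "wt \<alpha> v ==> wt \<alpha> (v * w)"
  by (induction \<alpha>) (auto simp: mult.assoc[symmetric])
lemma wtR_add: "wtR \<alpha> v ==> wtR \<alpha> w ==> wtR \<alpha> (v + w)"
  by (induction \<alpha>) (auto simp: distrib_right scale_right_distrib)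
lemma wtR_scale: "wtR \<alpha> v ==> wtR \<alpha> (a *s v)"
  by (induction \<alpha>) (auto simp: mult.commute)
lemma wtR_mult: "wtR \<alpha> v ==> wtR \<alpha> (w * v)"
  by (induction \<alpha>) (auto simp: mult.assoc)

lemma wt_left_commute:
  assumes "wt \<alpha> v" "u * y = y" "\<And>k. k < length \<alpha> ==> X k * y = y * X k"
  shows "wt \<alpha> (y * v)"
  using assms
proof (induction \<alpha>)
  case (Cons a \<eta>)
  have "X (length \<eta>) * (y * v) = y * (X (length \<eta>) * v)"
    using Cons.prems(3)[of "length \<eta>"] by (simp add: mult.assoc[symmetric])
  then show ?case using Cons by simp
qed (simp add: mult.assoc[symmetric])

text \<open>At a position where the weights differ, moving the Jucys-Murphy element from the left
  factor to the right one gives two different multiples of the same product.\<close>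

lemma wt_orth:
  assumes "wtR \<zeta> l" "wt \<eta> w" "length \<zeta> = length \<eta>" "\<zeta> \<noteq> \<eta>"
  shows "l * w = 0"
  using assms
proof (induction \<zeta> \<eta> rule: list_induct2')
  case (4 a \<zeta> b \<eta>)
  have "l * X (length \<eta>) * w = qe a *s (l * w)" using 4 by simp
  moreover have "X (length \<eta>) * w = qe b *s w" using 4 by simp
  then have "l * X (length \<eta>) * w = qe b *s (l * w)" by (simp only: mult.assoc mult_scale_right)
  ultimately have "qe a *s (l * w) = qe b *s (l * w)" by metis
  then have "qe a = qe b \<or> l * w = 0" by (simp only: scale_cancel_right)
  moreover have "l * w = 0" if "a = b" using 4 that by simp
  ultimately show ?case by auto
qed auto

lemma wt_Phi:
  assumes "wt (pre @ x # y # suf) v" "length (pre @ x # y # suf) \<le> n"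
  shows "wt (pre @ y # x # suf) (Phi (length suf) * v)"
  using assms
proof (induction pre)
  case Nil
  let ?k = "length suf"
  have k: "Suc ?k < n" using Nil by simp
  have "X (Suc ?k) * (Phi ?k * v) = qe y *s (Phi ?k * v)"
    using X_Suc_Phi[OF k] Nil by (simp add: mult.assoc[symmetric]) (simp add: mult.assoc)
  moreover have "X ?k * (Phi ?k * v) = qe x *s (Phi ?k * v)"
    using X_Phi[OF k] Nil by (simp add: mult.assoc[symmetric]) (simp add: mult.assoc)
  moreover have "wt suf (Phi ?k * v)"
    by (rule wt_left_commute) (use Nil k Phi_X_comm[OF k] in auto)
  ultimately show ?case by simp
next
  case (Cons a pre)
  let ?k = "length suf" and ?m = "length (pre @ x # y # suf)"
  have k: "Suc ?k < n" "?m < n" using Cons by auto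
  have "X ?m * (Phi ?k * v) = Phi ?k * (X ?m * v)"
    using Phi_X_comm[OF k(1), of ?m] k by (simp add: mult.assoc[symmetric])
  then show ?case using Cons by simp
qed

lemma Phi_sq_wt:
  assumes "X k * v = qe x *s v" "X (Suc k) * v = qe y *s v" "Suc k < n" "u * v = v"
  shows "Phi k * (Phi k * v) = ((zq * zq + 2) * qe x * qe y - qe x * qe x - qe y * qe y) *s v"
proof -
  have "Phi k * (Phi k * v) = (Phi k * Phi k) * v" by (simp add: mult.assoc)
  then show ?thesis using assms
    by (simp add: Phi_sq left_diff_distrib mult.assoc scale_left_diff_distrib mult.commute mult.left_commute)
qed

text \<open>As a quadratic in \<open>qe x\<close> this is - (qe x - qe (y + 1)) (qe x - qe (y - 1));
  hence the intertwiner is invertible between weights that swap nonadjacent contents.\<close>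

lemma Phi_sq_nonzero:
  assumes "x \<noteq> y + 1" "x \<noteq> y - 1"
  shows "(zq * zq + 2) * qe x * qe y - qe x * qe x - qe y * qe y \<noteq> 0"
proof -
  have 1: "qe (y + 1) + qe (y - 1) = (zq * zq + 2) * qe y"
    using qe_add[of y 1] qe_add[of y "-1"] by (simp only: qe_sum[symmetric]) (simp add: algebra_simps)
  have 2: "qe (y + 1) * qe (y - 1) = qe y * qe y"
    using qe_add[of "y + 1" "y - 1"] qe_add[of y y] by simp
  have "(zq * zq + 2) * qe x * qe y - qe x * qe x - qe y * qe y
      = (qe (y + 1) + qe (y - 1)) * qe x - qe x * qe x - qe (y + 1) * qe (y - 1)"
    unfolding 1 2 by (simp only: mult_ac)
  also have "\<dots> = - ((qe x - qe (y + 1)) * (qe x - qe (y - 1)))" by (simp add: algebra_simps)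
  finally show ?thesis using assms by simp
qed

text \<open>If the intertwiner kills v, then S v has the same eigenvalue for \<open>X k\<close> as
  v, and \<open>X (Suc k) = S k X k S k\<close> together with the quadratic relation becomes a
  linear equation for S v.\<close>

lemma Phi_zero_S:
  assumes "X k * v = qe x *s v" "X (Suc k) * v = qe y *s v" "Suc k < n" "u * v = v" "Phi k * v = 0"
  shows "S k * v = ((qe (y - x) - 1) / zq) *s v"
proof -
  have "X k * (S k * v) = S k * (X k * v)" using assms(5) by (simp add: Phi_def left_diff_distrib mult.assoc)
  then have 1: "X k * (S k * v) = qe x *s (S k * v)" using assms(1) by simp
  have "qe y *s v = S k * (X k * (S k * v))" using assms(2) by (simp add: X.simps(2) mult.assoc)
  also have "\<dots> = qe x *s (v + zq *s (S k * v))" using 1 assms(3,4) by (simp add: SSx)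
  finally have "qe y *s v = qe x *s v + (qe x * zq) *s (S k * v)" by (simp add: scale_right_distrib)
  then have "(qe x * zq) *s (S k * v) = (qe y - qe x) *s v" by (simp add: scale_left_diff_distrib)
  then have "inverse (qe x * zq) *s ((qe x * zq) *s (S k * v)) = inverse (qe x * zq) *s ((qe y - qe x) *s v)" by simp
  moreover have "inverse (qe x * zq) *s ((qe x * zq) *s w) = w" for w
  proof -
    have "inverse (qe x * zq) * (qe x * zq) = 1" using z0 qe_nz by (intro left_inverse) simp
    then show ?thesis by (simp only: scale_scale scale_one)
  qed
  ultimately have 2: "S k * v = (inverse (qe x * zq) * (qe y - qe x)) *s v" by simp
  have "inverse (qe x * zq) * (qe y - qe x) = (qe (y - x) - 1) / zq"
  proof -
    have "inverse (c * d) * (t * c - c) = (t - 1) / d" if "c \<noteq> 0" "d \<noteq> 0" for c d t :: 'k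
      using that by (simp add: field_simps)
    from this[OF qe_nz z0, of x "qe (y - x)"] show ?thesis using qe_add[of "y - x" x] by simp
  qed
  then show ?thesis using 2 by simp
qed

text \<open>Both intertwiners would lead to weights that the hypothesis \<open>nz\<close> forbids,
  so both vanish on v and the two generators act by scalars. The braid relation forces nonzero
  scalars to agree, but q^(2\<sigma>) and q^(-2\<sigma>) differ.\<close>

lemma repeated_weight_braid:
  assumes nz: "\<And>\<alpha> v. length \<alpha> = m ==> wt \<alpha> v ==> v \<noteq> 0 ==> content_list \<alpha>"
    and s: "\<sigma> = 1 \<or> \<sigma> = -1" and n: "Suc (Suc (Suc (length suf))) \<le> n" and m: "m = Suc (Suc (length suf))"
    and v: "wt ((b + \<sigma>) # b # (b + \<sigma>) # suf) v"
  shows "v = 0"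
proof (rule ccontr)
  assume v0: "v \<noteq> 0"
  let ?k = "length suf"
  have x: "X ?k * v = qe (b + \<sigma>) *s v" "X (Suc ?k) * v = qe b *s v" "X (Suc (Suc ?k)) * v = qe (b + \<sigma>) *s v"
    using v by auto
  have uv: "u * v = v" using wt_u[OF v] .
  have P1: "wt ((b + \<sigma>) # (b + \<sigma>) # b # suf) (Phi ?k * v)"
    using wt_Phi[of "[b + \<sigma>]" b "b + \<sigma>" suf v] v n by simp
  have P2: "wt (b # (b + \<sigma>) # (b + \<sigma>) # suf) (Phi (Suc ?k) * v)"
    using wt_Phi[of "[]" "b + \<sigma>" b "(b + \<sigma>) # suf" v] v n by simp
  have "content_list (b # (b + \<sigma>) # suf)" using nz[of "b # (b + \<sigma>) # suf" v] v v0 m by simp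
  then have "addable suf (b + \<sigma>)" by simp
  moreover have "Phi ?k * v \<noteq> 0 ==> addable suf b"
    using nz[of "(b + \<sigma>) # b # suf" "Phi ?k * v"] P1 m by simp
  ultimately have z1: "Phi ?k * v = 0" using not_both_addable'[of suf b \<sigma>] s by blast
  have "\<not> content_list ((b + \<sigma>) # (b + \<sigma>) # suf)" by (simp add: addable_def)
  then have z2: "Phi (Suc ?k) * v = 0" using nz[of "(b + \<sigma>) # (b + \<sigma>) # suf"] P2 m by auto
  define a1 where "a1 = (qe (- \<sigma>) - 1) / zq"
  define a2 where "a2 = (qe \<sigma> - 1) / zq"
  have s1: "S ?k * v = a1 *s v" using Phi_zero_S[OF x(1,2) _ uv z1] n by (simp add: a1_def)
  have s2: "S (Suc ?k) * v = a2 *s v" using Phi_zero_S[OF x(2,3) _ uv z2] n by (simp add: a2_def)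
  have "(S ?k * (S (Suc ?k) * S ?k)) * v = (S (Suc ?k) * (S ?k * S (Suc ?k))) * v" using braid[of ?k] n by simp
  then have "(a1 * a2 * a1) *s v = (a2 * a1 * a2) *s v" by (simp add: mult.assoc s1 s2 mult_ac)
  then have "(a1 * a2 * a1 - a2 * a1 * a2) *s v = 0" by (simp add: scale_left_diff_distrib)
  then have "a1 * a2 * (a1 - a2) = 0" using v0 by (simp add: algebra_simps)
  moreover have "a1 \<noteq> 0" "a2 \<noteq> 0" using s z0 qe_inj[of "-\<sigma>" 0] qe_inj[of \<sigma> 0] by (auto simp: a1_def a2_def)
  moreover have "a1 \<noteq> a2" using s z0 qe_inj[of "-\<sigma>" \<sigma>] by (auto simp: a1_def a2_def)
  ultimately show False by simp
qed

text \<open>The older b + \<sigma> is carried towards the newer one by intertwiners. The letters in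
  between are neither equal nor adjacent to it, so these are invertible, and the situation reduces
  to \<open>repeated_weight_braid\<close>.\<close>

lemma repeated_weight:
  assumes nz: "\<And>\<alpha> v. length \<alpha> = m ==> wt \<alpha> v ==> v \<noteq> 0 ==> content_list \<alpha>"
    and s: "\<sigma> = 1 \<or> \<sigma> = -1" and m: "Suc m \<le> n"
    and "m = length (b # pre @ (b + \<sigma>) # suf)"
    and "wt ((b + \<sigma>) # b # pre @ (b + \<sigma>) # suf) v"
    and "b + \<sigma> \<notin> set pre" "b + 2 * \<sigma> \<notin> set pre" "b \<notin> set pre"
  shows "v = 0"
  using assms(4-)
proof (induction pre arbitrary: suf v rule: rev_induct)
  case Nil
  show ?case
    by (rule repeated_weight_braid[OF nz s, where suf = suf and b = b]) (use Nil m in auto)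
next
  case (snoc c pre)
  let ?w = "Phi (length suf) * v"
  have "wt ((b + \<sigma>) # b # pre @ (b + \<sigma>) # c # suf) ?w"
    using wt_Phi[of "(b + \<sigma>) # b # pre" c "b + \<sigma>" suf v] snoc.prems m by simp
  then have w0: "?w = 0" using snoc.IH[of "c # suf" ?w] snoc.prems by simp
  have l: "wt (c # (b + \<sigma>) # suf) v"
  proof -
    have "wt (p @ l) v ==> wt l v" for p l by (induction p) auto
    then show ?thesis using snoc.prems(2) by (metis append_Cons append_assoc append_Nil)
  qed
  have "((zq * zq + 2) * qe (b + \<sigma>) * qe c - qe (b + \<sigma>) * qe (b + \<sigma>) - qe c * qe c) *s v = 0"
    using Phi_sq_wt[of "length suf" v "b + \<sigma>" c] l snoc.prems m w0 wt_u[OF l] by simp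
  moreover have "b + \<sigma> \<noteq> c + 1" "b + \<sigma> \<noteq> c - 1" using s snoc.prems by auto
  ultimately show ?case using Phi_sq_nonzero[of "b + \<sigma>" c] by simp
qed

lemma bad_weight:
  assumes nz: "\<And>\<alpha> v. length \<alpha> = m ==> wt \<alpha> v ==> v \<noteq> 0 ==> content_list \<alpha>"
    and s: "\<sigma> = 1 \<or> \<sigma> = -1" and m: "Suc m \<le> n" "m = length (b # \<eta>)"
    and v: "wt ((b + \<sigma>) # b # \<eta>) v" and na: "\<not> addable (b # \<eta>) (b + \<sigma>)"
  shows "v = 0"
proof (cases "content_list (b # \<eta>)")
  case True
  let ?P = "\<lambda>x. x \<noteq> b + \<sigma>"
  note f = not_addable_next[OF True s na]
  have "dropWhile ?P \<eta> \<noteq> []" using f(1) by (auto simp: dropWhile_eq_Nil_conv)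
  moreover then have "hd (dropWhile ?P \<eta>) = b + \<sigma>" using hd_dropWhile by blast
  ultimately obtain suf where d: "dropWhile ?P \<eta> = (b + \<sigma>) # suf" by (cases "dropWhile ?P \<eta>") auto
  have e: "\<eta> = takeWhile ?P \<eta> @ (b + \<sigma>) # suf" using takeWhile_dropWhile_id[of ?P \<eta>] d by simp
  show ?thesis
    by (rule repeated_weight[OF nz s m(1), where b = b and pre = "takeWhile ?P \<eta>" and suf = suf])
      (use e m v f in \<open>auto dest: set_takeWhileD\<close>)
next
  case False
  then show ?thesis using nz[of "b # \<eta>" v] v m by auto
qed

end

context alg_over
begin

lemma eig_prod_append: "eig_prod y (as @ bs) v = eig_prod y as (eig_prod y bs v)"
  by (induction as) auto

lemma eig_prod_kills:
  assumes "y * w = c *s w" "c \<in> set cs"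
  shows "eig_prod y cs w = 0"
  using eig_prod_eigen[OF assms(1), of cs] assms(2) by (auto simp: prod_list_zero_iff)

end

section \<open>Decomposition into weight idempotents\<close>

context hecke
begin

text \<open>A resolution of u by two-sided weight vectors. Orthogonality of different weights turns
  these automatically into orthogonal idempotents, some of which may be zero.\<close>

definition decomp :: "nat => (int list => 'b) => bool" where
  "decomp m e \<longleftrightarrow> (\<forall>\<alpha>\<in>contents m. wt \<alpha> (e \<alpha>) \<and> wtR \<alpha> (e \<alpha>) \<and> e \<alpha> \<in> H m) \<and> (\<Sum>\<alpha>\<in>contents m. e \<alpha>) = u"

lemma decomp_wt: "decomp m e ==> \<alpha> \<in> contents m ==> wt \<alpha> (e \<alpha>)"
  and decomp_wtR: "decomp m e ==> \<alpha> \<in> contents m ==> wtR \<alpha> (e \<alpha>)"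
  and decomp_H: "decomp m e ==> \<alpha> \<in> contents m ==> e \<alpha> \<in> H m"
  and decomp_sum: "decomp m e ==> (\<Sum>\<alpha>\<in>contents m. e \<alpha>) = u"
  by (simp_all add: decomp_def)

lemma decomp_expand: "decomp m e ==> u * v = v ==> v = (\<Sum>\<beta>\<in>contents m. e \<beta> * v)"
  by (simp add: sum_distrib_right[symmetric] decomp_sum)

lemma decomp_expand_right: "decomp m e ==> v * u = v ==> v = (\<Sum>\<beta>\<in>contents m. v * e \<beta>)"
  by (simp add: sum_distrib_left[symmetric] decomp_sum)

lemma decomp_orth:
  assumes "decomp m e" "wt \<alpha> v" "length \<alpha> = m" "\<beta> \<in> contents m" "\<beta> \<noteq> \<alpha>"
  shows "e \<beta> * v = 0"
  using wt_orth[OF decomp_wtR[OF assms(1,4)] assms(2) _ assms(5)] assms(3,4) by (simp add: contents_def)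

lemma decomp_orth_right:
  assumes "decomp m e" "wtR \<alpha> v" "length \<alpha> = m" "\<beta> \<in> contents m" "\<beta> \<noteq> \<alpha>"
  shows "v * e \<beta> = 0"
  using wt_orth[OF assms(2) decomp_wt[OF assms(1,4)]] assms(3-5) by (simp add: contents_def)

lemma decomp_nz:
  assumes "decomp m e" "length \<alpha> = m" "wt \<alpha> v" "v \<noteq> 0"
  shows "content_list \<alpha>"
proof (rule ccontr)
  assume "\<not> content_list \<alpha>"
  then have "\<beta> \<noteq> \<alpha>" if "\<beta> \<in> contents m" for \<beta> using that by (auto simp: contents_def)
  then have "(\<Sum>\<beta>\<in>contents m. e \<beta> * v) = 0" using decomp_orth[OF assms(1,3,2)] by (intro sum.neutral) auto
  then show False using decomp_expand[OF assms(1) wt_u[OF assms(3)]] assms(4) by simp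
qed

lemma decomp_proj:
  assumes "decomp m e" "wt \<alpha> v" "\<alpha> \<in> contents m"
  shows "e \<alpha> * v = v"
proof -
  have "v = (\<Sum>\<beta>\<in>contents m. e \<beta> * v)" using decomp_expand[OF assms(1) wt_u[OF assms(2)]] .
  also have "\<dots> = (\<Sum>\<beta>\<in>contents m. if \<beta> = \<alpha> then e \<alpha> * v else 0)"
    using decomp_orth[OF assms(1,2)] assms(3) by (intro sum.cong) (auto simp: contents_def)
  also have "\<dots> = e \<alpha> * v" using assms(3) by simp
  finally show ?thesis ..
qed

lemma decomp_proj_right:
  assumes "decomp m e" "wtR \<alpha> v" "\<alpha> \<in> contents m"
  shows "v * e \<alpha> = v"
proof -
  have "v = (\<Sum>\<beta>\<in>contents m. v * e \<beta>)" using decomp_expand_right[OF assms(1) wtR_u[OF assms(2)]] .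
  also have "\<dots> = (\<Sum>\<beta>\<in>contents m. if \<beta> = \<alpha> then v * e \<alpha> else 0)"
    using decomp_orth_right[OF assms(1,2)] assms(3) by (intro sum.cong) (auto simp: contents_def)
  also have "\<dots> = v * e \<alpha>" using assms(3) by simp
  finally show ?thesis ..
qed

lemma eig_prod_Phi:
  assumes "Suc k < n"
  shows "eig_prod (X k) cs (Phi k * v) = Phi k * eig_prod (X (Suc k)) cs v"
proof (induction cs)
  case (Cons c cs)
  have "X k * (Phi k * w) = Phi k * (X (Suc k) * w)" for w
    using X_Phi[OF assms] by (simp add: mult.assoc[symmetric])
  then show ?case using Cons by (simp add: right_diff_distrib)
qed simp

text \<open>The commutation of the intertwiner with \<open>X\<close> bounds the spectrum of the next
  Jucys-Murphy element on a weight space.\<close>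

lemma next_spectrum:
  assumes d: "decomp (Suc k) e" and k: "Suc k < n" and v: "wt (b # \<eta>) v" and l: "length \<eta> = k"
    and c: "content_list (b # \<eta>)"
  shows "eig_prod (X (Suc k)) ([qe (b + 1), qe (b - 1)] @
            map qe (sorted_list_of_set ({c. addable \<eta> c} - {b}))) v = 0"
proof -
  define A where "A = {c. addable \<eta> c} - {b}"
  define cs where "cs = map qe (sorted_list_of_set A)"
  have fA: "finite A" using finite_addable[of \<eta>] c by (simp add: A_def)
  have cs: "set cs = qe ` A" using fA by (simp add: cs_def)
  have uv: "u * v = v" using wt_u[OF v] .
  have xv: "X k * v = qe b *s v" using v l by simp
  let ?y = "\<lambda>\<beta>. e \<beta> * (S k * v)"
  have Sv: "S k * v = (\<Sum>\<beta>\<in>contents (Suc k). ?y \<beta>)"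
    using decomp_expand[OF d, of "S k * v"] k by simp
  have w\<eta>: "wt \<eta> (S k * v)"
    by (rule wt_left_commute) (use v l k S_X_comm in auto)
  have "Phi k * v = qe b *s (S k * v) - X k * (S k * v)"
    by (simp add: Phi_def left_diff_distrib mult.assoc xv)
  also have "\<dots> = (\<Sum>\<beta>\<in>contents (Suc k). qe b *s ?y \<beta> - X k * ?y \<beta>)"
    unfolding sum_subtractf scale_sum_right[symmetric] sum_distrib_left[symmetric] Sv[symmetric] ..
  finally have Pv: "Phi k * v = (\<Sum>\<beta>\<in>contents (Suc k). qe b *s ?y \<beta> - X k * ?y \<beta>)" .
  \<comment> \<open>The component of \<open>S k * v\<close> at content a enters with the factor qe b
    - qe a. So a = b drops out, and every other a is addable to \<eta> and is a root in
    \<open>cs\<close>.\<close>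
  have "eig_prod (X k) cs (qe b *s ?y \<beta> - X k * ?y \<beta>) = 0" if \<beta>: "\<beta> \<in> contents (Suc k)" for \<beta>
  proof -
    obtain a \<zeta> where \<beta>e: "\<beta> = a # \<zeta>" "length \<zeta> = k" "addable \<zeta> a"
      using \<beta> by (auto simp: contents_def length_Suc_conv)
    have eb: "wt (a # \<zeta>) (e \<beta>)" "wtR (a # \<zeta>) (e \<beta>)" using decomp_wt[OF d \<beta>] decomp_wtR[OF d \<beta>] \<beta>e by auto
    have z: "eig_prod (X k) cs 0 = 0" using eig_prod_scale[of "X k" cs 0 0] by simp
    show ?thesis
    proof (cases "\<zeta> = \<eta>")
      case False
      then have "?y \<beta> = 0" using wt_orth[of \<zeta> "e \<beta>" \<eta> "S k * v"] eb w\<eta> \<beta>e l by simp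
      then show ?thesis by (simp add: z)
    next
      case True
      have xy: "X k * ?y \<beta> = qe a *s ?y \<beta>" using eb \<beta>e by (simp add: mult.assoc[symmetric])
      have eq: "qe b *s ?y \<beta> - X k * ?y \<beta> = (qe b - qe a) *s ?y \<beta>" by (simp add: xy scale_left_diff_distrib)
      show ?thesis
      proof (cases "a = b")
        case False
        then have "qe a \<in> set cs" using True \<beta>e unfolding cs A_def by auto
        then show ?thesis unfolding eq eig_prod_scale using eig_prod_kills[OF xy] by simp
      qed (simp add: eq z)
    qed
  qed
  then have "eig_prod (X k) cs (Phi k * v) = 0" unfolding Pv eig_prod_sum by (intro sum.neutral) auto
  \<comment> \<open>On w the intertwiner vanishes, so \<open>Phi_sq\<close> becomes a quadratic
    equation for \<open>X (Suc k)\<close> whose roots belong to the contents b + 1 and b -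
    1.\<close>
  define w where "w = eig_prod (X (Suc k)) cs v"
  have P0: "Phi k * w = 0" using \<open>eig_prod (X k) cs (Phi k * v) = 0\<close> eig_prod_Phi[OF k, of cs v] by (simp add: w_def)
  have comm: "X k * (X (Suc k) * x) = X (Suc k) * (X k * x)" for x
    using X_comm[of k "Suc k"] k by (simp add: mult.assoc[symmetric])
  have xw: "X k * w = qe b *s w" unfolding w_def
    by (rule eig_prod_mem[of "\<lambda>w. X k * w = qe b *s w"])
      (auto simp: xv comm distrib_left scale_right_distrib mult.commute)
  have uw: "u * w = w" unfolding w_def
    by (rule eig_prod_mem[of "\<lambda>w. u * w = w"]) (use uv k in \<open>auto simp: distrib_left\<close>)
  have "(Phi k * Phi k) * w = 0" using P0 by (simp add: mult.assoc)
  then have e1: "X (Suc k) * (X (Suc k) * w) = ((zq * zq + 2) * qe b) *s (X (Suc k) * w) - (qe b * qe b) *s w"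
  proof -
    have "(zq * zq + 2) *s (X (Suc k) * (X k * w)) - X k * (X k * w) - X (Suc k) * (X (Suc k) * w) = 0"
      using \<open>(Phi k * Phi k) * w = 0\<close>
      by (simp only: Phi_sq[OF k] left_diff_distrib mult.assoc mult_scale_left)
    then show ?thesis by (simp only: xw mult_scale_right scale_scale) simp
  qed
  have s1: "qe (b + 1) + qe (b - 1) = (zq * zq + 2) * qe b"
    using qe_add[of b 1] qe_add[of b "-1"] by (simp only: qe_sum[symmetric]) (simp add: algebra_simps)
  have s2: "qe (b + 1) * qe (b - 1) = qe b * qe b"
    using qe_add[of "b + 1" "b - 1"] qe_add[of b b] by simp
  have "eig_prod (X (Suc k)) [qe (b + 1), qe (b - 1)] w = X (Suc k) * (X (Suc k) * w)
      - (qe (b + 1) + qe (b - 1)) *s (X (Suc k) * w) + (qe (b + 1) * qe (b - 1)) *s w"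
    by (simp add: right_diff_distrib scale_right_diff_distrib scale_left_distrib)
  also have "\<dots> = 0" unfolding s1 s2 e1 by simp
  finally show ?thesis unfolding eig_prod_append w_def cs_def A_def .
qed

text \<open>The possible next contents are b + 1, b - 1 and the other letters addable before b.
  Since b itself was addable, its neighbours were not, so this list is free of repetitions and the
  spectral splitting applies; eigenvalues that are not addable are removed by
  \<open>bad_weight\<close>.\<close>

lemma decomp_split:
  assumes d: "decomp m e" and m: "m = Suc k" "Suc m \<le> n" and \<alpha>: "\<alpha> \<in> contents m"
  shows "\<exists>f. e \<alpha> = (\<Sum>a\<in>{a. addable \<alpha> a}. f a) \<and>
    (\<forall>a. wt (a # \<alpha>) (f a) \<and> wtR (a # \<alpha>) (f a) \<and> f a \<in> H (Suc m))"
proof -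
  obtain b \<eta> where ae: "\<alpha> = b # \<eta>" "length \<eta> = k" "content_list (b # \<eta>)"
    using \<alpha> m by (auto simp: contents_def length_Suc_conv)
  define v where "v = e \<alpha>"
  have v: "wt \<alpha> v" "wtR \<alpha> v" "v \<in> H m" using decomp_wt[OF d \<alpha>] decomp_wtR[OF d \<alpha>] decomp_H[OF d \<alpha>] by (auto simp: v_def)
  define A where "A = {c. addable \<eta> c} - {b}"
  define L where "L = [b + 1, b - 1] @ sorted_list_of_set A"
  have fA: "finite A" using finite_addable[of \<eta>] ae by (simp add: A_def)
  have ab: "addable \<eta> b" using ae by simp
  have "b + 1 \<notin> A" "b - 1 \<notin> A"
    using not_both_addable[OF ab] not_both_addable[of \<eta> "b - 1"] ab by (auto simp: A_def)
  then have dL: "distinct L" using fA by (simp add: L_def)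
  have ep: "eig_prod (X m) (map qe L) v = 0"
    using next_spectrum[OF d[unfolded m(1)], of b \<eta> v] v ae m by (simp add: L_def A_def)
  have dq: "distinct (map qe L)" using dL by (simp add: distinct_map inj_on_def)
  define P where "P = (\<lambda>w. w \<in> H (Suc m) \<and> wt \<alpha> w \<and> wtR \<alpha> w \<and> X m * w = w * X m)"
  have Xc: "X j * X m = X m * X j" if "j \<le> m" for j using X_comm[of j m] that m by simp
  have l\<alpha>: "length \<alpha> = m" using \<alpha> by (simp add: contents_def)
  have "\<exists>f. v = (\<Sum>c\<in>set (map qe L). f c) \<and> (\<forall>c\<in>set (map qe L). X m * f c = c *s f c \<and> P (f c))"
  proof (rule spectral_split[OF ep dq])
    show "P v" unfolding P_def using v H_mono[of m "Suc m" v] H_X_commute[OF v(3), of m] m by auto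
    show "P (X m * w)" if "P w" for w
    proof -
      have "X m * w \<in> H (Suc m)" using that m H_mult H_X unfolding P_def by auto
      moreover have "wt \<alpha> (X m * w)"
        by (rule wt_left_commute) (use that m l\<alpha> Xc in \<open>auto simp: P_def\<close>)
      moreover have "wtR \<alpha> (X m * w)" using that wtR_mult unfolding P_def by blast
      moreover have "X m * (X m * w) = X m * w * X m" using that unfolding P_def by (metis mult.assoc)
      ultimately show ?thesis unfolding P_def by blast
    qed
    show "P (a *s w)" if "P w" for w a
      using that unfolding P_def by (auto intro: wt_scale wtR_scale simp: H_def alg_scale)
    show "P (w + w')" if "P w" "P w'" for w w'
      using that unfolding P_def by (auto intro: wt_add wtR_add simp: H_def alg_add distrib_left distrib_right)
  qed
  then obtain f where f: "v = (\<Sum>c\<in>set (map qe L). f c)"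
    "\<And>c. c \<in> set (map qe L) ==> X m * f c = c *s f c \<and> P (f c)" by auto
  define g where "g = (\<lambda>a. if a \<in> set L then f (qe a) else 0)"
  have g: "wt (a # \<alpha>) (g a) \<and> wtR (a # \<alpha>) (g a) \<and> g a \<in> H (Suc m)" for a
  proof (cases "a \<in> set L")
    case True
    then have "X m * g a = qe a *s g a \<and> P (g a)" using f(2)[of "qe a"] by (auto simp: g_def)
    then show ?thesis using l\<alpha> unfolding P_def by auto
  next
    case False
    then show ?thesis by (simp add: g_def H_def alg_zero)
  qed
  have g0: "g a = 0" if "a \<in> set L" "\<not> addable \<alpha> a" for a
  proof -
    have "a \<notin> A" using that(2) addable_Cons_other[OF ab] ae by (auto simp: A_def)
    then have "a = b + 1 \<or> a = b + (-1)" using that(1) fA by (simp add: L_def)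
    then obtain \<sigma> where s: "a = b + \<sigma>" "\<sigma> = 1 \<or> \<sigma> = -1" by blast
    show ?thesis
      by (rule bad_weight[where m = m and \<sigma> = \<sigma> and b = b and \<eta> = \<eta>])
        (use g[of a] s that ae m decomp_nz[OF d] in auto)
  qed
  have "v = (\<Sum>a\<in>set L. g a)"
    unfolding f(1) set_map by (subst sum.reindex) (auto simp: inj_on_def g_def)
  also have "\<dots> = (\<Sum>a\<in>{a. addable \<alpha> a}. g a)"
    by (rule sum.mono_neutral_cong) (use g0 finite_addable[of \<alpha>] ae in \<open>auto simp: g_def\<close>)
  finally show ?thesis using g unfolding v_def by blast
qed

lemma ex_decomp: "m \<le> n ==> \<exists>e. decomp m e"
proof (induction m)
  case 0
  then show ?case by (intro exI[of _ "\<lambda>_. u"]) (simp add: decomp_def contents_0 H_u)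
next
  case (Suc m)
  show ?case
  proof (cases m)
    case 0
    then show ?thesis by (intro exI[of _ "\<lambda>_. u"]) (simp add: decomp_def contents_1 H_u)
  next
    case (Suc k)
    obtain e where d: "decomp m e" using Suc.IH Suc.prems by auto
    have "\<forall>\<alpha>\<in>contents m. \<exists>f. e \<alpha> = (\<Sum>a\<in>{a. addable \<alpha> a}. f a) \<and>
      (\<forall>a. wt (a # \<alpha>) (f a) \<and> wtR (a # \<alpha>) (f a) \<and> f a \<in> H (Suc m))"
      using decomp_split[OF d Suc] Suc.prems by blast
    then obtain f where f: "\<And>\<alpha>. \<alpha> \<in> contents m ==> e \<alpha> = (\<Sum>a\<in>{a. addable \<alpha> a}. f \<alpha> a) \<and>
      (\<forall>a. wt (a # \<alpha>) (f \<alpha> a) \<and> wtR (a # \<alpha>) (f \<alpha> a) \<and> f \<alpha> a \<in> H (Suc m))"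
      using bchoice[of "contents m"] by (metis (no_types, lifting))
    define e' where "e' = (\<lambda>\<beta>. f (tl \<beta>) (hd \<beta>))"
    have "(\<Sum>\<beta>\<in>contents (Suc m). e' \<beta>) = (\<Sum>\<alpha>\<in>contents m. e \<alpha>)"
      unfolding sum_contents_Suc using f by (intro sum.cong) (auto simp: e'_def)
    then have "decomp (Suc m) e'" using decomp_sum[OF d] f unfolding decomp_def
      by (auto simp: e'_def contents_Suc)
    then show ?thesis by blast
  qed
qed

definition idem :: "nat => int list => 'b" where "idem m = (SOME e. decomp m e)"

lemma decomp_idem: "m \<le> n ==> decomp m (idem m)"
  unfolding idem_def using someI_ex[OF ex_decomp] by blast

end

section \<open>Connectivity of content lists\<close>

definition adm_swap :: "int list => int list => bool" where
  "adm_swap \<alpha> \<beta> \<longleftrightarrow> (\<exists>pre x y suf. \<alpha> = pre @ x # y # suf \<and> \<beta> = pre @ y # x # suf \<and>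
     x \<noteq> y \<and> x \<noteq> y + 1 \<and> x \<noteq> y - 1)"

lemma adm_swap_content: "adm_swap \<alpha> \<beta> ==> content_list \<alpha> ==> content_list \<beta>"
  unfolding adm_swap_def using content_list_swap by blast

lemma adm_swaps_content: "adm_swap\<^sup>*\<^sup>* \<alpha> \<beta> ==> content_list \<alpha> ==> content_list \<beta>"
  by (induction rule: rtranclp_induct) (auto intro: adm_swap_content)

lemma adm_swap_mset: "adm_swap \<alpha> \<beta> ==> mset \<alpha> = mset \<beta>"
  unfolding adm_swap_def by auto

lemma adm_swaps_mset: "adm_swap\<^sup>*\<^sup>* \<alpha> \<beta> ==> mset \<alpha> = mset \<beta>"
  by (induction rule: rtranclp_induct) (auto dest: adm_swap_mset)

lemma adm_swap_Cons: "adm_swap \<alpha> \<beta> ==> adm_swap (b # \<alpha>) (b # \<beta>)"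
  unfolding adm_swap_def by (metis append_Cons)

lemma adm_swaps_Cons: "adm_swap\<^sup>*\<^sup>* \<alpha> \<beta> ==> adm_swap\<^sup>*\<^sup>* (b # \<alpha>) (b # \<beta>)"
  by (induction rule: rtranclp_induct) (auto dest: adm_swap_Cons intro: rtranclp.rtrancl_into_rtrancl)

lemma adm_swaps_move_front:
  assumes "\<And>x. x \<in> set pre ==> x \<noteq> b \<and> x \<noteq> b + 1 \<and> x \<noteq> b - 1"
  shows "adm_swap\<^sup>*\<^sup>* (pre @ b # suf) (b # pre @ suf)"
  using assms
proof (induction pre arbitrary: suf rule: rev_induct)
  case (snoc c pre)
  have "adm_swap (pre @ c # b # suf) (pre @ b # c # suf)"
    unfolding adm_swap_def using snoc.prems[of c] by force
  moreover have "adm_swap\<^sup>*\<^sup>* (pre @ b # c # suf) (b # pre @ c # suf)" using snoc by auto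
  ultimately show ?case by (simp add: converse_rtranclp_into_rtranclp)
qed simp

text \<open>The letters \<open>c\<close> and \<open>c + 1\<close> alternate in a content list.\<close>

lemma content_list_alternate:
  assumes "content_list \<alpha>" "c \<ge> 0"
  shows "count (mset \<alpha>) c = count (mset \<alpha>) (c + 1) +
    (case filter (\<lambda>x. x = c \<or> x = c + 1) \<alpha> of [] => 0 | x # _ => if x = c then 1 else 0)"
  using assms(1)
proof (induction \<alpha>)
  case (Cons a \<eta>)
  let ?F = "filter (\<lambda>x. x = c \<or> x = c + 1)"
  have IH: "count (mset \<eta>) c = count (mset \<eta>) (c + 1) + (case ?F \<eta> of [] => 0 | x # _ => if x = c then 1 else 0)"
    using Cons by simp
  have ad: "addable \<eta> a" using Cons.prems by simp
  have hd_tw: "\<exists>l. ?F \<eta> = y # l"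
    if "y \<in> set (takeWhile (\<lambda>w. w \<noteq> x) \<eta>)" "{x, y} = {c, c + 1}" for x y
  proof -
    have "?F (takeWhile (\<lambda>w. w \<noteq> x) \<eta>) \<noteq> []" using that by (auto simp: filter_empty_conv)
    moreover have "w = y" if "w \<in> set (?F (takeWhile (\<lambda>w. w \<noteq> x) \<eta>))" for w
      using that \<open>{x, y} = {c, c + 1}\<close> by (auto dest: set_takeWhileD)
    ultimately obtain l where "?F (takeWhile (\<lambda>w. w \<noteq> x) \<eta>) = y # l"
      by (cases "?F (takeWhile (\<lambda>w. w \<noteq> x) \<eta>)") auto
    then have "?F (takeWhile (\<lambda>w. w \<noteq> x) \<eta> @ dropWhile (\<lambda>w. w \<noteq> x) \<eta>) = y # l @ ?F (dropWhile (\<lambda>w. w \<noteq> x) \<eta>)"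
      by (simp only: filter_append append_Cons)
    then show ?thesis by simp
  qed
  consider "a = c" | "a = c + 1" | "a \<noteq> c" "a \<noteq> c + 1" by blast
  then show ?case
  proof cases
    case 1
    have "count (mset \<eta>) c = count (mset \<eta>) (c + 1)"
    proof (cases "c \<in> set \<eta>")
      case True
      then obtain l where "?F \<eta> = (c + 1) # l" using ad 1 hd_tw[of "c + 1" c] by (auto simp: addable_def)
      then show ?thesis using IH by simp
    next
      case False
      then have "count (mset \<eta>) c = 0" by (simp add: count_eq_zero_iff)
      then show ?thesis using IH by simp
    qed
    then show ?thesis using 1 by simp
  next
    case 2
    have "count (mset \<eta>) c = count (mset \<eta>) (c + 1) + 1"
    proof (cases "c + 1 \<in> set \<eta>")
      case True
      then obtain l where "?F \<eta> = c # l" using ad 2 hd_tw[of c "c + 1"] by (auto simp: addable_def insert_commute)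
      then show ?thesis using IH by simp
    next
      case False
      then have z: "count (mset \<eta>) (c + 1) = 0" by (simp add: count_eq_zero_iff)
      have "c \<in> set \<eta>" using ad 2 False assms(2) by (auto simp: addable_def)
      then have "count (mset \<eta>) c \<noteq> 0" by (simp add: count_eq_zero_iff)
      then show ?thesis using IH z by (auto split: list.splits if_splits)
    qed
    then show ?thesis using 2 by simp
  next
    case 3
    then show ?thesis using IH by simp
  qed
qed simp

lemma addable_uminus: "addable (map uminus \<eta>) (- a) = addable \<eta> a"
proof -
  have tw: "takeWhile (\<lambda>x. x \<noteq> - a) (map uminus \<eta>) = map uminus (takeWhile (\<lambda>x. x \<noteq> a) \<eta>)" for \<eta> :: "int list"
    by (induction \<eta>) auto
  have m: "- b \<in> uminus ` A \<longleftrightarrow> b \<in> A" for b :: int and A by force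
  have 1: "- a + 1 = - (a - 1)" "- a - 1 = - (a + 1)" by auto
  show ?thesis unfolding addable_def tw set_map m 1 by auto
qed

lemma content_list_uminus: "content_list \<alpha> ==> content_list (map uminus \<alpha>)"
  by (induction \<alpha>) (auto simp: addable_uminus)

text \<open>By the alternation, the difference of the multiplicities of c and c + 1 tells which of
  the two was added last, and this difference depends only on the multiset.\<close>

lemma same_first_letter_nonneg:
  assumes "content_list \<alpha>" "content_list \<beta>" "mset \<alpha> = mset \<beta>" "c \<ge> 0"
    "filter (\<lambda>x. x = c \<or> x = c + 1) \<alpha> = x # l" "filter (\<lambda>x. x = c \<or> x = c + 1) \<beta> = y # l'"
  shows "x = y"
proof -
  have "x \<in> set (filter (\<lambda>x. x = c \<or> x = c + 1) \<alpha>)" "y \<in> set (filter (\<lambda>x. x = c \<or> x = c + 1) \<beta>)"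
    unfolding assms(5,6) by simp_all
  then have "x = c \<or> x = c + 1" "y = c \<or> y = c + 1" by auto
  then show ?thesis
    using content_list_alternate[OF assms(1,4)] content_list_alternate[OF assms(2,4)] assms(3,5,6)
    by (auto split: if_splits)
qed

text \<open>Negating all contents transposes the diagram and exchanges the cases c \<ge> 0 and c <
  0.\<close>

lemma same_first_letter:
  assumes "content_list \<alpha>" "content_list \<beta>" "mset \<alpha> = mset \<beta>"
    "filter (\<lambda>x. x = c \<or> x = c + 1) \<alpha> = x # l" "filter (\<lambda>x. x = c \<or> x = c + 1) \<beta> = y # l'"
  shows "x = y"
proof (cases "c \<ge> 0")
  case True
  then show ?thesis using same_first_letter_nonneg assms by blast
next
  case False
  have f: "filter (\<lambda>x. x = - c - 1 \<or> x = - c - 1 + 1) (map uminus \<gamma>) = map uminus (filter (\<lambda>x. x = c \<or> x = c + 1) \<gamma>)"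
    for \<gamma> :: "int list"
  proof -
    have "((\<lambda>x. x = - c - 1 \<or> x = - c - 1 + 1) \<circ> uminus) = (\<lambda>x. x = c \<or> x = c + 1)" by (auto simp: fun_eq_iff)
    then show ?thesis by (simp add: filter_map)
  qed
  have "- x = - y"
    by (rule same_first_letter_nonneg[of "map uminus \<alpha>" "map uminus \<beta>" "- c - 1"])
      (use assms False in \<open>auto simp only: f intro: content_list_uminus simp: list.map mset_map\<close>)
  then show ?thesis by simp
qed

text \<open>Let b be the newest letter of \<beta>. In \<alpha> no neighbour of b can be newer than
  the last b, because then the newest of the two adjacent letters would differ between \<alpha> and
  \<beta>. So b can be moved to the front by admissible swaps.\<close>

lemma content_lists_connected:
  "content_list \<alpha> ==> content_list \<beta> ==> mset \<alpha> = mset \<beta> ==> adm_swap\<^sup>*\<^sup>* \<alpha> \<beta>"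
proof (induction \<beta> arbitrary: \<alpha>)
  case (Cons b \<beta>)
  have "b \<in> set \<alpha>" using Cons.prems(3) by (metis list.set_intros(1) set_mset_mset)
  then obtain pre suf where \<alpha>: "\<alpha> = pre @ b # suf" "b \<notin> set pre" by (meson split_list_first)
  have no: False if s: "\<sigma> = 1 \<or> \<sigma> = -1" and i: "b + \<sigma> \<in> set pre" for \<sigma>
  proof -
    define c where "c = (if \<sigma> = 1 then b else b - 1)"
    let ?F = "filter (\<lambda>x. x = c \<or> x = c + 1)"
    have m: "(x = c \<or> x = c + 1) \<longleftrightarrow> (x = b \<or> x = b + \<sigma>)" for x using s by (auto simp: c_def)
    have "?F pre \<noteq> []" using i m by (auto simp: filter_empty_conv)
    moreover have "w = b + \<sigma>" if "w \<in> set (?F pre)" for w using that m \<alpha>(2) by auto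
    ultimately obtain l where "?F pre = (b + \<sigma>) # l" by (cases "?F pre") auto
    then have "?F \<alpha> = (b + \<sigma>) # (l @ ?F (b # suf))" unfolding \<alpha>(1) filter_append by simp
    moreover have "?F (b # \<beta>) = b # ?F \<beta>" using m[of b] by simp
    ultimately have "b + \<sigma> = b" using same_first_letter[OF Cons.prems] by blast
    then show False using s by auto
  qed
  have mv: "adm_swap\<^sup>*\<^sup>* \<alpha> (b # pre @ suf)"
    unfolding \<alpha>(1) using no[of 1] no[of "-1"] \<alpha>(2) by (intro adm_swaps_move_front) auto
  have "content_list (pre @ suf)" using adm_swaps_content[OF mv Cons.prems(1)] by simp
  moreover have "mset (pre @ suf) = mset \<beta>" using adm_swaps_mset[OF mv] Cons.prems(3) by simp
  ultimately have "adm_swap\<^sup>*\<^sup>* (pre @ suf) \<beta>" using Cons by auto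
  then show ?case using mv adm_swaps_Cons by (meson rtranclp_trans)
qed simp

section \<open>Central elements of Hecke algebras\<close>

context alg_over
begin

text \<open>The element s commutes with x + y and x y, hence with the power sums by Newton's
  recursion, and the symmetrised monomial is a power of x y times a power sum. The error term w is
  general because it is a multiple of y for the multiplicative Jucys-Murphy elements and has an
  extra u for the additive ones.\<close>

lemma pair_symmetric:
  fixes x y s w :: 'b
  assumes ys: "y * s = s * x + w" and sy: "s * y = x * s + w" and xy: "x * y = y * x" and wx: "w * x = x * w"
  shows "s * (x ^ a * y ^ b + x ^ b * y ^ a) = (x ^ a * y ^ b + x ^ b * y ^ a) * s"
proof -
  define C where "C = {w. s * w = w * s}"
  have Cm: "v * w \<in> C" if "v \<in> C" "w \<in> C" for v w
  proof -
    have "s * (v * w) = v * (s * w)" using that(1) by (simp add: C_def mult.assoc[symmetric])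
    then show ?thesis using that(2) by (simp add: C_def mult.assoc)
  qed
  have Cd: "v - w \<in> C" if "v \<in> C" "w \<in> C" for v w using that by (auto simp: C_def left_diff_distrib right_diff_distrib)
  have C1: "x + y \<in> C" by (simp add: C_def distrib_left distrib_right ys sy add_ac)
  have C2: "x * y \<in> C"
  proof -
    have "s * (x * y) = (s * y) * x" by (simp add: xy mult.assoc)
    also have "\<dots> = x * (y * s)" by (simp add: sy ys distrib_left distrib_right mult.assoc wx)
    finally show ?thesis by (simp add: C_def mult.assoc)
  qed
  have C2p: "(x * y) ^ m \<in> C" for m
    by (induction m) (auto intro: Cm C2, auto simp: C_def)
  have xpy: "x ^ m * y ^ k = y ^ k * x ^ m" for m k by (rule power_commuting_commutes[symmetric, THEN power_commuting_commutes]) (simp add: xy)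
  have pw: "x ^ m + y ^ m \<in> C" for m
  proof (induction m rule: induct_nat_012)
    case (ge2 m)
    have "x ^ Suc (Suc m) + y ^ Suc (Suc m) = (x + y) * (x ^ Suc m + y ^ Suc m) - (x * y) * (x ^ m + y ^ m)"
    proof -
      have "x * (y * x ^ m) = y * (x * x ^ m)" by (simp add: xy mult.assoc[symmetric])
      then show ?thesis by (simp add: distrib_left distrib_right mult.assoc)
    qed
    then show ?case using Cd Cm C1 C2 ge2 by presburger
  next
    case 0
    have "1 + 1 \<in> C" by (simp add: C_def distrib_left distrib_right del: one_add_one)
    then show ?case by simp
  qed (simp add: C1)
  have xym: "(x * y) ^ m = x ^ m * y ^ m" for m
  proof (induction m)
    case (Suc m)
    have "x * y * (x ^ m * y ^ m) = x * ((y ^ 1 * x ^ m) * y ^ m)" by (simp add: mult.assoc)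
    also have "\<dots> = x ^ Suc m * y ^ Suc m" by (simp only: xpy[symmetric]) (simp add: mult.assoc)
    finally show ?case using Suc by simp
  qed simp
  have *: "x ^ a * y ^ (a + d) + x ^ (a + d) * y ^ a \<in> C" for a d
  proof -
    have "x ^ a * y ^ (a + d) + x ^ (a + d) * y ^ a = (x * y) ^ a * (x ^ d + y ^ d)"
      using xpy[of d a] by (simp add: xym distrib_left power_add mult.assoc add.commute)
    then show ?thesis using Cm C2p pw by presburger
  qed
  have "x ^ a * y ^ b + x ^ b * y ^ a \<in> C"
  proof (cases "a \<le> b")
    case True then show ?thesis using *[of a "b - a"] by simp
  next
    case False then show ?thesis using *[of b "a - b"] by (simp add: add.commute)
  qed
  then show ?thesis by (simp add: C_def)
qed

end

lemma (in alg_over) hecke_pair_symmetric: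
  assumes "y * s = s * x + c *s y" "s * y = x * s + c *s y" "x * y = y * x"
  shows "s * (x ^ a * y ^ b + x ^ b * y ^ a) = (x ^ a * y ^ b + x ^ b * y ^ a) * s"
  by (rule pair_symmetric[OF assms]) (simp add: assms(3))

context hecke
begin

text \<open>The symmetric group on m letters has two double cosets in the one on m + 1 letters;
  \<open>S (m - 1)\<close> is the generator by which \<open>H (Suc m)\<close> exceeds
  \<open>H m\<close>.\<close>

inductive_set two_cosets :: "nat => 'b set" for m where
  base: "h \<in> H m ==> h \<in> two_cosets m"
| mid: "h \<in> H m ==> h' \<in> H m ==> h * (S (m - 1) * h') \<in> two_cosets m"
| add: "x \<in> two_cosets m ==> y \<in> two_cosets m ==> x + y \<in> two_cosets m"

lemma H_scale: "x \<in> H m ==> a *s x \<in> H m" unfolding H_def by (rule alg_scale)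

lemma two_cosets_scale: "x \<in> two_cosets m ==> a *s x \<in> two_cosets m"
proof (induction rule: two_cosets.induct)
  case (mid h h')
  then have "(a *s h) * (S (m - 1) * h') \<in> two_cosets m" by (intro two_cosets.mid H_scale)
  then show ?case by simp
qed (auto simp: scale_right_distrib intro: two_cosets.intros H_scale)

lemma two_cosets_left: "h \<in> H m ==> m \<le> n ==> x \<in> two_cosets m ==> h * x \<in> two_cosets m"
proof (rotate_tac 2, induction rule: two_cosets.induct)
  case (mid a b)
  have "(h * a) * (S (m - 1) * b) \<in> two_cosets m" using mid by (intro two_cosets.mid H_mult)
  then show ?case by (simp only: mult.assoc)
qed (auto simp: distrib_left intro: two_cosets.base two_cosets.add H_mult)

text \<open>The critical product is S h S h'. The induction hypothesis writes h as an element
  commuting with S or as a T b with a and b commuting with S, and then S T S = T S T leaves a single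
  S.\<close>

lemma H_two_cosets: "1 \<le> m ==> Suc m \<le> n ==> x \<in> H (Suc m) ==> x \<in> two_cosets m"
proof (induction m arbitrary: x)
  case (Suc m)
  let ?S = "S m"
  have S_H: "?S * h \<in> two_cosets (Suc m)" if "h \<in> H (Suc m)" for h
    using two_cosets.mid[OF H_u that] H_u_left[OF _ that] Suc.prems by simp
  have SS_H: "?S * (h * (?S * h')) \<in> two_cosets (Suc m)" if h': "h' \<in> H (Suc m)" and h: "h \<in> H (Suc m)" for h h'
  proof -
    have far: "?S * (h * (?S * h')) \<in> two_cosets (Suc m)" if "h \<in> H m" for h
    proof -
      have hS: "h \<in> H (Suc m)" using H_mono[of m "Suc m"] that by simp
      have c: "h * ?S = ?S * h" using H_S_commute[OF that, of m] Suc.prems by simp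
      have "?S * (h * (?S * h')) = h * (?S * (?S * h'))" by (simp add: c[symmetric] mult.assoc[symmetric])
      also have "\<dots> = h * h' + zq *s (h * (?S * h'))"
        using Suc.prems H_u_left[OF _ h'] by (simp add: SSx distrib_left)
      also have "\<dots> \<in> two_cosets (Suc m)"
      proof (rule two_cosets.add)
        show "h * h' \<in> two_cosets (Suc m)" using hS h' Suc.prems by (intro two_cosets.base H_mult) auto
        show "zq *s (h * (?S * h')) \<in> two_cosets (Suc m)"
          using two_cosets.mid[OF hS h'] by (intro two_cosets_scale) simp
      qed
      finally show ?thesis .
    qed
    show ?thesis
    proof (cases "m = 0")
      case True
      then have "h \<in> H m" using h by (simp add: H_def)
      then show ?thesis by (rule far)
    next
      case False
      have "h \<in> two_cosets m" using Suc.IH[OF _ _ h] False Suc.prems by simp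
      then show ?thesis
      proof (induction rule: two_cosets.induct)
        case (base h)
        then show ?case by (rule far)
      next
        case (add x y)
        then show ?case by (simp add: distrib_left distrib_right two_cosets.add)
      next
        case (mid a b)
        let ?T = "S (m - 1)"
        have aS: "a * ?S = ?S * a" "b * ?S = ?S * b"
          using H_S_commute[of _ m m] mid Suc.prems by auto
        have br: "?S * (?T * ?S) = ?T * (?S * ?T)" using braid[of "m - 1"] False Suc.prems by simp
        have "?S * (a * (?T * b) * (?S * h')) = a * ((?S * (?T * ?S)) * (b * h'))"
        proof -
          have "?S * (a * (?T * b) * (?S * h')) = (?S * a) * (?T * ((b * ?S) * h'))" by (simp only: mult.assoc)
          also have "\<dots> = a * ((?S * (?T * ?S)) * (b * h'))" by (simp only: aS(1)[symmetric] aS(2) mult.assoc)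
          finally show ?thesis .
        qed
        also have "\<dots> = (a * ?T) * (?S * (?T * (b * h')))" by (simp only: br mult.assoc)
        also have "\<dots> \<in> two_cosets (Suc m)"
        proof -
          have "a \<in> H (Suc m)" "b \<in> H (Suc m)" "?T \<in> H (Suc m)"
            using mid H_mono[of m "Suc m"] H_S[of "m - 1" "Suc m"] False Suc.prems by auto
          then have "a * ?T \<in> H (Suc m)" "?T * (b * h') \<in> H (Suc m)" using h' Suc.prems by (auto intro!: H_mult)
          from two_cosets.mid[OF this] show ?thesis by simp
        qed
        finally show ?case .
      qed
    qed
  qed
  show ?case using Suc.prems(3) unfolding H_def
  proof (induction rule: alg.induct)
    case alg_unit
    then show ?case using two_cosets.base[OF H_u] by simp
  next
    case (alg_add x y)
    then show ?case by (intro two_cosets.add)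
  next
    case (alg_scale x a)
    then show ?case by (intro two_cosets_scale)
  next
    case (alg_gen g x)
    then obtain k where k: "g = S k" "Suc k < Suc (Suc m)" by auto
    show ?case
    proof (cases "k = m")
      case False
      then have "S k \<in> H (Suc m)" using k H_S[of k "Suc m"] Suc.prems by simp
      then show ?thesis using two_cosets_left[OF _ _ alg_gen(3)] k Suc.prems by simp
    next
      case True
      from alg_gen(3) show ?thesis unfolding k(1) True
        by (induction rule: two_cosets.induct) (auto intro: S_H SS_H two_cosets.add simp: distrib_left)
    qed
  qed
qed simp

lemma S_psum: "Suc k < m ==> m \<le> n ==> S k * (\<Sum>j<m. X j ^ p) = (\<Sum>j<m. X j ^ p) * S k"
proof -
  assume k: "Suc k < m" "m \<le> n"
  have s: "(\<Sum>j<m. X j ^ p) = (X k ^ p + X (Suc k) ^ p) + (\<Sum>j\<in>{..<m} - {k, Suc k}. X j ^ p)"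
    using k by (subst sum.subset_diff[of "{k, Suc k}"]) (auto simp: add_ac)
  have "S k * (X k ^ p + X (Suc k) ^ p) = (X k ^ p + X (Suc k) ^ p) * S k"
    using hecke_pair_symmetric[of "X (Suc k)" "S k" "X k" zq p 0] XS SX X_comm k by simp
  moreover have "S k * X j ^ p = X j ^ p * S k" if "j \<in> {..<m} - {k, Suc k}" for j
    using S_X_comm[of k j] that k by (intro power_commuting_commutes[symmetric]) auto
  ultimately show ?thesis unfolding s by (simp add: distrib_left distrib_right sum_distrib_left sum_distrib_right)
qed

lemma H_psum: "x \<in> H m ==> m \<le> n ==> 0 < p ==> x * (\<Sum>j<m. X j ^ p) = (\<Sum>j<m. X j ^ p) * x"
proof (rule H_commute[where m = m])
  assume m: "m \<le> n" and p: "0 < p"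
  then obtain p' where p': "p = Suc p'" by (cases p) auto
  have "u * X j ^ p = X j ^ p" if "j < m" for j
    using that m uX[of j] by (simp add: p')
  moreover have "X j ^ p * u = X j ^ p" if "j < m" for j
    using that m Xu[of j] by (simp only: p' power_Suc2 mult.assoc)
  ultimately show "u * (\<Sum>j<m. X j ^ p) = (\<Sum>j<m. X j ^ p)" "(\<Sum>j<m. X j ^ p) * u = (\<Sum>j<m. X j ^ p)"
    by (auto simp: sum_distrib_left sum_distrib_right)
qed (auto simp: S_psum)

lemma psum_wt: "wt \<alpha> v ==> 0 < p ==> (\<Sum>j<length \<alpha>. X j ^ p) * v = (\<Sum>a\<leftarrow>\<alpha>. qe a ^ p) *s v"
proof (induction \<alpha>)
  case (Cons a \<eta>)
  have "x ^ k * v = c ^ k *s v" if "x * v = c *s v" for x c k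
    by (induction k) (auto simp: that mult.assoc mult.commute)
  then show ?case using Cons by (simp add: distrib_right scale_left_distrib add.commute)
qed simp

lemma psum_wtR: "wtR \<alpha> v ==> 0 < p ==> v * (\<Sum>j<length \<alpha>. X j ^ p) = (\<Sum>a\<leftarrow>\<alpha>. qe a ^ p) *s v"
proof (induction \<alpha>)
  case (Cons a \<eta>)
  have "v * x ^ k = c ^ k *s v" if "v * x = c *s v" for x c k
    by (induction k) (auto simp: that mult.assoc[symmetric])
  then show ?case using Cons by (simp add: distrib_left scale_left_distrib add.commute)
qed simp

lemma H_0: "x \<in> H m ==> m \<le> 1 ==> \<exists>k. x = k *s u"
proof -
  assume "x \<in> H m" "m \<le> 1"
  then have "x \<in> alg {} u" by (simp add: H_def)
  then show ?thesis
    by induction (auto simp: scale_left_distrib[symmetric] intro: exI[of _ 1])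
qed

text \<open>Each weight occurs with multiplicity one. After splitting x by
  \<open>H_two_cosets\<close> and inserting the idempotents of \<open>H m\<close> on both sides of
  the last generator, only one of them can contribute, and there the generator acts by a known
  scalar.\<close>

lemma idem_H_idem:
  "m \<le> n ==> \<alpha> \<in> contents m ==> x \<in> H m ==> \<exists>k. idem m \<alpha> * x * idem m \<alpha> = k *s idem m \<alpha>"
proof (induction m arbitrary: \<alpha> x)
  case 0
  obtain k where k: "x = k *s u" using H_0[OF 0(3)] by auto
  have "idem 0 \<alpha> * idem 0 \<alpha> = idem 0 \<alpha>" "idem 0 \<alpha> * u = idem 0 \<alpha>"
    using decomp_proj[OF decomp_idem decomp_wt] wtR_u[OF decomp_wtR] decomp_idem 0 by blast+
  then show ?case by (intro exI[of _ k]) (simp add: k)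
next
  case (Suc m)
  let ?e = "idem (Suc m) \<alpha>"
  have d: "decomp (Suc m) (idem (Suc m))" "decomp m (idem m)" using decomp_idem Suc.prems by auto
  have ee: "?e * ?e = ?e" using decomp_proj[OF d(1) decomp_wt[OF d(1)]] Suc.prems by blast
  have eu: "?e * u = ?e" using wtR_u[OF decomp_wtR[OF d(1)]] Suc.prems by blast
  show ?case
  proof (cases "m = 0")
    case True
    obtain k where k: "x = k *s u" using H_0[OF Suc.prems(3)] True by auto
    then show ?thesis using ee eu by (intro exI[of _ k]) (simp add: k)
  next
    case False
    obtain a \<eta> where \<alpha>: "\<alpha> = a # \<eta>" "length \<eta> = m" "content_list \<eta>" using Suc.prems(2)
      by (auto simp: contents_def length_Suc_conv)
    have \<eta>: "\<eta> \<in> contents m" using \<alpha> by (simp add: contents_def)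
    have we: "wt (a # \<eta>) ?e" "wtR (a # \<eta>) ?e" using decomp_wt[OF d(1) Suc.prems(2)] decomp_wtR[OF d(1) Suc.prems(2)] by (simp_all only: \<alpha>(1))
    have pe: "idem m \<eta> * ?e = ?e" "?e * idem m \<eta> = ?e"
      using decomp_proj[OF d(2) _ \<eta>] decomp_proj_right[OF d(2) _ \<eta>] we by auto
    have H1: "\<exists>k. ?e * h * ?e = k *s ?e" if hm: "h \<in> H m" for h
    proof -
      obtain k where k: "idem m \<eta> * h * idem m \<eta> = k *s idem m \<eta>" using Suc.IH[OF _ \<eta> hm] Suc.prems by auto
      have "?e * h * ?e = ?e * (idem m \<eta> * h * idem m \<eta>) * ?e" by (metis pe mult.assoc)
      also have "\<dots> = k *s ?e" unfolding k using ee pe by simp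
      finally show ?thesis by blast
    qed
    have H2: "\<exists>k. (?e * h * idem m \<gamma>) * (S (m - 1) * (idem m \<gamma>' * h' * ?e)) = k *s ?e"
      if hh: "h \<in> H m" "h' \<in> H m" and g: "\<gamma> \<in> contents m" "\<gamma>' \<in> contents m" for h h' \<gamma> \<gamma>'
    proof -
      obtain b \<zeta> b' \<zeta>' where gg: "\<gamma> = b # \<zeta>" "\<gamma>' = b' # \<zeta>'" "length \<zeta> = m - 1" "length \<zeta>' = m - 1"
        using g False by (cases \<gamma>; cases \<gamma>') (auto simp: contents_def)
      define l where "l = ?e * h * idem m \<gamma>"
      define w where "w = idem m \<gamma>' * h' * ?e"
      have lw: "wtR \<gamma> l" "wt \<gamma>' w" unfolding l_def w_def
        using decomp_wtR[OF d(2) g(1)] decomp_wt[OF d(2) g(2)] wtR_mult wt_mult by (auto simp: mult.assoc)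
      have eg: "idem m \<gamma> \<in> H m" "idem m \<gamma>' \<in> H m" using decomp_H[OF d(2)] g by auto
      have Sn: "Suc (m - 1) < n" using False Suc.prems by simp
      show ?thesis
      proof (cases "\<zeta> = \<zeta>'")
        case F: False
        have "wt \<zeta>' (S (m - 1) * w)"
        proof (rule wt_left_commute)
          show "wt \<zeta>' w" using lw(2) gg(2) by simp
          show "u * S (m - 1) = S (m - 1)" using Sn by simp
          show "X k * S (m - 1) = S (m - 1) * X k" if "k < length \<zeta>'" for k
            using S_X_comm[of "m - 1" k] that gg(4) Sn by simp
        qed
        then have "l * (S (m - 1) * w) = 0" using wt_orth[of \<zeta> l \<zeta>' "S (m - 1) * w"] F lw gg by auto
        then show ?thesis unfolding l_def w_def by (intro exI[of _ 0]) simp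
      next
        case T: True
        \<comment> \<open>The sum p is central in \<open>H m\<close>. If neither l nor w vanishes,
          its eigenvalues at \<gamma>, \<gamma>' and \<eta> agree; as \<gamma> and \<gamma>' have
          the same tail, they are equal.\<close>
        define p where "p = (\<Sum>j<m. X j ^ 1)"
        have ph: "h * p = p * h" "h' * p = p * h'" unfolding p_def using H_psum[OF hh(1), of 1] H_psum[OF hh(2), of 1] Suc.prems by simp_all
        define ws where "ws = (\<lambda>\<alpha>::int list. \<Sum>a\<leftarrow>\<alpha>. qe a ^ 1)"
        have "l * p = ws \<gamma> *s l" using psum_wtR[OF lw(1), of 1] g(1) unfolding p_def ws_def by (simp add: contents_def)
        moreover have "idem m \<gamma> * p = p * idem m \<gamma>" using H_psum[OF eg(1), of 1] Suc.prems unfolding p_def by auto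
        then have "l * p = ?e * p * h * idem m \<gamma>" unfolding l_def by (metis ph(1) mult.assoc)
        moreover have "?e * p = ws \<eta> *s ?e"
          using psum_wtR[of \<eta> ?e 1] we \<alpha> unfolding p_def ws_def by auto
        ultimately have "ws \<gamma> *s l = ws \<eta> *s l" unfolding l_def by (metis mult_scale_left)
        then have 1: "ws \<gamma> = ws \<eta> \<or> l = 0" by (simp only: scale_cancel_right)
        have "p * w = ws \<gamma>' *s w" using psum_wt[OF lw(2), of 1] g(2) unfolding p_def ws_def by (simp add: contents_def)
        moreover have "idem m \<gamma>' * p = p * idem m \<gamma>'" using H_psum[OF eg(2), of 1] Suc.prems unfolding p_def by auto
        then have "p * w = idem m \<gamma>' * h' * (p * ?e)" unfolding w_def by (metis ph(2) mult.assoc)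
        moreover have "p * ?e = ws \<eta> *s ?e"
          using psum_wt[of \<eta> ?e 1] we \<alpha> unfolding p_def ws_def by auto
        ultimately have "ws \<gamma>' *s w = ws \<eta> *s w" unfolding w_def by (metis mult_scale_right)
        then have 2: "ws \<gamma>' = ws \<eta> \<or> w = 0" by (simp only: scale_cancel_right)
        show ?thesis
        proof (cases "l = 0 \<or> w = 0")
          case True
          then have "l * (S (m - 1) * w) = 0" by auto
          then show ?thesis unfolding l_def w_def by (intro exI[of _ 0]) simp
        next
          case lw0: False
          then have "ws \<gamma> = ws \<gamma>'" using 1 2 by simp
          then have bb: "b = b'" using T gg by (simp add: ws_def)
          have wtw: "wt (a # \<gamma>) w"
          proof -
            have 1: "X m * idem m \<gamma>' = idem m \<gamma>' * X m" "X m * h' = h' * X m"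
              using H_X_commute[OF eg(2), of m] H_X_commute[OF hh(2), of m] Suc.prems by auto
            have "X m * w = (X m * idem m \<gamma>') * (h' * ?e)" by (simp only: w_def mult.assoc)
            also have "\<dots> = idem m \<gamma>' * ((X m * h') * ?e)" by (simp only: 1(1) mult.assoc)
            also have "\<dots> = idem m \<gamma>' * h' * (X m * ?e)" by (simp only: 1(2) mult.assoc)
            finally have "X m * w = idem m \<gamma>' * h' * (X m * ?e)" .
            then have "X m * w = qe a *s w" using we \<alpha> by (simp add: w_def)
            then show ?thesis using lw(2) g(1) gg T bb by (simp add: contents_def)
          qed
          have "content_list (a # \<gamma>)" using decomp_nz[OF d(1) _ wtw] lw0 g(1) by (simp add: contents_def)
          then have ab: "a \<noteq> b" using gg by (auto simp: addable_def)
          have 1: "idem m \<gamma> * X m = X m * idem m \<gamma>" "h * X m = X m * h"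
            using H_X_commute[OF eg(1), of m] H_X_commute[OF hh(1), of m] Suc.prems by auto
          have "l * X m = ?e * (h * (idem m \<gamma> * X m))" by (simp only: l_def mult.assoc)
          also have "\<dots> = ?e * ((h * X m) * idem m \<gamma>)" by (simp only: 1(1) mult.assoc)
          also have "\<dots> = (?e * X m) * h * idem m \<gamma>" by (simp only: 1(2) mult.assoc)
          finally have "l * X m = (?e * X m) * h * idem m \<gamma>" .
          then have lX: "l * X m = qe a *s l" using we \<alpha> by (simp add: l_def)
          have Xw: "X (m - 1) * w = qe b *s w" "X m * w = qe a *s w" using wtw gg lw(2) bb g(1) by (auto simp: contents_def)
          \<comment> \<open>The relation \<open>XS\<close> is evaluated between a left and a right
            eigenvector; since a and b differ, it can be solved for l S w.\<close>
          have "qe a *s (l * (S (m - 1) * w)) = l * (X m * S (m - 1)) * w" using lX by (metis mult.assoc mult_scale_left)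
          also have "X m * S (m - 1) = S (m - 1) * X (m - 1) + zq *s X m" using XS[OF Sn] False by simp
          also have "l * \<dots> * w = l * (S (m - 1) * (X (m - 1) * w)) + zq *s (l * (X m * w))"
            by (simp add: distrib_left distrib_right mult.assoc)
          finally have "qe a *s (l * (S (m - 1) * w)) = qe b *s (l * (S (m - 1) * w)) + (zq * qe a) *s (l * w)"
            by (simp only: Xw mult_scale_right scale_scale)
          then have "(qe a - qe b) *s (l * (S (m - 1) * w)) = (zq * qe a) *s (l * w)"
            by (simp add: scale_left_diff_distrib)
          then have "inverse (qe a - qe b) *s ((qe a - qe b) *s (l * (S (m - 1) * w)))
              = inverse (qe a - qe b) *s ((zq * qe a) *s (l * w))" by (simp only:)
          moreover have "inverse (qe a - qe b) *s ((qe a - qe b) *s v) = v" for v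
          proof -
            have "inverse (qe a - qe b) * (qe a - qe b) = 1" using ab by (intro left_inverse) simp
            then show ?thesis by (simp only: scale_scale scale_one)
          qed
          ultimately have lSw: "l * (S (m - 1) * w) = (inverse (qe a - qe b) * (zq * qe a)) *s (l * w)"
            by (simp only: scale_scale)
          have "idem m \<gamma> * idem m \<gamma> = idem m \<gamma>" using decomp_proj[OF d(2) decomp_wt[OF d(2)]] g by blast
          then have "idem m \<gamma> * (idem m \<gamma> * y) = idem m \<gamma> * y" for y by (simp only: mult.assoc[symmetric])
          moreover have "\<gamma>' = \<gamma>" using gg T bb by simp
          ultimately have "l * w = ?e * (h * idem m \<gamma> * h') * ?e" unfolding l_def w_def by (simp only: mult.assoc)
          moreover have "h * idem m \<gamma> * h' \<in> H m" using hh eg Suc.prems by (auto intro!: H_mult)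
          ultimately obtain k where "l * w = k *s ?e" using H1 by metis
          then show ?thesis using lSw unfolding l_def w_def by auto
        qed
      qed
    qed
    have "x \<in> two_cosets m" using H_two_cosets[of m x] Suc.prems False by simp
    then show ?thesis
    proof (induction rule: two_cosets.induct)
      case (base h)
      then show ?case by (rule H1)
    next
      case (add x y)
      then obtain k k' where "?e * x * ?e = k *s ?e" "?e * y * ?e = k' *s ?e" by auto
      then show ?case by (intro exI[of _ "k + k'"]) (simp add: distrib_left distrib_right scale_left_distrib)
    next
      case (mid h h')
      have hu: "h * u = h" using H_u_right mid by auto
      have uh: "u * h' = h'" using H_u_left[of m h'] mid Suc.prems by auto
      have 1: "?e * h = (\<Sum>\<gamma>\<in>contents m. ?e * h * idem m \<gamma>)"
        by (rule decomp_expand_right[OF d(2)]) (simp only: mult.assoc hu)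
      have 2: "h' * ?e = (\<Sum>\<gamma>'\<in>contents m. idem m \<gamma>' * (h' * ?e))"
        by (rule decomp_expand[OF d(2)]) (simp only: mult.assoc[symmetric] uh)
      have "?e * (h * (S (m - 1) * h')) * ?e = (?e * h) * (S (m - 1) * (h' * ?e))" by (simp only: mult.assoc)
      also have "\<dots> = (\<Sum>\<gamma>\<in>contents m. ?e * h * idem m \<gamma>) * (\<Sum>\<gamma>'\<in>contents m. S (m - 1) * (idem m \<gamma>' * (h' * ?e)))"
        using 1 2 by (simp only: sum_distrib_left[symmetric])
      finally have E: "?e * (h * (S (m - 1) * h')) * ?e = (\<Sum>\<gamma>\<in>contents m. \<Sum>\<gamma>'\<in>contents m.
          (?e * h * idem m \<gamma>) * (S (m - 1) * (idem m \<gamma>' * h' * ?e)))"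
        by (simp only: sum_product mult.assoc)
      have cl: "\<exists>k. (\<Sum>i\<in>I. f i) = k *s ?e" if "\<And>i. i \<in> I ==> \<exists>k. f i = k *s ?e" for I :: "int list set" and f
        using that
      proof (induction I rule: infinite_finite_induct)
        case (insert i I)
        then obtain k k' where "f i = k *s ?e" "(\<Sum>i\<in>I. f i) = k' *s ?e" by (meson insertCI)
        then show ?case using insert by (intro exI[of _ "k + k'"]) (simp add: scale_left_distrib)
      qed (auto intro: exI[of _ 0])
      show ?case unfolding E using H2 mid by (intro cl) auto
    qed
  qed
qed

text \<open>The element z commutes with the intertwiner, which is invertible between the two weight
  spaces, so the eigenvalues of z agree. The commuting factor w serves to fix one tensor factor
  while the other one moves.\<close>

lemma adm_swap_scalar:
  assumes m: "m \<le> n" and \<alpha>: "\<alpha> \<in> contents m" and sw: "adm_swap \<alpha> \<beta>"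
    and w: "\<And>x. x \<in> H m ==> x * w = w * x" and zH: "\<And>x. x \<in> H m ==> x * z = z * x"
    and c: "\<And>\<gamma>. \<gamma> \<in> contents m ==> z * (idem m \<gamma> * w) = c \<gamma> *s (idem m \<gamma> * w)"
    and nz: "idem m \<alpha> * w \<noteq> 0"
  shows "c \<beta> = c \<alpha> \<and> idem m \<beta> * w \<noteq> 0 \<and> \<beta> \<in> contents m"
proof -
  obtain pre x y suf where s: "\<alpha> = pre @ x # y # suf" "\<beta> = pre @ y # x # suf"
    "x \<noteq> y" "x \<noteq> y + 1" "x \<noteq> y - 1" using sw by (auto simp: adm_swap_def)
  have \<beta>: "\<beta> \<in> contents m" using \<alpha> adm_swap_content[OF sw] s by (auto simp: contents_def)
  note d = decomp_idem[OF m]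
  let ?k = "length suf" and ?e = "idem m \<alpha>"
  have k: "Suc ?k < m" using \<alpha> s by (auto simp: contents_def)
  then have kn: "Suc ?k < n" using m by simp
  have "S ?k * X ?k \<in> H m" "X ?k * S ?k \<in> H m" using k m by (auto intro!: H_mult H_S H_X)
  then have P: "Phi ?k \<in> H m" unfolding Phi_def H_def by (rule alg_diff)
  have we: "wt \<alpha> ?e" using decomp_wt[OF d \<alpha>] .
  have l: "length (pre @ x # y # suf) \<le> n" using \<alpha> s m by (simp add: contents_def)
  have wP: "wt \<beta> (Phi ?k * ?e)" using wt_Phi[OF _ l, of ?e] we s by simp
  have eP: "idem m \<beta> * (Phi ?k * ?e) = Phi ?k * ?e" by (rule decomp_proj[OF d wP \<beta>])
  define t where "t = Phi ?k * ?e * w"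
  have eH: "?e \<in> H m" using decomp_H[OF d \<alpha>] .
  have PeH: "Phi ?k * ?e \<in> H m" using H_mult[OF m P eH] .
  have "z * t = Phi ?k * (z * (?e * w))" unfolding t_def using zH[OF P] by (metis mult.assoc)
  then have 1: "z * t = c \<alpha> *s t" using c[OF \<alpha>] by (simp add: t_def mult.assoc)
  have te: "t = idem m \<beta> * w * (Phi ?k * ?e)"
  proof -
    have "t = idem m \<beta> * (Phi ?k * ?e) * w" unfolding t_def eP ..
    also have "\<dots> = idem m \<beta> * (w * (Phi ?k * ?e))" unfolding w[OF PeH, symmetric] by (simp only: mult.assoc)
    finally show ?thesis by (simp only: mult.assoc)
  qed
  have 2: "z * t = c \<beta> *s t" unfolding te using c[OF \<beta>] by (metis mult.assoc mult_scale_left)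
  have tail: "wt (p @ r) v ==> wt r v" for p r v by (induction p) auto
  have "wt (x # y # suf) ?e" using we tail unfolding s(1) by blast
  then have "Phi ?k * (Phi ?k * ?e) = ((zq * zq + 2) * qe y * qe x - qe y * qe y - qe x * qe x) *s ?e"
    using Phi_sq_wt[of ?k ?e y x] kn wt_u[OF we] by simp
  then have "Phi ?k * t = ((zq * zq + 2) * qe y * qe x - qe y * qe y - qe x * qe x) *s (?e * w)"
    unfolding t_def by (metis mult.assoc mult_scale_left)
  moreover have "(zq * zq + 2) * qe y * qe x - qe y * qe y - qe x * qe x \<noteq> 0"
    using Phi_sq_nonzero[of y x] s by auto
  ultimately have "t \<noteq> 0" using nz by auto
  then show ?thesis using 1 2 te \<beta> by (auto simp: scale_cancel_right)
qed

lemma adm_swaps_scalar: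
  assumes m: "m \<le> n" and \<alpha>: "\<alpha> \<in> contents m" and sw: "adm_swap\<^sup>*\<^sup>* \<alpha> \<beta>"
    and w: "\<And>x. x \<in> H m ==> x * w = w * x" and zH: "\<And>x. x \<in> H m ==> x * z = z * x"
    and c: "\<And>\<gamma>. \<gamma> \<in> contents m ==> z * (idem m \<gamma> * w) = c \<gamma> *s (idem m \<gamma> * w)"
    and nz: "idem m \<alpha> * w \<noteq> 0"
  shows "c \<beta> = c \<alpha> \<and> idem m \<beta> * w \<noteq> 0 \<and> \<beta> \<in> contents m"
  using sw
proof (induction rule: rtranclp_induct)
  case base
  then show ?case using \<alpha> nz by simp
next
  case (step y z')
  then show ?case using adm_swap_scalar[OF m _ step(2) w zH, of c] c by auto
qed

end

lemma commute_mult_left: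
  fixes t y :: "'a::semigroup_mult"
  shows "t * y = y * t ==> t * (y * x) = y * (t * x)"
  by (simp only: mult.assoc[symmetric])

lemma commute_sandwich:
  fixes t y e :: "'a::semigroup_mult"
  assumes "t * y = y * t" "e * y = y * e"
  shows "t * (e * t) * y = y * (t * (e * t))"
  by (simp only: mult.assoc assms commute_mult_left[OF assms(1)] commute_mult_left[OF assms(2)])

section \<open>Inverse generators and the additive form of the Jucys-Murphy elements\<close>

context hecke
begin

definition Si :: "nat => 'b" where "Si k = S k - zq *s u"

lemma S_Si: "Suc k < n ==> S k * Si k = u"
  by (simp add: Si_def right_diff_distrib quadz)

lemma Si_S: "Suc k < n ==> Si k * S k = u"
  by (simp add: Si_def left_diff_distrib quadz)

lemma u_Si [simp]: "Suc k < n ==> u * Si k = Si k"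
  by (simp add: Si_def right_diff_distrib)

lemma Si_u [simp]: "Suc k < n ==> Si k * u = Si k"
  by (simp add: Si_def left_diff_distrib)

text \<open>The q-analogue of the transpositions that involve the last strand; their sum is the
  additive Jucys-Murphy element, as \<open>X_sandwich\<close> shows.\<close>

fun sandwich :: "nat => nat => 'b" where
  "sandwich k 0 = S k"
| "sandwich k (Suc d) = S (k - 1 - d) * (sandwich k d * S (k - 1 - d))"

lemma S_sandwich: "Suc (Suc k) < n ==> d \<le> k ==> S (Suc k) * (sandwich k d * S (Suc k)) = sandwich (Suc k) (Suc d)"
proof (induction d)
  case 0
  then show ?case using braid[of k] by simp
next
  case (Suc d)
  let ?t = "S (k - 1 - d)" and ?s = "S (Suc k)"
  have c: "?t * ?s = ?s * ?t" using comm[of "Suc k" "k - 1 - d"] Suc.prems by simp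
  have "?s * (sandwich k (Suc d) * ?s) = ?s * (?t * (sandwich k d * (?t * ?s)))" by (simp add: mult.assoc)
  also have "\<dots> = (?s * ?t) * (sandwich k d * (?s * ?t))" by (simp only: c mult.assoc)
  also have "\<dots> = ?t * ((?s * (sandwich k d * ?s)) * ?t)" by (simp only: c[symmetric] mult.assoc)
  also have "\<dots> = ?t * (sandwich (Suc k) (Suc d) * ?t)" using Suc by simp
  also have "\<dots> = sandwich (Suc k) (Suc (Suc d))"
  proof -
    have "Suc k - 1 - Suc d = k - 1 - d" by simp
    then show ?thesis by (simp only: sandwich.simps(2)[of "Suc k" "Suc d"])
  qed
  finally show ?case .
qed

lemma X_sandwich: "Suc k < n ==> X (Suc k) = u + zq *s (\<Sum>d\<le>k. sandwich k d)"
proof (induction k)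
  case 0
  then show ?case by (simp add: X.simps quad zq_def)
next
  case (Suc k)
  have "X (Suc (Suc k)) = S (Suc k) * (X (Suc k) * S (Suc k))" by (rule X.simps)
  also have "\<dots> = S (Suc k) * S (Suc k) + zq *s (\<Sum>d\<le>k. S (Suc k) * (sandwich k d * S (Suc k)))"
    using Suc by (simp add: distrib_left distrib_right sum_distrib_left sum_distrib_right)
  also have "(\<Sum>d\<le>k. S (Suc k) * (sandwich k d * S (Suc k))) = (\<Sum>d\<le>k. sandwich (Suc k) (Suc d))"
    using S_sandwich Suc.prems by (intro sum.cong) auto
  also have "S (Suc k) * S (Suc k) + zq *s (\<Sum>d\<le>k. sandwich (Suc k) (Suc d))
      = u + zq *s (\<Sum>d\<le>Suc k. sandwich (Suc k) d)"
    using quadz[of "Suc k"] Suc.prems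
    by (simp only: sum.atMost_Suc_shift sandwich.simps(1) scale_right_distrib add.assoc)
  finally show ?case .
qed

end

section \<open>The quantized walled Brauer algebra\<close>

text \<open>The algebra is presented through \<open>g k\<close> (the inverse of the generator with index \<open>k + 1\<close>) to the
  left of the wall and \<open>T k\<close> (the generator with index \<open>r + 1 + k\<close>) to its right. All relations are
  relative to an idempotent \<open>u\<close> in place of the unit, so that corners are again of this form.\<close>

locale walled = alg_over scale
  for scale :: "'k::field => 'b::ring_1 => 'b" (infixr "*s" 75) +
  fixes u :: 'b and q \<rho> :: 'k and r s :: nat and g T :: "nat => 'b" and E :: 'b
  assumes hecke_left: "hecke scale u (inverse q) g r"
    and hecke_right: "hecke scale u q T s"
    and gT: "Suc k < r ==> Suc l < s ==> g k * T l = T l * g k"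
    and uE [simp]: "u * E = E" and Eu [simp]: "E * u = E"
    and EE: "E * E = delta q \<rho> *s E"
    and Eg: "Suc (Suc k) < r ==> E * g k = g k * E"
    and ET: "Suc (Suc k) < s ==> E * T (Suc k) = T (Suc k) * E"
    and EgE: "2 \<le> r ==> E * (g (r - 2) * E) = inverse \<rho> *s E"
    and ETE: "2 \<le> s ==> E * (T 0 * E) = \<rho> *s E"
    and DR: "2 \<le> r ==> 2 \<le> s ==>
      E * (g (r - 2) * (T 0 * E)) * (g (r - 2) * T 0) = E * (g (r - 2) * (T 0 * E))"
    and DL: "2 \<le> r ==> 2 \<le> s ==>
      (g (r - 2) * T 0) * (E * (g (r - 2) * (T 0 * E))) = E * (g (r - 2) * (T 0 * E))"
    and E0: "r = 0 \<or> s = 0 ==> E = 0"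
    and rho0: "\<rho> \<noteq> 0"
begin

sublocale L: hecke scale u "inverse q" g r by (rule hecke_left)
sublocale R: hecke scale u q T s by (rule hecke_right)

abbreviation "dl \<equiv> delta q \<rho>"

lemma Lzq: "L.zq = - R.zq" using R.q0 by (simp add: L.zq_def R.zq_def)

lemma z_delta: "R.zq * dl = \<rho> - inverse \<rho>"
  using R.z0 by (simp add: delta_def R.zq_def)

lemma rho_delta: "\<rho> * \<rho> - R.zq * \<rho> * dl = 1"
proof -
  have "R.zq * \<rho> * dl = \<rho> * (\<rho> - inverse \<rho>)" using z_delta by (simp add: mult.commute mult.left_commute)
  then show ?thesis using rho0 by (simp add: right_diff_distrib)
qed

definition B :: "'b set" where "B = alg (g ` {k. Suc k < r} \<union> T ` {k. Suc k < s} \<union> {E}) u"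

lemma B_u: "u \<in> B" unfolding B_def by (rule alg_unit)
lemma B_add: "x \<in> B ==> y \<in> B ==> x + y \<in> B" unfolding B_def by (rule alg_add)
lemma B_diff: "x \<in> B ==> y \<in> B ==> x - y \<in> B" unfolding B_def by (rule alg_diff)
lemma B_scale: "x \<in> B ==> a *s x \<in> B" unfolding B_def by (rule alg_scale)
lemma B_sum: "(\<And>i. i \<in> I ==> f i \<in> B) ==> sum f I \<in> B" unfolding B_def by (rule alg_sum)
lemma B_mult: "x \<in> B ==> y \<in> B ==> x * y \<in> B" unfolding B_def by (rule alg_mult) auto
lemma B_u_left: "x \<in> B ==> u * x = x" unfolding B_def by (rule alg_unit_left) auto
lemma B_u_right: "x \<in> B ==> x * u = x" unfolding B_def by (rule alg_unit_right) auto
lemma B_g: "Suc k < r ==> g k \<in> B" unfolding B_def by (rule alg_genI) auto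
lemma B_T: "Suc k < s ==> T k \<in> B" unfolding B_def by (rule alg_genI) auto
lemma B_E: "E \<in> B" unfolding B_def by (rule alg_genI) auto
lemma B_LH: "m \<le> r ==> x \<in> L.H m ==> x \<in> B" unfolding B_def L.H_def by (rule alg_mono) auto
lemma B_RH: "m \<le> s ==> x \<in> R.H m ==> x \<in> B" unfolding B_def R.H_def by (rule alg_mono) auto

lemma B_commuteI:
  assumes "u * y = y" "y * u = y" "\<And>k. Suc k < r ==> g k * y = y * g k" "\<And>k. Suc k < s ==> T k * y = y * T k"
    "E * y = y * E" "x \<in> B"
  shows "x * y = y * x"
  by (rule alg_commute[OF assms(1,2) _ assms(6)[unfolded B_def]]) (use assms in auto)

subsection \<open>Jucys-Murphy elements\<close>

text \<open>The arc that joins strand r - d on the left of the wall to the first strand on its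
  right.\<close>

fun Ed :: "nat => 'b" where
  "Ed 0 = E"
| "Ed (Suc d) = g (r - 2 - d) * (Ed d * g (r - 2 - d))"

declare Ed.simps(2) [simp del]

definition Esum :: 'b where "Esum = (\<Sum>d<r. Ed d)"

text \<open>This is 1 + (q - q^-1) L for the elements on the right; the constant is \<rho>^2 because
  (q - q^-1) \<rho> \<delta> = \<rho>^2 - 1.\<close>

fun Y :: "nat => 'b" where
  "Y 0 = (\<rho> * \<rho>) *s u - (R.zq * \<rho>) *s Esum"
| "Y (Suc k) = T k * (Y k * T k)"

declare Y.simps [simp del]

lemma Ed_B: "d < r ==> Ed d \<in> B"
  by (induction d) (auto simp: Ed.simps intro!: B_mult B_g B_E)

lemma Esum_B: "Esum \<in> B" unfolding Esum_def by (rule B_sum) (simp add: Ed_B)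

lemma Y_B: "k < s ==> Y k \<in> B"
  by (induction k) (auto simp: Y.simps intro!: B_diff B_scale B_mult B_T Esum_B B_u)

lemma X_B: "k < r ==> L.X k \<in> B" using B_LH[of r] L.H_X[of k r] by simp

lemma uY [simp]: "k < s ==> u * Y k = Y k" and Yu [simp]: "k < s ==> Y k * u = Y k"
  using B_u_left B_u_right Y_B by auto

lemma T_Ed: "Suc (Suc k) < s ==> d < r ==> T (Suc k) * Ed d = Ed d * T (Suc k)"
proof (induction d)
  case 0 then show ?case using ET by simp
next
  case (Suc d)
  let ?g = "g (r - 2 - d)"
  have c: "T (Suc k) * ?g = ?g * T (Suc k)" using gT[of "r - 2 - d" "Suc k"] Suc.prems by simp
  have "T (Suc k) * Ed (Suc d) = ?g * ((T (Suc k) * Ed d) * ?g)" by (simp only: Ed.simps c mult.assoc[symmetric])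
  also have "\<dots> = ?g * (Ed d * (T (Suc k) * ?g))" using Suc by (simp add: mult.assoc)
  also have "\<dots> = Ed (Suc d) * T (Suc k)" by (simp only: Ed.simps c mult.assoc)
  finally show ?case .
qed

lemma T_Y0: "Suc (Suc k) < s ==> T (Suc k) * Y 0 = Y 0 * T (Suc k)"
  by (simp add: Y.simps Esum_def right_diff_distrib left_diff_distrib sum_distrib_left sum_distrib_right T_Ed)

lemma g_Ed_far: "Suc k < r ==> d + k + 2 < r ==> g k * Ed d = Ed d * g k"
proof (induction d)
  case 0 then show ?case using Eg[of k] by simp
next
  case (Suc d)
  let ?g = "g (r - 2 - d)"
  have c: "g k * ?g = ?g * g k" using L.comm[of "r - 2 - d" k] Suc.prems by simp
  have "g k * Ed (Suc d) = ?g * ((g k * Ed d) * ?g)" by (simp only: Ed.simps c mult.assoc[symmetric])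
  also have "\<dots> = ?g * (Ed d * (g k * ?g))" using Suc by (simp add: mult.assoc)
  also have "\<dots> = Ed (Suc d) * g k" by (simp only: Ed.simps c mult.assoc)
  finally show ?case .
qed

lemma g_Ed_near: "Suc k < r ==> d < r ==> r < d + k + 1 ==> g k * Ed d = Ed d * g k"
proof (induction d)
  case (Suc d)
  let ?g = "g (r - 2 - d)"
  show ?case
  proof (cases "d + k + 1 = r")
    case True
    then obtain a where a: "d = Suc a" using Suc.prems by (cases d) auto
    define j where "j = k - 1"
    have j: "k = Suc j" "r - 2 - d = j" "r - 2 - a = k" using True Suc.prems a by (auto simp: j_def)
    have b: "g j * (g k * g j) = g k * (g j * g k)" using L.braid[of j] j Suc.prems by simp
    have f: "g j * Ed a = Ed a * g j" using g_Ed_far[of j a] True Suc.prems a j by simp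
    have e: "Ed (Suc d) = g j * (g k * (Ed a * (g k * g j)))"
      unfolding a Ed.simps using j(2,3) a by (simp add: mult.assoc)
    have "g k * Ed (Suc d) = (g k * (g j * g k)) * (Ed a * (g k * g j))" by (simp only: e mult.assoc)
    also have "\<dots> = g j * (g k * ((g j * Ed a) * (g k * g j)))" by (simp only: b[symmetric] mult.assoc)
    also have "\<dots> = g j * (g k * (Ed a * (g j * (g k * g j))))" by (simp only: f mult.assoc)
    also have "\<dots> = Ed (Suc d) * g k" by (simp only: b e mult.assoc)
    finally show ?thesis .
  next
    case False
    have c: "?g * g k = g k * ?g" using L.comm[of k "r - 2 - d"] Suc.prems False by simp
    have IH: "g k * Ed d = Ed d * g k" using Suc False by simp
    have "g k * Ed (Suc d) = ?g * ((g k * Ed d) * ?g)" by (simp only: Ed.simps c[symmetric] mult.assoc[symmetric])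
    also have "\<dots> = ?g * (Ed d * (g k * ?g))" by (simp only: IH mult.assoc)
    also have "\<dots> = Ed (Suc d) * g k" by (simp only: Ed.simps c[symmetric] mult.assoc)
    finally show ?thesis .
  qed
qed simp

text \<open>Conjugation by g takes the shorter arc to the longer one, and the quadratic relation
  makes the two error terms equal. All other arcs commute with g, so the sum of all arcs
  does.\<close>

lemma g_Ed_pair:
  assumes "Suc k < r" "d + k + 2 = r"
  shows "g k * (Ed d + Ed (Suc d)) = (Ed d + Ed (Suc d)) * g k"
proof -
  have "r - 2 - d = k" using assms by simp
  then have e: "Ed (Suc d) = g k * (Ed d * g k)" by (simp only: Ed.simps(2))
  have uEd: "u * Ed d = Ed d" "Ed d * u = Ed d" using B_u_left B_u_right Ed_B[of d] assms by auto
  have "g k * Ed (Suc d) = Ed d * g k + L.zq *s (g k * (Ed d * g k))"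
    using L.SSx[OF assms(1), of "Ed d * g k"] uEd by (simp add: e mult.assoc[symmetric])
  moreover have "Ed (Suc d) * g k = g k * Ed d + L.zq *s (g k * (Ed d * g k))"
    using L.quadz[OF assms(1)] uEd by (simp add: e mult.assoc distrib_left)
  ultimately show ?thesis by (simp add: distrib_left distrib_right)
qed

lemma g_Esum: assumes k: "Suc k < r" shows "g k * Esum = Esum * g k"
proof -
  define d where "d = r - 2 - k"
  have d: "d + k + 2 = r" using k by (simp add: d_def)
  have s: "Esum = (Ed d + Ed (Suc d)) + (\<Sum>j\<in>{..<r} - {d, Suc d}. Ed j)"
    unfolding Esum_def using d by (subst sum.subset_diff[of "{d, Suc d}"]) (auto simp: add_ac)
  have "g k * Ed j = Ed j * g k" if "j \<in> {..<r} - {d, Suc d}" for j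
    using that g_Ed_far[OF k, of j] g_Ed_near[OF k, of j] d by (cases "j < d") auto
  then show ?thesis unfolding s using g_Ed_pair[OF k d]
    by (simp add: distrib_left distrib_right sum_distrib_left sum_distrib_right)
qed

lemma g_Y: "Suc k < r ==> j < s ==> g k * Y j = Y j * g k"
proof (induction j)
  case 0
  then show ?case by (simp add: Y.simps right_diff_distrib left_diff_distrib g_Esum)
next
  case (Suc j)
  have c: "g k * T j = T j * g k" using gT Suc.prems by simp
  have "g k * Y (Suc j) = T j * ((g k * Y j) * T j)" by (simp only: Y.simps c mult.assoc[symmetric])
  also have "\<dots> = T j * (Y j * (g k * T j))" using Suc by (simp add: mult.assoc)
  also have "\<dots> = Y (Suc j) * g k" by (simp only: Y.simps c mult.assoc)
  finally show ?case .
qed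

lemma X_Y: "k < r ==> j < s ==> L.X k * Y j = Y j * L.X k"
  by (rule L.H_commute[where m = r]) (auto simp: g_Y L.H_X)

lemma T_X: "k < r ==> Suc l < s ==> L.X k * T l = T l * L.X k"
  by (rule L.H_commute[where m = r]) (auto simp: gT L.H_X)

lemma E_X: "Suc k < r ==> E * L.X k = L.X k * E"
  by (rule L.H_commute[where m = "r - 1", symmetric]) (auto simp: Eg L.H_X)

text \<open>The elements \<open>Dd d\<close> are the arcs of the inner algebra, up to the factor \<open>dl\<close>.\<close>

definition D :: 'b where "D = E * (g (r - 2) * (T 0 * E))"

fun Dd :: "nat => 'b" where
  "Dd 0 = D"
| "Dd (Suc d) = g (r - 3 - d) * (Dd d * g (r - 3 - d))"

lemma E_g_E_g: "2 \<le> r ==> E * (g (r - 2) * (E * x)) = inverse \<rho> *s (E * x)"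
  using EgE by (metis mult.assoc mult_scale_left)

text \<open>The relation E g E = \<rho>^-1 E contracts the arc inside, which leaves the
  q-transposition of the left Hecke algebra. Thus E times the sum of arcs sees the Jucys-Murphy
  element of strand r.\<close>

lemma E_Ed: "Suc d < r ==> E * Ed (Suc d) = inverse \<rho> *s (E * L.sandwich (r - 2) d)"
  and Ed_E: "Suc d < r ==> Ed (Suc d) * E = inverse \<rho> *s (L.sandwich (r - 2) d * E)"
proof (induction d)
  case 0
  {
    case 1
    then show ?case using E_g_E_g[of "g (r - 2)"] by (simp add: Ed.simps)
  next
    case 2
    then have "2 \<le> r" by simp
    then show ?case using EgE by (simp add: Ed.simps mult.assoc)
  }
next
  case (Suc d)
  let ?t = "g (r - 2 - Suc d)"
  have eq: "r - 2 - 1 - d = r - 2 - Suc d" by simp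
  {
    case 1
    have c: "E * ?t = ?t * E" using Eg[of "r - 2 - Suc d"] 1 by simp
    have "E * Ed (Suc (Suc d)) = ?t * ((E * Ed (Suc d)) * ?t)"
      by (simp only: Ed.simps(2)[of "Suc d"] c mult.assoc[symmetric])
    also have "\<dots> = inverse \<rho> *s ((?t * E) * (L.sandwich (r - 2) d * ?t))" using Suc 1 by (simp add: mult.assoc)
    also have "\<dots> = inverse \<rho> *s (E * L.sandwich (r - 2) (Suc d))"
      by (simp only: c[symmetric] L.sandwich.simps eq mult.assoc)
    finally show ?case .
  next
    case 2
    have c: "E * ?t = ?t * E" using Eg[of "r - 2 - Suc d"] 2 by simp
    have "Ed (Suc (Suc d)) * E = ?t * ((Ed (Suc d) * E) * ?t)"
      by (simp only: Ed.simps(2)[of "Suc d"] c[symmetric] mult.assoc)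
    also have "\<dots> = inverse \<rho> *s (?t * (L.sandwich (r - 2) d * (E * ?t)))" using Suc 2 by (simp add: mult.assoc)
    also have "\<dots> = inverse \<rho> *s (L.sandwich (r - 2) (Suc d) * E)"
      by (simp only: c L.sandwich.simps eq mult.assoc)
    finally show ?case .
  }
qed

lemma Esum_split: "1 \<le> r ==> Esum = E + (\<Sum>d<r - 1. Ed (Suc d))"
proof -
  assume "1 \<le> r"
  then have "Esum = (\<Sum>d<Suc (r - 1). Ed d)" by (simp add: Esum_def)
  then show ?thesis by (simp only: sum.lessThan_Suc_shift Ed.simps(1))
qed

text \<open>By \<open>E_Ed\<close> and \<open>X_sandwich\<close> both sides are E minus z times a
  sum of sandwiches; the coefficients of E agree because \<rho>^2 - z \<rho> \<delta> = 1.\<close>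

lemma E_Y0: "1 \<le> r ==> 1 \<le> s ==> E * Y 0 = E * L.X (r - 1)"
  and Y0_E: "1 \<le> r ==> 1 \<le> s ==> Y 0 * E = L.X (r - 1) * E"
proof -
  assume rs: "1 \<le> r" "1 \<le> s"
  have key: "(\<rho> * \<rho>) *s E - (R.zq * \<rho>) *s (dl *s E + inverse \<rho> *s A) = E - R.zq *s A" for A
  proof -
    have "(\<rho> * \<rho>) *s E - (R.zq * \<rho> * dl) *s E = E"
      using rho_delta by (simp only: scale_left_diff_distrib[symmetric] scale_one)
    then show ?thesis using rho0 by (simp add: scale_right_distrib algebra_simps)
  qed
  have Es: "Esum = E + (\<Sum>d<r - 1. Ed (Suc d))" using Esum_split rs by simp
  have Xs: "L.X (r - 1) = u - R.zq *s (\<Sum>d<r - 1. L.sandwich (r - 2) d)"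
  proof (cases "r = 1")
    case False
    then have "Suc (r - 2) = r - 1" "{..r - 2} = {..<r - 1}" using rs by auto
    then show ?thesis using L.X_sandwich[of "r - 2"] False rs by (simp add: Lzq)
  qed simp
  have "E * Y 0 = (\<rho> * \<rho>) *s E - (R.zq * \<rho>) *s (dl *s E + inverse \<rho> *s (\<Sum>d<r - 1. E * L.sandwich (r - 2) d))"
    by (simp add: Y.simps right_diff_distrib Es distrib_left EE sum_distrib_left E_Ed scale_sum_right)
  also have "\<dots> = E * L.X (r - 1)" unfolding key Xs by (simp add: right_diff_distrib sum_distrib_left)
  finally show "E * Y 0 = E * L.X (r - 1)" .
  have "Y 0 * E = (\<rho> * \<rho>) *s E - (R.zq * \<rho>) *s (dl *s E + inverse \<rho> *s (\<Sum>d<r - 1. L.sandwich (r - 2) d * E))"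
    by (simp add: Y.simps left_diff_distrib Es distrib_right EE sum_distrib_right Ed_E scale_sum_right)
  also have "\<dots> = L.X (r - 1) * E" unfolding key Xs by (simp add: left_diff_distrib sum_distrib_right)
  finally show "Y 0 * E = L.X (r - 1) * E" .
qed

text \<open>The relations \<open>DR\<close> and \<open>DL\<close> say that the arc moved over to the
  second strand on the right becomes, next to E, an arc of the inner algebra. It does not matter on
  which side E stands.\<close>

lemma E_T_Ed: "2 \<le> s ==> Suc d < r ==> E * (T 0 * (Ed (Suc d) * T 0)) = Dd d"
  and T_Ed_E: "2 \<le> s ==> Suc d < r ==> T 0 * (Ed (Suc d) * T 0) * E = Dd d"
proof (induction d)
  case 0
  let ?g = "g (r - 2)"
  {
    case 1
    then have c: "T 0 * ?g = ?g * T 0" using gT[of "r - 2" 0] by simp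
    have "E * (T 0 * (Ed (Suc 0) * T 0)) = E * ((T 0 * ?g) * (E * (?g * T 0)))" by (simp add: Ed.simps mult.assoc)
    also have "\<dots> = D" using DR 1 by (simp add: D_def c mult.assoc)
    finally show ?case by simp
  next
    case 2
    then have c: "T 0 * ?g = ?g * T 0" using gT[of "r - 2" 0] by simp
    have "T 0 * (Ed (Suc 0) * T 0) * E = (T 0 * ?g) * (E * (?g * (T 0 * E)))" by (simp add: Ed.simps mult.assoc)
    also have "\<dots> = D" using DL 2 by (simp add: D_def c)
    finally show ?case by simp
  }
next
  case (Suc d)
  let ?t = "g (r - 2 - Suc d)"
  have eq: "r - 3 - d = r - 2 - Suc d" by simp
  {
    case 1
    have c: "E * ?t = ?t * E" "T 0 * ?t = ?t * T 0" using Eg[of "r - 2 - Suc d"] gT[of "r - 2 - Suc d" 0] 1 by auto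
    have "E * (T 0 * (Ed (Suc (Suc d)) * T 0)) = E * (T 0 * (?t * (Ed (Suc d) * (?t * T 0))))"
      by (simp only: Ed.simps(2)[of "Suc d"] mult.assoc)
    also have "\<dots> = ?t * (E * (T 0 * (Ed (Suc d) * T 0))) * ?t"
      by (simp only: mult.assoc c commute_mult_left[OF c(1)] commute_mult_left[OF c(2)])
    also have "\<dots> = Dd (Suc d)" using Suc 1 by (simp only: Dd.simps eq mult.assoc)
    finally show ?case .
  next
    case 2
    have c: "E * ?t = ?t * E" "T 0 * ?t = ?t * T 0" using Eg[of "r - 2 - Suc d"] gT[of "r - 2 - Suc d" 0] 2 by auto
    have "T 0 * (Ed (Suc (Suc d)) * T 0) * E = T 0 * (?t * (Ed (Suc d) * (?t * (T 0 * E))))"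
      by (simp only: Ed.simps(2)[of "Suc d"] mult.assoc)
    also have "\<dots> = ?t * (T 0 * (Ed (Suc d) * T 0) * E) * ?t"
      by (simp only: mult.assoc c commute_mult_left[OF c(1)] commute_mult_left[OF c(2)])
    also have "\<dots> = Dd (Suc d)" using Suc(2)[OF 2(1)] 2(2) by (simp only: Dd.simps eq mult.assoc[symmetric])
    finally show ?case .
  }
qed

text \<open>The contribution of the shortest arc cancels against the linear term of T^2, by E T E =
  \<rho> E. What remains is \<delta> times the first \<open>Y\<close> of the inner algebra; that
  both products agree also shows that E commutes with \<open>Y 1\<close>.\<close>

lemma E_Y1: "2 \<le> s ==> 1 \<le> r ==> E * Y 1 = (\<rho> * \<rho>) *s E - (R.zq * \<rho>) *s (\<Sum>d<r - 1. Dd d)"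
  and Y1_E: "2 \<le> s ==> 1 \<le> r ==> Y 1 * E = (\<rho> * \<rho>) *s E - (R.zq * \<rho>) *s (\<Sum>d<r - 1. Dd d)"
proof -
  assume rs: "2 \<le> s" "1 \<le> r"
  have Es: "Esum = E + (\<Sum>d<r - 1. Ed (Suc d))" using Esum_split rs by simp
  have Y1: "Y 1 = (\<rho> * \<rho>) *s (T 0 * T 0) - (R.zq * \<rho>) *s (T 0 * (E * T 0) + (\<Sum>d<r - 1. T 0 * (Ed (Suc d) * T 0)))"
    using rs by (simp add: Y.simps Es right_diff_distrib left_diff_distrib distrib_left distrib_right
        sum_distrib_left sum_distrib_right)
  have TT: "T 0 * T 0 = u + R.zq *s T 0" using R.quadz[of 0] rs by simp
  have a: "E * (T 0 * (E * T 0)) = \<rho> *s (E * T 0)" using ETE rs by (metis mult.assoc mult_scale_left)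
  have b: "T 0 * (E * T 0) * E = \<rho> *s (T 0 * E)" using ETE rs by (simp add: mult.assoc)
  have s1: "(\<Sum>d<r - 1. E * (T 0 * (Ed (Suc d) * T 0))) = (\<Sum>d<r - 1. Dd d)"
    by (rule sum.cong) (use E_T_Ed rs in auto)
  have s2: "(\<Sum>d<r - 1. T 0 * (Ed (Suc d) * T 0) * E) = (\<Sum>d<r - 1. Dd d)"
    by (rule sum.cong) (use T_Ed_E rs in auto)
  have "E * Y 1 = (\<rho> * \<rho>) *s (E + R.zq *s (E * T 0)) - (R.zq * \<rho>) *s (\<rho> *s (E * T 0) + (\<Sum>d<r - 1. Dd d))"
    unfolding Y1 TT by (simp only: right_diff_distrib distrib_left mult_scale_right sum_distrib_left a s1 Eu)
  then show "E * Y 1 = (\<rho> * \<rho>) *s E - (R.zq * \<rho>) *s (\<Sum>d<r - 1. Dd d)"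
    by (simp add: scale_right_distrib mult_ac)
  have "Y 1 * E = (\<rho> * \<rho>) *s (E + R.zq *s (T 0 * E)) - (R.zq * \<rho>) *s (\<rho> *s (T 0 * E) + (\<Sum>d<r - 1. Dd d))"
    unfolding Y1 TT by (simp only: left_diff_distrib distrib_right mult_scale_left sum_distrib_right b s2 uE)
  then show "Y 1 * E = (\<rho> * \<rho>) *s E - (R.zq * \<rho>) *s (\<Sum>d<r - 1. Dd d)"
    by (simp add: scale_right_distrib mult_ac)
qed

lemma E_Y: "Suc k < s ==> E * Y (Suc k) = Y (Suc k) * E"
proof (cases "r = 0")
  case True
  then show ?thesis using E0 by simp
next
  case False
  then show "Suc k < s ==> E * Y (Suc k) = Y (Suc k) * E"
  proof (induction k)
    case 0
    then show ?case using E_Y1 Y1_E by (simp add: One_nat_def)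
  next
    case (Suc k)
    have c: "E * T (Suc k) = T (Suc k) * E" using ET Suc.prems by simp
    have "E * Y (Suc (Suc k)) = T (Suc k) * ((E * Y (Suc k)) * T (Suc k))"
      by (simp only: Y.simps(2)[of "Suc k"] c mult.assoc[symmetric])
    also have "\<dots> = T (Suc k) * (Y (Suc k) * (E * T (Suc k)))" using Suc by (simp add: mult.assoc)
    also have "\<dots> = Y (Suc (Suc k)) * E" by (simp only: Y.simps(2)[of "Suc k"] c mult.assoc)
    finally show ?case .
  qed
qed

lemma Ed_Y: "Suc k < s ==> d < r ==> Ed d * Y (Suc k) = Y (Suc k) * Ed d"
proof (induction d)
  case (Suc d)
  have c: "g (r - 2 - d) * Y (Suc k) = Y (Suc k) * g (r - 2 - d)" using g_Y Suc.prems by simp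
  have IH: "Ed d * Y (Suc k) = Y (Suc k) * Ed d" using Suc by simp
  show ?case by (simp only: Ed.simps commute_sandwich[OF c IH])
qed (simp add: E_Y)

lemma Y0_Y: "k < s ==> Y 0 * Y k = Y k * Y 0"
proof (cases k)
  case (Suc j)
  assume "k < s"
  then have "Esum * Y k = Y k * Esum" unfolding Esum_def Suc
    by (simp add: sum_distrib_left sum_distrib_right Ed_Y)
  then show ?thesis using \<open>k < s\<close> by (simp add: Y.simps(1) left_diff_distrib right_diff_distrib)
qed simp

lemma T_Y_far: "Suc l < s ==> k < l ==> T l * Y k = Y k * T l"
proof (induction k)
  case 0
  then show ?case using T_Y0[of "l - 1"] by simp
next
  case (Suc k)
  have c: "T k * T l = T l * T k" using R.comm[of l k] Suc.prems by simp
  have IH: "Y k * T l = T l * Y k" using Suc by simp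
  show ?case by (simp only: Y.simps commute_sandwich[OF c IH])
qed

lemma Y_T: "Suc k < s ==> Y (Suc k) * T k = T k * Y k + R.zq *s Y (Suc k)"
  and T_Y: "Suc k < s ==> T k * Y (Suc k) = Y k * T k + R.zq *s Y (Suc k)"
proof -
  assume k: "Suc k < s"
  show "Y (Suc k) * T k = T k * Y k + R.zq *s Y (Suc k)"
    using k by (simp add: Y.simps(2) mult.assoc R.quadz distrib_left)
  have uYT: "u * (Y k * T k) = Y k * T k" using uY[of k] k by (simp add: mult.assoc[symmetric])
  show "T k * Y (Suc k) = Y k * T k + R.zq *s Y (Suc k)"
    using R.SSx[OF k, of "Y k * T k"] uYT by (simp add: Y.simps(2))
qed

lemma T_Y_near: "k < s ==> Suc j < k ==> T j * Y k = Y k * T j"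
proof (induction k)
  case (Suc k)
  show ?case
  proof (cases "Suc j = k")
    case True
    let ?t = "T (Suc j)"
    have b: "T j * (?t * T j) = ?t * (T j * ?t)" using R.braid[of j] Suc.prems True by simp
    have c: "?t * Y j = Y j * ?t" using T_Y_far[of "Suc j" j] Suc.prems True by simp
    have Yk: "Y (Suc k) = ?t * (T j * (Y j * (T j * ?t)))"
      using True by (simp add: Y.simps(2) mult.assoc flip: True)
    have "T j * Y (Suc k) = (T j * (?t * T j)) * (Y j * (T j * ?t))" by (simp add: Yk mult.assoc)
    also have "\<dots> = ?t * (T j * ((?t * Y j) * (T j * ?t)))" by (simp add: b mult.assoc)
    also have "\<dots> = ?t * (T j * (Y j * (?t * (T j * ?t))))" by (simp only: c mult.assoc)
    also have "\<dots> = Y (Suc k) * T j" by (simp add: b[symmetric] Yk mult.assoc)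
    finally show ?thesis .
  next
    case False
    have c: "T k * T j = T j * T k" using R.comm[of k j] Suc.prems False by simp
    have IH: "Y k * T j = T j * Y k" using Suc False by simp
    show ?thesis by (simp only: Y.simps commute_sandwich[OF c IH])
  qed
qed simp

lemma Y_comm_less: "l < s ==> k < l ==> Y k * Y l = Y l * Y k"
proof (induction k)
  case 0
  then show ?case using Y0_Y by simp
next
  case (Suc k)
  have c: "T k * Y l = Y l * T k" using T_Y_near[of l k] Suc.prems by simp
  have IH: "Y k * Y l = Y l * Y k" using Suc by simp
  show ?case by (simp only: Y.simps commute_sandwich[OF c IH])
qed

lemma Y_comm: "k < s ==> l < s ==> Y k * Y l = Y l * Y k"
  using Y_comm_less[of l k] Y_comm_less[of k l] by (cases k l rule: linorder_cases) auto

lemma T_Y_comm: "Suc j < s ==> k < s ==> k \<noteq> j ==> k \<noteq> Suc j ==> T j * Y k = Y k * T j"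
  using T_Y_far[of j k] T_Y_near[of k j] by linarith

end

lemma idem_power:
  fixes e x :: "'a::ring_1"
  assumes "e * e = e" "e * x = x * e" "0 < p"
  shows "(e * x) ^ p = e * x ^ p"
  using assms(3)
proof (induction p)
  case (Suc p)
  show ?case
  proof (cases "p = 0")
    case False
    then have "(e * x) ^ Suc p = e * (x * (e * x ^ p))" using Suc by (simp add: mult.assoc)
    also have "\<dots> = (e * e) * (x * x ^ p)" using assms(2) by (simp only: commute_mult_left[OF assms(2)[symmetric]] mult.assoc)
    finally show ?thesis using assms(1) by simp
  qed simp
qed simp

section \<open>Corners, shifts and reversals of Hecke algebras\<close>

context hecke
begin

lemma hecke_corner:
  assumes "m \<le> n" "e * e = e" "u * e = e" "\<And>k. Suc k < m ==> e * S k = S k * e"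
  shows "hecke scale e q (\<lambda>k. S k * e) m"
proof
  have c: "e * (S k * x) = S k * (e * x)" if "Suc k < m" for k x
    using commute_mult_left[OF assms(4)[OF that]] .
  have ee: "e * (e * x) = e * x" for x using assms(2) by (simp add: mult.assoc[symmetric])
  show "e * e = e" by fact
  show "e * (S k * e) = S k * e" if "Suc k < m" for k using c[OF that] assms(2) by simp
  show "S k * e * e = S k * e" for k using assms(2) by (simp add: mult.assoc)
  show "S k * e * (S k * e) = e + (q - inverse q) *s (S k * e)" if "Suc k < m" for k
  proof -
    have "S k * e * (S k * e) = (S k * S k) * e" using c[OF that] assms(2) by (simp add: mult.assoc)
    also have "\<dots> = (u + (q - inverse q) *s S k) * e" using quad[of k] that assms(1) by simp
    finally show ?thesis using assms(3) by (simp only: distrib_right mult_scale_left)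
  qed
  show "S k * e * (S (Suc k) * e * (S k * e)) = S (Suc k) * e * (S k * e * (S (Suc k) * e))" if k: "Suc (Suc k) < m" for k
  proof -
    have k': "Suc k < m" using k by simp
    have "S k * e * (S (Suc k) * e * (S k * e)) = (S k * (S (Suc k) * S k)) * e"
      by (simp only: mult.assoc c[OF k] c[OF k'] assms(2) ee)
    also have "\<dots> = (S (Suc k) * (S k * S (Suc k))) * e" using braid[of k] k assms(1) by simp
    also have "\<dots> = S (Suc k) * e * (S k * e * (S (Suc k) * e))"
      by (simp only: mult.assoc c[OF k] c[OF k'] assms(2) ee)
    finally show ?thesis .
  qed
  show "S i * e * (S j * e) = S j * e * (S i * e)" if ij: "Suc j < m" "Suc i < j" for i j
  proof -
    have i: "Suc i < m" using ij by simp
    have "S i * e * (S j * e) = (S i * S j) * e" by (simp only: mult.assoc c[OF ij(1)] assms(2))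
    also have "\<dots> = (S j * S i) * e" using comm[of j i] ij assms(1) by simp
    also have "\<dots> = S j * e * (S i * e)" by (simp only: mult.assoc c[OF i] assms(2))
    finally show ?thesis .
  qed
qed (use q0 generic in auto)

lemma hecke_shift: "hecke scale u q (\<lambda>k. S (Suc k)) (n - 1)"
  by standard (use quad braid comm q0 generic in auto)

lemma hecke_reverse: "hecke scale u q (\<lambda>k. S (n - 2 - k)) n"
proof
  show "S (n - 2 - k) * (S (n - 2 - Suc k) * S (n - 2 - k)) = S (n - 2 - Suc k) * (S (n - 2 - k) * S (n - 2 - Suc k))"
    if "Suc (Suc k) < n" for k
  proof -
    have "n - 2 - k = Suc (n - 2 - Suc k)" using that by simp
    then show ?thesis using braid[of "n - 2 - Suc k"] that by simp
  qed
  show "S (n - 2 - i) * S (n - 2 - j) = S (n - 2 - j) * S (n - 2 - i)" if "Suc j < n" "Suc i < j" for i j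
    using comm[of "n - 2 - i" "n - 2 - j"] that by simp
qed (use quad q0 generic in auto)

end

context walled
begin

subsection \<open>Central power sums\<close>

definition Z :: "nat => 'b" where "Z p = (\<Sum>i<r. L.X i ^ p) - (\<Sum>j<s. Y j ^ p)"

lemma B_power: "0 < p ==> x \<in> B ==> x ^ p \<in> B"
proof (induction p)
  case (Suc p)
  then show ?case by (cases "p = 0") (auto intro: B_mult)
qed simp

lemma Z_B: "0 < p ==> Z p \<in> B"
  unfolding Z_def by (intro B_diff B_sum B_power) (auto simp: X_B Y_B)

lemma T_Ysum: "Suc k < s ==> T k * (\<Sum>j<s. Y j ^ p) = (\<Sum>j<s. Y j ^ p) * T k"
proof -
  assume k: "Suc k < s"
  have e: "(\<Sum>j<s. Y j ^ p) = (Y k ^ p + Y (Suc k) ^ p) + (\<Sum>j\<in>{..<s} - {k, Suc k}. Y j ^ p)"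
    using k by (subst sum.subset_diff[of "{k, Suc k}"]) (auto simp: add_ac)
  have "T k * (Y k ^ p + Y (Suc k) ^ p) = (Y k ^ p + Y (Suc k) ^ p) * T k"
    using hecke_pair_symmetric[OF Y_T[OF k] T_Y[OF k], of p 0] Y_comm k by simp
  moreover have "T k * Y j ^ p = Y j ^ p * T k" if "j \<in> {..<s} - {k, Suc k}" for j
    using T_Y_comm[of k j] that k by (intro power_commuting_commutes[symmetric]) auto
  ultimately show ?thesis unfolding e by (simp add: distrib_left distrib_right sum_distrib_left sum_distrib_right)
qed

lemma E_X_Y_power:
  assumes "1 \<le> r" "1 \<le> s"
  shows "E * L.X (r - 1) ^ p = E * Y 0 ^ p" "L.X (r - 1) ^ p * E = Y 0 ^ p * E"
proof -
  have c: "L.X (r - 1) ^ p * Y 0 = Y 0 * L.X (r - 1) ^ p" for p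
    using X_Y[of "r - 1" 0] assms by (intro power_commuting_commutes) simp
  show "E * L.X (r - 1) ^ p = E * Y 0 ^ p"
  proof (induction p)
    case (Suc p)
    have "E * Y 0 ^ Suc p = (E * Y 0 ^ p) * Y 0" by (simp only: power_Suc2 mult.assoc)
    also have "\<dots> = (E * Y 0) * L.X (r - 1) ^ p" by (simp only: Suc[symmetric] mult.assoc c)
    also have "\<dots> = E * L.X (r - 1) ^ Suc p" by (simp only: E_Y0[OF assms] power_Suc mult.assoc)
    finally show ?case ..
  qed simp
  show "L.X (r - 1) ^ p * E = Y 0 ^ p * E"
  proof (induction p)
    case (Suc p)
    have "Y 0 ^ Suc p * E = Y 0 * (Y 0 ^ p * E)" by (simp only: power_Suc mult.assoc)
    also have "\<dots> = L.X (r - 1) ^ p * (Y 0 * E)" by (simp only: Suc[symmetric] mult.assoc[symmetric] c)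
    also have "\<dots> = L.X (r - 1) ^ Suc p * E" by (simp only: Y0_E[OF assms] power_Suc2 mult.assoc)
    finally show ?case ..
  qed simp
qed

lemma sum_less_split_last: "1 \<le> (m::nat) ==> (\<Sum>i<m. f i) = (\<Sum>i<m - 1. f i) + (f (m - 1) :: 'b)"
  by (cases m) auto

lemma sum_less_split_first: "1 \<le> (m::nat) ==> (\<Sum>i<m. f i) = f 0 + (\<Sum>i<m - 1. f (Suc i) :: 'b)"
  by (cases m) (auto simp: sum.lessThan_Suc_shift simp del: sum.lessThan_Suc)

text \<open>Supersymmetry at work: next to E the last \<open>X\<close> and the first
  \<open>Y\<close> have equal powers and cancel.\<close>

lemma E_Z:
  assumes "1 \<le> r" "1 \<le> s"
  shows "E * Z p = E * ((\<Sum>i<r - 1. L.X i ^ p) - (\<Sum>j<s - 1. Y (Suc j) ^ p))"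
    "Z p * E = ((\<Sum>i<r - 1. L.X i ^ p) - (\<Sum>j<s - 1. Y (Suc j) ^ p)) * E"
  unfolding Z_def sum_less_split_last[OF assms(1)] sum_less_split_first[OF assms(2)]
  using E_X_Y_power[OF assms, of p]
  by (simp_all add: right_diff_distrib left_diff_distrib distrib_left distrib_right)

lemma E_Z_comm: "E * Z p = Z p * E"
proof (cases "r = 0 \<or> s = 0")
  case True then show ?thesis using E0 by simp
next
  case False
  have "E * L.X i ^ p = L.X i ^ p * E" if "i < r - 1" for i
    using E_X[of i] that by (intro power_commuting_commutes[symmetric]) auto
  moreover have "E * Y (Suc j) ^ p = Y (Suc j) ^ p * E" if "j < s - 1" for j
    using E_Y[of j] that by (intro power_commuting_commutes[symmetric]) auto
  ultimately show ?thesis using E_Z False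
    by (simp add: right_diff_distrib left_diff_distrib sum_distrib_left sum_distrib_right)
qed

lemma Z_central: "0 < p ==> x \<in> B ==> x * Z p = Z p * x"
proof (rule B_commuteI)
  assume p: "0 < p"
  show "u * Z p = Z p" "Z p * u = Z p" using Z_B[OF p] B_u_left B_u_right by auto
  show "E * Z p = Z p * E" by (rule E_Z_comm)
  show "g k * Z p = Z p * g k" if k: "Suc k < r" for k
  proof -
    have "g k * Y j ^ p = Y j ^ p * g k" if "j < s" for j
      using g_Y[OF k that] by (intro power_commuting_commutes[symmetric]) auto
    then show ?thesis unfolding Z_def using L.S_psum[of k r p] k
      by (simp add: right_diff_distrib left_diff_distrib) (simp add: sum_distrib_left sum_distrib_right)
  qed
  show "T k * Z p = Z p * T k" if k: "Suc k < s" for k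
  proof -
    have "T k * L.X i ^ p = L.X i ^ p * T k" if "i < r" for i
      using T_X[OF that k] by (intro power_commuting_commutes[symmetric]) auto
    then show ?thesis unfolding Z_def using T_Ysum[OF k, of p]
      by (simp add: right_diff_distrib left_diff_distrib) (simp add: sum_distrib_left sum_distrib_right)
  qed
qed

subsection \<open>The inner algebra\<close>

lemma D_h: assumes "2 \<le> r" "2 \<le> s"
  shows "D * (g (r - 2) * T 0) = D" "(g (r - 2) * T 0) * D = D" "E * D = dl *s D" "D * E = dl *s D"
    "D = E * ((g (r - 2) * T 0) * E)" "u * D = D" "D * u = D"
proof -
  show "D * (g (r - 2) * T 0) = D" "(g (r - 2) * T 0) * D = D" using DR DL assms by (simp_all add: D_def)
  have "E * D = (E * E) * (g (r - 2) * (T 0 * E))" by (simp only: D_def mult.assoc)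
  then show "E * D = dl *s D" unfolding EE by (simp add: D_def)
  show "D * E = dl *s D" by (simp add: D_def mult.assoc EE)
  show "D = E * ((g (r - 2) * T 0) * E)" by (simp add: D_def mult.assoc)
  show "u * D = D" "D * u = D" by (simp_all add: D_def mult.assoc, simp add: mult.assoc[symmetric])
qed

lemma D_DD: assumes "2 \<le> r" "2 \<le> s" shows "D * D = (dl * dl) *s D"
proof -
  have "D * D = D * (E * ((g (r - 2) * T 0) * E))" by (rule arg_cong[OF D_h(5)[OF assms]])
  also have "\<dots> = (D * E) * ((g (r - 2) * T 0) * E)" by (simp only: mult.assoc)
  also have "\<dots> = dl *s ((D * (g (r - 2) * T 0)) * E)" by (simp only: D_h(4)[OF assms] mult_scale_left mult.assoc)
  also have "\<dots> = (dl * dl) *s D" by (simp only: D_h(1)[OF assms] D_h(4)[OF assms] scale_scale)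
  finally show ?thesis .
qed

lemma D_x_D:
  assumes "2 \<le> r" "2 \<le> s" "E * x = x * E"
  shows "D * (x * D) = dl *s (D * (x * ((g (r - 2) * T 0) * E)))"
    "D * (x * D) = dl *s (E * ((g (r - 2) * T 0) * (x * D)))"
proof -
  have "D * (x * D) = D * ((x * E) * ((g (r - 2) * T 0) * E))"
    by (subst (2) D_h(5)[OF assms(1,2)]) (simp only: mult.assoc)
  also have "\<dots> = (D * E) * (x * ((g (r - 2) * T 0) * E))" by (simp only: assms(3)[symmetric] mult.assoc)
  finally show "D * (x * D) = dl *s (D * (x * ((g (r - 2) * T 0) * E)))"
    by (simp only: D_h(4)[OF assms(1,2)] mult_scale_left)
  have "D * (x * D) = E * ((g (r - 2) * T 0) * ((E * x) * D))"
    by (subst (1) D_h(5)[OF assms(1,2)]) (simp only: mult.assoc)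
  also have "\<dots> = E * ((g (r - 2) * T 0) * (x * (E * D)))" by (simp only: assms(3) mult.assoc)
  finally show "D * (x * D) = dl *s (E * ((g (r - 2) * T 0) * (x * D)))"
    by (simp only: D_h(3)[OF assms(1,2)] mult_scale_right)
qed

text \<open>D absorbs g T on its right, hence also the inverse of this product. This allows inverses
  to be inserted after D in the contractions below.\<close>

lemma D_inverse: assumes "2 \<le> r" "2 \<le> s" shows "D = D * (R.Si 0 * L.Si (r - 2))"
proof -
  have n: "Suc (r - 2) < r" "Suc 0 < s" using assms by auto
  have "D * R.Si 0 = D * (g (r - 2) * T 0) * R.Si 0" by (simp only: D_h(1)[OF assms])
  also have "\<dots> = D * (g (r - 2) * (T 0 * R.Si 0))" by (simp only: mult.assoc)
  also have "\<dots> = D * g (r - 2)" using R.S_Si[OF n(2)] n by simp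
  finally have 1: "D * R.Si 0 = D * g (r - 2)" .
  have "D * (R.Si 0 * L.Si (r - 2)) = D * (g (r - 2) * L.Si (r - 2))" using 1 by (simp only: mult.assoc[symmetric])
  then show ?thesis using L.S_Si[OF n(1)] D_h(7)[OF assms] by simp
qed

lemma gTi: assumes "Suc k < r" "Suc l < s"
  shows "L.Si k * T l = T l * L.Si k" "g k * R.Si l = R.Si l * g k" "L.Si k * R.Si l = R.Si l * L.Si k"
  using gT[OF assms] assms
  by (simp_all add: L.Si_def R.Si_def left_diff_distrib right_diff_distrib scale_right_diff_distrib)

text \<open>The inner form of E g E = \<rho>^-1 E. The inserted inverse of T cancels a T, the
  inserted inverse of b turns a b into a b A by the braid relation, and the E b E that appears can
  be contracted.\<close>

lemma D_gD:
  assumes r: "3 \<le> r" and s: "2 \<le> s"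
  shows "D * (g (r - 3) * D) = (dl * inverse \<rho>) *s D"
proof -
  define a b t where "a = g (r - 3)" and "b = g (r - 2)" and "t = T 0"
  define A Bi ti where "A = L.Si (r - 3)" and "Bi = L.Si (r - 2)" and "ti = R.Si 0"
  have rs: "2 \<le> r" "2 \<le> s" using r s by auto
  have n: "Suc (r - 3) < r" "Suc (r - 2) < r" "Suc 0 < s" "Suc (r - 3) = r - 2" using r s by auto
  have Ea: "E * a = a * E" unfolding a_def using Eg[of "r - 3"] r by simp
  have EA: "E * A = A * E" unfolding A_def L.Si_def using Ea[unfolded a_def] by (simp add: left_diff_distrib right_diff_distrib)
  have br: "a * (b * a) = b * (a * b)" unfolding a_def b_def using L.braid[of "r - 3"] r n(4) by simp
  have Bb: "Bi * b = u" "a * A = u" unfolding Bi_def b_def a_def A_def using L.Si_S L.S_Si n by auto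
  have tt: "ti * t = u" unfolding ti_def t_def using R.Si_S n by auto
  have ui: "u * a = a" "u * E = E" "u * t = t" "b * u = b" unfolding a_def t_def b_def using n by auto
  have ta: "ti * a = a * ti" "ti * b = b * ti" "t * a = a * t" "ti * Bi = Bi * ti" unfolding ti_def a_def b_def t_def Bi_def
    using gTi[of "r - 3" 0] gTi[of "r - 2" 0] gT[of "r - 3" 0] n by auto
  have BA: "Bi * (a * b) = a * (b * A)"
  proof -
    have "Bi * (a * b) = Bi * (a * (b * (a * A)))" by (simp only: Bb ui)
    also have "\<dots> = Bi * ((a * (b * a)) * A)" by (simp only: mult.assoc)
    also have "\<dots> = (Bi * b) * (a * (b * A))" by (simp only: br mult.assoc)
    finally show ?thesis using ui by (simp only: Bb mult.assoc[symmetric])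
  qed
  have "D * (a * ((b * t) * E)) = D * (ti * Bi) * (a * (b * (t * E)))"
    using D_inverse[OF rs] by (simp only: ti_def[symmetric] Bi_def[symmetric] mult.assoc)
  also have "\<dots> = D * (Bi * (a * (b * ((ti * t) * E))))"
    by (simp only: mult.assoc ta commute_mult_left[OF ta(1)] commute_mult_left[OF ta(2)] commute_mult_left[OF ta(4)])
  also have "\<dots> = D * ((Bi * (a * b)) * E)" by (simp only: tt ui mult.assoc)
  also have "\<dots> = D * (a * (b * (E * A)))" by (simp only: BA EA mult.assoc)
  also have "\<dots> = E * (b * (t * ((E * a) * (b * (E * A)))))" by (simp only: D_def b_def t_def mult.assoc)
  also have "\<dots> = E * (b * (t * (a * ((E * (b * E)) * A))))" by (simp only: Ea mult.assoc)
  also have "\<dots> = inverse \<rho> *s (E * (b * (t * ((a * E) * A))))"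
    using EgE[OF rs(1)] by (simp only: b_def mult_scale_left mult_scale_right mult.assoc)
  also have "\<dots> = inverse \<rho> *s (D * (a * A))" by (simp only: Ea[symmetric] D_def b_def t_def mult.assoc)
  also have "\<dots> = inverse \<rho> *s D" using D_h[OF rs] by (simp only: Bb)
  finally have "D * (a * ((b * t) * E)) = inverse \<rho> *s D" .
  then show ?thesis using D_x_D(1)[OF rs Ea] by (simp only: a_def b_def t_def scale_scale)
qed

lemma D_TD:
  assumes r: "2 \<le> r" and s: "3 \<le> s"
  shows "D * (T 1 * D) = (dl * \<rho>) *s D"
proof -
  define c b t where "c = T 1" and "b = g (r - 2)" and "t = T 0"
  define C Bi ti where "C = R.Si 1" and "Bi = L.Si (r - 2)" and "ti = R.Si 0"
  have rs: "2 \<le> r" "2 \<le> s" using r s by auto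
  have n: "Suc (r - 2) < r" "Suc 0 < s" "Suc 1 < s" using r s by auto
  have Ec: "E * c = c * E" unfolding c_def using ET[of 0] s by simp
  have EC: "E * C = C * E" unfolding C_def R.Si_def using Ec[unfolded c_def] by (simp add: left_diff_distrib right_diff_distrib)
  have br: "t * (c * t) = c * (t * c)" unfolding c_def t_def using R.braid[of 0] s by simp
  have Bb: "Bi * b = u" "c * C = u" unfolding Bi_def b_def c_def C_def using L.Si_S R.S_Si n by auto
  have tt: "ti * t = u" unfolding ti_def t_def using R.Si_S n by auto
  have ui: "u * c = c" "u * E = E" "u * t = t" "t * u = t" unfolding c_def t_def using n by auto
  have ta: "c * b = b * c" "Bi * c = c * Bi" unfolding c_def b_def Bi_def
    using gT[of "r - 2" 1] gTi[of "r - 2" 1] n by auto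
  have BA: "ti * (c * t) = c * (t * C)"
  proof -
    have "c * (t * C) = (ti * t) * (c * (t * C))" using ui by (simp only: tt mult.assoc[symmetric])
    also have "\<dots> = ti * ((t * (c * t)) * C)" by (simp only: mult.assoc)
    also have "\<dots> = ti * (c * (t * (c * C)))" by (simp only: br mult.assoc)
    finally show ?thesis by (simp only: Bb ui)
  qed
  have "D * (c * ((b * t) * E)) = D * (ti * Bi) * (c * (b * (t * E)))"
    using D_inverse[OF rs] by (simp only: ti_def[symmetric] Bi_def[symmetric] mult.assoc)
  also have "\<dots> = D * (ti * (c * ((Bi * b) * (t * E))))"
    by (simp only: mult.assoc commute_mult_left[OF ta(2)])
  also have "\<dots> = D * ((ti * (c * t)) * E)" using ui by (simp only: Bb mult.assoc) (simp only: mult.assoc[symmetric])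
  also have "\<dots> = D * (c * (t * (E * C)))" by (simp only: BA EC mult.assoc)
  also have "\<dots> = E * (b * (t * ((E * c) * (t * (E * C)))))" by (simp only: D_def b_def t_def mult.assoc)
  also have "\<dots> = E * (b * (t * (c * ((E * (t * E)) * C))))" by (simp only: Ec mult.assoc)
  also have "\<dots> = \<rho> *s (E * (b * (t * ((c * E) * C))))"
    using ETE[OF rs(2)] by (simp only: t_def mult_scale_left mult_scale_right mult.assoc)
  also have "\<dots> = \<rho> *s (D * (c * C))" by (simp only: Ec[symmetric] D_def b_def t_def mult.assoc)
  also have "\<dots> = \<rho> *s D" using D_h[OF rs] by (simp only: Bb)
  finally have "D * (c * ((b * t) * E)) = \<rho> *s D" .
  then show ?thesis using D_x_D(1)[OF rs Ec] by (simp only: c_def b_def t_def scale_scale)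
qed

text \<open>The inner form of \<open>DR\<close> and \<open>DL\<close>. The products b t and h of a
  left with a right generator satisfy the braid relation, by which h is passed through until D
  absorbs b t.\<close>

lemma D_hh:
  assumes r: "3 \<le> r" and s: "3 \<le> s"
  defines "h \<equiv> g (r - 3) * T 1"
  shows "D * (h * D) * h = D * (h * D)" "h * (D * (h * D)) = D * (h * D)"
proof -
  define a b t c where "a = g (r - 3)" and "b = g (r - 2)" and "t = T 0" and "c = T 1"
  have rs: "2 \<le> r" "2 \<le> s" using r s by auto
  have n: "Suc (r - 3) < r" "Suc (r - 2) < r" "Suc 0 < s" "Suc 1 < s" "Suc (r - 3) = r - 2" using r s by auto
  have co: "t * a = a * t" "t * b = b * t" "c * a = a * c" "c * b = b * c"
    unfolding a_def b_def t_def c_def using gT n by auto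
  have h: "h = a * c" by (simp add: h_def a_def c_def)
  have Eh: "E * h = h * E"
    unfolding h_def using Eg[of "r - 3"] ET[of 0] r s
    by (simp add: mult.assoc commute_mult_left[of E "g (r - 3)"])
  have bra: "a * (b * a) = b * (a * b)" unfolding a_def b_def using L.braid[of "r - 3"] r n(5) by simp
  have brc: "t * (c * t) = c * (t * c)" unfolding c_def t_def using R.braid[of 0] s by simp
  have hb: "h * ((b * t) * h) = (b * t) * (h * (b * t))"
  proof -
    have "h * ((b * t) * h) = (a * (b * a)) * (c * (t * c))" unfolding h
      by (simp only: mult.assoc co commute_mult_left[OF co(1)] commute_mult_left[OF co(2)] commute_mult_left[OF co(3)] commute_mult_left[OF co(4)])
    also have "\<dots> = (b * (a * b)) * (t * (c * t))" by (simp only: bra brc)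
    also have "\<dots> = (b * t) * (h * (b * t))" unfolding h
      by (simp only: mult.assoc co commute_mult_left[OF co(1)] commute_mult_left[OF co(2)] commute_mult_left[OF co(3)] commute_mult_left[OF co(4)])
    finally show ?thesis .
  qed
  have Dbt: "D * (b * t) = D" "(b * t) * D = D" using D_h(1,2)[OF rs] by (simp_all add: b_def t_def)
  have e1: "D * (h * D) = dl *s (D * (h * ((b * t) * E)))" using D_x_D(1)[OF rs Eh] by (simp add: b_def t_def)
  have e2: "D * (h * D) = dl *s (E * ((b * t) * (h * D)))" using D_x_D(2)[OF rs Eh] by (simp add: b_def t_def)
  have "D * (h * ((b * t) * E)) * h = D * ((h * ((b * t) * h)) * E)" by (simp only: mult.assoc Eh)
  also have "\<dots> = D * (((b * t) * (h * (b * t))) * E)" by (simp only: hb)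
  also have "\<dots> = (D * (b * t)) * (h * ((b * t) * E))" by (simp only: mult.assoc)
  finally have "D * (h * ((b * t) * E)) * h = D * (h * ((b * t) * E))" by (simp only: Dbt)
  then show "D * (h * D) * h = D * (h * D)" unfolding e1 by simp
  have "h * (E * ((b * t) * (h * D))) = E * ((h * ((b * t) * h)) * D)" by (simp only: mult.assoc commute_mult_left[OF Eh])
  also have "\<dots> = E * (((b * t) * (h * (b * t))) * D)" by (simp only: hb)
  also have "\<dots> = E * ((b * t) * (h * ((b * t) * D)))" by (simp only: mult.assoc)
  finally have "h * (E * ((b * t) * (h * D))) = E * ((b * t) * (h * D))" by (simp only: Dbt)
  then show "h * (D * (h * D)) = D * (h * D)" unfolding e2 by simp
qed

definition e :: 'b where "e = inverse dl *s E"
text \<open>As D^2 = \<delta>^2 D, this normalisation gives the square \<delta> E' required of the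
  inner arc. It is 0 when the inner algebra has no strands on one side of the wall.\<close>

definition E' :: 'b where "E' = (if 2 \<le> r \<and> 2 \<le> s then inverse dl *s D else 0)"

lemma eg: "Suc (Suc k) < r ==> e * g k = g k * e" by (simp add: e_def Eg)
lemma eT: "Suc (Suc k) < s ==> e * T (Suc k) = T (Suc k) * e" by (simp add: e_def ET)

lemma inner_walled:
  assumes d0: "dl \<noteq> 0"
  shows "walled scale e q \<rho> (r - 1) (s - 1) (\<lambda>k. g k * e) (\<lambda>k. T (Suc k) * e) E'"
proof -
  have ee: "e * e = e" using d0 by (simp add: e_def EE)
  have ue: "u * e = e" "e * u = e" by (simp_all add: e_def)
  have eE': "e * E' = E'" "E' * e = E'" using d0 D_h(3,4) by (auto simp: e_def E'_def)
  have eex: "e * (e * x) = e * x" for x using ee by (simp add: mult.assoc[symmetric])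
  have DE: "E' * E' = dl *s E'" using D_DD d0 by (auto simp: E'_def field_simps)
  have E'g: "E' * g k = g k * E'" if "Suc (Suc k) < r - 1" for k
  proof (cases "2 \<le> s")
    case True
    have 1: "g k * E = E * g k" "g k * g (r - 2) = g (r - 2) * g k" "g k * T 0 = T 0 * g k"
      using Eg[of k] L.comm[of "r - 2" k] gT[of k 0] that True by auto
    show ?thesis unfolding E'_def D_def using that True
      by (simp add: mult.assoc 1 commute_mult_left[OF 1(1)] commute_mult_left[OF 1(2)] commute_mult_left[OF 1(3)])
  qed (simp add: E'_def)
  have E'T: "E' * T (Suc k) = T (Suc k) * E'" if "Suc (Suc k) < s" "1 \<le> k" for k
  proof (cases "2 \<le> r")
    case True
    have 1: "T (Suc k) * E = E * T (Suc k)" "T (Suc k) * g (r - 2) = g (r - 2) * T (Suc k)" "T (Suc k) * T 0 = T 0 * T (Suc k)"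
      using ET[of k] R.comm[of "Suc k" 0] gT[of "r - 2" "Suc k"] that True by auto
    show ?thesis unfolding E'_def D_def using that True
      by (simp add: mult.assoc 1 commute_mult_left[OF 1(1)] commute_mult_left[OF 1(2)] commute_mult_left[OF 1(3)])
  qed (simp add: E'_def)
  show ?thesis
  proof (intro walled.intro walled_axioms.intro)
    show "alg_over scale" by (rule alg_over_axioms)
    show "hecke scale e (inverse q) (\<lambda>k. g k * e) (r - 1)"
      by (rule L.hecke_corner) (use ee ue eg in auto)
    interpret Rs: hecke scale u q "\<lambda>k. T (Suc k)" "s - 1" by (rule R.hecke_shift)
    show "hecke scale e q (\<lambda>k. T (Suc k) * e) (s - 1)"
      by (rule Rs.hecke_corner) (use ee ue eT in auto)
    show "g k * e * (T (Suc l) * e) = T (Suc l) * e * (g k * e)" if "Suc k < r - 1" "Suc l < s - 1" for k l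
    proof -
      have a: "e * g k = g k * e" "e * T (Suc l) = T (Suc l) * e" "g k * T (Suc l) = T (Suc l) * g k"
        using eg eT gT that by auto
      show ?thesis by (simp only: mult.assoc commute_mult_left[OF a(1)] commute_mult_left[OF a(2)] commute_mult_left[OF a(3)])
    qed
    show "e * E' = E'" "E' * e = E'" by (rule eE')+
    show "E' * E' = dl *s E'" by (rule DE)
    show "E' * (g k * e) = g k * e * E'" if "Suc (Suc k) < r - 1" for k
    proof -
      have "E' * (g k * e) = (E' * g k) * e" by (simp only: mult.assoc)
      also have "\<dots> = g k * e * E'" by (simp only: E'g[OF that] mult.assoc eE')
      finally show ?thesis .
    qed
    show "E' * (T (Suc (Suc k)) * e) = T (Suc (Suc k)) * e * E'" if "Suc (Suc k) < s - 1" for k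
    proof -
      have a: "E' * T (Suc (Suc k)) = T (Suc (Suc k)) * E'" using E'T[of "Suc k"] that by simp
      have "E' * (T (Suc (Suc k)) * e) = (E' * T (Suc (Suc k))) * e" by (simp only: mult.assoc)
      also have "\<dots> = T (Suc (Suc k)) * e * E'" by (simp only: a mult.assoc eE')
      finally show ?thesis .
    qed
    have r3: "r - 1 - 2 = r - 3" by simp
    show "E' * (g (r - 1 - 2) * e * E') = inverse \<rho> *s E'" if "2 \<le> r - 1"
    proof (cases "2 \<le> s")
      case True
      then show ?thesis unfolding r3 using D_gD that d0 unfolding mult.assoc eE'
        by (simp add: E'_def)
    qed (simp add: E'_def)
    show "E' * (T (Suc 0) * e * E') = \<rho> *s E'" if "2 \<le> s - 1"
    proof (cases "2 \<le> r")
      case True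
      then show ?thesis using D_TD that d0 unfolding mult.assoc eE' by (simp add: E'_def)
    qed (simp add: E'_def)
    {
      assume a: "2 \<le> r - 1" "2 \<le> s - 1"
      let ?h = "g (r - 3) * T 1"
      have eh: "e * g (r - 3) = g (r - 3) * e" "e * T 1 = T 1 * e" using eg[of "r - 3"] eT[of 0] a by auto
      have "2 \<le> r" "2 \<le> s" using a by auto
      then have De: "E' = inverse dl *s D" by (simp add: E'_def)
      have x: "E' * (g (r - 3) * e * (T 1 * e * E')) = (inverse dl * inverse dl) *s (D * (?h * D))"
        using eE' by (simp only: mult.assoc commute_mult_left[OF eh(2)]) (simp add: De mult.assoc)
      have y: "g (r - 3) * e * (T 1 * e) = ?h * e" "g (r - 3) * e * (T 1 * e) = e * ?h"
        by (simp_all only: mult.assoc commute_mult_left[OF eh(2)] commute_mult_left[OF eh(1)] eh ee)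
      have De': "D * e = D" "e * D = D" using D_h(3,4) d0 a by (auto simp: e_def)
      show "E' * (g (r - 1 - 2) * e * (T (Suc 0) * e * E')) * (g (r - 1 - 2) * e * (T (Suc 0) * e)) =
          E' * (g (r - 1 - 2) * e * (T (Suc 0) * e * E'))"
      proof -
        have "(D * (?h * D)) * (?h * e) = D * (?h * D)"
        proof -
          have "(D * (?h * D)) * (?h * e) = (D * (?h * D) * ?h) * e" by (simp only: mult.assoc)
          also have "\<dots> = (D * (?h * D)) * e" using D_hh(1) a by simp
          finally show ?thesis by (simp only: mult.assoc De')
        qed
        then show ?thesis unfolding r3 One_nat_def[symmetric] x y(1) by simp
      qed
      show "g (r - 1 - 2) * e * (T (Suc 0) * e) * (E' * (g (r - 1 - 2) * e * (T (Suc 0) * e * E'))) =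
          E' * (g (r - 1 - 2) * e * (T (Suc 0) * e * E'))"
      proof -
        have "(e * ?h) * (D * (?h * D)) = D * (?h * D)"
        proof -
          have "(e * ?h) * (D * (?h * D)) = e * (?h * (D * (?h * D)))" by (simp only: mult.assoc)
          also have "\<dots> = e * (D * (?h * D))" using D_hh(2) a by simp
          finally show ?thesis by (simp only: mult.assoc[symmetric] De')
        qed
        then show ?thesis unfolding r3 One_nat_def[symmetric] x y(2) by simp
      qed
    }
    show "E' = 0" if "r - 1 = 0 \<or> s - 1 = 0" using that by (auto simp: E'_def)
  qed (rule rho0)
qed

end

context walled
begin

lemma D_B: "2 \<le> r ==> 2 \<le> s ==> D \<in> B"
  unfolding D_def by (intro B_mult B_E B_g B_T) auto

text \<open>The reversed numbering makes \<open>T 0\<close>, the generator next to the wall, the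
  last one, so that the double coset decomposition isolates it. On the left of the wall the natural
  order already does this.\<close>

definition Tr :: "nat => 'b" where "Tr k = T (s - 2 - k)"

sublocale Rv: hecke scale u q Tr s unfolding Tr_def by (rule R.hecke_reverse)

end

section \<open>Jucys-Murphy elements and power sums of the inner algebra\<close>

locale walled_inner = walled +
  fixes r' s' :: nat
  assumes d0: "dl \<noteq> 0" and rS: "r = Suc r'" and sS: "s = Suc s'"
begin

sublocale I: walled scale e q \<rho> r' s' "\<lambda>k. g k * e" "\<lambda>k. T (Suc k) * e" E'
  using inner_walled[OF d0] rS sS by simp

lemma r1: "1 \<le> r" and s1: "1 \<le> s" using rS sS by auto
lemma less_r [simp]: "Suc k < r \<longleftrightarrow> k < r'" and less_s [simp]: "Suc k < s \<longleftrightarrow> k < s'" using rS sS by auto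
lemma rs_pred [simp]: "r - Suc 0 = r'" "s - Suc 0 = s'" using rS sS by auto

lemma E_e: "E = dl *s e" using d0 by (simp add: e_def)
lemma ee [simp]: "e * e = e" by (rule I.L.uu)
lemma eex [simp]: "e * (e * x) = e * x" by (simp add: mult.assoc[symmetric])
lemma ue [simp]: "u * e = e" "e * u = e" by (simp_all add: e_def)
lemma e_mult: "e * x = inverse dl *s (E * x)" by (simp add: e_def)
lemma e_B: "e \<in> B" unfolding e_def by (intro B_scale B_E)

lemma eX: "Suc k < r ==> e * L.X k = L.X k * e" by (simp add: e_def E_X)
lemma eY: "Suc k < s ==> e * Y (Suc k) = Y (Suc k) * e" by (simp add: e_def E_Y)

lemma IX: "k < r' ==> I.L.X k = e * L.X k"
proof (induction k)
  case (Suc k)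
  have c: "g k * e = e * g k" "L.X k * e = e * L.X k" using eg[of k] eX[of k] Suc.prems by auto
  have "I.L.X (Suc k) = g k * e * (e * L.X k * (g k * e))" using Suc by (simp add: I.L.X.simps(2))
  also have "\<dots> = e * (g k * (L.X k * g k))"
    by (simp only: mult.assoc c commute_mult_left[OF c(1)] commute_mult_left[OF c(2)] ee eex)
  finally show ?case by (simp only: L.X.simps(2))
qed simp

lemma eDd: "2 \<le> s ==> d < r' ==> e * Dd d = Dd d \<and> Dd d * e = Dd d"
proof (induction d)
  case 0
  then have "2 \<le> r" "2 \<le> s" using rS by auto
  then show ?case using D_h(3,4) d0 by (simp add: e_def)
next
  case (Suc d)
  let ?t = "g (r - 3 - d)"
  have c: "e * ?t = ?t * e" using eg[of "r - 3 - d"] Suc.prems rS by simp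
  have IH: "e * Dd d = Dd d" "Dd d * e = Dd d" using Suc by auto
  have "e * Dd (Suc d) = ?t * ((e * Dd d) * ?t)" by (simp only: Dd.simps mult.assoc commute_mult_left[OF c])
  moreover have "Dd (Suc d) * e = ?t * ((Dd d * e) * ?t)" by (simp only: Dd.simps mult.assoc c)
  ultimately show ?case by (simp only: IH Dd.simps simp_thms)
qed

lemma IEd: "2 \<le> s ==> d < r' ==> I.Ed d = inverse dl *s Dd d"
proof (induction d)
  case 0
  then have "2 \<le> r" "2 \<le> s" using rS by auto
  then have e': "E' = inverse dl *s D" by (simp add: E'_def)
  have "I.Ed 0 = E'" by (rule I.Ed.simps(1))
  also have "\<dots> = inverse dl *s Dd 0" by (subst e', subst Dd.simps(1)) simp
  finally show ?case .
next
  case (Suc d)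
  have t: "r' - 2 - d = r - 3 - d" using rS by simp
  have ed: "e * (Dd d * x) = Dd d * x" for x
    using eDd[of d] Suc.prems by (simp add: mult.assoc[symmetric])
  have c: "e * g (r - 3 - d) = g (r - 3 - d) * e" using eg[of "r - 3 - d"] Suc.prems rS by simp
  have de: "Dd d * (e * x) = Dd d * x" for x
    using eDd[of d] Suc.prems by (simp add: mult.assoc[symmetric])
  have "I.Ed (Suc d) = inverse dl *s (g (r - 3 - d) * e * (Dd d * (g (r - 3 - d) * e)))"
    using Suc by (simp only: I.Ed.simps t) simp
  also have "\<dots> = inverse dl *s (g (r - 3 - d) * (Dd d * g (r - 3 - d)))"
    by (simp only: mult.assoc ed) (simp only: c[symmetric] de)
  finally show ?case by (simp only: Dd.simps)
qed

lemma IY: "k < s' ==> I.Y k = e * Y (Suc k)"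
proof (induction k)
  case 0
  have "I.Esum = inverse dl *s (\<Sum>d<r'. Dd d)"
    unfolding I.Esum_def scale_sum_right using IEd 0 sS by (intro sum.cong) auto
  then have "I.Y 0 = (\<rho> * \<rho>) *s e - (R.zq * \<rho>) *s (inverse dl *s (\<Sum>d<r'. Dd d))"
    by (simp only: I.Y.simps(1))
  also have "\<dots> = inverse dl *s ((\<rho> * \<rho>) *s E - (R.zq * \<rho>) *s (\<Sum>d<r'. Dd d))"
  proof -
    have "(\<rho> * \<rho>) *s e = inverse dl *s ((\<rho> * \<rho>) *s E)" unfolding e_def by (rule scale_left_commute)
    then show ?thesis by (simp only: scale_right_diff_distrib scale_left_commute[of "R.zq * \<rho>" "inverse dl"])
  qed
  also have "\<dots> = inverse dl *s (E * Y 1)"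
  proof -
    have "2 \<le> s" using 0 sS by simp
    from E_Y1[OF this r1] have "E * Y 1 = (\<rho> * \<rho>) *s E - (R.zq * \<rho>) *s (\<Sum>d<r'. Dd d)"
      by (simp only: rs_pred One_nat_def)
    then show ?thesis by (simp only:)
  qed
  finally show ?case by (simp only: e_mult One_nat_def)
next
  case (Suc k)
  have c: "T (Suc k) * e = e * T (Suc k)" "Y (Suc k) * e = e * Y (Suc k)" using eT[of k] eY[of k] Suc.prems by auto
  have "I.Y (Suc k) = T (Suc k) * e * (e * Y (Suc k) * (T (Suc k) * e))" using Suc by (simp add: I.Y.simps(2))
  also have "\<dots> = e * (T (Suc k) * (Y (Suc k) * T (Suc k)))"
    by (simp only: mult.assoc c commute_mult_left[OF c(1)] commute_mult_left[OF c(2)] ee eex)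
  finally show ?case by (simp only: Y.simps(2))
qed

lemma IZ: assumes "0 < p" shows "I.Z p = e * Z p"
proof -
  have "I.L.X i ^ p = e * L.X i ^ p" if "i < r'" for i
    using IX[OF that] idem_power[OF ee eX[of i] assms] that by simp
  moreover have "I.Y j ^ p = e * Y (Suc j) ^ p" if "j < s'" for j
    using IY[OF that] idem_power[OF ee eY[of j] assms] that by simp
  ultimately have "I.Z p = e * ((\<Sum>i<r'. L.X i ^ p) - (\<Sum>j<s'. Y (Suc j) ^ p))"
    by (simp add: I.Z_def right_diff_distrib sum_distrib_left)
  also have "\<dots> = e * Z p" using E_Z(1)[OF r1 s1, of p] by (simp add: e_def)
  finally show ?thesis .
qed

lemma E'_B: "E' \<in> B"
proof (cases "2 \<le> r \<and> 2 \<le> s")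
  case True
  then show ?thesis using D_B by (simp add: E'_def B_scale)
qed (auto simp: E'_def B_def alg_zero)

lemma I_B_sub: "x \<in> I.B ==> x \<in> B"
  unfolding I.B_def
proof (induction rule: alg.induct)
  case (alg_gen h x)
  have "h \<in> B" using alg_gen(1) by (auto intro!: B_mult B_g B_T e_B E'_B)
  then show ?case using alg_gen by (intro B_mult)
qed (auto intro: e_B B_add B_scale)

subsection \<open>The corner is generated by the inner algebra\<close>

lemma LH_e: "x \<in> L.H r' ==> x * e \<in> I.B \<and> e * x = x * e"
proof -
  assume x: "x \<in> L.H r'"
  then have "x * e = e * x" by (intro L.H_commute[of e r' x]) (auto simp: eg)
  moreover from x have "x * e \<in> I.B" unfolding L.H_def
  proof (induction rule: alg.induct)
    case (alg_gen h x)
    then obtain k where k: "h = g k" "Suc k < r'" by auto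
    have "e * (x * e) = x * e" using I.B_u_left[OF alg_gen(3)] .
    then have "h * x * e = (g k * e) * (x * e)" by (simp only: k mult.assoc)
    then show ?case using I.B_mult[OF I.B_g[OF k(2)] alg_gen(3)] by simp
  qed (auto simp: distrib_right I.B_u intro: I.B_add I.B_scale)
  ultimately show ?thesis by simp
qed

lemma RH_e: "x \<in> Rv.H s' ==> x * e \<in> I.B \<and> e * x = x * e"
proof -
  assume x: "x \<in> Rv.H s'"
  have Te: "Tr k * e = e * Tr k" if "Suc k < s'" for k
  proof -
    have "s - 2 - k = Suc (s - 3 - k)" using that sS by arith
    moreover have "Suc (Suc (s - 3 - k)) < s" using that sS by arith
    ultimately show ?thesis using eT[of "s - 3 - k"] by (simp only: Tr_def)
  qed
  have "x * e = e * x"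
    by (rule Rv.H_commute[where m = s']) (simp, simp, rule Te, assumption, rule x)
  moreover from x have "x * e \<in> I.B" unfolding Rv.H_def
  proof (induction rule: alg.induct)
    case (alg_gen h x)
    then obtain k where k: "h = T (s - 2 - k)" "Suc k < s'" by (auto simp: Tr_def)
    have "s - 2 - k = Suc (s - 3 - k)" "Suc (s - 3 - k) < s'" using k sS by arith+
    then have h: "h = T (Suc (s - 3 - k))" "Suc (s - 3 - k) < s'" using k by auto
    have "e * (x * e) = x * e" using I.B_u_left[OF alg_gen(3)] .
    then have "h * x * e = (T (Suc (s - 3 - k)) * e) * (x * e)" by (simp only: h mult.assoc)
    then show ?case using I.B_mult[OF I.B_T[OF h(2)] alg_gen(3)] by simp
  qed (auto simp: distrib_right I.B_u intro: I.B_add I.B_scale)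
  ultimately show ?thesis by simp
qed

lemma LH_IB: "x \<in> L.H r' ==> b \<in> I.B ==> x * b \<in> I.B"
  and RH_IB: "y \<in> Rv.H s' ==> b \<in> I.B ==> y * b \<in> I.B"
proof -
  assume b: "b \<in> I.B"
  have eb: "e * b = b" using I.B_u_left[OF b] .
  have eb2: "y * e * b = y * b" for y by (simp only: mult.assoc eb)
  show "x * b \<in> I.B" if "x \<in> L.H r'"
    using I.B_mult[OF conjunct1[OF LH_e[OF that]] b] by (simp only: eb2)
  show "y * b \<in> I.B" if "y \<in> Rv.H s'"
    using I.B_mult[OF conjunct1[OF RH_e[OF that]] b] by (simp only: eb2)
qed

lemma E_LH: "x \<in> L.H r' ==> E * x = x * E" using conjunct2[OF LH_e, of x] d0 by (simp add: e_def)
lemma E_RH: "x \<in> Rv.H s' ==> E * x = x * E" using conjunct2[OF RH_e, of x] d0 by (simp add: e_def)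

lemma E_IB: "b \<in> I.B ==> E * b = dl *s b"
proof -
  assume "b \<in> I.B"
  then have "dl *s (e * b) = dl *s b" using I.B_u_left[of b] by simp
  then show ?thesis using d0 by (simp add: e_def)
qed

lemma IB_E: "b \<in> I.B ==> b = inverse dl *s (E * b)"
  using E_IB[of b] d0 by simp

lemma E_mid_IB:
  assumes "1 < r" "b \<in> I.B" shows "E * (g (r - 2) * b) \<in> I.B"
proof -
  have "E * (g (r - 2) * b) = inverse dl *s ((E * (g (r - 2) * E)) * b)"
    by (subst IB_E[OF assms(2)]) (simp add: mult.assoc)
  also have "\<dots> = inverse dl *s (inverse \<rho> *s (E * b))" using EgE assms(1) by simp
  finally show ?thesis using E_IB[OF assms(2)] assms(2) by (auto intro!: I.B_scale)
qed

lemma E_T_IB: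
  assumes "1 < s" "b \<in> I.B" shows "E * (T 0 * b) \<in> I.B"
proof -
  have "E * (T 0 * b) = inverse dl *s ((E * (T 0 * E)) * b)"
    by (subst IB_E[OF assms(2)]) (simp add: mult.assoc)
  also have "\<dots> = inverse dl *s (\<rho> *s (E * b))" using ETE assms(1) by simp
  finally show ?thesis using E_IB[OF assms(2)] assms(2) by (auto intro!: I.B_scale)
qed

lemma E_gT_IB:
  assumes "1 < r" "1 < s" "b \<in> I.B" shows "E * (g (r - 2) * (T 0 * b)) \<in> I.B"
proof -
  have "E * (g (r - 2) * (T 0 * b)) = inverse dl *s (D * b)"
    by (subst IB_E[OF assms(3)]) (simp add: mult.assoc D_def)
  also have "\<dots> = E' * b"
  proof -
    have "2 \<le> r" "2 \<le> s" using assms rS sS by auto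
    then have e': "E' = inverse dl *s D" by (simp add: E'_def)
    show ?thesis by (simp only: e' mult_scale_left)
  qed
  finally show ?thesis using I.B_mult[OF I.B_E assms(3)] by simp
qed

lemma Tr_two_cosets: "y \<in> Rv.H s ==> 1 < s ==> y \<in> Rv.two_cosets s'"
  using Rv.H_two_cosets[of s' y] sS by simp

lemma T_LH: "Suc l < s ==> x \<in> L.H r ==> x * T l = T l * x"
  by (rule L.H_commute[where m = r]) (auto simp: gT)

lemma LH_RH: "x \<in> L.H r ==> y \<in> Rv.H s ==> x * y = y * x"
proof (rule Rv.H_commute[where m = s, symmetric])
  assume x: "x \<in> L.H r"
  show "u * x = x" "x * u = x" using L.H_u_left[OF _ x] L.H_u_right[OF x] by auto
  show "Tr k * x = x * Tr k" if "Suc k < s" for k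
  proof -
    have "Suc (s - 2 - k) < s" using that by linarith
    then show ?thesis using T_LH[OF _ x] by (simp only: Tr_def)
  qed
qed

lemma E_right_IB:
  assumes y: "y \<in> Rv.H s" and b: "b \<in> I.B"
  shows "E * (y * b) \<in> I.B" and "1 < r ==> E * (g (r - 2) * (y * b)) \<in> I.B"
proof -
  have both: "E * (y * b) \<in> I.B \<and> (1 < r \<longrightarrow> E * (g (r - 2) * (y * b)) \<in> I.B)"
  proof (cases "1 < s")
    case False
    then obtain k where k: "y = k *s u" using Rv.H_0[OF y] sS by auto
    have "u * b = b" using B_u_left[OF I_B_sub[OF b]] .
    then show ?thesis using E_IB[OF b] b E_mid_IB by (auto simp: k intro!: I.B_scale)
  next
    case s: True
    have "s - 2 - (s' - 1) = 0" using sS by simp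
    then have s2: "Tr (s' - 1) = T 0" by (simp only: Tr_def)
    have "y \<in> Rv.two_cosets s'" using Tr_two_cosets[OF y s] .
    then show ?thesis
    proof (induction rule: Rv.two_cosets.induct)
      case (base c)
      have "c * b \<in> I.B" using RH_IB[OF base b] .
      then show ?case using E_IB E_mid_IB by (auto intro!: I.B_scale)
    next
      case (mid c c')
      have c'b: "c' * b \<in> I.B" using RH_IB[OF mid(2) b] .
      have Ec: "E * c = c * E" using E_RH[OF mid(1)] .
      have "E * (c * (Tr (s' - 1) * c') * b) = c * (E * (T 0 * (c' * b)))"
        by (simp only: s2 mult.assoc commute_mult_left[OF Ec])
      then have 1: "E * (c * (Tr (s' - 1) * c') * b) \<in> I.B"
        using RH_IB[OF mid(1) E_T_IB[OF s c'b]] by simp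
      have "E * (g (r - 2) * (c * (Tr (s' - 1) * c') * b)) \<in> I.B" if r: "1 < r"
      proof -
        have "c \<in> Rv.H s" using Rv.H_mono[of s' s] mid(1) sS by simp
        moreover have "r - 2 < r'" using r rS by simp
        ultimately have gc: "g (r - 2) * c = c * g (r - 2)" using LH_RH[of "g (r - 2)" c] L.H_S[of "r - 2" r] r by simp
        have "E * (g (r - 2) * (c * (Tr (s' - 1) * c') * b)) = c * (E * (g (r - 2) * (T 0 * (c' * b))))"
          by (simp only: s2 mult.assoc commute_mult_left[OF gc] commute_mult_left[OF Ec])
        then show ?thesis using RH_IB[OF mid(1) E_gT_IB[OF r s c'b]] by simp
      qed
      then show ?case using 1 by blast
    next
      case (add x y)
      then show ?case using I.B_add unfolding distrib_right distrib_left by blast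
    qed
  qed
  then show "E * (y * b) \<in> I.B" and "1 < r ==> E * (g (r - 2) * (y * b)) \<in> I.B" by auto
qed

text \<open>The two double coset decompositions leave at most one generator on each side of the
  wall; everything else commutes with E. The remaining products of E with g, T or g T are contracted
  because b can be written with E as a left factor.\<close>

lemma E_left_right_IB:
  assumes x: "x \<in> L.H r" and y: "y \<in> Rv.H s" and b: "b \<in> I.B"
  shows "E * (x * (y * b)) \<in> I.B"
proof (cases "1 < r")
  case False
  then obtain k where k: "x = k *s u" using L.H_0[OF x] rS by auto
  have "u * (y * b) = y * b" using Rv.H_u_left[OF _ y] by (simp add: mult.assoc[symmetric])
  then show ?thesis using E_right_IB(1)[OF y b] by (auto simp: k intro: I.B_scale)
next
  case r: True
  then have "x \<in> L.two_cosets r'" using L.H_two_cosets[of r' x] x rS by simp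
  then show ?thesis
  proof (induction rule: L.two_cosets.induct)
    case (base a)
    have "E * (a * (y * b)) = a * (E * (y * b))" by (rule commute_mult_left[OF E_LH[OF base]])
    then show ?case using LH_IB[OF base E_right_IB(1)[OF y b]] by simp
  next
    case (mid a a')
    have r2: "r' - 1 = r - 2" using rS by simp
    have "a' \<in> L.H r" using L.H_mono[of r' r] mid(2) rS by simp
    then have ay: "a' * y = y * a'" using LH_RH y by blast
    have "E * (a * (g (r' - 1) * a') * (y * b)) = a * (E * (g (r - 2) * (y * (a' * b))))"
      by (simp only: r2 mult.assoc commute_mult_left[OF ay] commute_mult_left[OF E_LH[OF mid(1)]])
    then show ?case using LH_IB[OF mid(1) E_right_IB(2)[OF y LH_IB[OF mid(2) b] r]] by simp
  next
    case (add x x')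
    then show ?case by (simp add: distrib_left distrib_right I.B_add)
  qed
qed

text \<open>A normal form for the left ideal generated by e: elements of the two Hecke algebras in
  front, the inner algebra behind. \<open>E_left_right_IB\<close> shows that it is stable under
  E.\<close>

inductive_set Be :: "'b set" where
  prod: "x \<in> L.H r ==> y \<in> Rv.H s ==> b \<in> I.B ==> x * (y * b) \<in> Be"
| add: "v \<in> Be ==> w \<in> Be ==> v + w \<in> Be"

lemma Be_scale: "v \<in> Be ==> a *s v \<in> Be"
proof (induction rule: Be.induct)
  case (prod x y b)
  have "(a *s x) * (y * b) \<in> Be" using prod L.H_scale by (intro Be.prod) auto
  then show ?case by simp
qed (auto simp: scale_right_distrib intro: Be.add)

lemma IB_Be: "b \<in> I.B ==> b \<in> Be"
  using Be.prod[OF L.H_u Rv.H_u, of b] B_u_left[OF I_B_sub, of b] by simp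

lemma E_Be: "v \<in> Be ==> E * v \<in> I.B"
  by (induction rule: Be.induct) (auto simp: distrib_left E_left_right_IB intro: I.B_add)

lemma B_Be: "x \<in> B ==> x * e \<in> Be"
  unfolding B_def
proof (induction rule: alg.induct)
  case alg_unit
  then show ?case using IB_Be[OF I.B_u] by simp
next
  case (alg_gen h x)
  consider k where "h = g k" "Suc k < r" | k where "h = T k" "Suc k < s" | "h = E" using alg_gen(1) by auto
  then show ?case
  proof cases
    case 1
    have "g k * v \<in> Be" if "v \<in> Be" for v using that
    proof (induction rule: Be.induct)
      case (prod x y b)
      have "(g k * x) * (y * b) \<in> Be" using prod 1 by (intro Be.prod L.H_mult L.H_S) auto
      then show ?case by (simp add: mult.assoc)
    qed (auto simp: distrib_left intro: Be.add)
    then show ?thesis using alg_gen 1 by (simp add: mult.assoc)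
  next
    case 2
    have "s - 2 - (s - 2 - k) = k" "Suc (s - 2 - k) < s" using 2(2) by linarith+
    then have TR: "T k \<in> Rv.H s" using Rv.H_S[of "s - 2 - k" s] by (simp only: Tr_def le_refl)
    have "T k * v \<in> Be" if "v \<in> Be" for v using that
    proof (induction rule: Be.induct)
      case (prod x y b)
      have "x * ((T k * y) * b) \<in> Be" using prod TR by (intro Be.prod Rv.H_mult) auto
      moreover have "x * T k = T k * x" using T_LH 2 prod by simp
      ultimately show ?case by (simp add: mult.assoc commute_mult_left)
    qed (auto simp: distrib_left intro: Be.add)
    then show ?thesis using alg_gen 2 by (simp add: mult.assoc)
  next
    case 3
    then show ?thesis using IB_Be[OF E_Be[OF alg_gen(3)]] by (simp add: mult.assoc)
  qed
qed (auto simp: distrib_right intro: Be.add Be_scale)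

lemma corner_IB: "x \<in> B ==> e * (x * e) \<in> I.B"
  unfolding e_mult[of "x * e"] by (intro I.B_scale E_Be B_Be)

end

section \<open>Assembling the centre\<close>

context alg_over
begin

text \<open>\<open>lag Z u \<omega> l\<close> is the Lagrange polynomial in the elements \<open>Z k\<close> which is 1 on the joint
  eigenvalue \<open>\<omega>\<close> and 0 on the other joint eigenvalues listed in \<open>l\<close>.\<close>

fun lag :: "(nat => 'b) => 'b => (nat => 'k) => (nat => 'k) list => 'b" where
  "lag Z u \<omega> [] = u"
| "lag Z u \<omega> (\<nu> # l) = (if \<nu> = \<omega> then lag Z u \<omega> l else
     (let k = (SOME k. \<omega> k \<noteq> \<nu> k) in
       inverse (\<omega> k - \<nu> k) *s (Z k * lag Z u \<omega> l - \<nu> k *s lag Z u \<omega> l)))"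

lemma lag_Cons:
  assumes "\<nu> \<noteq> \<omega>"
  obtains k where "\<omega> k \<noteq> \<nu> k"
    "\<And>l. lag Z u \<omega> (\<nu> # l) = inverse (\<omega> k - \<nu> k) *s (Z k * lag Z u \<omega> l - \<nu> k *s lag Z u \<omega> l)"
proof -
  have "\<exists>k. \<omega> k \<noteq> \<nu> k" using assms by auto
  then have "\<omega> (SOME k. \<omega> k \<noteq> \<nu> k) \<noteq> \<nu> (SOME k. \<omega> k \<noteq> \<nu> k)" by (rule someI_ex)
  then show ?thesis using that[of "SOME k. \<omega> k \<noteq> \<nu> k"] assms by (simp add: Let_def)
qed

lemma lag_alg: "lag Z u \<omega> l \<in> alg (range Z) u"
proof (induction l)
  case (Cons \<nu> l)
  show ?case
  proof (cases "\<nu> = \<omega>")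
    case False
    obtain k where k: "\<And>l. lag Z u \<omega> (\<nu> # l) = inverse (\<omega> k - \<nu> k) *s (Z k * lag Z u \<omega> l - \<nu> k *s lag Z u \<omega> l)"
      using lag_Cons[OF False] by metis
    show ?thesis unfolding k using Cons by (intro alg_scale alg_diff alg_gen) auto
  qed (use Cons in simp)
qed (simp add: alg_unit)

context
  fixes J :: "'b set" and Z :: "nat => 'b" and u x :: 'b and \<nu> :: "nat => 'k"
  assumes J0: "0 \<in> J" and Jadd: "\<And>a b. a \<in> J ==> b \<in> J ==> a + b \<in> J"
    and Jscale: "\<And>a c. a \<in> J ==> c *s a \<in> J" and JZ: "\<And>a k. a \<in> J ==> Z k * a \<in> J"
    and ux: "u * x = x" and Zx: "\<And>k. Z k * x - \<nu> k *s x \<in> J"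
begin

lemma Jdiff: "a \<in> J ==> b \<in> J ==> a - b \<in> J"
  using Jadd[of a "(-1) *s b"] Jscale[of b "-1"] by simp

text \<open>Modulo J the factor for \<mu> multiplies x by (\<nu> k - \<mu> k) / (\<omega> k - \<mu>
  k), which is 1 for \<omega> = \<nu> and 0 for \<mu> = \<nu>. With J = {0} this is the statement
  for true eigenvectors.\<close>

lemma lag_scalar: "\<exists>c. lag Z u \<omega> l * x - c *s x \<in> J \<and> (\<omega> = \<nu> \<longrightarrow> c = 1) \<and> (\<omega> \<noteq> \<nu> \<longrightarrow> \<nu> \<in> set l \<longrightarrow> c = 0)"
proof (induction l)
  case Nil
  then show ?case using J0 ux by (intro exI[of _ 1]) simp
next
  case (Cons \<mu> l)
  then obtain c where c: "lag Z u \<omega> l * x - c *s x \<in> J" "\<omega> = \<nu> \<longrightarrow> c = 1" "\<omega> \<noteq> \<nu> \<longrightarrow> \<nu> \<in> set l \<longrightarrow> c = 0" by auto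
  show ?case
  proof (cases "\<mu> = \<omega>")
    case True
    then show ?thesis using c by auto
  next
    case False
    obtain k where k: "\<omega> k \<noteq> \<mu> k" "\<And>l. lag Z u \<omega> (\<mu> # l) = inverse (\<omega> k - \<mu> k) *s (Z k * lag Z u \<omega> l - \<mu> k *s lag Z u \<omega> l)"
      using lag_Cons[OF False] by metis
    define j where "j = lag Z u \<omega> l * x - c *s x"
    define d where "d = inverse (\<omega> k - \<mu> k) * ((\<nu> k - \<mu> k) * c)"
    have lx: "lag Z u \<omega> l * x = j + c *s x" by (simp add: j_def)
    have "lag Z u \<omega> (\<mu> # l) * x = inverse (\<omega> k - \<mu> k) *s (Z k * (lag Z u \<omega> l * x) - \<mu> k *s (lag Z u \<omega> l * x))"
      by (simp only: k(2) mult_scale_left left_diff_distrib mult.assoc)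
    also have "Z k * (lag Z u \<omega> l * x) - \<mu> k *s (lag Z u \<omega> l * x)
        = (Z k * j - \<mu> k *s j) + c *s (Z k * x - \<nu> k *s x) + ((\<nu> k - \<mu> k) * c) *s x"
      by (simp add: lx distrib_left scale_right_distrib scale_right_diff_distrib algebra_simps)
    finally have "lag Z u \<omega> (\<mu> # l) * x - d *s x = inverse (\<omega> k - \<mu> k) *s ((Z k * j - \<mu> k *s j) + c *s (Z k * x - \<nu> k *s x))"
      by (simp add: d_def scale_right_distrib)
    moreover have "j \<in> J" using c(1) by (simp add: j_def)
    then have "inverse (\<omega> k - \<mu> k) *s ((Z k * j - \<mu> k *s j) + c *s (Z k * x - \<nu> k *s x)) \<in> J"
      by (intro Jscale Jadd[OF Jdiff[OF JZ Jscale] Jscale[OF Zx]])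
    ultimately have "lag Z u \<omega> (\<mu> # l) * x - d *s x \<in> J" by (simp only:)
    moreover have "\<omega> = \<nu> \<longrightarrow> d = 1" using c(2) k(1) by (auto simp: d_def)
    moreover have "\<omega> \<noteq> \<nu> \<longrightarrow> \<nu> \<in> set (\<mu> # l) \<longrightarrow> d = 0" using c(3) by (auto simp: d_def)
    ultimately show ?thesis by blast
  qed
qed

lemma lag_same: "lag Z u \<nu> l * x - x \<in> J"
  using lag_scalar[of \<nu> l] by auto

lemma lag_other: "\<omega> \<noteq> \<nu> ==> \<nu> \<in> set l ==> lag Z u \<omega> l * x \<in> J"
  using lag_scalar[of \<omega> l] by auto

end

lemma lag_eigen:
  assumes "u * x = x" "\<And>k. Z k * x = \<nu> k *s x" "\<nu> \<in> set l"
  shows "lag Z u \<omega> l * x = (if \<omega> = \<nu> then x else 0)"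
  using lag_same[of "{0}" Z u x \<nu> l] lag_other[of "{0}" Z u x \<nu> \<omega> l] assms by auto

end

section \<open>The ideal generated by E and the joint spectrum modulo it\<close>

context walled
begin

text \<open>The joint eigenvalue of the power sums on the weight (\<alpha>, \<beta>) of the quotient
  by the ideal of E. The index p stands for the exponent p + 1, so that only positive powers are
  taken, which lie in B.\<close>

definition val :: "int list => int list => nat => 'k" where
  "val \<alpha> \<beta> p = (\<Sum>a\<leftarrow>\<alpha>. L.qe a ^ Suc p) - (\<Sum>b\<leftarrow>\<beta>. (\<rho> * \<rho> * R.qe b) ^ Suc p)"

inductive_set J :: "'b set" where
  gen: "a \<in> B ==> b \<in> B ==> a * (E * b) \<in> J"
| add: "x \<in> J ==> y \<in> J ==> x + y \<in> J"

lemma J_scale: "x \<in> J ==> c *s x \<in> J"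
proof (induction rule: J.induct)
  case (gen a b)
  have "(c *s a) * (E * b) \<in> J" using gen by (intro J.gen B_scale)
  then show ?case by simp
qed (simp add: scale_right_distrib J.add)

lemma J_left: "y \<in> B ==> x \<in> J ==> y * x \<in> J"
proof (rotate_tac 1, induction rule: J.induct)
  case (gen a b)
  have "(y * a) * (E * b) \<in> J" using gen by (intro J.gen B_mult)
  then show ?case by (simp add: mult.assoc)
qed (simp add: distrib_left J.add)

lemma J_right: "y \<in> B ==> x \<in> J ==> x * y \<in> J"
proof (rotate_tac 1, induction rule: J.induct)
  case (gen a b)
  have "a * (E * (b * y)) \<in> J" using gen by (intro J.gen B_mult)
  then show ?case by (simp add: mult.assoc)
qed (simp add: distrib_right J.add)

lemma J_0: "0 \<in> J" using J_scale[OF J.gen[OF B_u B_u], of 0] by simp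
lemma J_uminus: "x \<in> J ==> - x \<in> J" using J_scale[of x "-1"] by simp
lemma J_sum: "(\<And>i. i \<in> I ==> f i \<in> J) ==> sum f I \<in> J"
  by (induction I rule: infinite_finite_induct) (auto simp: J_0 J.add)
lemma J_E: "E \<in> J" using J.gen[OF B_u B_u] by simp

lemma Ed_J: "d < r ==> Ed d \<in> J"
proof (induction d)
  case (Suc d)
  then have "g (r - 2 - d) \<in> B" by (intro B_g) simp
  then show ?case using Suc by (simp add: Ed.simps J_left J_right)
qed (simp add: J_E)

lemma RX_B: "k < s ==> R.X k \<in> B" using B_RH[of s] R.H_X[of k s] by simp

text \<open>All arcs lie in the ideal, so only the constant \<rho>^2 of \<open>Y 0\<close> survives,
  conjugated by the generators.\<close>

lemma Y_cong: "k < s ==> Y k - (\<rho> * \<rho>) *s R.X k \<in> J"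
proof (induction k)
  case 0
  have "Esum \<in> J" unfolding Esum_def by (rule J_sum) (simp add: Ed_J)
  then show ?case using J_scale[of Esum "- (R.zq * \<rho>)"] by (simp add: Y.simps)
next
  case (Suc k)
  have "T k * ((Y k - (\<rho> * \<rho>) *s R.X k) * T k) \<in> J" using Suc by (intro J_left J_right B_T) auto
  then show ?case by (simp add: Y.simps R.X.simps left_diff_distrib right_diff_distrib)
qed

lemma power_cong_J: "x \<in> B ==> y \<in> B ==> x - y \<in> J ==> x ^ Suc p - y ^ Suc p \<in> J"
proof (induction p)
  case (Suc p)
  have "x ^ Suc (Suc p) - y ^ Suc (Suc p) = x * (x ^ Suc p - y ^ Suc p) + (x - y) * y ^ Suc p"
    by (simp add: right_diff_distrib left_diff_distrib)
  moreover have "x * (x ^ Suc p - y ^ Suc p) \<in> J" using Suc by (intro J_left) auto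
  moreover have "(x - y) * y ^ Suc p \<in> J" using Suc by (intro J_right B_power) auto
  ultimately show ?case using J.add by presburger
qed simp

lemma scale_power: "(c *s x) ^ p = c ^ p *s x ^ p"
  by (induction p) (auto simp: mult.commute)

lemma Z_weight:
  assumes x: "x \<in> B" "L.wt \<alpha> x" "R.wt \<beta> x" and l: "length \<alpha> = r" "length \<beta> = s"
  shows "Z (Suc p) * x - val \<alpha> \<beta> p *s x \<in> J"
proof -
  define K where "K = (\<Sum>j<s. ((\<rho> * \<rho>) *s R.X j) ^ Suc p)"
  define N where "N = (\<Sum>j<s. Y j ^ Suc p)"
  have "N - K \<in> J"
    unfolding N_def K_def sum_subtractf[symmetric]
    by (intro J_sum power_cong_J Y_cong) (auto intro: Y_B B_scale RX_B)
  then have j: "(N - K) * x \<in> J" using x J_right by blast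
  have kx: "K * x = (\<Sum>b\<leftarrow>\<beta>. (\<rho> * \<rho> * R.qe b) ^ Suc p) *s x"
  proof -
    have "K = (\<rho> * \<rho>) ^ Suc p *s (\<Sum>j<length \<beta>. R.X j ^ Suc p)"
      unfolding K_def scale_power l by (simp only: scale_sum_right)
    then have "K * x = (\<rho> * \<rho>) ^ Suc p *s ((\<Sum>b\<leftarrow>\<beta>. R.qe b ^ Suc p) *s x)"
      using R.psum_wt[OF x(3), of "Suc p"] by (simp only: mult_scale_left zero_less_Suc)
    also have "(\<rho> * \<rho>) ^ Suc p *s ((\<Sum>b\<leftarrow>\<beta>. R.qe b ^ Suc p) *s x) = (\<Sum>b\<leftarrow>\<beta>. (\<rho> * \<rho> * R.qe b) ^ Suc p) *s x"
      by (simp only: scale_scale sum_list_const_mult[symmetric] power_mult_distrib)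
    finally show ?thesis .
  qed
  have "(\<Sum>i<r. L.X i ^ Suc p) * x = (\<Sum>a\<leftarrow>\<alpha>. L.qe a ^ Suc p) *s x"
    using L.psum_wt[OF x(2), of "Suc p"] l by simp
  then have "Z (Suc p) * x - val \<alpha> \<beta> p *s x = - ((N - K) * x)"
    unfolding Z_def N_def[symmetric] val_def using kx by (simp add: left_diff_distrib scale_left_diff_distrib)
  then show ?thesis using J_uminus[OF j] by simp
qed

lemma RH_LH: "x \<in> L.H r ==> y \<in> R.H s ==> x * y = y * x"
proof (rule R.H_commute[where m = s, symmetric])
  assume x: "x \<in> L.H r"
  show "u * x = x" "x * u = x" using L.H_u_left[OF _ x] L.H_u_right[OF x] by auto
  show "T k * x = x * T k" if "Suc k < s" for k
    by (rule L.H_commute[where m = r, symmetric]) (use x that gT in auto)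
qed

text \<open>The components are indexed by their own joint eigenvalues. Distinct ones are thereby
  separated by the power sums, and a Lagrange polynomial applied to u returns a single
  component.\<close>

definition resolved :: "(nat => 'k) set => ((nat => 'k) => 'b) => bool" where
  "resolved \<Omega> \<epsilon> \<longleftrightarrow> finite \<Omega> \<and> (\<Sum>\<omega>\<in>\<Omega>. \<epsilon> \<omega>) = u \<and> (\<forall>\<omega>\<in>\<Omega>. u * \<epsilon> \<omega> = \<epsilon> \<omega>) \<and>
    (\<forall>\<omega>\<in>\<Omega>. \<forall>p. Z (Suc p) * \<epsilon> \<omega> = \<omega> p *s \<epsilon> \<omega>) \<and>
    (\<forall>z\<in>B. (\<forall>x\<in>B. x * z = z * x) \<longrightarrow> (\<exists>c. z = (\<Sum>\<omega>\<in>\<Omega>. c \<omega> *s \<epsilon> \<omega>)))"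

definition vals :: "(nat => 'k) set" where
  "vals = (\<lambda>(\<alpha>, \<beta>). val \<alpha> \<beta>) ` (contents r \<times> contents s)"

lemma finite_vals [simp]: "finite vals" by (simp add: vals_def)

end

text \<open>What the induction delivers on the ideal: E as a sum of joint eigenvectors in terms of
  which every product of E with a central element can be expanded. The last two assumptions express
  the absence of cancellation between the eigenvalues.\<close>

locale walled_split = walled +
  fixes \<Omega>J :: "(nat => 'a) set" and \<epsilon>J :: "(nat => 'a) => 'b"
  assumes fin_\<Omega>J: "finite \<Omega>J" and sum_\<epsilon>J: "(\<Sum>\<nu>\<in>\<Omega>J. \<epsilon>J \<nu>) = E"
    and u_\<epsilon>J: "\<nu> \<in> \<Omega>J ==> u * \<epsilon>J \<nu> = \<epsilon>J \<nu>"
    and Z_\<epsilon>J: "\<nu> \<in> \<Omega>J ==> Z (Suc p) * \<epsilon>J \<nu> = \<nu> p *s \<epsilon>J \<nu>"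
    and center_E: "z \<in> B ==> (\<And>x. x \<in> B ==> x * z = z * x) ==> \<exists>c. z * E = (\<Sum>\<nu>\<in>\<Omega>J. c \<nu> *s \<epsilon>J \<nu>)"
    and disj: "\<Omega>J \<inter> vals = {}"
    and val_inj: "\<alpha> \<in> contents r ==> \<alpha>' \<in> contents r ==> \<beta> \<in> contents s ==> \<beta>' \<in> contents s ==>
      val \<alpha> \<beta> = val \<alpha>' \<beta>' ==> mset \<alpha> = mset \<alpha>' \<and> mset \<beta> = mset \<beta>'"
begin

definition l\<Omega> where "l\<Omega> = (SOME l. set l = vals \<union> \<Omega>J)"

lemma set_l\<Omega>: "set l\<Omega> = vals \<union> \<Omega>J"
proof -
  have "\<exists>l. set l = vals \<union> \<Omega>J" using fin_\<Omega>J by (intro finite_list) simp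
  then show ?thesis unfolding l\<Omega>_def by (rule someI_ex)
qed

definition lg where "lg \<omega> = lag (\<lambda>p. Z (Suc p)) u \<omega> l\<Omega>"

lemma lg_B: "lg \<omega> \<in> B"
proof -
  have "x \<in> alg (range (\<lambda>p. Z (Suc p))) u ==> x \<in> B" for x
    by (induction rule: alg.induct) (auto intro: B_u B_add B_scale B_mult Z_B)
  then show ?thesis unfolding lg_def using lag_alg by blast
qed

lemma lg_central: "x \<in> B ==> x * lg \<omega> = lg \<omega> * x"
proof -
  assume x: "x \<in> B"
  have "y * x = x * y" if "y \<in> alg (range (\<lambda>p. Z (Suc p))) u" for y
  proof (rule alg_commute[OF _ _ _ that])
    show "u * x = x" "x * u = x" using x B_u_left B_u_right by auto
    show "h * x = x * h" if "h \<in> range (\<lambda>p. Z (Suc p))" for h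
      using that Z_central[OF zero_less_Suc x] by (auto simp del: One_nat_def)
  qed
  then show ?thesis unfolding lg_def using lag_alg by metis
qed

lemma lg_\<epsilon>J: "\<nu> \<in> \<Omega>J ==> lg \<omega> * \<epsilon>J \<nu> = (if \<omega> = \<nu> then \<epsilon>J \<nu> else 0)"
  unfolding lg_def by (rule lag_eigen) (auto simp: u_\<epsilon>J Z_\<epsilon>J set_l\<Omega>)

lemma lg_E: "lg \<omega> * E = (if \<omega> \<in> \<Omega>J then \<epsilon>J \<omega> else 0)"
proof -
  have "lg \<omega> * E = (\<Sum>\<nu>\<in>\<Omega>J. lg \<omega> * \<epsilon>J \<nu>)" by (simp only: sum_\<epsilon>J[symmetric] sum_distrib_left)
  also have "\<dots> = (\<Sum>\<nu>\<in>\<Omega>J. if \<omega> = \<nu> then \<epsilon>J \<nu> else 0)" by (rule sum.cong) (auto simp: lg_\<epsilon>J)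
  also have "\<dots> = (if \<omega> \<in> \<Omega>J then \<epsilon>J \<omega> else 0)" using fin_\<Omega>J by simp
  finally show ?thesis .
qed

text \<open>A polynomial in the power sums that is 1 on the spectrum of the quotient and 0 on that
  of the ideal. It turns out to be the central idempotent that splits off the ideal: f kills J and u
  - f lies in J.\<close>

definition f where "f = (\<Sum>\<omega>\<in>vals. lg \<omega>)"

lemma f_B: "f \<in> B" unfolding f_def by (rule B_sum) (rule lg_B)

lemma f_central: "x \<in> B ==> x * f = f * x"
  by (simp add: f_def sum_distrib_left sum_distrib_right lg_central)

lemma f_E: "f * E = 0"
  unfolding f_def sum_distrib_right using disj by (intro sum.neutral) (auto simp: lg_E)

lemma J_kill: assumes "y \<in> B" "\<And>x. x \<in> B ==> x * y = y * x" "y * E = 0" "x \<in> J" shows "y * x = 0"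
  using assms(4)
proof (induction rule: J.induct)
  case (gen a b)
  have "y * (a * (E * b)) = a * ((y * E) * b)"
    by (simp only: mult.assoc commute_mult_left[OF assms(2)[OF gen(1), symmetric]])
  then show ?case by (simp add: assms(3))
qed (simp add: distrib_left)

lemma f_J: "x \<in> J ==> f * x = 0"
  using J_kill[OF f_B f_central f_E] by blast

lemma lg_weight:
  assumes "x \<in> B" "L.wt \<alpha> x" "R.wt \<beta> x" "\<alpha> \<in> contents r" "\<beta> \<in> contents s"
  shows "f * x - x \<in> J"
proof -
  have Zx: "Z (Suc p) * x - val \<alpha> \<beta> p *s x \<in> J" for p
    by (rule Z_weight) (use assms in \<open>auto simp: contents_def\<close>)
  have v: "val \<alpha> \<beta> \<in> vals" using assms by (auto simp: vals_def)
  have ux: "u * x = x" using assms(1) by (rule B_u_left)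
  have JZ: "\<And>a k. a \<in> J ==> Z (Suc k) * a \<in> J" using J_left Z_B by simp
  have 1: "lg (val \<alpha> \<beta>) * x - x \<in> J" unfolding lg_def
    by (rule lag_same[where J = J]) (use J_0 J.add J_scale JZ ux Zx in auto)
  have 2: "lg \<omega> * x \<in> J" if "\<omega> \<noteq> val \<alpha> \<beta>" for \<omega> unfolding lg_def
    by (rule lag_other[where J = J and \<nu> = "val \<alpha> \<beta>"]) (use J_0 J.add J_scale JZ ux Zx that v set_l\<Omega> in auto)
  have eq: "f * x - x = (lg (val \<alpha> \<beta>) * x - x) + (\<Sum>\<omega>\<in>vals - {val \<alpha> \<beta>}. lg \<omega> * x)"
    unfolding f_def sum_distrib_right using v by (subst sum.remove[of vals "val \<alpha> \<beta>"]) auto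
  show ?thesis unfolding eq by (rule J.add[OF 1 J_sum]) (use 2 in auto)
qed

text \<open>The products of weight idempotents of the two Hecke algebras add up to u, and modulo J
  each of them is fixed by f, since its joint eigenvalue modulo J lies in
  \<open>vals\<close>.\<close>

lemma u_f_J: "u - f \<in> J"
proof -
  note dL = L.decomp_idem[OF order.refl] and dR = R.decomp_idem[OF order.refl]
  have "f * (L.idem r \<alpha> * R.idem s \<beta>) - L.idem r \<alpha> * R.idem s \<beta> \<in> J"
    if a: "\<alpha> \<in> contents r" and b: "\<beta> \<in> contents s" for \<alpha> \<beta>
  proof (rule lg_weight[OF _ _ _ a b])
    note LH = L.decomp_H[OF dL a] and RH = R.decomp_H[OF dR b]
    show "L.idem r \<alpha> * R.idem s \<beta> \<in> B" using LH RH B_LH[of r] B_RH[of s] by (intro B_mult) auto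
    show "L.wt \<alpha> (L.idem r \<alpha> * R.idem s \<beta>)" using L.decomp_wt[OF dL a] by (rule L.wt_mult)
    show "R.wt \<beta> (L.idem r \<alpha> * R.idem s \<beta>)"
      unfolding RH_LH[OF LH RH] using R.decomp_wt[OF dR b] by (rule R.wt_mult)
  qed
  then have "(\<Sum>\<alpha>\<in>contents r. \<Sum>\<beta>\<in>contents s. f * (L.idem r \<alpha> * R.idem s \<beta>) - L.idem r \<alpha> * R.idem s \<beta>) \<in> J"
    by (intro J_sum)
  also have "(\<Sum>\<alpha>\<in>contents r. \<Sum>\<beta>\<in>contents s. f * (L.idem r \<alpha> * R.idem s \<beta>) - L.idem r \<alpha> * R.idem s \<beta>)
      = f * ((\<Sum>\<alpha>\<in>contents r. L.idem r \<alpha>) * (\<Sum>\<beta>\<in>contents s. R.idem s \<beta>)) - (\<Sum>\<alpha>\<in>contents r. L.idem r \<alpha>) * (\<Sum>\<beta>\<in>contents s. R.idem s \<beta>)"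
  proof -
    have "(\<Sum>\<alpha>\<in>contents r. L.idem r \<alpha>) * (\<Sum>\<beta>\<in>contents s. R.idem s \<beta>) = (\<Sum>\<alpha>\<in>contents r. \<Sum>\<beta>\<in>contents s. L.idem r \<alpha> * R.idem s \<beta>)"
      by (rule sum_product)
    then show ?thesis by (simp only: sum_distrib_left[of f] sum_subtractf)
  qed
  also have "\<dots> = f - u" using L.decomp_sum[OF dL] R.decomp_sum[OF dR] B_u_right[OF f_B] by simp
  finally show ?thesis using J_uminus[of "f - u"] by simp
qed

lemma ff: "f * f = f"
  using f_J[OF u_f_J] B_u_right[OF f_B] by (simp add: right_diff_distrib)

lemma uf [simp]: "u * f = f" "f * u = f" using B_u_left[OF f_B] B_u_right[OF f_B] by auto

text \<open>Multiplication by f realises the quotient by the ideal inside the algebra. There the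
  theory of Hecke algebras applies again, with f as unit.\<close>

sublocale Lf: hecke scale f "inverse q" "\<lambda>k. g k * f" r
  by (rule L.hecke_corner) (use ff f_central B_g in auto)
sublocale Rf: hecke scale f q "\<lambda>k. T k * f" s
  by (rule R.hecke_corner) (use ff f_central B_T in auto)

lemma LfX: "k < r ==> Lf.X k = L.X k * f"
proof (induction k)
  case (Suc k)
  have c: "f * L.X k = L.X k * f" "f * g k = g k * f" using f_central X_B[of k] B_g[of k] Suc.prems by auto
  have "Lf.X (Suc k) = g k * f * (L.X k * f * (g k * f))" using Suc by (simp add: Lf.X.simps)
  also have "\<dots> = g k * (L.X k * g k) * f"
    by (simp only: mult.assoc commute_mult_left[OF c(1)] commute_mult_left[OF c(2)] ff)
  finally show ?case by (simp only: L.X.simps)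
qed simp

lemma RfX: "k < s ==> Rf.X k = R.X k * f"
proof (induction k)
  case (Suc k)
  have c: "f * R.X k = R.X k * f" "f * T k = T k * f" using f_central RX_B[of k] B_T[of k] Suc.prems by auto
  have "Rf.X (Suc k) = T k * f * (R.X k * f * (T k * f))" using Suc by (simp add: Rf.X.simps)
  also have "\<dots> = T k * (R.X k * T k) * f"
    by (simp only: mult.assoc commute_mult_left[OF c(1)] commute_mult_left[OF c(2)] ff)
  finally show ?case by (simp only: R.X.simps)
qed simp

lemma Lf_wt: "length \<alpha> \<le> r ==> Lf.wt \<alpha> v ==> L.wt \<alpha> v"
proof (induction \<alpha>)
  case Nil
  then show ?case using uf(1) by (metis Lf.wt.simps(1) L.wt.simps(1) mult.assoc)
next
  case (Cons a \<eta>)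
  have fv: "f * v = v" using Lf.wt_u[OF Cons.prems(2)] .
  have "L.X (length \<eta>) * v = Lf.X (length \<eta>) * v" using LfX[of "length \<eta>"] Cons.prems fv by (simp add: mult.assoc)
  moreover have "Lf.qe a = L.qe a" by (simp add: Lf.qe_def L.qe_def)
  ultimately show ?case using Cons by simp
qed

lemma Rf_wt: "length \<alpha> \<le> s ==> Rf.wt \<alpha> v ==> R.wt \<alpha> v"
proof (induction \<alpha>)
  case Nil
  then show ?case using uf(1) by (metis Rf.wt.simps(1) R.wt.simps(1) mult.assoc)
next
  case (Cons a \<eta>)
  have fv: "f * v = v" using Rf.wt_u[OF Cons.prems(2)] .
  have "R.X (length \<eta>) * v = Rf.X (length \<eta>) * v" using RfX[of "length \<eta>"] Cons.prems fv by (simp add: mult.assoc)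
  moreover have "Rf.qe a = R.qe a" by (simp add: Rf.qe_def R.qe_def)
  ultimately show ?case using Cons by simp
qed

lemma LfH_B: "x \<in> Lf.H r ==> x \<in> B"
  unfolding Lf.H_def
proof (induction rule: alg.induct)
  case (alg_gen h x)
  then have "h \<in> B" using B_g f_B B_mult by auto
  then show ?case using alg_gen by (intro B_mult)
qed (auto intro: f_B B_add B_scale)

lemma RfH_B: "x \<in> Rf.H s ==> x \<in> B"
  unfolding Rf.H_def
proof (induction rule: alg.induct)
  case (alg_gen h x)
  then have "h \<in> B" using B_T f_B B_mult by auto
  then show ?case using alg_gen by (intro B_mult)
qed (auto intro: f_B B_add B_scale)

lemma LfH_T: "x \<in> Lf.H r ==> Suc k < s ==> x * (T k * f) = T k * f * x"
proof (rule Lf.H_commute[where m = r])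
  assume k: "Suc k < s"
  have c: "f * T k = T k * f" using f_central B_T[OF k] by simp
  show "f * (T k * f) = T k * f" by (simp only: commute_mult_left[OF c] ff)
  show "T k * f * f = T k * f" by (simp only: mult.assoc ff)
  show "g j * f * (T k * f) = T k * f * (g j * f)" if "Suc j < r" for j
  proof -
    have d: "f * g j = g j * f" using f_central B_g[OF that] by simp
    show ?thesis using gT[OF that k]
      by (simp only: mult.assoc commute_mult_left[OF c] commute_mult_left[OF d] ff) (simp only: mult.assoc[symmetric])
  qed
qed

lemma LfH_RfH: "x \<in> Lf.H r ==> y \<in> Rf.H s ==> x * y = y * x"
proof (rule Rf.H_commute[where m = s, symmetric])
  assume x: "x \<in> Lf.H r"
  show "f * x = x" "x * f = x" using Lf.H_u_left[OF _ x] Lf.H_u_right[OF x] by auto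
  show "T k * f * x = x * (T k * f)" if "Suc k < s" for k using LfH_T[OF x that] by simp
qed

inductive_set Bf :: "'b set" where
  prod: "x \<in> Lf.H r ==> y \<in> Rf.H s ==> x * y \<in> Bf"
| add: "v \<in> Bf ==> w \<in> Bf ==> v + w \<in> Bf"

lemma Bf_scale: "v \<in> Bf ==> a *s v \<in> Bf"
proof (induction rule: Bf.induct)
  case (prod x y)
  have "(a *s x) * y \<in> Bf" using prod Lf.H_scale by (intro Bf.prod) auto
  then show ?case by simp
qed (auto simp: scale_right_distrib intro: Bf.add)

lemma f_Bf: "v \<in> Bf ==> f * v = v"
proof (induction rule: Bf.induct)
  case (prod x y)
  then show ?case using Lf.H_u_left[of r x] by (simp add: mult.assoc[symmetric])
qed (simp add: distrib_left)

text \<open>E f = 0, so only the two commuting Hecke algebras are left after multiplication by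
  f.\<close>

lemma B_Bf: "x \<in> B ==> x * f \<in> Bf"
  unfolding B_def
proof (induction rule: alg.induct)
  case alg_unit
  then show ?case using Bf.prod[OF Lf.H_u Rf.H_u] ff by simp
next
  case (alg_gen h x)
  let ?w = "x * f"
  have w: "f * ?w = ?w" using f_Bf[OF alg_gen(3)] .
  have hw: "h * x * f = (h * f) * ?w" using w by (simp add: mult.assoc)
  consider k where "h = g k" "Suc k < r" | k where "h = T k" "Suc k < s" | "h = E" using alg_gen(1) by auto
  then show ?case
  proof cases
    case 1
    have "(g k * f) * v \<in> Bf" if "v \<in> Bf" for v using that
    proof (induction rule: Bf.induct)
      case (prod x y)
      have "(g k * f * x) * y \<in> Bf" using prod 1 by (intro Bf.prod Lf.H_mult Lf.H_S) auto
      then show ?case by (simp add: mult.assoc)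
    qed (auto simp: distrib_left intro: Bf.add)
    from this[OF alg_gen(3)] show ?thesis by (subst hw) (simp only: 1(1))
  next
    case 2
    have "(T k * f) * v \<in> Bf" if "v \<in> Bf" for v using that
    proof (induction rule: Bf.induct)
      case (prod x y)
      have "x * (T k * f * y) \<in> Bf" using prod 2 by (intro Bf.prod Rf.H_mult Rf.H_S) auto
      moreover have "T k * f * (x * y) = x * (T k * f * y)"
        by (rule commute_mult_left[OF LfH_T[OF prod(1) 2(2), symmetric]])
      ultimately show ?case by simp
    qed (auto simp: distrib_left intro: Bf.add)
    from this[OF alg_gen(3)] show ?thesis by (subst hw) (simp only: 2(1))
  next
    case 3
    have "E * f = 0" using f_central[OF B_E] f_E by simp
    then have "h * x * f = 0 *s ?w" by (subst hw) (simp add: 3)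
    then show ?thesis using Bf_scale[OF alg_gen(3), of 0] by simp
  qed
qed (auto simp: distrib_right intro: Bf.add Bf_scale)

definition pf where "pf \<alpha> \<beta> = Lf.idem r \<alpha> * Rf.idem s \<beta>"

lemma
  assumes a: "\<alpha> \<in> contents r" and b: "\<beta> \<in> contents s"
  shows LfI: "Lf.idem r \<alpha> \<in> Lf.H r" and RfI: "Rf.idem s \<beta> \<in> Rf.H s"
    and LfII: "Lf.idem r \<alpha> * Lf.idem r \<alpha> = Lf.idem r \<alpha>" and RfII: "Rf.idem s \<beta> * Rf.idem s \<beta> = Rf.idem s \<beta>"
  using Lf.decomp_H[OF Lf.decomp_idem a] Rf.decomp_H[OF Rf.decomp_idem b]
    Lf.decomp_proj[OF Lf.decomp_idem Lf.decomp_wt[OF Lf.decomp_idem a] a]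
    Rf.decomp_proj[OF Rf.decomp_idem Rf.decomp_wt[OF Rf.decomp_idem b] b] by auto

lemma pf_B: "\<alpha> \<in> contents r ==> \<beta> \<in> contents s ==> pf \<alpha> \<beta> \<in> B"
  unfolding pf_def by (intro B_mult LfH_B RfH_B LfI RfI)

lemma pf_pf: assumes "\<alpha> \<in> contents r" "\<beta> \<in> contents s" shows "pf \<alpha> \<beta> * pf \<alpha> \<beta> = pf \<alpha> \<beta>"
proof -
  have c: "Rf.idem s \<beta> * Lf.idem r \<alpha> = Lf.idem r \<alpha> * Rf.idem s \<beta>" using LfH_RfH[OF LfI RfI] assms by simp
  have "pf \<alpha> \<beta> * pf \<alpha> \<beta> = (Lf.idem r \<alpha> * Lf.idem r \<alpha>) * (Rf.idem s \<beta> * Rf.idem s \<beta>)"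
    unfolding pf_def by (simp only: mult.assoc commute_mult_left[OF c])
  then show ?thesis using LfII RfII assms by (simp add: pf_def)
qed

text \<open>The eigenvalue equation holds modulo J; its error term is fixed by f as well as killed
  by f.\<close>

lemma Z_pf:
  assumes a: "\<alpha> \<in> contents r" and b: "\<beta> \<in> contents s"
  shows "Z (Suc p) * pf \<alpha> \<beta> = val \<alpha> \<beta> p *s pf \<alpha> \<beta>"
proof -
  have l: "length \<alpha> = r" "length \<beta> = s" using a b by (auto simp: contents_def)
  have 1: "L.wt \<alpha> (pf \<alpha> \<beta>)" unfolding pf_def
    using Lf_wt[OF _ Lf.decomp_wt[OF Lf.decomp_idem a]] l by (intro L.wt_mult) auto
  have 2: "R.wt \<beta> (pf \<alpha> \<beta>)" unfolding pf_def LfH_RfH[OF LfI[OF a b] RfI[OF a b]]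
    using Rf_wt[OF _ Rf.decomp_wt[OF Rf.decomp_idem b]] l by (intro R.wt_mult) auto
  let ?d = "Z (Suc p) * pf \<alpha> \<beta> - val \<alpha> \<beta> p *s pf \<alpha> \<beta>"
  have d: "?d \<in> J" by (rule Z_weight[OF pf_B[OF a b] 1 2 l])
  have fp: "f * pf \<alpha> \<beta> = pf \<alpha> \<beta>"
    unfolding pf_def using Lf.H_u_left[OF _ LfI[OF a b]] by (simp add: mult.assoc[symmetric])
  have "f * (Z (Suc p) * pf \<alpha> \<beta>) = Z (Suc p) * pf \<alpha> \<beta>"
    using commute_mult_left[OF f_central[OF Z_B, symmetric], of "Suc p" "pf \<alpha> \<beta>"] fp by simp
  then have "f * ?d = ?d" using fp by (simp add: right_diff_distrib)
  then have "?d = 0" using f_J[OF d] by simp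
  then show ?thesis by simp
qed

lemma pf_sandwich:
  assumes a: "\<alpha> \<in> contents r" and b: "\<beta> \<in> contents s" and w: "w \<in> Bf"
  shows "\<exists>k. pf \<alpha> \<beta> * w * pf \<alpha> \<beta> = k *s pf \<alpha> \<beta>"
  using w
proof (induction rule: Bf.induct)
  case (prod x y)
  obtain k where k: "Lf.idem r \<alpha> * x * Lf.idem r \<alpha> = k *s Lf.idem r \<alpha>" using Lf.idem_H_idem[OF _ a prod(1)] by auto
  obtain k' where k': "Rf.idem s \<beta> * y * Rf.idem s \<beta> = k' *s Rf.idem s \<beta>" using Rf.idem_H_idem[OF _ b prod(2)] by auto
  have c: "Rf.idem s \<beta> * x = x * Rf.idem s \<beta>" "Rf.idem s \<beta> * Lf.idem r \<alpha> = Lf.idem r \<alpha> * Rf.idem s \<beta>" "y * Lf.idem r \<alpha> = Lf.idem r \<alpha> * y"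
    using LfH_RfH LfI[OF a b] RfI[OF a b] prod by metis+
  have "pf \<alpha> \<beta> * (x * y) * pf \<alpha> \<beta> = (Lf.idem r \<alpha> * x * Lf.idem r \<alpha>) * (Rf.idem s \<beta> * y * Rf.idem s \<beta>)"
    unfolding pf_def by (simp only: mult.assoc commute_mult_left[OF c(1)] commute_mult_left[OF c(2)] commute_mult_left[OF c(3)])
  then show ?case unfolding k k' by (intro exI[of _ "k * k'"]) (simp add: pf_def mult.commute)
next
  case (add v w)
  then obtain k k' where "pf \<alpha> \<beta> * v * pf \<alpha> \<beta> = k *s pf \<alpha> \<beta>" "pf \<alpha> \<beta> * w * pf \<alpha> \<beta> = k' *s pf \<alpha> \<beta>" by auto
  then show ?case by (intro exI[of _ "k + k'"]) (simp add: distrib_left distrib_right scale_left_distrib)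
qed

lemma sum_pf: "(\<Sum>\<alpha>\<in>contents r. \<Sum>\<beta>\<in>contents s. pf \<alpha> \<beta>) = f"
  unfolding pf_def sum_product[symmetric]
  using Lf.decomp_sum[OF Lf.decomp_idem] Rf.decomp_sum[OF Rf.decomp_idem] ff by simp

text \<open>Equal eigenvalues mean equal multisets of contents on both sides; the lists are then
  connected by admissible swaps, first in \<alpha> with \<beta> fixed, then in \<beta>.\<close>

lemma center_const:
  assumes zc: "z \<in> B" "\<And>x. x \<in> B ==> x * z = z * x"
    and c: "\<And>\<alpha> \<beta>. \<alpha> \<in> contents r ==> \<beta> \<in> contents s ==> z * pf \<alpha> \<beta> = c \<alpha> \<beta> *s pf \<alpha> \<beta>"
    and m: "\<alpha> \<in> contents r" "\<alpha>' \<in> contents r" "\<beta> \<in> contents s" "\<beta>' \<in> contents s"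
    and v: "val \<alpha> \<beta> = val \<alpha>' \<beta>'" and nz: "pf \<alpha> \<beta> \<noteq> 0"
  shows "c \<alpha>' \<beta>' = c \<alpha> \<beta>"
proof -
  have ms: "mset \<alpha> = mset \<alpha>'" "mset \<beta> = mset \<beta>'" using val_inj[OF m v] by auto
  have sa: "adm_swap\<^sup>*\<^sup>* \<alpha> \<alpha>'" using content_lists_connected[of \<alpha> \<alpha>'] m ms by (simp add: contents_def)
  have sb: "adm_swap\<^sup>*\<^sup>* \<beta> \<beta>'" using content_lists_connected[of \<beta> \<beta>'] m ms by (simp add: contents_def)
  have 1: "c \<alpha>' \<beta> = c \<alpha> \<beta> \<and> Lf.idem r \<alpha>' * Rf.idem s \<beta> \<noteq> 0 \<and> \<alpha>' \<in> contents r"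
    by (rule Lf.adm_swaps_scalar[where z = z and c = "\<lambda>\<alpha>. c \<alpha> \<beta>", OF order.refl m(1) sa])
      (use zc(2) LfH_B c m nz in \<open>auto simp: pf_def intro!: LfH_RfH RfI[OF m(1)]\<close>)
  have pc: "pf \<alpha>' \<beta>'' = Rf.idem s \<beta>'' * Lf.idem r \<alpha>'" if "\<beta>'' \<in> contents s" for \<beta>''
    unfolding pf_def by (rule LfH_RfH[OF LfI[OF m(2) that] RfI[OF m(2) that]])
  have 2: "c \<alpha>' \<beta>' = c \<alpha>' \<beta> \<and> Rf.idem s \<beta>' * Lf.idem r \<alpha>' \<noteq> 0 \<and> \<beta>' \<in> contents s"
  proof (rule Rf.adm_swaps_scalar[where z = z and c = "\<lambda>\<beta>. c \<alpha>' \<beta>", OF order.refl m(3) sb])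
    show "x * Lf.idem r \<alpha>' = Lf.idem r \<alpha>' * x" if "x \<in> Rf.H s" for x
      using LfH_RfH[OF LfI[OF m(2,3)] that] by simp
    show "x * z = z * x" if "x \<in> Rf.H s" for x using zc(2) RfH_B[OF that] by simp
    show "z * (Rf.idem s \<gamma> * Lf.idem r \<alpha>') = c \<alpha>' \<gamma> *s (Rf.idem s \<gamma> * Lf.idem r \<alpha>')" if "\<gamma> \<in> contents s" for \<gamma>
      using c[OF m(2) that] pc[OF that] by simp
    show "Rf.idem s \<beta> * Lf.idem r \<alpha>' \<noteq> 0" using 1 pc[OF m(3)] by (simp add: pf_def)
  qed
  show ?thesis using 1 2 by simp
qed

text \<open>On the ideal the components are cut out of u - f by Lagrange polynomials; on the
  quotient all weight idempotents with the same joint eigenvalue are collected.\<close>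

definition ep where "ep \<omega> = (if \<omega> \<in> \<Omega>J then lg \<omega> * (u - f)
  else (\<Sum>(\<alpha>, \<beta>)\<in>{(\<alpha>, \<beta>) \<in> contents r \<times> contents s. val \<alpha> \<beta> = \<omega>}. pf \<alpha> \<beta>))"

lemma lg_J_sum: "x \<in> J ==> (\<Sum>\<nu>\<in>\<Omega>J. lg \<nu> * x) = x"
proof (induction rule: J.induct)
  case (gen a b)
  have "lg \<nu> * (a * (E * b)) = a * (\<epsilon>J \<nu> * b)" if "\<nu> \<in> \<Omega>J" for \<nu>
  proof -
    have "lg \<nu> * (a * (E * b)) = a * ((lg \<nu> * E) * b)"
      by (simp only: mult.assoc commute_mult_left[OF lg_central[OF gen(1), symmetric]])
    then show ?thesis using that by (simp add: lg_E)
  qed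
  then have "(\<Sum>\<nu>\<in>\<Omega>J. lg \<nu> * (a * (E * b))) = a * ((\<Sum>\<nu>\<in>\<Omega>J. \<epsilon>J \<nu>) * b)"
    by (simp add: sum_distrib_left sum_distrib_right)
  then show ?case by (simp add: sum_\<epsilon>J)
qed (simp add: distrib_left sum.distrib)

lemma lg_J_Z: "x \<in> J ==> \<nu> \<in> \<Omega>J ==> Z (Suc p) * (lg \<nu> * x) = \<nu> p *s (lg \<nu> * x)"
proof (induction rule: J.induct)
  case (gen a b)
  have 1: "lg \<nu> * (a * (E * b)) = a * (\<epsilon>J \<nu> * b)"
  proof -
    have "lg \<nu> * (a * (E * b)) = a * ((lg \<nu> * E) * b)"
      by (simp only: mult.assoc commute_mult_left[OF lg_central[OF gen(1), symmetric]])
    then show ?thesis using gen by (simp add: lg_E)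
  qed
  have "Z (Suc p) * (a * (\<epsilon>J \<nu> * b)) = a * ((Z (Suc p) * \<epsilon>J \<nu>) * b)"
    by (simp only: mult.assoc commute_mult_left[OF Z_central[OF _ gen(1), symmetric]] zero_less_Suc)
  then show ?case unfolding 1 using Z_\<epsilon>J[OF gen(3)] by simp
qed (simp add: distrib_left scale_right_distrib)

theorem resolved_ep: "resolved (vals \<union> \<Omega>J) ep"
  unfolding resolved_def
proof (intro conjI ballI allI impI)
  show "finite (vals \<union> \<Omega>J)" using fin_\<Omega>J by simp
  have split: "(\<Sum>\<omega>\<in>vals \<union> \<Omega>J. h \<omega>) = (\<Sum>\<omega>\<in>vals. h \<omega>) + (\<Sum>\<omega>\<in>\<Omega>J. h \<omega>)" for h :: "_ => 'b"
    using disj fin_\<Omega>J by (intro sum.union_disjoint) auto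
  have F: "(\<Sum>\<omega>\<in>vals. C \<omega> *s ep \<omega>) = (\<Sum>\<alpha>\<in>contents r. \<Sum>\<beta>\<in>contents s. C (val \<alpha> \<beta>) *s pf \<alpha> \<beta>)" for C
  proof -
    let ?A = "contents r \<times> contents s"
    have "(\<Sum>\<omega>\<in>vals. C \<omega> *s ep \<omega>) = (\<Sum>\<omega>\<in>vals. \<Sum>(\<alpha>, \<beta>)\<in>{x \<in> ?A. (case x of (\<alpha>, \<beta>) => val \<alpha> \<beta>) = \<omega>}. C (val \<alpha> \<beta>) *s pf \<alpha> \<beta>)"
    proof (rule sum.cong[OF HOL.refl])
      fix \<omega> assume "\<omega> \<in> vals"
      then have "\<omega> \<notin> \<Omega>J" using disj by auto
      then show "C \<omega> *s ep \<omega> = (\<Sum>(\<alpha>, \<beta>)\<in>{x \<in> ?A. (case x of (\<alpha>, \<beta>) => val \<alpha> \<beta>) = \<omega>}. C (val \<alpha> \<beta>) *s pf \<alpha> \<beta>)"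
        unfolding ep_def by (simp add: scale_sum_right) (rule sum.cong, auto)
    qed
    also have "\<dots> = (\<Sum>(\<alpha>, \<beta>)\<in>?A. C (val \<alpha> \<beta>) *s pf \<alpha> \<beta>)"
      by (rule sum.group) (auto simp: vals_def)
    finally show ?thesis by (simp add: sum.cartesian_product)
  qed
  show "(\<Sum>\<omega>\<in>vals \<union> \<Omega>J. ep \<omega>) = u"
  proof -
    have "(\<Sum>\<omega>\<in>vals. ep \<omega>) = f" using F[of "\<lambda>_. 1"] sum_pf by simp
    moreover have "(\<Sum>\<omega>\<in>\<Omega>J. ep \<omega>) = u - f" using lg_J_sum[OF u_f_J] by (simp add: ep_def)
    ultimately show ?thesis by (simp add: split)
  qed
  show "u * ep \<omega> = ep \<omega>" for \<omega>
  proof -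
    have "ep \<omega> \<in> B" unfolding ep_def by (auto intro!: B_mult lg_B B_diff B_u f_B B_sum pf_B)
    then show ?thesis by (rule B_u_left)
  qed
  show "Z (Suc p) * ep \<omega> = \<omega> p *s ep \<omega>" if "\<omega> \<in> vals \<union> \<Omega>J" for \<omega> p
  proof (cases "\<omega> \<in> \<Omega>J")
    case True
    then show ?thesis using lg_J_Z[OF u_f_J] by (simp add: ep_def)
  next
    case False
    have "Z (Suc p) * ep \<omega> = (\<Sum>(\<alpha>, \<beta>)\<in>{(\<alpha>, \<beta>) \<in> contents r \<times> contents s. val \<alpha> \<beta> = \<omega>}. \<omega> p *s pf \<alpha> \<beta>)"
      unfolding ep_def using False by (simp add: sum_distrib_left) (rule sum.cong, auto simp: Z_pf)
    then show ?thesis unfolding ep_def using False by (simp add: scale_sum_right case_prod_unfold)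
  qed
  fix z assume z: "z \<in> B" and zc': "\<forall>x\<in>B. x * z = z * x"
  then have zc: "\<And>x. x \<in> B ==> x * z = z * x" by auto
  have "\<exists>c. z * pf \<alpha> \<beta> = c *s pf \<alpha> \<beta>" if a: "\<alpha> \<in> contents r" and b: "\<beta> \<in> contents s" for \<alpha> \<beta>
  proof -
    obtain k where k: "pf \<alpha> \<beta> * (z * f) * pf \<alpha> \<beta> = k *s pf \<alpha> \<beta>" using pf_sandwich[OF a b B_Bf[OF z]] by auto
    have fp: "f * pf \<alpha> \<beta> = pf \<alpha> \<beta>"
      unfolding pf_def using Lf.H_u_left[OF _ LfI[OF a b]] by (simp add: mult.assoc[symmetric])
    have "pf \<alpha> \<beta> * (z * f) * pf \<alpha> \<beta> = z * (pf \<alpha> \<beta> * pf \<alpha> \<beta>)"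
      by (simp only: mult.assoc fp commute_mult_left[OF zc[OF pf_B[OF a b]]])
    then show ?thesis using k pf_pf[OF a b] by (intro exI[of _ k]) simp
  qed
  then obtain c where c: "\<And>\<alpha> \<beta>. \<alpha> \<in> contents r ==> \<beta> \<in> contents s ==> z * pf \<alpha> \<beta> = c \<alpha> \<beta> *s pf \<alpha> \<beta>" by metis
  \<comment> \<open>The scalar of z at some nonzero weight idempotent with joint eigenvalue
    \<omega>; by \<open>center_const\<close> every other choice gives the same value.\<close>
  define C where "C \<omega> = (case (SOME (\<alpha>, \<beta>). \<alpha> \<in> contents r \<and> \<beta> \<in> contents s \<and> val \<alpha> \<beta> = \<omega> \<and> pf \<alpha> \<beta> \<noteq> 0) of (\<alpha>, \<beta>) => c \<alpha> \<beta>)" for \<omega>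
  have C: "C (val \<alpha> \<beta>) *s pf \<alpha> \<beta> = c \<alpha> \<beta> *s pf \<alpha> \<beta>" if a: "\<alpha> \<in> contents r" and b: "\<beta> \<in> contents s" for \<alpha> \<beta>
  proof (cases "pf \<alpha> \<beta> = 0")
    case False
    let ?P = "\<lambda>(\<alpha>', \<beta>'). \<alpha>' \<in> contents r \<and> \<beta>' \<in> contents s \<and> val \<alpha>' \<beta>' = val \<alpha> \<beta> \<and> pf \<alpha>' \<beta>' \<noteq> 0"
    have "?P (SOME x. ?P x)" using a b False by (intro someI[of ?P "(\<alpha>, \<beta>)"]) auto
    then obtain \<alpha>' \<beta>' where s: "(SOME x. ?P x) = (\<alpha>', \<beta>')" "?P (\<alpha>', \<beta>')" by (cases "SOME x. ?P x") auto
    have "C (val \<alpha> \<beta>) = c \<alpha>' \<beta>'" unfolding C_def s(1) by simp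
    also have "\<dots> = c \<alpha> \<beta>" using center_const[OF z zc c a _ b _ _ False, of \<alpha>' \<beta>'] s(2) by auto
    finally show ?thesis by simp
  qed simp
  obtain cJ where cJ: "z * E = (\<Sum>\<nu>\<in>\<Omega>J. cJ \<nu> *s \<epsilon>J \<nu>)" using center_E[OF z zc] by auto
  \<comment> \<open>P is a central combination of Lagrange polynomials with P E = z E. So z - P
    kills the ideal, in particular u - f.\<close>
  define P where "P = (\<Sum>\<nu>\<in>\<Omega>J. cJ \<nu> *s lg \<nu>)"
  have PB: "P \<in> B" unfolding P_def by (intro B_sum B_scale lg_B)
  have Pc: "x * P = P * x" if "x \<in> B" for x
    unfolding P_def by (simp add: sum_distrib_left sum_distrib_right lg_central[OF that])
  have "P * E = z * E" unfolding P_def cJ sum_distrib_right by (rule sum.cong) (auto simp: lg_E)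
  then have "(z - P) * E = 0" by (simp add: left_diff_distrib)
  then have "(z - P) * (u - f) = 0"
    using J_kill[OF B_diff[OF z PB] _ _ u_f_J] zc Pc by (simp add: left_diff_distrib right_diff_distrib)
  then have zv: "z * (u - f) = (\<Sum>\<nu>\<in>\<Omega>J. cJ \<nu> *s ep \<nu>)"
    unfolding P_def by (simp add: left_diff_distrib sum_distrib_right ep_def)
  have zf: "z * f = (\<Sum>\<omega>\<in>vals. C \<omega> *s ep \<omega>)"
    unfolding F sum_pf[symmetric] sum_distrib_left by (intro sum.cong HOL.refl) (simp add: c C)
  have "z = z * f + z * (u - f)" using B_u_right[OF z] by (simp add: right_diff_distrib)
  also have "\<dots> = (\<Sum>\<omega>\<in>vals \<union> \<Omega>J. (if \<omega> \<in> \<Omega>J then cJ \<omega> else C \<omega>) *s ep \<omega>)"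
  proof -
    have "(\<Sum>\<omega>\<in>vals. C \<omega> *s ep \<omega>) = (\<Sum>\<omega>\<in>vals. (if \<omega> \<in> \<Omega>J then cJ \<omega> else C \<omega>) *s ep \<omega>)"
      using disj by (intro sum.cong) auto
    then show ?thesis unfolding zf zv split by simp
  qed
  finally show "\<exists>c. z = (\<Sum>\<omega>\<in>vals \<union> \<Omega>J. c \<omega> *s ep \<omega>)"
    by (rule exI[of _ "\<lambda>\<omega>. if \<omega> \<in> \<Omega>J then cJ \<omega> else C \<omega>"])
qed

end

section \<open>Power sums determine multisets\<close>

lemma sum_mset_single_support:
  fixes f :: "'a => 'k::comm_semiring_1"
  assumes "\<And>x. x \<in># M ==> x \<noteq> t ==> f x = 0"
  shows "(\<Sum>x\<in>#M. f x) = of_nat (count M t) * f t"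
  using assms by (induction M) (auto simp: algebra_simps)

text \<open>A polynomial that vanishes at all values except t turns equality of power sums into
  equality of the multiplicities of t. As the exponents start at 1 only nonzero values are seen, and
  characteristic zero recovers the multiplicity.\<close>

lemma psum_determines_mset:
  fixes M M' :: "'k::field multiset"
  assumes char: "inj (of_nat :: nat => 'k)"
    and nz: "0 \<notin># M" "0 \<notin># M'"
    and ps: "\<And>p. (\<Sum>x\<in>#M. x ^ Suc p) = (\<Sum>x\<in>#M'. x ^ Suc p)"
  shows "M = M'"
proof (rule multiset_eqI)
  fix t
  have poly: "(\<Sum>x\<in>#M. x ^ Suc k * poly P x) = (\<Sum>x\<in>#M'. x ^ Suc k * poly P x)" for P k
  proof (induction P arbitrary: k)
    case (pCons a P)
    have e: "x ^ Suc k * poly (pCons a P) x = a * x ^ Suc k + x ^ Suc (Suc k) * poly P x" for x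
      by (simp add: algebra_simps)
    show ?case unfolding e sum_mset.distrib sum_mset_distrib_left[symmetric] ps pCons(2) ..
  qed simp
  show "count M t = count M' t"
  proof (cases "t = 0")
    case True
    then show ?thesis using nz by (simp add: not_in_iff)
  next
    case False
    define A where "A = set_mset (M + M') - {t}"
    define P where "P = (\<Prod>y\<in>A. [:- y, 1:])"
    have P: "poly P x = (\<Prod>y\<in>A. x - y)" for x by (simp add: P_def poly_prod)
    have z: "x ^ Suc 0 * poly P x = 0" if "x \<in># M + M'" "x \<noteq> t" for x
      using that by (auto simp: P A_def)
    have pt: "poly P t \<noteq> 0" by (auto simp: P A_def)
    have "of_nat (count M t) * (t ^ Suc 0 * poly P t) = of_nat (count M' t) * (t ^ Suc 0 * poly P t)"
      using poly[of 0 P] sum_mset_single_support[of M t "\<lambda>x. x ^ Suc 0 * poly P x"]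
        sum_mset_single_support[of M' t "\<lambda>x. x ^ Suc 0 * poly P x"] z by force
    then have "(of_nat (count M t) :: 'k) = of_nat (count M' t)" using False pt by simp
    then show ?thesis by (rule injD[OF char])
  qed
qed

definition spsum :: "'k::field multiset => 'k multiset => nat => 'k" where
  "spsum A B p = (\<Sum>x\<in>#A. x ^ Suc p) - (\<Sum>x\<in>#B. x ^ Suc p)"

lemma spsum_inj:
  fixes A B :: "'k::field multiset"
  assumes char: "inj (of_nat :: nat => 'k)"
    and nz: "0 \<notin># A" "0 \<notin># B" "0 \<notin># A'" "0 \<notin># B'"
    and eq: "spsum A B = spsum A' B'"
  shows "A + B' = A' + B"
proof (rule psum_determines_mset[OF char])
  show "(\<Sum>x\<in>#A + B'. x ^ Suc p) = (\<Sum>x\<in>#A' + B. x ^ Suc p)" for p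
    using fun_cong[OF eq, of p] by (simp add: spsum_def algebra_simps)
qed (use nz in auto)

lemma disjoint_mset_cancel:
  assumes "A + B' = A' + B" "set_mset A \<inter> set_mset B = {}" "set_mset A' \<inter> set_mset B' = {}"
  shows "A = A'" "B = B'"
proof -
  show 1: "A = A'"
  proof (rule multiset_eqI)
    fix x
    have "count A x + count B' x = count A' x + count B x" using arg_cong[OF assms(1), of "\<lambda>M. count M x"] by simp
    moreover have "count A x = 0 \<or> count B x = 0" "count A' x = 0 \<or> count B' x = 0"
      using assms(2,3) by (auto simp: count_eq_zero_iff)
    ultimately show "count A x = count A' x" by auto
  qed
  show "B = B'" using assms(1) 1 by simp
qed

text \<open>Differences of power sums in reduced form. Reduced forms are unique, so the size of the
  positive part is an invariant: it is r for the values in \<open>vals\<close>, and at most r - 1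
  for those coming from the inner algebra.\<close>

definition svals :: "nat => (nat => 'k::field) set" where
  "svals n = {spsum A B | A B. 0 \<notin># A \<and> 0 \<notin># B \<and> set_mset A \<inter> set_mset B = {} \<and> size A \<le> n}"

section \<open>The centre for generic parameters\<close>

context walled
begin

lemma resolved_alg:
  assumes r: "resolved \<Omega> \<epsilon>" and z: "z \<in> B" "\<And>x. x \<in> B ==> x * z = z * x"
  shows "z \<in> alg (range (\<lambda>p. Z (Suc p))) u"
proof -
  have fin: "finite \<Omega>" and su: "(\<Sum>\<omega>\<in>\<Omega>. \<epsilon> \<omega>) = u" and ue: "\<And>\<omega>. \<omega> \<in> \<Omega> ==> u * \<epsilon> \<omega> = \<epsilon> \<omega>"
    and Ze: "\<And>\<omega> p. \<omega> \<in> \<Omega> ==> Z (Suc p) * \<epsilon> \<omega> = \<omega> p *s \<epsilon> \<omega>"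
    using r unfolding resolved_def by blast+
  obtain c where c: "z = (\<Sum>\<omega>\<in>\<Omega>. c \<omega> *s \<epsilon> \<omega>)" using r z unfolding resolved_def by blast
  obtain l where l: "set l = \<Omega>" using finite_list[OF fin] by blast
  let ?l = "\<lambda>\<omega>. lag (\<lambda>p. Z (Suc p)) u \<omega> l"
  have lu: "?l \<omega> * u = ?l \<omega>" for \<omega> using alg_unit_right[OF _ lag_alg] R.uu by blast
  have "?l \<omega> = \<epsilon> \<omega>" if "\<omega> \<in> \<Omega>" for \<omega>
  proof -
    have "?l \<omega> = (\<Sum>\<nu>\<in>\<Omega>. ?l \<omega> * \<epsilon> \<nu>)" using lu su by (simp only: sum_distrib_left[symmetric])
    also have "\<dots> = (\<Sum>\<nu>\<in>\<Omega>. if \<omega> = \<nu> then \<epsilon> \<nu> else 0)"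
      by (intro sum.cong HOL.refl lag_eigen) (auto simp: ue Ze l)
    finally show ?thesis using that fin by simp
  qed
  then have "\<epsilon> \<omega> \<in> alg (range (\<lambda>p. Z (Suc p))) u" if "\<omega> \<in> \<Omega>" for \<omega>
    using that lag_alg[of "\<lambda>p. Z (Suc p)" u \<omega> l] by simp
  then show ?thesis unfolding c by (intro alg_sum alg_scale)
qed

definition Aset where "Aset \<alpha> = mset (map L.qe \<alpha>)"
definition Bset where "Bset \<beta> = mset (map (\<lambda>b. \<rho> * \<rho> * R.qe b) \<beta>)"

lemma val_spsum: "val \<alpha> \<beta> = spsum (Aset \<alpha>) (Bset \<beta>)"
proof
  fix p
  have 1: "(\<Sum>x\<leftarrow>xs. h x ^ Suc p) = (\<Sum>x\<in>#mset (map h xs). x ^ Suc p)" for h and xs :: "int list"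
    by (induction xs) auto
  show "val \<alpha> \<beta> p = spsum (Aset \<alpha>) (Bset \<beta>) p"
    unfolding val_def spsum_def Aset_def Bset_def 1 ..
qed

lemma Aset_0: "0 \<notin># Aset \<alpha>" and Bset_0: "0 \<notin># Bset \<beta>"
  using rho0 by (auto simp: Aset_def Bset_def)

lemma Aset_inj: "Aset \<alpha> = Aset \<alpha>' ==> mset \<alpha> = mset \<alpha>'"
  unfolding Aset_def mset_map by (rule injD[OF multiset.inj_map[of L.qe]]) (auto simp: inj_def)

lemma Bset_inj: "Bset \<alpha> = Bset \<alpha>' ==> mset \<alpha> = mset \<alpha>'"
  unfolding Bset_def mset_map by (rule injD[OF multiset.inj_map]) (auto simp: inj_def rho0)

lemma Lqe: "L.qe a = R.qe (- a)"
  by (simp add: L.qe_def R.qe_def power_int_minus power_inverse power_int_inverse)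

text \<open>An eigenvalue common to both sides gives \<rho>^2 q^(2(a + b)) = 1 for contents a of
  \<alpha> and b of \<beta>, and |a + b| \<le> r + s - 2.\<close>

lemma Aset_Bset_disjoint:
  assumes G: "\<forall>m::int. \<bar>m\<bar> < int r + int s - 1 \<longrightarrow> \<rho> * \<rho> * R.qe m \<noteq> 1"
    and c: "\<alpha> \<in> contents r" "\<beta> \<in> contents s"
  shows "set_mset (Aset \<alpha>) \<inter> set_mset (Bset \<beta>) = {}"
proof (rule ccontr)
  assume "\<not> ?thesis"
  then obtain a b where ab: "a \<in> set \<alpha>" "b \<in> set \<beta>" "L.qe a = \<rho> * \<rho> * R.qe b"
    by (auto simp: Aset_def Bset_def)
  have "\<bar>a\<bar> < int r" "\<bar>b\<bar> < int s" using content_list_bound[of \<alpha> a] content_list_bound[of \<beta> b] ab c by (auto simp: contents_def)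
  then have "\<bar>a + b\<bar> < int r + int s - 1" by linarith
  moreover have "\<rho> * \<rho> * R.qe (a + b) = R.qe a * L.qe a" using ab(3) by (simp add: R.qe_add mult_ac)
  then have "\<rho> * \<rho> * R.qe (a + b) = 1" unfolding Lqe R.qe_add[symmetric] by simp
  ultimately show False using G by blast
qed

lemma vals_disjoint_parts:
  assumes char: "inj (of_nat :: nat => 'k)"
    and G: "\<forall>m::int. \<bar>m\<bar> < int r + int s - 1 \<longrightarrow> \<rho> * \<rho> * R.qe m \<noteq> 1"
  shows "vals \<subseteq> svals r"
    and "\<And>\<alpha> \<alpha>' \<beta> \<beta>'. \<alpha> \<in> contents r ==> \<alpha>' \<in> contents r ==> \<beta> \<in> contents s ==> \<beta>' \<in> contents s ==>
      val \<alpha> \<beta> = val \<alpha>' \<beta>' ==> mset \<alpha> = mset \<alpha>' \<and> mset \<beta> = mset \<beta>'"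
    and "0 < r ==> svals (r - 1) \<inter> vals = {}"
proof -
  note dj = Aset_Bset_disjoint[OF G]
  have sz: "size (Aset \<alpha>) = r" if "\<alpha> \<in> contents r" for \<alpha> using that by (simp add: Aset_def contents_def)
  show "vals \<subseteq> svals r"
    unfolding vals_def svals_def val_spsum using dj sz Aset_0 Bset_0 by fastforce
  show "mset \<alpha> = mset \<alpha>' \<and> mset \<beta> = mset \<beta>'"
    if "\<alpha> \<in> contents r" "\<alpha>' \<in> contents r" "\<beta> \<in> contents s" "\<beta>' \<in> contents s" "val \<alpha> \<beta> = val \<alpha>' \<beta>'" for \<alpha> \<alpha>' \<beta> \<beta>'
  proof -
    have "Aset \<alpha> + Bset \<beta>' = Aset \<alpha>' + Bset \<beta>"
      using spsum_inj[OF char Aset_0 Bset_0 Aset_0 Bset_0] that(5) unfolding val_spsum by blast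
    from disjoint_mset_cancel[OF this] dj that have "Aset \<alpha> = Aset \<alpha>'" "Bset \<beta> = Bset \<beta>'" by auto
    then show ?thesis using Aset_inj Bset_inj by blast
  qed
  show "svals (r - 1) \<inter> vals = {}" if r: "0 < r"
  proof (rule ccontr)
    assume "\<not> ?thesis"
    then obtain \<omega> where o: "\<omega> \<in> svals (r - 1)" "\<omega> \<in> vals" by blast
    obtain A B where AB: "0 \<notin># A" "0 \<notin># B" "set_mset A \<inter> set_mset B = {}" "size A \<le> r - 1" "\<omega> = spsum A B"
      using o(1) unfolding svals_def by blast
    obtain \<alpha> \<beta> where ab: "\<alpha> \<in> contents r" "\<beta> \<in> contents s" "\<omega> = val \<alpha> \<beta>" using o(2) by (auto simp: vals_def)
    note h0 = AB(1-4) ab(1,2) AB(5)[symmetric, unfolded ab(3)]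
    have h: "0 \<notin># A" "0 \<notin># B" "set_mset A \<inter> set_mset B = {}" "size A \<le> r - 1"
      "\<alpha> \<in> contents r" "\<beta> \<in> contents s" "spsum A B = val \<alpha> \<beta>"
      using h0 by blast+
    have "A + Bset \<beta> = Aset \<alpha> + B"
      using spsum_inj[OF char h(1,2) Aset_0 Bset_0] h(7) unfolding val_spsum by blast
    from disjoint_mset_cancel(1)[OF this h(3) dj[OF h(5,6)]] have "A = Aset \<alpha>" .
    then show False using sz[OF h(5)] h(4) r by simp
  qed
qed

end

text \<open>The inner algebra has another unit, other generators and fewer strands on both sides, so
  all of these vary in the induction. The claim \<Omega> \<subseteq> \<open>svals r\<close> is
  carried along because it makes the spectrum of the ideal disjoint from that of the quotient at the
  next stage.\<close>

theorem generic_resolved: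
  fixes scale :: "'k::field => 'b::ring_1 => 'b" (infixr "*s" 75) and u E :: 'b
  assumes char: "inj (of_nat :: nat => 'k)"
  shows "walled scale u q \<rho> r s g T E ==>
    \<forall>m::int. \<bar>m\<bar> < int r + int s - 1 \<longrightarrow> \<rho> * \<rho> * power_int (q ^ 2) m \<noteq> 1 ==>
    \<exists>\<Omega> \<epsilon>. walled.resolved scale u q \<rho> r s g T E \<Omega> \<epsilon> \<and> \<Omega> \<subseteq> svals r"
proof (induction r arbitrary: u s g T E)
  case 0
  interpret walled scale u q \<rho> 0 s g T E by (rule 0)
  have G: "\<forall>m::int. \<bar>m\<bar> < int 0 + int s - 1 \<longrightarrow> \<rho> * \<rho> * R.qe m \<noteq> 1" using 0(2) by (simp add: R.qe_def)
  note vd = vals_disjoint_parts[OF char G]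
  interpret walled_split scale u q \<rho> 0 s g T E "{}" "\<lambda>_. 0"
  proof unfold_locales
    show "finite {}" by simp
    show "(\<Sum>\<nu>\<in>{}. 0) = E" using E0 by simp
    show "\<exists>c. z * E = (\<Sum>\<nu>\<in>{}. c \<nu> *s 0)" for z using E0 by simp
    show "{} \<inter> vals = {}" by simp
  qed (rule vd(2) | simp)+
  show ?case using resolved_ep vd(1) by (intro exI[of _ vals] exI[of _ ep]) auto
next
  case (Suc r')
  interpret walled scale u q \<rho> "Suc r'" s g T E by (rule Suc)
  have G: "\<forall>m::int. \<bar>m\<bar> < int (Suc r') + int s - 1 \<longrightarrow> \<rho> * \<rho> * R.qe m \<noteq> 1"
    using Suc.prems(2) by (simp add: R.qe_def)
  note vd = vals_disjoint_parts[OF char G]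
  show ?case
  proof (cases s)
    case 0
    interpret walled_split scale u q \<rho> "Suc r'" s g T E "{}" "\<lambda>_. 0"
  proof unfold_locales
    show "finite {}" by simp
    show "(\<Sum>\<nu>\<in>{}. 0) = E" using E0 0 by simp
    show "\<exists>c. z * E = (\<Sum>\<nu>\<in>{}. c \<nu> *s 0)" for z using E0 0 by simp
    show "{} \<inter> vals = {}" by simp
  qed (rule vd(2) | simp)+
    show ?thesis using resolved_ep vd(1) by (intro exI[of _ vals] exI[of _ ep]) auto
  next
    case s: (Suc s')
    \<comment> \<open>The case m = 0 of the genericity condition is what makes \<delta> nonzero, so
      that E can be normalised to an idempotent.\<close>
    have "\<rho> * \<rho> \<noteq> 1" using G[rule_format, of 0] s by simp
    then have "\<rho> - inverse \<rho> \<noteq> 0" using rho0 by (metis eq_iff_diff_eq_0 right_inverse)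
    then have d0: "dl \<noteq> 0" using z_delta R.z0 by auto
    interpret walled_inner scale u q \<rho> "Suc r'" s g T E r' s'
      by unfold_locales (use d0 s in auto)
    have "\<exists>\<Omega> \<epsilon>. I.resolved \<Omega> \<epsilon> \<and> \<Omega> \<subseteq> svals r'"
    proof (rule Suc.IH)
      show "walled scale e q \<rho> r' s' (\<lambda>k. g k * e) (\<lambda>k. T (Suc k) * e) E'" by (rule I.walled_axioms)
      show "\<forall>m::int. \<bar>m\<bar> < int r' + int s' - 1 \<longrightarrow> \<rho> * \<rho> * power_int (q ^ 2) m \<noteq> 1"
        using Suc.prems(2) s by simp
    qed
    then obtain \<Omega> \<epsilon> where O: "I.resolved \<Omega> \<epsilon>" "\<Omega> \<subseteq> svals r'" by blast
    have fin: "finite \<Omega>" and su: "(\<Sum>\<omega>\<in>\<Omega>. \<epsilon> \<omega>) = e" and ue: "\<And>\<omega>. \<omega> \<in> \<Omega> ==> e * \<epsilon> \<omega> = \<epsilon> \<omega>"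
      and Ze: "\<And>\<omega> p. \<omega> \<in> \<Omega> ==> I.Z (Suc p) * \<epsilon> \<omega> = \<omega> p *s \<epsilon> \<omega>"
      and ce: "\<And>z. z \<in> I.B ==> (\<And>x. x \<in> I.B ==> x * z = z * x) ==> \<exists>c. z = (\<Sum>\<omega>\<in>\<Omega>. c \<omega> *s \<epsilon> \<omega>)"
      using O(1) unfolding I.resolved_def by blast+
    interpret walled_split scale u q \<rho> "Suc r'" s g T E \<Omega> "\<lambda>\<omega>. dl *s \<epsilon> \<omega>"
    proof unfold_locales
      show "finite \<Omega>" by (rule fin)
      show "(\<Sum>\<nu>\<in>\<Omega>. dl *s \<epsilon> \<nu>) = E" unfolding scale_sum_right[symmetric] su by (rule E_e[symmetric])
      show "u * (dl *s \<epsilon> \<nu>) = dl *s \<epsilon> \<nu>" if "\<nu> \<in> \<Omega>" for \<nu>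
      proof -
        have "u * \<epsilon> \<nu> = u * (e * \<epsilon> \<nu>)" using ue[OF that] by simp
        also have "\<dots> = (u * e) * \<epsilon> \<nu>" by (simp only: mult.assoc)
        finally show ?thesis using ue[OF that] ue by (simp only: mult_scale_right) (simp add: walled_inner.ue[OF walled_inner_axioms])
      qed
      show "Z (Suc p) * (dl *s \<epsilon> \<nu>) = \<nu> p *s dl *s \<epsilon> \<nu>" if "\<nu> \<in> \<Omega>" for \<nu> p
      proof -
        have "Z (Suc p) * \<epsilon> \<nu> = Z (Suc p) * (e * \<epsilon> \<nu>)" using ue[OF that] by simp
        also have "\<dots> = I.Z (Suc p) * \<epsilon> \<nu>"
          unfolding IZ[OF zero_less_Suc] Z_central[OF zero_less_Suc e_B] by (simp only: mult.assoc)
        also have "\<dots> = \<nu> p *s \<epsilon> \<nu>" using Ze[OF that] .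
        finally have "Z (Suc p) * \<epsilon> \<nu> = \<nu> p *s \<epsilon> \<nu>" .
        then show ?thesis by (simp only: mult_scale_right) (rule scale_left_commute)
      qed
      show "\<exists>c. z * E = (\<Sum>\<nu>\<in>\<Omega>. c \<nu> *s dl *s \<epsilon> \<nu>)" if z: "z \<in> B" "\<And>x. x \<in> B ==> x * z = z * x" for z
      proof -
        have ez: "e * (z * e) = z * e"
        proof -
          have "e * (z * e) = (z * e) * e" using z(2)[OF e_B] by (simp only: mult.assoc[symmetric])
          then show ?thesis by (simp only: mult.assoc ee)
        qed
        have zI: "z * e \<in> I.B" using corner_IB[OF z(1)] ez by simp
        have "x * (z * e) = z * e * x" if x: "x \<in> I.B" for x
        proof -
          have "x * (z * e) = z * (x * e)" using z(2)[OF I_B_sub[OF x]] by (simp only: mult.assoc[symmetric])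
          also have "\<dots> = z * (e * x)" using I.B_u_left[OF x] I.B_u_right[OF x] by simp
          finally show ?thesis by (simp only: mult.assoc)
        qed
        then obtain c where c: "z * e = (\<Sum>\<omega>\<in>\<Omega>. c \<omega> *s \<epsilon> \<omega>)" using ce[OF zI] by blast
        have "z * E = dl *s (z * e)" unfolding e_def using d0 by simp
        also have "\<dots> = (\<Sum>\<nu>\<in>\<Omega>. c \<nu> *s dl *s \<epsilon> \<nu>)"
          unfolding c scale_sum_right by (intro sum.cong HOL.refl scale_left_commute)
        finally show ?thesis by blast
      qed
      show "\<Omega> \<inter> vals = {}" using vd(3) O(2) by auto
    qed (rule vd(2))
    have "svals r' \<subseteq> (svals (Suc r') :: (nat => 'k) set)" unfolding svals_def by fastforce
    then show ?thesis using resolved_ep vd(1) O(2) by (intro exI[of _ "vals \<union> \<Omega>"] exI[of _ ep]) auto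
  qed
qed

section \<open>Semisimple cases with vanishing parameter\<close>

lemma contents_2: "contents 2 = {[1, 0], [-1, 0]}"
proof -
  have "a = 1 \<or> a = - 1" if "addable [0] a" for a
    using that by (auto simp: addable_def split: if_splits)
  moreover have "addable [0] 1" "addable [0] (-1)" by (auto simp: addable_def)
  ultimately have "{a. addable [0] a} = {1, -1}" by blast
  then show ?thesis by (simp add: numeral_2_eq_2 contents_Suc[of "Suc 0"] contents_1) auto
qed

lemma contents_short_inj:
  assumes "m = 1 \<or> m = 2" "\<alpha> \<in> contents m" "\<beta> \<in> contents m" "mset \<alpha> = mset \<beta>"
  shows "\<alpha> = \<beta>"
proof -
  have "set \<alpha> = set \<beta>" using assms(4) by (metis set_mset_mset)
  then show ?thesis using assms(1-3) contents_1 by (auto simp: contents_2 doubleton_eq_iff)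
qed

lemma zero_in_content_list: "content_list \<alpha> ==> \<alpha> \<noteq> [] ==> 0 \<in> set \<alpha>"
proof (induction \<alpha>)
  case (Cons a \<eta>)
  then show ?case by (cases "\<eta> = []") (auto simp: addable_def split: if_splits)
qed simp

text \<open>A second box of content 0 needs 0, 1 and -1 before it, hence at least four
  boxes.\<close>

lemma two_zeros_long:
  assumes "content_list \<alpha>" "length \<alpha> \<le> 3"
  shows "count (mset \<alpha>) 0 \<le> 1"
  using assms
proof (induction \<alpha>)
  case (Cons a \<eta>)
  show ?case
  proof (cases "a = 0 \<and> 0 \<in> set \<eta>")
    case True
    then have "1 \<in> set (takeWhile (\<lambda>x. x \<noteq> 0) \<eta>)" "-1 \<in> set (takeWhile (\<lambda>x. x \<noteq> 0) \<eta>)"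
      using Cons.prems by (auto simp: addable_def)
    then have "{0, 1, - 1} \<subseteq> set \<eta>" using True by (auto dest: set_takeWhileD)
    then have "card {0, 1, - 1 :: int} \<le> card (set \<eta>)" by (intro card_mono) auto
    then have "3 \<le> length \<eta>" using card_length[of \<eta>] by simp
    then show ?thesis using Cons.prems by simp
  next
    case False
    then show ?thesis using Cons by (auto simp: count_eq_zero_iff)
  qed
qed simp

lemma content_list_no_extra_zero:
  assumes "content_list \<alpha>" "length \<alpha> \<le> 3" "content_list \<beta>" "\<beta> \<noteq> []"
  shows "mset \<alpha> \<noteq> add_mset 0 (mset \<beta>)"
proof
  assume "mset \<alpha> = add_mset 0 (mset \<beta>)"
  moreover have "count (mset \<beta>) 0 \<noteq> 0" using zero_in_content_list[OF assms(3,4)] by (simp add: count_eq_zero_iff)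
  ultimately show False using two_zeros_long[OF assms(1,2)] by simp
qed

context hecke
begin

text \<open>With at most two strands the Hecke algebra is commutative, so h acts on the idempotent
  through the one-dimensional corner.\<close>

lemma idem_short_eigen:
  assumes m: "m = 1 \<or> m = 2" "m \<le> n" and h: "h \<in> H m" and \<alpha>: "\<alpha> \<in> contents m"
  shows "\<exists>k. h * idem m \<alpha> = k *s idem m \<alpha>"
proof -
  have com: "x * y = y * x" if "x \<in> H m" "y \<in> H m" for x y
  proof -
    have s: "S k * S j = S j * S k" if "Suc k < m" "Suc j < m" for k j using that m by (auto simp: less_Suc_eq numeral_2_eq_2)
    have yS: "S k * y = y * S k" if k: "Suc k < m" for k
      by (rule H_commute[where m = m, symmetric]) (use s k m \<open>y \<in> H m\<close> in auto)
    show ?thesis by (rule H_commute[where m = m]) (use that m H_u_left H_u_right yS in auto)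
  qed
  note d = decomp_idem[OF m(2)]
  have e: "idem m \<alpha> \<in> H m" using decomp_H[OF d \<alpha>] .
  have ee: "idem m \<alpha> * idem m \<alpha> = idem m \<alpha>" using decomp_proj[OF d decomp_wt[OF d \<alpha>] \<alpha>] .
  obtain k where k: "idem m \<alpha> * h * idem m \<alpha> = k *s idem m \<alpha>" using idem_H_idem[OF m(2) \<alpha> h] by auto
  have "h * idem m \<alpha> = h * (idem m \<alpha> * idem m \<alpha>)" by (simp only: ee)
  also have "\<dots> = idem m \<alpha> * h * idem m \<alpha>" using com[OF h e] by (simp only: mult.assoc[symmetric])
  finally show ?thesis using k by auto
qed

end

context walled
begin

text \<open>A substitute for the corner of E that also works for \<delta> = 0. With E G E = c E one
  has c z E = z E G E = E (z G) E; the left ideal B E is H E, and E H E lies in H' E for the Hecke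
  subalgebra H' that commutes with E.\<close>

lemma center_E_hecke:
  assumes K: "hecke scale u p G n" and n: "2 \<le> n" and c: "c \<noteq> 0" "E * (G (n - 2) * E) = c *s E"
    and EG: "\<And>k. Suc (Suc k) < n ==> E * G k = G k * E"
    and B: "B = alg (G ` {k. Suc k < n} \<union> {E}) u" and z: "z \<in> B" "\<And>x. x \<in> B ==> x * z = z * x"
  shows "\<exists>h\<in>alg (G ` {k. Suc (Suc k) < n}) u. z * E = h * E"
proof -
  interpret K: hecke scale u p G n by (rule K)
  have H1: "K.H (n - 1) = alg (G ` {k. Suc (Suc k) < n}) u"
    unfolding K.H_def by (intro arg_cong[where f = "\<lambda>A. alg (G ` A) u"]) auto
  have n2: "n - 1 - 1 = n - 2" by simp
  have com: "E * x = x * E" if "x \<in> K.H (n - 1)" for x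
    by (rule K.H_commute[where m = "n - 1", symmetric]) (use that EG in auto)
  have EHE: "\<exists>h'\<in>K.H (n - 1). E * (h * E) = h' * E" if h: "h \<in> K.H n" for h
  proof -
    have "h \<in> K.two_cosets (n - 1)" using K.H_two_cosets[of "n - 1" h] h n by simp
    then show ?thesis
    proof (induction rule: K.two_cosets.induct)
      case (base c')
      have "E * (c' * E) = (dl *s c') * E" using com[OF base] EE by (simp add: mult.assoc[symmetric]) (simp add: mult.assoc)
      then show ?case using K.H_scale[OF base] by blast
    next
      case (mid a b)
      have "E * (a * (G (n - 1 - 1) * b) * E) = a * ((E * (G (n - 2) * E)) * b)"
        by (simp only: n2 mult.assoc commute_mult_left[OF com[OF mid(1)]] com[OF mid(2)])
      also have "\<dots> = c *s (a * (E * b))" using c by simp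
      also have "\<dots> = (c *s (a * b)) * E" using com[OF mid(2)] by (simp add: mult.assoc)
      finally show ?case using K.H_scale[OF K.H_mult[OF _ mid(1,2)], of c]
        by (intro bexI[of _ "c *s (a * b)"]) simp_all
    next
      case (add x y)
      then obtain h h' where "h \<in> K.H (n - 1)" "h' \<in> K.H (n - 1)" "E * (x * E) = h * E" "E * (y * E) = h' * E" by auto
      then show ?case by (intro bexI[of _ "h + h'"]) (auto simp: distrib_left distrib_right K.H_def alg_add)
    qed
  qed
  have BE: "\<exists>h\<in>K.H n. x * E = h * E" if "x \<in> B" for x
    using that unfolding B
  proof (induction rule: alg.induct)
    case alg_unit
    then show ?case by (intro bexI[of _ u]) (simp_all add: K.H_u)
  next
    case (alg_add x y)
    then obtain h h' where "h \<in> K.H n" "h' \<in> K.H n" "x * E = h * E" "y * E = h' * E" by auto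
    then show ?case by (intro bexI[of _ "h + h'"]) (auto simp: distrib_right K.H_def alg.alg_add)
  next
    case (alg_scale x a)
    then obtain h where "h \<in> K.H n" "x * E = h * E" by auto
    then show ?case by (intro bexI[of _ "a *s h"]) (auto intro: K.H_scale)
  next
    case (alg_gen t x)
    then obtain h where h: "h \<in> K.H n" "x * E = h * E" by auto
    consider k where "t = G k" "Suc k < n" | "t = E" using alg_gen(1) by auto
    then show ?case
    proof cases
      case 1
      then have "G k * h \<in> K.H n" using h K.H_mult K.H_S[of k n] by blast
      then show ?thesis using h(2) 1(1) by (intro bexI[of _ "G k * h"]) (simp_all add: mult.assoc)
    next
      case 2
      obtain h' where "h' \<in> K.H (n - 1)" "E * (h * E) = h' * E" using EHE[OF h(1)] by auto
      then show ?thesis using h(2) 2 K.H_mono[of "n - 1" n h'] by (intro bexI[of _ h']) (simp_all add: mult.assoc)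
    qed
  qed
  have "G (n - 2) \<in> B" unfolding B by (rule alg_genI) (use n in auto)
  then obtain h where h: "h \<in> K.H n" "z * G (n - 2) * E = h * E" using BE[OF B_mult[OF z(1)]] by blast
  obtain h' where h': "h' \<in> K.H (n - 1)" "E * (h * E) = h' * E" using EHE[OF h(1)] by auto
  have "c *s (z * E) = z * (E * (G (n - 2) * E))" using c by simp
  also have "\<dots> = E * (z * G (n - 2) * E)" using z(2)[OF B_E] by (simp only: mult.assoc[symmetric])
  finally have "c *s (z * E) = h' * E" using h h' by simp
  then have "z * E = (inverse c *s h') * E" using c(1) by (metis mult_scale_left scale_one scale_scale left_inverse)
  then show ?thesis using K.H_scale[OF h'(1)] unfolding H1 by blast
qed

text \<open>Provides the data of \<open>walled_split\<close> from weight idempotents f \<beta> of a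
  Hecke subalgebra, with f \<beta> E as components of E. The set A holds the elements by which
  central elements act on E.\<close>

lemma resolved_by_weights:
  assumes sum: "(\<Sum>\<beta>\<in>contents m. f \<beta>) = u" and ue: "\<And>\<beta>. \<beta> \<in> contents m ==> u * f \<beta> = f \<beta>"
    and Ze: "\<And>\<beta> p. \<beta> \<in> contents m ==> Z (Suc p) * (f \<beta> * E) = \<omega> \<beta> p *s (f \<beta> * E)"
    and cen: "\<And>z. z \<in> B ==> (\<And>x. x \<in> B ==> x * z = z * x) ==> \<exists>x\<in>A. z * E = x * E"
    and eig: "\<And>x \<beta>. x \<in> A ==> \<beta> \<in> contents m ==> \<exists>k. x * f \<beta> = k *s f \<beta>"
    and winj: "inj_on \<omega> (contents m)" and disj: "\<omega> ` contents m \<inter> vals = {}"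
    and sep: "\<And>\<alpha> \<alpha>' \<beta> \<beta>'. \<alpha> \<in> contents r ==> \<alpha>' \<in> contents r ==> \<beta> \<in> contents s ==> \<beta>' \<in> contents s ==>
      val \<alpha> \<beta> = val \<alpha>' \<beta>' ==> mset \<alpha> = mset \<alpha>' \<and> mset \<beta> = mset \<beta>'"
  shows "\<exists>\<Omega> \<epsilon>. resolved \<Omega> \<epsilon>"
proof -
  let ?i = "inv_into (contents m) \<omega>"
  define \<epsilon> where "\<epsilon> w = f (?i w) * E" for w
  have \<epsilon>: "\<epsilon> (\<omega> \<beta>) = f \<beta> * E" if "\<beta> \<in> contents m" for \<beta> using winj that by (simp add: \<epsilon>_def)
  have sumw: "(\<Sum>w\<in>\<omega> ` contents m. c (?i w) *s \<epsilon> w) = (\<Sum>\<beta>\<in>contents m. c \<beta> *s (f \<beta> * E))" for c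
    using winj by (subst sum.reindex) (auto simp: \<epsilon>)
  interpret walled_split scale u q \<rho> r s g T E "\<omega> ` contents m" \<epsilon>
  proof unfold_locales
    show "finite (\<omega> ` contents m)" by simp
    show "(\<Sum>\<nu>\<in>\<omega> ` contents m. \<epsilon> \<nu>) = E"
      using sumw[of "\<lambda>_. 1"] sum by (simp add: sum_distrib_right[symmetric])
    show "u * \<epsilon> \<nu> = \<epsilon> \<nu>" if "\<nu> \<in> \<omega> ` contents m" for \<nu>
      using that ue by (auto simp: \<epsilon> mult.assoc[symmetric])
    show "Z (Suc p) * \<epsilon> \<nu> = \<nu> p *s \<epsilon> \<nu>" if "\<nu> \<in> \<omega> ` contents m" for \<nu> p
      using that Ze by (auto simp: \<epsilon>)
    show "\<exists>c. z * E = (\<Sum>\<nu>\<in>\<omega> ` contents m. c \<nu> *s \<epsilon> \<nu>)" if z: "z \<in> B" "\<And>x. x \<in> B ==> x * z = z * x" for z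
    proof -
      obtain x where x: "x \<in> A" "z * E = x * E" using cen[OF z] by blast
      obtain k where k: "\<And>\<beta>. \<beta> \<in> contents m ==> x * f \<beta> = k \<beta> *s f \<beta>" using eig[OF x(1)] by metis
      have "z * E = x * ((\<Sum>\<beta>\<in>contents m. f \<beta>) * E)" using x sum by simp
      also have "\<dots> = (\<Sum>\<beta>\<in>contents m. k \<beta> *s (f \<beta> * E))"
        unfolding sum_distrib_right sum_distrib_left
        by (intro sum.cong HOL.refl) (simp add: k mult.assoc[symmetric])
      also have "\<dots> = (\<Sum>\<nu>\<in>\<omega> ` contents m. k (?i \<nu>) *s \<epsilon> \<nu>)" by (rule sumw[symmetric])
      finally show ?thesis by (rule exI[of _ "\<lambda>\<nu>. k (?i \<nu>)"])
    qed
  qed (use disj sep in blast)+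
  show ?thesis using resolved_ep by blast
qed

lemma sum_list_power_mset: "(\<Sum>x\<leftarrow>xs. f x ^ p) = (\<Sum>x\<in>#mset (map f xs). x ^ p)" for f :: "int => 'k"
  by (induction xs) auto

text \<open>Here \<delta> = 0. For r = 1 there are no inner arcs and \<rho>^2 = 1, so on E the
  elements \<open>Y (Suc k)\<close> act as the Jucys-Murphy elements of the Hecke algebra on the
  strands away from the wall, whose weights resolve E.\<close>

lemma exceptional_right:
  assumes char: "inj (of_nat :: nat => 'k)" and r: "r = 1" and s: "s = 2 \<or> s = 3" and rho: "\<rho> * \<rho> = 1"
  shows "\<exists>\<Omega> \<epsilon>. resolved \<Omega> \<epsilon>"
proof -
  define s' where "s' = s - 1"
  have s': "s' = 1 \<or> s' = 2" "s = Suc s'" "2 \<le> s" using s by (auto simp: s'_def)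
  interpret Rs: hecke scale u q "\<lambda>k. T (Suc k)" s' unfolding s'_def by (rule R.hecke_shift)
  note dR = Rs.decomp_idem[OF order.refl]
  have ET': "x * E = E * x" if "x \<in> Rs.H s'" for x
    by (rule Rs.H_commute[where m = s']) (use that ET s' in auto)
  have YE: "k < s' ==> Y (Suc k) * E = Rs.X k * E" for k
  proof (induction k)
    case 0
    show ?case using Y1_E[OF s'(3)] r rho by simp
  next
    case (Suc k)
    have c: "T (Suc k) * E = E * T (Suc k)" using ET[of k] Suc.prems s' by simp
    have "Y (Suc (Suc k)) * E = T (Suc k) * ((Y (Suc k) * E) * T (Suc k))"
      by (simp only: Y.simps(2)[of "Suc k"] c mult.assoc)
    also have "\<dots> = T (Suc k) * (Rs.X k * (E * T (Suc k)))" using Suc by (simp add: mult.assoc)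
    also have "\<dots> = Rs.X (Suc k) * E" by (simp only: c[symmetric] Rs.X.simps mult.assoc)
    finally show ?case .
  qed
  define h where "h \<beta> = Rs.idem s' \<beta> * E" for \<beta>
  define \<omega> where "\<omega> \<beta> = spsum {#} (Bset \<beta>)" for \<beta>
  have Yh: "Y (Suc k) * h \<beta> = Rs.X k * h \<beta>" if "k < s'" "\<beta> \<in> contents s'" for k \<beta>
  proof -
    have c: "Rs.idem s' \<beta> * E = E * Rs.idem s' \<beta>" using ET'[OF Rs.decomp_H[OF dR that(2)]] .
    have "Y (Suc k) * h \<beta> = (Y (Suc k) * E) * Rs.idem s' \<beta>" by (simp only: h_def c mult.assoc)
    also have "\<dots> = Rs.X k * h \<beta>" using YE[OF that(1)] by (simp only: h_def c mult.assoc)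
    finally show ?thesis .
  qed
  have Zh: "Z (Suc p) * h \<beta> = \<omega> \<beta> p *s h \<beta>" if b: "\<beta> \<in> contents s'" for p \<beta>
  proof -
    have w: "Rs.wt \<beta> (h \<beta>)" unfolding h_def using Rs.decomp_wt[OF dR b] by (rule Rs.wt_mult)
    have c: "Rs.idem s' \<beta> * E = E * Rs.idem s' \<beta>" using ET'[OF Rs.decomp_H[OF dR b]] .
    have pw: "Y (Suc k) ^ p * h \<beta> = Rs.X k ^ p * h \<beta>" if k: "k < s'" for k p
    proof (induction p)
      case (Suc p)
      have yx: "Y (Suc k) * (Rs.X k ^ p * h \<beta>) = Rs.X k ^ p * (Y (Suc k) * h \<beta>)"
      proof -
        obtain c where c: "Rs.X k * h \<beta> = c *s h \<beta>"
        proof -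
          have "Rs.wt \<gamma> v ==> k < length \<gamma> ==> \<exists>c. Rs.X k * v = c *s v" for \<gamma> v
          proof (induction \<gamma>)
            case (Cons a \<gamma>)
            then show ?case by (cases "k = length \<gamma>") auto
          qed simp
          then show ?thesis using that w k b by (auto simp: contents_def)
        qed
        have cp: "Rs.X k ^ p * h \<beta> = c ^ p *s h \<beta>" for p
          by (induction p) (auto simp: mult.assoc c mult.commute)
        show ?thesis using Yh[OF k b] by (simp add: cp c)
      qed
      have "Y (Suc k) ^ Suc p * h \<beta> = Y (Suc k) * (Rs.X k ^ p * h \<beta>)" using Suc by (simp add: mult.assoc)
      also have "\<dots> = Rs.X k ^ p * (Rs.X k * h \<beta>)" using yx Yh[OF k b] by simp
      also have "\<dots> = Rs.X k ^ Suc p * h \<beta>" by (simp only: power_Suc2 mult.assoc)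
      finally show ?case .
    qed simp
    have "Z (Suc p) * h \<beta> = (Z (Suc p) * E) * Rs.idem s' \<beta>" by (simp only: h_def c mult.assoc)
    also have "\<dots> = - (\<Sum>j<s'. Y (Suc j) ^ Suc p) * h \<beta>"
      using E_Z(2)[of "Suc p"] r s' by (simp add: h_def c mult.assoc)
    also have "\<dots> = - ((\<Sum>j<length \<beta>. Rs.X j ^ Suc p) * h \<beta>)"
      using pw b by (simp add: sum_distrib_right contents_def del: power_Suc)
    also have "\<dots> = - ((\<Sum>a\<leftarrow>\<beta>. Rs.qe a ^ Suc p) *s h \<beta>)" using Rs.psum_wt[OF w, of "Suc p"] by simp
    also have "\<dots> = \<omega> \<beta> p *s h \<beta>"
      by (simp add: sum_list_power_mset \<omega>_def spsum_def Bset_def rho Rs.qe_def R.qe_def del: power_Suc)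
    finally show ?thesis .
  qed
  have winj: "\<beta> = \<beta>'" if "\<beta> \<in> contents s'" "\<beta>' \<in> contents s'" "\<omega> \<beta> = \<omega> \<beta>'" for \<beta> \<beta>'
  proof -
    have "{#} + Bset \<beta>' = {#} + Bset \<beta>"
      by (rule spsum_inj[OF char _ Bset_0 _ Bset_0]) (use that(3) in \<open>auto simp: \<omega>_def\<close>)
    then have "Bset \<beta> = Bset \<beta>'" by simp
    from contents_short_inj[OF s'(1) that(1,2) Bset_inj[OF this]] show ?thesis .
  qed
  have "Tr ` {k. Suc (Suc k) < s} \<subseteq> (\<lambda>k. T (Suc k)) ` {k. Suc k < s'}"
  proof safe
    fix k assume k: "Suc (Suc k) < s"
    then have "s - 2 - k = Suc (s - 3 - k)" "Suc (s - 3 - k) < s'" using s' by arith+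
    then show "Tr k \<in> (\<lambda>k. T (Suc k)) ` {k. Suc k < s'}" by (auto simp: Tr_def)
  qed
  note sub = alg_mono[OF this, of _ u, folded Rs.H_def]
  have "g ` {k. Suc k < r} \<union> T ` {k. Suc k < s} \<union> {E} = Tr ` {k. Suc k < s} \<union> {E}"
  proof -
    have "T k \<in> Tr ` {k. Suc k < s}" if "Suc k < s" for k
    proof -
      have "s - 2 - (s - 2 - k) = k" "Suc (s - 2 - k) < s" using that by linarith+
      then have "T k = Tr (s - 2 - k)" by (simp only: Tr_def)
      then show ?thesis using \<open>Suc (s - 2 - k) < s\<close> by blast
    qed
    then show ?thesis using r by (auto simp: Tr_def)
  qed
  then have BT: "B = alg (Tr ` {k. Suc k < s} \<union> {E}) u" unfolding B_def by (rule arg_cong)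
  have ETr: "E * Tr k = Tr k * E" if "Suc (Suc k) < s" for k
  proof -
    have "s - 2 - k = Suc (s - 3 - k)" "Suc (Suc (s - 3 - k)) < s" using that by arith+
    then show ?thesis using ET[of "s - 3 - k"] by (simp only: Tr_def)
  qed
  have T0: "E * (Tr (s - 2) * E) = \<rho> *s E" using ETE[OF s'(3)] by (simp add: Tr_def)
  have A0: "Aset \<alpha> = {#1#}" if "\<alpha> \<in> contents r" for \<alpha>
    using that r contents_1 by (auto simp: Aset_def)
  have B0: "Bset \<beta> = mset (map R.qe \<beta>)" for \<beta> by (simp add: Bset_def rho)
  show ?thesis
  proof (rule resolved_by_weights[where m = s' and f = "Rs.idem s'" and \<omega> = \<omega> and A = "Rs.H s'"])
    show "Z (Suc p) * (Rs.idem s' \<beta> * E) = \<omega> \<beta> p *s (Rs.idem s' \<beta> * E)" if "\<beta> \<in> contents s'" for \<beta> p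
      using Zh[OF that] unfolding h_def .
    show "\<exists>x\<in>Rs.H s'. z * E = x * E" if "z \<in> B" "\<And>x. x \<in> B ==> x * z = z * x" for z
      using center_E_hecke[OF Rv.hecke_axioms s'(3) rho0 T0 ETr BT that] sub by blast
    show "inj_on \<omega> (contents s')" using winj by (auto simp: inj_on_def)
    show "\<omega> ` contents s' \<inter> vals = {}"
    proof (rule ccontr)
      assume "\<not> ?thesis"
      then obtain \<alpha> \<beta> \<beta>' where h: "\<alpha> \<in> contents r" "\<beta> \<in> contents s" "\<beta>' \<in> contents s'" "\<omega> \<beta>' = val \<alpha> \<beta>"
        by (auto simp: vals_def)
      have "Aset \<alpha> + Bset \<beta>' = {#} + Bset \<beta>"
        by (rule spsum_inj[OF char Aset_0 Bset_0 _ Bset_0]) (use h(4)[symmetric] in \<open>auto simp: val_spsum \<omega>_def\<close>)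
      \<comment> \<open>The only \<open>X\<close>-eigenvalue is 1, the one of content 0. A
        coincidence with the quotient would thus add a second 0 to the contents of at most three
        boxes.\<close>
      then have "Bset (0 # \<beta>') = Bset \<beta>" using A0[OF h(1)] by (simp add: B0)
      then have "mset \<beta> = add_mset 0 (mset \<beta>')" using Bset_inj[of "0 # \<beta>'" \<beta>] by simp
      moreover have "\<beta>' \<noteq> []" using h(3) s s' by (auto simp: contents_def)
      ultimately show False using content_list_no_extra_zero[of \<beta> \<beta>'] h s s' by (auto simp: contents_def)
    qed
    show "mset \<alpha> = mset \<alpha>' \<and> mset \<beta> = mset \<beta>'"
      if "\<alpha> \<in> contents r" "\<alpha>' \<in> contents r" "\<beta> \<in> contents s" "\<beta>' \<in> contents s" "val \<alpha> \<beta> = val \<alpha>' \<beta>'" for \<alpha> \<alpha>' \<beta> \<beta>'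
    proof -
      have "Aset \<alpha> + Bset \<beta>' = Aset \<alpha>' + Bset \<beta>"
        using spsum_inj[OF char Aset_0 Bset_0 Aset_0 Bset_0] that(5) unfolding val_spsum by blast
      then have "Bset \<beta>' = Bset \<beta>" using A0 that by simp
      then show ?thesis using Bset_inj[of \<beta>' \<beta>] that r contents_1 by auto
    qed
  qed (use Rs.decomp_sum[OF dR] Rs.H_u_left[OF _ Rs.decomp_H[OF dR]] Rs.idem_short_eigen[OF s'(1) order.refl] in auto)
qed

text \<open>The mirror image of \<open>exceptional_right\<close>. The left elements
  \<open>L.X\<close> need no comparison step, since they are already those of the Hecke
  subalgebra.\<close>

lemma exceptional_left:
  assumes char: "inj (of_nat :: nat => 'k)" and s: "s = 1" and r: "r = 2 \<or> r = 3" and rho: "\<rho> * \<rho> = 1"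
  shows "\<exists>\<Omega> \<epsilon>. resolved \<Omega> \<epsilon>"
proof -
  define r' where "r' = r - 1"
  have r': "r' = 1 \<or> r' = 2" "r = Suc r'" "2 \<le> r" "r' \<le> r" using r by (auto simp: r'_def)
  note dL = L.decomp_idem[OF r'(4)]
  have Eg': "x * E = E * x" if "x \<in> L.H r'" for x
    by (rule L.H_commute[where m = r']) (use that Eg r' in auto)
  define h where "h \<alpha> = L.idem r' \<alpha> * E" for \<alpha>
  define \<omega> where "\<omega> \<alpha> = spsum (Aset \<alpha>) {#}" for \<alpha>
  have Zh: "Z (Suc p) * h \<alpha> = \<omega> \<alpha> p *s h \<alpha>" if b: "\<alpha> \<in> contents r'" for p \<alpha>
  proof -
    have w: "L.wt \<alpha> (h \<alpha>)" unfolding h_def using L.decomp_wt[OF dL b] by (rule L.wt_mult)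
    have c: "L.idem r' \<alpha> * E = E * L.idem r' \<alpha>" using Eg'[OF L.decomp_H[OF dL b]] .
    have "Z (Suc p) * h \<alpha> = (Z (Suc p) * E) * L.idem r' \<alpha>" by (simp only: h_def c mult.assoc)
    also have "\<dots> = (\<Sum>j<length \<alpha>. L.X j ^ Suc p) * h \<alpha>"
      using E_Z(2)[of "Suc p"] s r' b by (simp add: h_def c mult.assoc contents_def)
    also have "\<dots> = (\<Sum>a\<leftarrow>\<alpha>. L.qe a ^ Suc p) *s h \<alpha>" using L.psum_wt[OF w, of "Suc p"] by simp
    also have "\<dots> = \<omega> \<alpha> p *s h \<alpha>"
      by (simp add: sum_list_power_mset \<omega>_def spsum_def Aset_def del: power_Suc)
    finally show ?thesis .
  qed
  have winj: "\<beta> = \<beta>'" if "\<beta> \<in> contents r'" "\<beta>' \<in> contents r'" "\<omega> \<beta> = \<omega> \<beta>'" for \<beta> \<beta>'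
  proof -
    have "Aset \<beta> + {#} = Aset \<beta>' + {#}"
      by (rule spsum_inj[OF char Aset_0 _ Aset_0]) (use that(3) in \<open>auto simp: \<omega>_def\<close>)
    then have "Aset \<beta> = Aset \<beta>'" by simp
    from contents_short_inj[OF r'(1) that(1,2) Aset_inj[OF this]] show ?thesis .
  qed
  have "g ` {k. Suc k < r} \<union> T ` {k. Suc k < s} \<union> {E} = g ` {k. Suc k < r} \<union> {E}" using s by simp
  then have Bg: "B = alg (g ` {k. Suc k < r} \<union> {E}) u" unfolding B_def by (rule arg_cong)
  have "alg (g ` {k. Suc (Suc k) < r}) u = L.H r'"
    unfolding L.H_def by (intro arg_cong[where f = "\<lambda>A. alg (g ` A) u"]) (auto simp: r'_def)
  note cen = center_E_hecke[OF hecke_left r'(3) nonzero_imp_inverse_nonzero[OF rho0] EgE[OF r'(3)] Eg Bg, unfolded this]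
  have B0: "Bset \<beta> = {#1#}" if "\<beta> \<in> contents s" for \<beta>
    using that s contents_1 by (auto simp: Bset_def rho)
  show ?thesis
  proof (rule resolved_by_weights[where m = r' and f = "L.idem r'" and \<omega> = \<omega> and A = "L.H r'"])
    show "Z (Suc p) * (L.idem r' \<beta> * E) = \<omega> \<beta> p *s (L.idem r' \<beta> * E)" if "\<beta> \<in> contents r'" for \<beta> p
      using Zh[OF that] unfolding h_def .
    show "\<exists>x\<in>L.H r'. z * E = x * E" if "z \<in> B" "\<And>x. x \<in> B ==> x * z = z * x" for z
      by (rule cen) (use that in auto)
    show "inj_on \<omega> (contents r')" using winj by (auto simp: inj_on_def)
    show "\<omega> ` contents r' \<inter> vals = {}"
    proof (rule ccontr)
      assume "\<not> ?thesis"
      then obtain \<alpha> \<beta> \<alpha>' where h: "\<alpha> \<in> contents r" "\<beta> \<in> contents s" "\<alpha>' \<in> contents r'" "\<omega> \<alpha>' = val \<alpha> \<beta>"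
        by (auto simp: vals_def)
      have "Aset \<alpha> + {#} = Aset \<alpha>' + Bset \<beta>"
        by (rule spsum_inj[OF char Aset_0 Bset_0 Aset_0]) (use h(4)[symmetric] in \<open>auto simp: val_spsum \<omega>_def\<close>)
      then have "Aset \<alpha> = Aset (0 # \<alpha>')" using B0[OF h(2)] by (simp add: Aset_def)
      then have "mset \<alpha> = add_mset 0 (mset \<alpha>')" using Aset_inj[of \<alpha> "0 # \<alpha>'"] by simp
      moreover have "\<alpha>' \<noteq> []" using h(3) r r' by (auto simp: contents_def)
      ultimately show False using content_list_no_extra_zero[of \<alpha> \<alpha>'] h r r' by (auto simp: contents_def)
    qed
    show "mset \<alpha> = mset \<alpha>' \<and> mset \<beta> = mset \<beta>'"
      if "\<alpha> \<in> contents r" "\<alpha>' \<in> contents r" "\<beta> \<in> contents s" "\<beta>' \<in> contents s" "val \<alpha> \<beta> = val \<alpha>' \<beta>'" for \<alpha> \<alpha>' \<beta> \<beta>'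
    proof -
      have "Aset \<alpha> + Bset \<beta>' = Aset \<alpha>' + Bset \<beta>"
        using spsum_inj[OF char Aset_0 Bset_0 Aset_0 Bset_0] that(5) unfolding val_spsum by blast
      then have "Aset \<alpha> = Aset \<alpha>'" using B0 that by simp
      then show ?thesis using Aset_inj[of \<alpha> \<alpha>'] that s contents_1 by auto
    qed
  qed (use L.decomp_sum[OF dL] L.H_u_left[OF r'(4) L.decomp_H[OF dL]] L.idem_short_eigen[OF r'(1,4)] in auto)
qed

end

section \<open>The presented algebras as corners of one ring\<close>

text \<open>The algebras for all parameters are put into one type, as a direct product; the algebra for
  fixed parameters is then a corner of that product.\<close>

type_synonym 'k hpar = "nat \<times> nat \<times> 'k \<times> 'k"

definition hrelf :: "('k::field hpar => 'k hexp) => ('k hpar => 'k hexp) => bool" where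
  "hrelf f g \<longleftrightarrow> (\<forall>r s q \<rho>. heq r s q \<rho> (f (r, s, q, \<rho>)) (g (r, s, q, \<rho>)))"

quotient_type (overloaded) 'k halg = "'k::field hpar => 'k hexp" / hrelf
  by (rule equivpI)
    (simp_all add: hrelf_def reflp_def symp_def transp_def, blast intro: heq.refl, blast intro: heq.sym,
      blast intro: heq.trans)

text \<open>The one-dimensional representation in which every S is q and E is 0; it shows that the
  presented algebra is not the zero ring.\<close>

fun hev :: "'k::field => 'k hexp => 'k" where
  "hev q (Gen (S i)) = q"
| "hev q (Gen E) = 0"
| "hev q (Sc a) = a"
| "hev q (Pl x y) = hev q x + hev q y"
| "hev q (Tm x y) = hev q x * hev q y"

lemma hrel_hev: "hrel r s q \<rho> x y ==> hev q x = hev q y"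
  by (induction rule: hrel.induct) (simp_all add: Sg_def Eg_def hprod_def Sinv_def)

lemma heq_hev: "heq r s q \<rho> x y ==> hev q x = hev q y"
  by (induction rule: heq.induct) (simp_all add: hrel_hev algebra_simps)

instantiation halg :: (field) ring_1
begin

lift_definition zero_halg :: "'a halg" is "\<lambda>_. Sc 0" .
lift_definition one_halg :: "'a halg" is "\<lambda>_. Sc 1" .
lift_definition plus_halg :: "'a halg => 'a halg => 'a halg" is "\<lambda>f g p. Pl (f p) (g p)"
  by (auto simp: hrelf_def intro: heq.cong_Pl)
lift_definition times_halg :: "'a halg => 'a halg => 'a halg" is "\<lambda>f g p. Tm (f p) (g p)"
  by (auto simp: hrelf_def intro: heq.cong_Tm)
lift_definition uminus_halg :: "'a halg => 'a halg" is "\<lambda>f p. Tm (Sc (-1)) (f p)"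
  by (auto simp: hrelf_def intro: heq.cong_Tm heq.refl)
lift_definition minus_halg :: "'a halg => 'a halg => 'a halg" is "\<lambda>f g p. Pl (f p) (Tm (Sc (-1)) (g p))"
  by (auto simp: hrelf_def intro!: heq.cong_Tm heq.cong_Pl heq.refl)

instance
proof
  fix a b c :: "'a halg"
  show "a + b + c = a + (b + c)" by transfer (simp add: hrelf_def heq.add_assoc)
  show "a + b = b + a" by transfer (simp add: hrelf_def heq.add_comm)
  show "0 + a = a" by transfer (auto simp: hrelf_def intro: heq.trans[OF heq.add_comm heq.add_zero])
  show "- a + a = 0" by transfer (auto simp: hrelf_def intro: heq.trans[OF heq.add_comm heq.add_neg])
  show "a - b = a + - b" by transfer (simp add: hrelf_def heq.refl)
  show "a * b * c = a * (b * c)" by transfer (simp add: hrelf_def heq.mul_assoc)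
  show "1 * a = a" by transfer (simp add: hrelf_def heq.mul_one_l)
  show "a * 1 = a" by transfer (simp add: hrelf_def heq.mul_one_r)
  show "(a + b) * c = a * c + b * c" by transfer (simp add: hrelf_def heq.distrib_r)
  show "a * (b + c) = a * b + a * c" by transfer (simp add: hrelf_def heq.distrib_l)
  show "(0::'a halg) \<noteq> 1"
  proof transfer
    show "\<not> hrelf (\<lambda>_. Sc (0::'a)) (\<lambda>_. Sc 1)"
    proof
      assume "hrelf (\<lambda>_. Sc (0::'a)) (\<lambda>_. Sc 1)"
      then have "heq 0 0 (0::'a) 0 (Sc 0) (Sc 1)" by (simp add: hrelf_def)
      then show False using heq_hev by fastforce
    qed
  qed
qed

end

lift_definition hscale :: "'k::field => 'k halg => 'k halg" (infixr "*h" 75) is "\<lambda>a f p. Tm (Sc a) (f p)"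
  by (auto simp: hrelf_def intro: heq.cong_Tm heq.refl)

interpretation hs: alg_over hscale
proof
  fix a b :: "'k::field" and x y :: "'k halg"
  show "a *h (x + y) = a *h x + a *h y" by transfer (simp add: hrelf_def heq.distrib_l)
  show "(a + b) *h x = a *h x + b *h x"
    by transfer (auto simp: hrelf_def intro: heq.trans[OF heq.cong_Tm[OF heq.sym[OF heq.sc_add] heq.refl] heq.distrib_r])
  show "a *h b *h x = (a * b) *h x"
    by transfer (auto simp: hrelf_def intro: heq.trans[OF heq.sym[OF heq.mul_assoc] heq.cong_Tm[OF heq.sc_mul heq.refl]])
  show "1 *h x = x" by transfer (simp add: hrelf_def heq.mul_one_l)
  show "(a *h x) * y = a *h (x * y)" by transfer (simp add: hrelf_def heq.mul_assoc)
  show "x * (a *h y) = a *h (x * y)"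
  proof transfer
    fix a :: 'k and x y :: "'k hpar => 'k hexp"
    have "heq r s q \<rho> (Tm v (Tm (Sc a) w)) (Tm (Sc a) (Tm v w))" for r s q \<rho> v w
      by (rule heq.trans[OF heq.sym[OF heq.mul_assoc]], rule heq.trans[OF heq.cong_Tm[OF heq.sym[OF heq.sc_central] heq.refl]], rule heq.mul_assoc)
    then show "hrelf (\<lambda>p. Tm (x p) (Tm (Sc a) (y p))) (\<lambda>p. Tm (Sc a) (Tm (x p) (y p)))"
      by (simp add: hrelf_def)
  qed
qed

section \<open>The inverse generators satisfy the Hecke relations for the inverse parameter\<close>

context hecke
begin

lemma Si_comm: "Suc j < n ==> Suc i < j ==> Si i * Si j = Si j * Si i"
  using comm[of j i] by (simp add: Si_def left_diff_distrib right_diff_distrib scale_right_diff_distrib algebra_simps)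

lemma Si_braid: assumes "Suc (Suc k) < n" shows "Si k * (Si (Suc k) * Si k) = Si (Suc k) * (Si k * Si (Suc k))"
proof -
  have k: "Suc k < n" "Suc (Suc k) < n" using assms by auto
  define a b A B where "a = S k" and "b = S (Suc k)" and "A = Si k" and "B = Si (Suc k)"
  have i: "a * A = u" "b * B = u" "A * a = u" "B * b = u" unfolding a_def b_def A_def B_def using S_Si Si_S k by auto
  have ui: "u * A = A" "A * u = A" "u * B = B" "B * u = B" "u * a = a" "u * b = b" "a * u = a" "b * u = b"
    unfolding a_def b_def A_def B_def using k by auto
  have br: "a * (b * a) = b * (a * b)" unfolding a_def b_def using braid k by simp
  have r: "(b * (a * b)) * (B * (A * B)) = u"
  proof -
    have "(b * (a * b)) * (B * (A * B)) = b * (a * ((b * B) * (A * B)))" by (simp only: mult.assoc)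
    also have "\<dots> = b * ((a * (u * A)) * B)" by (simp only: i mult.assoc)
    finally show ?thesis by (simp only: ui i)
  qed
  have l: "(A * (B * A)) * (a * (b * a)) = u"
  proof -
    have "(A * (B * A)) * (a * (b * a)) = A * (B * ((A * a) * (b * a)))" by (simp only: mult.assoc)
    also have "\<dots> = A * ((B * (u * b)) * a)" by (simp only: i mult.assoc)
    finally show ?thesis by (simp only: ui i)
  qed
  have "A * (B * A) = (A * (B * A)) * ((b * (a * b)) * (B * (A * B)))" by (simp only: r) (simp only: mult.assoc ui)
  also have "\<dots> = ((A * (B * A)) * (a * (b * a))) * (B * (A * B))" by (simp only: br mult.assoc)
  also have "\<dots> = B * (A * B)" by (simp only: l) (simp only: mult.assoc[symmetric] ui)
  finally show ?thesis unfolding A_def B_def .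
qed

lemma hecke_inverse: "hecke scale u (inverse q) Si n"
proof
  show "Si k * Si k = u + (inverse q - inverse (inverse q)) *s Si k" if "Suc k < n" for k
  proof -
    have "Si k * Si k = Si k * S k - zq *s Si k" using that
      by (subst (2) Si_def) (simp add: right_diff_distrib)
    also have "\<dots> = u + (- zq) *s Si k" using Si_S[OF that] by simp
    finally show ?thesis by (simp add: zq_def)
  qed
  show "inverse q ^ m \<noteq> 1" if "0 < m" for m using generic[OF that] by (simp add: power_inverse)
qed (use q0 Si_braid Si_comm in auto)

end

section \<open>The presented algebra is a walled algebra\<close>

locale presentation =
  fixes r s :: nat and q \<rho> :: "'k::field"
  assumes r1: "1 \<le> r" and s1: "1 \<le> s" and q0: "q \<noteq> 0" and generic: "0 < m ==> q ^ m \<noteq> 1" and rho0: "\<rho> \<noteq> 0"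
begin

text \<open>The embedding of one factor into the product of all presented algebras, with zero in the
  other components. The unit of the factor becomes an idempotent.\<close>

definition \<pi> :: "'k hexp => 'k halg" where
  "\<pi> x = abs_halg (\<lambda>p. if p = (r, s, q, \<rho>) then x else Sc 0)"

definition u :: "'k halg" where "u = \<pi> (Sc 1)"

abbreviation "z \<equiv> q - inverse q"

lemma \<pi>_eq: "\<pi> x = \<pi> y \<longleftrightarrow> heq r s q \<rho> x y"
  unfolding \<pi>_def halg.abs_eq_iff hrelf_def by (auto intro: heq.refl)

lemma \<pi>_Pl: "\<pi> (Pl x y) = \<pi> x + \<pi> y"
  unfolding \<pi>_def plus_halg.abs_eq halg.abs_eq_iff hrelf_def
  by (auto intro: heq.refl heq.sym[OF heq.add_zero])

lemma \<pi>_Tm: "\<pi> (Tm x y) = \<pi> x * \<pi> y"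
proof -
  have "heq r' s' q' \<rho>' (Sc 0) (Tm (Sc 0) (Sc 0))" for r' s' and q' \<rho>' :: 'k
    using heq.sc_mul[of r' s' q' \<rho>' 0 0] by (simp add: heq.sym)
  then show ?thesis unfolding \<pi>_def times_halg.abs_eq halg.abs_eq_iff hrelf_def by (auto intro: heq.refl)
qed

lemma \<pi>_Sc_Tm: "\<pi> (Tm (Sc a) x) = a *h \<pi> x"
proof -
  have "heq r' s' q' \<rho>' (Sc 0) (Tm (Sc a) (Sc 0))" for r' s' and q' \<rho>' :: 'k
    using heq.sc_mul[of r' s' q' \<rho>' a 0] by (simp add: heq.sym)
  then show ?thesis unfolding \<pi>_def hscale.abs_eq halg.abs_eq_iff hrelf_def by (auto intro: heq.refl)
qed

lemma \<pi>_Sc: "\<pi> (Sc a) = a *h u"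
  unfolding u_def \<pi>_Sc_Tm[symmetric] \<pi>_eq by (rule heq.sym[OF heq.mul_one_r])

lemma u_\<pi> [simp]: "u * \<pi> x = \<pi> x" and \<pi>_u [simp]: "\<pi> x * u = \<pi> x"
  unfolding u_def \<pi>_Tm[symmetric] \<pi>_eq by (rule heq.mul_one_l heq.mul_one_r)+

lemma uu [simp]: "u * u = u" using u_\<pi>[of "Sc 1"] by (simp add: u_def[symmetric])

lemma u_\<pi>_x [simp]: "u * (\<pi> x * y) = \<pi> x * y" by (simp add: mult.assoc[symmetric])

lemmas \<pi>_simps = \<pi>_Pl \<pi>_Sc_Tm \<pi>_Tm \<pi>_Sc

lemma \<pi>_hprod_Nil: "\<pi> (hprod []) = u" by (simp add: hprod_def u_def)
lemma \<pi>_hprod_Cons: "\<pi> (hprod (x # xs)) = \<pi> x * \<pi> (hprod xs)" by (simp add: hprod_def \<pi>_Tm)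
lemma \<pi>_hprod_append: "\<pi> (hprod (xs @ ys)) = \<pi> (hprod xs) * \<pi> (hprod ys)"
  by (induction xs) (auto simp: \<pi>_hprod_Nil \<pi>_hprod_Cons mult.assoc)
lemma \<pi>_hsum: "\<pi> (hsum xs) = (\<Sum>x\<leftarrow>xs. \<pi> x)"
  by (induction xs) (auto simp: hsum_def \<pi>_Pl \<pi>_Sc)
lemmas \<pi>_hprod = \<pi>_hprod_Nil \<pi>_hprod_Cons

lemma \<pi>_hrel: "hrel r s q \<rho> x y ==> \<pi> x = \<pi> y"
  unfolding \<pi>_eq by (rule heq.rel)

definition sg :: "nat => 'k halg" where "sg i = \<pi> (Sg i)"
definition EE where "EE = \<pi> Eg"
definition gg :: "nat => 'k halg" where "gg k = \<pi> (Sinv q (Suc k))"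
definition TT :: "nat => 'k halg" where "TT k = sg (r + 1 + k)"

lemma gg_eq: "gg k = sg (Suc k) - z *h u"
  by (simp add: gg_def Sinv_def \<pi>_Pl \<pi>_Sc sg_def hs.scale_left_diff_distrib)

lemma sg_u [simp]: "u * sg i = sg i" "sg i * u = sg i" by (simp_all add: sg_def)
lemma E_u [simp]: "u * EE = EE" "EE * u = EE" by (simp_all add: EE_def)
lemma TT_u [simp]: "u * TT i = TT i" "TT i * u = TT i" by (simp_all add: TT_def)

lemma sg_quad: assumes "validS r s i" shows "sg i * sg i = u + z *h sg i"
proof -
  have "(sg i + (- q) *h u) * (sg i + inverse q *h u) = 0 *h u"
    using \<pi>_hrel[OF hrel.quad[OF assms]] by (simp only: \<pi>_Pl \<pi>_Tm \<pi>_Sc sg_def)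
  then have "sg i * sg i + inverse q *h sg i - q *h sg i - u = 0"
    using q0 by (simp add: distrib_left distrib_right algebra_simps)
  then show ?thesis by (simp add: hs.scale_left_diff_distrib algebra_simps)
qed

lemma sg_braid: "validS r s i ==> validS r s (Suc i) ==> sg i * (sg (Suc i) * sg i) = sg (Suc i) * (sg i * sg (Suc i))"
  using \<pi>_hrel[OF hrel.braid[of r s i]] by (simp add: \<pi>_hprod sg_def)

lemma sg_comm: "validS r s i ==> validS r s j ==> i + 1 < j ==> sg i * sg j = sg j * sg i"
  using \<pi>_hrel[OF hrel.comm[of r s i j]] by (simp add: \<pi>_Tm sg_def)

sublocale SL: hecke hscale u q "\<lambda>k. sg (Suc k)" r
proof
  show "sg (Suc k) * (sg (Suc (Suc k)) * sg (Suc k)) = sg (Suc (Suc k)) * (sg (Suc k) * sg (Suc (Suc k)))" if "Suc (Suc k) < r" for k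
    using that by (intro sg_braid) (auto simp: validS_def)
qed (use q0 generic in \<open>auto intro!: sg_quad sg_comm simp: validS_def\<close>)

sublocale SR: hecke hscale u q TT s
proof
  show "TT k * (TT (Suc k) * TT k) = TT (Suc k) * (TT k * TT (Suc k))" if "Suc (Suc k) < s" for k
    unfolding TT_def using sg_braid[of "r + 1 + k"] that by (simp add: validS_def)
qed (use q0 generic in \<open>auto intro!: sg_quad sg_comm simp: validS_def TT_def\<close>)

lemma gg_Si: "gg = SL.Si" by (rule ext) (simp add: gg_eq SL.Si_def SL.zq_def)

lemma EE_sq: "EE * EE = delta q \<rho> *h EE"
  using \<pi>_hrel[OF hrel.Esq] by (simp add: \<pi>_Sc_Tm) (simp add: \<pi>_Tm EE_def)

lemma EE_sg: "validS r s j ==> j + 1 \<noteq> r ==> j \<noteq> r + 1 ==> EE * sg j = sg j * EE"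
  using \<pi>_hrel[OF hrel.ES[of r s j]] by (simp add: \<pi>_Tm EE_def sg_def)

lemma EE_sg_EE: "2 \<le> r ==> EE * (sg (r - 1) * EE) = \<rho> *h EE" "2 \<le> s ==> EE * (TT 0 * EE) = \<rho> *h EE"
proof -
  show "EE * (sg (r - 1) * EE) = \<rho> *h EE" if "2 \<le> r"
  proof -
    have "validS r s (r - 1)" using that by (auto simp: validS_def)
    from \<pi>_hrel[OF hrel.ESE1[OF this]] show ?thesis by (simp add: \<pi>_Sc_Tm \<pi>_hprod EE_def sg_def)
  qed
  show "EE * (TT 0 * EE) = \<rho> *h EE" if "2 \<le> s"
    using \<pi>_hrel[OF hrel.ESE2] that by (simp add: validS_def \<pi>_Sc_Tm \<pi>_hprod EE_def sg_def TT_def)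
qed

lemma RR:
  assumes "2 \<le> r" "2 \<le> s"
  defines "D \<equiv> EE * (gg (r - 2) * (TT 0 * EE))"
  shows "D * sg (r - 1) = D * TT 0" "sg (r - 1) * D = TT 0 * D"
proof -
  have v: "validS r s (r - 1)" "validS r s (r + 1)" using assms by (auto simp: validS_def)
  have g: "gg (r - 2) = \<pi> (Sinv q (r - 1))" using assms by (simp add: gg_def Suc_diff_Suc numeral_2_eq_2)
  show "D * sg (r - 1) = D * TT 0"
    using \<pi>_hrel[OF hrel.R7[OF v]] unfolding D_def g by (simp add: \<pi>_hprod EE_def sg_def TT_def mult.assoc)
  show "sg (r - 1) * D = TT 0 * D"
    using \<pi>_hrel[OF hrel.R8[OF v]] unfolding D_def g by (simp add: \<pi>_hprod EE_def sg_def TT_def mult.assoc)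
qed

lemma z0: "z \<noteq> 0"
  using SL.z0 by (simp add: SL.zq_def)

lemma gT': "Suc k < r ==> Suc l < s ==> gg k * TT l = TT l * gg k"
  using sg_comm[of "Suc k" "r + 1 + l"] by (simp add: gg_eq TT_def validS_def left_diff_distrib right_diff_distrib)

sublocale W: walled hscale u q \<rho> r s gg TT EE
proof (intro walled.intro walled_axioms.intro)
  show "alg_over hscale" by (rule hs.alg_over_axioms)
  show "hecke hscale u (inverse q) gg r" unfolding gg_Si by (rule SL.hecke_inverse)
  show "hecke hscale u q TT s" by (rule SR.hecke_axioms)
  show "gg k * TT l = TT l * gg k" if "Suc k < r" "Suc l < s" for k l using gT' that .
  show "EE * EE = delta q \<rho> *h EE" by (rule EE_sq)
  show "EE * gg k = gg k * EE" if "Suc (Suc k) < r" for k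
    using EE_sg[of "Suc k"] that by (simp add: gg_eq validS_def left_diff_distrib right_diff_distrib)
  show "EE * TT (Suc k) = TT (Suc k) * EE" if "Suc (Suc k) < s" for k
    unfolding TT_def using that by (intro EE_sg) (auto simp: validS_def)
  show "EE * (gg (r - 2) * EE) = inverse \<rho> *h EE" if "2 \<le> r"
  proof -
    have "Suc (r - 2) = r - 1" using that by simp
    \<comment> \<open>The inverse of S is S - z, so E S^-1 E = (\<rho> - z \<delta>) E, and \<rho> -
      z \<delta> = \<rho>^-1.\<close>
    then have "EE * (gg (r - 2) * EE) = \<rho> *h EE - z *h (delta q \<rho> *h EE)"
      using EE_sg_EE(1)[OF that] EE_sq by (simp add: gg_eq left_diff_distrib right_diff_distrib)
    also have "\<dots> = (\<rho> - z * delta q \<rho>) *h EE" by (simp add: hs.scale_left_diff_distrib)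
    also have "\<rho> - z * delta q \<rho> = inverse \<rho>" using z0 by (simp add: delta_def)
    finally show ?thesis .
  qed
  show "EE * (TT 0 * EE) = \<rho> *h EE" if "2 \<le> s" using EE_sg_EE(2)[OF that] .
  {
    assume rs: "2 \<le> r" "2 \<le> s"
    let ?D = "EE * (gg (r - 2) * (TT 0 * EE))"
    have n: "Suc (r - 2) < r" "Suc 0 < s" "Suc (r - 2) = r - 1" using rs by auto
    have sgg: "sg (r - 1) * gg (r - 2) = u" "gg (r - 2) * sg (r - 1) = u"
      using SL.S_Si[OF n(1)] SL.Si_S[OF n(1)] by (simp_all only: gg_Si n(3))
    \<comment> \<open>The defining relation says that D S = D T for the two generators next to the
      wall; since g is the inverse of S, this means D T g = D.\<close>
    show "?D * (gg (r - 2) * TT 0) = ?D"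
    proof -
      have "?D * (gg (r - 2) * TT 0) = (?D * TT 0) * gg (r - 2)" using gT'[OF n(1,2)] by (simp only: mult.assoc)
      also have "\<dots> = (?D * sg (r - 1)) * gg (r - 2)" by (simp only: RR(1)[OF rs])
      also have "\<dots> = ?D * (sg (r - 1) * gg (r - 2))" by (simp only: mult.assoc)
      also have "\<dots> = ?D" by (simp only: sgg mult.assoc E_u)
      finally show ?thesis .
    qed
    show "(gg (r - 2) * TT 0) * ?D = ?D"
    proof -
      have "(gg (r - 2) * TT 0) * ?D = gg (r - 2) * (TT 0 * ?D)" by (simp only: mult.assoc)
      also have "\<dots> = gg (r - 2) * (sg (r - 1) * ?D)" by (simp only: RR(2)[OF rs])
      also have "\<dots> = (gg (r - 2) * sg (r - 1)) * ?D" by (simp only: mult.assoc)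
      also have "\<dots> = ?D" by (simp only: sgg mult.assoc[symmetric] E_u)
      finally show ?thesis .
    qed
  }
  show "EE = 0" if "r = 0 \<or> s = 0" using that r1 s1 by simp
  show "\<rho> \<noteq> 0" by (rule rho0)
qed auto

subsection \<open>Jucys-Murphy elements and the centre\<close>

definition l :: "nat => 'k halg" where "l i = \<pi> (JM r q \<rho> i)"

lemma l_u [simp]: "u * l i = l i" "l i * u = l i" by (simp_all add: l_def)

lemma l_1: "l (Suc 0) = 0" by (simp add: l_def \<pi>_Sc)

lemma l_left: "Suc (Suc k) \<le> r ==> l (Suc (Suc k)) = gg k * (l (Suc k) * gg k) + gg k"
  by (simp add: l_def \<pi>_Pl \<pi>_hprod gg_def)

lemma l_right: "1 \<le> j ==> l (Suc (r + j)) = TT (j - 1) * (l (r + j) * TT (j - 1)) + TT (j - 1)"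
proof -
  assume j: "1 \<le> j"
  obtain n where n: "r + j = Suc n" using j by (cases "r + j") auto
  have "r + 1 + (j - 1) = Suc n" using j n by simp
  then show ?thesis using n r1 j unfolding l_def TT_def sg_def by (simp add: \<pi>_Pl \<pi>_hprod)
qed

lemma \<pi>_Ejr: "d < r ==> \<pi> (Ejr r q (r - d)) = W.Ed d"
proof (induction d)
  case 0
  have "\<pi> (Ejr r q r) = EE" by (simp add: Ejr_def \<pi>_hprod EE_def)
  then show ?case by simp
next
  case (Suc d)
  let ?j = "r - Suc d"
  have "[?j..<r] = ?j # [Suc ?j..<r]" using Suc.prems by (simp add: upt_conv_Cons)
  moreover have "Suc ?j = r - d" using Suc.prems by simp
  ultimately have j: "[?j..<r] = ?j # [r - d..<r]" by simp
  have g: "gg (r - 2 - d) = \<pi> (Sinv q ?j)"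
  proof -
    have "Suc (r - 2 - d) = ?j" using Suc.prems by simp
    then show ?thesis by (simp only: gg_def)
  qed
  have "\<pi> (Ejr r q ?j) = \<pi> (Sinv q ?j) * (\<pi> (Ejr r q (r - d)) * \<pi> (Sinv q ?j))"
    unfolding Ejr_def j by (simp add: \<pi>_hprod \<pi>_hprod_append mult.assoc)
  then show ?case using Suc g by (simp add: W.Ed.simps)
qed

lemma l_wall: "l (Suc r) = \<rho> *h (delta q \<rho> *h u - W.Esum)"
proof -
  obtain n where n: "r = Suc n" using r1 by (cases r) auto
  have "(\<Sum>x\<leftarrow>map (Ejr r q) [1..<r + 1]. \<pi> x) = (\<Sum>j\<in>{1..<r + 1}. \<pi> (Ejr r q j))"
    by (simp add: sum_list_distinct_conv_sum_set comp_def del: upt_Suc)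
  also have "\<dots> = (\<Sum>d<r. \<pi> (Ejr r q (r - d)))"
    by (rule sum.reindex_bij_witness[of _ "\<lambda>d. r - d" "\<lambda>j. r - j"]) auto
  also have "\<dots> = W.Esum" unfolding W.Esum_def by (rule sum.cong) (auto simp: \<pi>_Ejr)
  finally have E: "\<pi> (hsum (map (Ejr r q) [1..<r + 1])) = W.Esum" unfolding \<pi>_hsum .
  have "l (Suc r) = \<pi> (Tm (Sc \<rho>) (Pl (Tm (Sc (-1)) (hsum (map (Ejr r q) [1..<r + 1]))) (Sc (delta q \<rho>))))"
    unfolding l_def by (subst n, subst JM.simps(3)) (simp add: n del: upt_Suc)
  then show ?thesis unfolding \<pi>_Sc_Tm \<pi>_Pl E by (simp add: \<pi>_Sc)
qed

lemma X_l: "k < r ==> W.L.X k = u - z *h l (Suc k)"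
proof (induction k)
  case 0
  then show ?case by (simp add: l_1)
next
  case (Suc k)
  have "gg k * gg k = u - z *h gg k" using W.L.quad[of k] Suc.prems by (simp add: hs.scale_left_diff_distrib)
  then show ?case using Suc l_left[of k]
    by (simp add: W.L.X.simps left_diff_distrib right_diff_distrib hs.scale_right_distrib)
qed

lemma Y_l: "k < s ==> W.Y k = u + z *h l (Suc (r + k))"
proof (induction k)
  case 0
  have "z * (\<rho> * delta q \<rho>) = \<rho> * \<rho> - 1" using W.rho_delta by (simp add: SR.zq_def algebra_simps)
  then have "u + z *h (\<rho> *h delta q \<rho> *h u) = (\<rho> * \<rho>) *h u"
    by (simp add: hs.scale_left_diff_distrib mult.assoc)
  then show ?case by (simp add: W.Y.simps l_wall hs.scale_right_diff_distrib SR.zq_def algebra_simps)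
next
  case (Suc k)
  have "TT k * TT k = u + z *h TT k" using SR.quad[of k] Suc.prems by simp
  then show ?case using Suc l_right[of "Suc k"]
    by (simp add: W.Y.simps distrib_left distrib_right hs.scale_right_distrib)
qed

lemma wf_B: "wf r s x ==> \<pi> x \<in> W.B"
proof (induction x)
  case (Gen h)
  show ?case
  proof (cases h)
    case (S i)
    then have v: "validS r s i" using Gen by simp
    show ?thesis
    proof (cases "i < r")
      case True
      then obtain k where k: "i = Suc k" "Suc k < r" using v by (cases i) (auto simp: validS_def)
      have "\<pi> (Gen h) = gg k + z *h u" using S k by (simp add: gg_eq sg_def Sg_def)
      then show ?thesis using W.B_add[OF W.B_g[OF k(2)] W.B_scale[OF W.B_u]] by simp
    next
      case False
      then obtain k where k: "i = r + 1 + k" "Suc k < s" using v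
        by (auto simp: validS_def intro!: that[of "i - r - 1"])
      have "\<pi> (Gen h) = TT k" using S k by (simp add: TT_def sg_def Sg_def)
      then show ?thesis using W.B_T[OF k(2)] by simp
    qed
  next
    case E
    then show ?thesis using W.B_E by (simp add: EE_def Eg_def)
  qed
qed (auto simp: \<pi>_simps intro: W.B_add W.B_mult W.B_scale W.B_u)

lemma B_wf: "b \<in> W.B ==> \<exists>x. wf r s x \<and> b = \<pi> x"
  unfolding W.B_def
proof (induction rule: hs.alg.induct)
  case alg_unit
  then show ?case by (intro exI[of _ "Sc 1"]) (simp add: u_def)
next
  case (alg_add x y)
  then obtain x' y' where "wf r s x'" "x = \<pi> x'" "wf r s y'" "y = \<pi> y'" by auto
  then show ?case by (intro exI[of _ "Pl x' y'"]) (simp add: \<pi>_Pl)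
next
  case (alg_scale x a)
  then obtain x' where "wf r s x'" "x = \<pi> x'" by auto
  then show ?case by (intro exI[of _ "Tm (Sc a) x'"]) (simp add: \<pi>_Sc_Tm)
next
  case (alg_gen h x)
  then obtain x' where x: "wf r s x'" "x = \<pi> x'" by auto
  have "\<exists>y. wf r s y \<and> h = \<pi> y"
    using alg_gen(1)
  proof (elim UnE)
    assume "h \<in> gg ` {k. Suc k < r}"
    then show ?thesis by (force simp: gg_def Sinv_def Sg_def validS_def)
  next
    assume "h \<in> TT ` {k. Suc k < s}"
    then show ?thesis by (force simp: TT_def sg_def Sg_def validS_def)
  next
    assume "h \<in> {EE}"
    then show ?thesis by (auto simp: EE_def Eg_def intro!: exI[of _ Eg])
  qed
  then obtain y where "wf r s y" "h = \<pi> y" by auto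
  then show ?case using x by (intro exI[of _ "Tm y x'"]) (simp add: \<pi>_Tm)
qed

lemma in_center_iff: "wf r s x ==> in_center r s q \<rho> x \<longleftrightarrow> (\<forall>b\<in>W.B. b * \<pi> x = \<pi> x * b)"
proof -
  assume "wf r s x"
  have "heq r s q \<rho> (Tm x y) (Tm y x) \<longleftrightarrow> \<pi> y * \<pi> x = \<pi> x * \<pi> y" for y
    unfolding \<pi>_eq[symmetric] \<pi>_Tm by auto
  then show ?thesis using \<open>wf r s x\<close> B_wf wf_B unfolding in_center_def by (metis (no_types, lifting))
qed

end

section \<open>Supersymmetric polynomials in the Jucys-Murphy elements\<close>

lemma upt_append: "a \<le> b ==> b \<le> c ==> [a..<c] = [a..<b] @ [b..<c]"
  using upt_add_eq_append[of a b "c - b"] by simp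

lemma pcoeff_Nil [simp]: "pcoeff [] m = 0" by (simp add: pcoeff_def)
lemma pcoeff_Cons: "pcoeff ((c, n) # p) m = (if n = m then c else 0) + pcoeff p m" by (simp add: pcoeff_def)
lemma pcoeff_append: "pcoeff (p @ p') m = pcoeff p m + pcoeff p' m" by (simp add: pcoeff_def)

lemma supersymmetric_const: "supersymmetric r s [(c, \<lambda>_. 0)]"
proof -
  have "(m \<circ> \<sigma> = (\<lambda>_. 0)) = (m = (\<lambda>_. 0))" if "bij \<sigma>" for m :: "nat => nat" and \<sigma> :: "nat => nat"
  proof
    assume h: "m \<circ> \<sigma> = (\<lambda>_. 0)"
    show "m = (\<lambda>_. 0)"
    proof
      fix x
      obtain y where "x = \<sigma> y" using bij_is_surj[OF \<open>bij \<sigma>\<close>] by (metis surj_def)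
      then show "m x = 0" using fun_cong[OF h, of y] by simp
    qed
  qed auto
  then have p: "pcoeff [(c, \<lambda>_. 0)] (m \<circ> \<sigma>) = pcoeff [(c, \<lambda>_. 0)] m" if "\<sigma> permutes A" for m \<sigma> A
    using permutes_bij[OF that] by (auto simp: pcoeff_Cons eq_commute[of "\<lambda>_. 0"])
  have "(\<lambda>_. 0) \<noteq> n(r := a, r + 1 := k - a)" if "1 \<le> k" for n :: "nat => nat" and a k
  proof
    assume "(\<lambda>_. 0) = n(r := a, r + 1 := k - a)"
    from fun_cong[OF this, of r] fun_cong[OF this, of "r + 1"] show False using that by simp
  qed
  then show ?thesis using p unfolding supersymmetric_def pvars_ok_def
    by (auto simp: pcoeff_Cons intro!: sum.neutral)
qed

lemma supersymmetric_append:
  assumes "supersymmetric r s p" "supersymmetric r s p'"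
  shows "supersymmetric r s (p @ p')"
  using assms unfolding supersymmetric_def pvars_ok_def
  by (auto simp: pcoeff_append distrib_left sum.distrib)

definition pscale :: "'k::comm_ring_1 => 'k mpoly => 'k mpoly" where
  "pscale a p = map (\<lambda>(c, m). (a * c, m)) p"

lemma pcoeff_pscale: "pcoeff (pscale a p) m = a * pcoeff p m"
  by (induction p) (auto simp: pcoeff_Cons pscale_def distrib_left)

lemma supersymmetric_pscale:
  assumes "supersymmetric r s p"
  shows "supersymmetric r s (pscale a p)"
proof -
  have v: "pvars_ok r s (pscale a p)" using assms unfolding supersymmetric_def pvars_ok_def pscale_def by auto
  have "(\<Sum>b\<le>k. (- 1) ^ (k - b) * (a * pcoeff p (n(r := b, r + 1 := k - b)))) =
      a * (\<Sum>b\<le>k. (- 1) ^ (k - b) * pcoeff p (n(r := b, r + 1 := k - b)))" for n k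
    by (simp add: sum_distrib_left mult.left_commute)
  then show ?thesis using assms v unfolding supersymmetric_def pcoeff_pscale by simp
qed

text \<open>The product of \<open>p\<close> with the supersymmetric power sum
  \<open>\<Sum>\<^sub>i x\<^sub>i^k - \<Sum>\<^sub>j (-y\<^sub>j)^k\<close>.\<close>

definition psgn :: "nat => nat => nat => 'k::comm_ring_1" where
  "psgn r k i = (if i \<le> r then 1 else - ((- 1) ^ k))"

definition pmul_power_sum :: "nat => nat => nat => 'k::comm_ring_1 mpoly => 'k mpoly" where
  "pmul_power_sum r s k p =
    concat (map (\<lambda>(c, m). map (\<lambda>i. (psgn r k i * c, m(i := m i + k))) [1..<r + s + 1]) p)"

text \<open>The coefficient of m in p times the k-th power of variable i.\<close>

definition pshift :: "nat => 'k::comm_ring_1 mpoly => nat => (nat => nat) => 'k" where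
  "pshift k p i m = (if k \<le> m i then pcoeff p (m(i := m i - k)) else 0)"

lemma pcoeff_pmul_power_sum:
  "pcoeff (pmul_power_sum r s k p) m = (\<Sum>i\<in>{1..r + s}. psgn r k i * pshift k p i m)"
proof (induction p)
  case Nil
  have "pshift k [] i m = (0::'a)" for i by (simp add: pshift_def)
  then show ?case by (simp add: pmul_power_sum_def)
next
  case (Cons cm p)
  obtain c n where cm: "cm = (c, n)" by (cases cm)
  have eq: "n(i := n i + k) = m \<longleftrightarrow> k \<le> m i \<and> n = m(i := m i - k)" for i
    by (auto simp: fun_eq_iff)
  have 1: "pcoeff (map (\<lambda>i. (psgn r k i * c, n(i := n i + k))) xs) m =
      (\<Sum>i\<leftarrow>xs. if n(i := n i + k) = m then psgn r k i * c else 0)" for xs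
    by (induction xs) (auto simp: pcoeff_Cons)
  have "(\<Sum>i\<leftarrow>[1..<r + s + 1]. if n(i := n i + k) = m then psgn r k i * c else 0) =
      (\<Sum>i\<in>{1..r + s}. if n(i := n i + k) = m then psgn r k i * c else 0)"
    by (simp add: sum_list_distinct_conv_sum_set atLeastLessThanSuc_atLeastAtMost del: upt_Suc)
  then have "pcoeff (pmul_power_sum r s k (cm # p)) m =
      (\<Sum>i\<in>{1..r + s}. if n(i := n i + k) = m then psgn r k i * c else 0) + (\<Sum>i\<in>{1..r + s}. psgn r k i * pshift k p i m)"
    using Cons by (simp add: pmul_power_sum_def cm pcoeff_append 1 del: upt_Suc)
  also have "\<dots> = (\<Sum>i\<in>{1..r + s}. psgn r k i * pshift k (cm # p) i m)"
    unfolding sum.distrib[symmetric]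
    by (rule sum.cong) (auto simp: cm pshift_def pcoeff_Cons eq distrib_left)
  finally show ?case .
qed

lemma pshift_comp:
  assumes "bij \<sigma>" "\<And>m. pcoeff p (m \<circ> \<sigma>) = pcoeff p m"
  shows "pshift k p i (m \<circ> \<sigma>) = pshift k p (\<sigma> i) m"
proof -
  have "(m \<circ> \<sigma>)(i := m (\<sigma> i) - k) = m(\<sigma> i := m (\<sigma> i) - k) \<circ> \<sigma>"
    using bij_is_inj[OF assms(1)] by (auto simp: fun_eq_iff dest: injD)
  then show ?thesis using assms(2) by (simp add: pshift_def)
qed

lemma pcoeff_pmul_power_sum_comp:
  assumes "\<sigma> permutes {1..r + s}" "\<And>i. i \<in> {1..r + s} ==> \<sigma> i \<le> r \<longleftrightarrow> i \<le> r"
    "\<And>m. pcoeff p (m \<circ> \<sigma>) = pcoeff p m"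
  shows "pcoeff (pmul_power_sum r s k p) (m \<circ> \<sigma>) = pcoeff (pmul_power_sum r s k p) m"
proof -
  have "(\<Sum>i\<in>{1..r + s}. psgn r k i * pshift k p i (m \<circ> \<sigma>)) = (\<Sum>i\<in>{1..r + s}. psgn r k (\<sigma> i) * pshift k p (\<sigma> i) m)"
    by (rule sum.cong) (auto simp: pshift_comp[OF permutes_bij[OF assms(1)] assms(3)] psgn_def assms(2))
  also have "\<dots> = (\<Sum>i\<in>{1..r + s}. psgn r k i * pshift k p i m)"
    using sum.permute[OF assms(1), of "\<lambda>i. psgn r k i * pshift k p i m"] by (simp add: comp_def)
  finally show ?thesis unfolding pcoeff_pmul_power_sum .
qed

lemma supersymmetric_pmul_power_sum:
  assumes r: "1 \<le> r" and s: "1 \<le> s" and p: "supersymmetric r s p"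
  shows "supersymmetric r s (pmul_power_sum r s k p)"
proof -
  have "pvars_ok r s p" using p by (simp add: supersymmetric_def)
  then have v: "pvars_ok r s (pmul_power_sum r s k p)"
    unfolding pvars_ok_def pmul_power_sum_def by (auto simp del: upt_Suc)
  have c1: "pcoeff (pmul_power_sum r s k p) (m \<circ> \<sigma>) = pcoeff (pmul_power_sum r s k p) m" if "\<sigma> permutes {1..r}" for m \<sigma>
  proof (rule pcoeff_pmul_power_sum_comp)
    show "\<sigma> permutes {1..r + s}" by (rule permutes_subset[OF that]) auto
    show "\<sigma> i \<le> r \<longleftrightarrow> i \<le> r" if "i \<in> {1..r + s}" for i
      using permutes_in_image[OF \<open>\<sigma> permutes {1..r}\<close>, of i] permutes_not_in[OF \<open>\<sigma> permutes {1..r}\<close>, of i] that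
      by (cases "i \<le> r") auto
  qed (use p that in \<open>simp add: supersymmetric_def\<close>)
  have c2: "pcoeff (pmul_power_sum r s k p) (m \<circ> \<sigma>) = pcoeff (pmul_power_sum r s k p) m" if "\<sigma> permutes {r + 1..r + s}" for m \<sigma>
  proof (rule pcoeff_pmul_power_sum_comp)
    show "\<sigma> permutes {1..r + s}" by (rule permutes_subset[OF that]) auto
    show "\<sigma> i \<le> r \<longleftrightarrow> i \<le> r" if "i \<in> {1..r + s}" for i
      using permutes_in_image[OF \<open>\<sigma> permutes {r + 1..r + s}\<close>, of i] permutes_not_in[OF \<open>\<sigma> permutes {r + 1..r + s}\<close>, of i] that
      by (cases "i \<le> r") auto
  qed (use p that in \<open>simp add: supersymmetric_def\<close>)
  have c3: "(\<Sum>a\<le>K. (- 1) ^ (K - a) * pcoeff (pmul_power_sum r s k p) (n(r := a, r + 1 := K - a))) = 0"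
    if n: "n r = 0" "n (r + 1) = 0" and K: "1 \<le> K" for n K
  proof -
    let ?n = "\<lambda>a. n(r := a, r + 1 := K - a)"
    define F where "F i = (\<Sum>a\<le>K. (- 1) ^ (K - a) * pshift k p i (?n a))" for i
    have "(\<Sum>a\<le>K. (- 1) ^ (K - a) * pcoeff (pmul_power_sum r s k p) (?n a)) = (\<Sum>i\<in>{1..r + s}. psgn r k i * F i)"
      unfolding pcoeff_pmul_power_sum sum_distrib_left F_def
      by (subst sum.swap) (simp add: mult.left_commute)
    \<comment> \<open>For a variable away from the wall the shift only changes the fixed exponents
      n, and the condition for p itself applies.\<close>
    also have "\<dots> = (\<Sum>i\<in>{r, r + 1}. psgn r k i * F i)"
    proof (rule sum.mono_neutral_right)
      show "\<forall>i\<in>{1..r + s} - {r, r + 1}. psgn r k i * F i = 0"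
      proof
        fix i assume i: "i \<in> {1..r + s} - {r, r + 1}"
        have "F i = 0"
        proof (cases "k \<le> n i")
          case True
          define n' where "n' = n(i := n i - k)"
          have "(?n a)(i := n i - k) = n'(r := a, r + 1 := K - a)" for a
            using i by (auto simp: n'_def fun_eq_iff)
          then have "F i = (\<Sum>a\<le>K. (- 1) ^ (K - a) * pcoeff p (n'(r := a, r + 1 := K - a)))"
            unfolding F_def pshift_def using i True by auto
          also have "\<dots> = 0" using p i n K unfolding supersymmetric_def by (simp add: n'_def)
          finally show ?thesis .
        next
          case False
          then show ?thesis using i by (simp add: F_def pshift_def)
        qed
        then show "psgn r k i * F i = 0" by simp
      qed
    qed (use r s in auto)
    \<comment> \<open>At the wall the factor becomes t^k - (-1)^k (-t)^k = 0; in terms of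
      coefficients, the two shifted sums differ exactly by the sign (-1)^k.\<close>
    also have "\<dots> = F r - (- 1) ^ k * F (r + 1)" by (simp add: psgn_def)
    also have "\<dots> = 0"
    proof (cases "k \<le> K")
      case False
      have "pshift k p r (?n a) = 0" "pshift k p (r + 1) (?n a) = 0" if "a \<le> K" for a
        using False that by (auto simp: pshift_def)
      then have "F r = 0" "F (r + 1) = 0" by (simp_all add: F_def)
      then show ?thesis by simp
    next
      case True
      define c where "c b = pcoeff p (n(r := b, r + 1 := K - k - b))" for b
      have "F r = (\<Sum>a\<in>{k..K}. (- 1) ^ (K - a) * c (a - k))"
        unfolding F_def
      proof (rule sum.mono_neutral_cong_right)
        fix a assume a: "a \<in> {k..K}"
        have "(?n a)(r := a - k) = n(r := a - k, r + 1 := K - k - (a - k))" using a by (auto simp: fun_eq_iff)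
        then show "(- 1) ^ (K - a) * pshift k p r (?n a) = (- 1) ^ (K - a) * c (a - k)"
          using a by (simp add: pshift_def c_def)
      qed (auto simp: pshift_def)
      also have "\<dots> = (\<Sum>b\<le>K - k. (- 1) ^ (K - k - b) * c b)"
        using True by (intro sum.reindex_bij_witness[of _ "\<lambda>b. b + k" "\<lambda>a. a - k"]) (auto simp: diff_diff_left add.commute)
      finally have 1: "F r = (\<Sum>b\<le>K - k. (- 1) ^ (K - k - b) * c b)" .
      have 2: "F (r + 1) = (\<Sum>a\<le>K - k. (- 1) ^ (K - a) * c a)"
        unfolding F_def
      proof (rule sum.mono_neutral_cong_right)
        fix a assume a: "a \<in> {..K - k}"
        have "K - a - k = K - k - a" by simp
        then have "(?n a)(r + 1 := K - a - k) = n(r := a, r + 1 := K - k - a)" by (auto simp: fun_eq_iff)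
        then show "(- 1) ^ (K - a) * pshift k p (r + 1) (?n a) = (- 1) ^ (K - a) * c a"
          using a True by (simp add: pshift_def c_def)
      next
        show "\<forall>i\<in>{..K} - {..K - k}. (- 1) ^ (K - i) * pshift k p (r + 1) (?n i) = 0"
          using True by (auto simp: pshift_def)
      qed auto
      have "(- 1) ^ k * ((- 1) ^ (K - a) * c a) = (- 1) ^ (K - k - a) * c a" if "a \<le> K - k" for a
      proof -
        have e: "k + (K - a) = 2 * k + (K - k - a)" using that True by simp
        have "(- 1 :: 'a) ^ (k + (K - a)) = (- 1) ^ (K - k - a)" unfolding e by (simp add: power_add power_mult)
        then show ?thesis by (simp add: power_add mult.assoc[symmetric])
      qed
      then show ?thesis unfolding 1 2 sum_distrib_left by simp
    qed
    finally show ?thesis .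
  qed
  show ?thesis unfolding supersymmetric_def using v c1 c2 c3 by blast
qed

context presentation
begin

definition lprod :: "(nat => nat) => nat list => 'k halg" where
  "lprod m xs = prod_list (map (\<lambda>i. l i ^ m i) xs)"

text \<open>Zeroth powers are the 1 of the ambient ring; the factor u replaces it by the unit of the
  factor.\<close>

definition mon :: "(nat => nat) => 'k halg" where
  "mon m = u * lprod m [1..<r + s + 1]"

definition ev :: "'k mpoly => 'k halg" where
  "ev p = (\<Sum>(c, m)\<leftarrow>p. c *h mon m)"

lemma u_l_power: "u * l i ^ k = l i ^ k * u"
  by (rule power_commuting_commutes[symmetric]) simp

lemma \<pi>_hpow: "\<pi> (hpow (JM r q \<rho> i) k) = u * l i ^ k"
  by (induction k) (simp_all add: u_def[symmetric] \<pi>_Tm l_def[symmetric] mult.assoc[symmetric])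

lemma \<pi>_eval_JM: "\<pi> (eval_JM r s q \<rho> p) = ev p"
proof -
  have "\<pi> (hprod (map (\<lambda>i. hpow (JM r q \<rho> i) (m i)) xs)) = u * lprod m xs" for m xs
  proof (induction xs)
    case Nil
    then show ?case by (simp add: \<pi>_hprod lprod_def)
  next
    case (Cons i xs)
    have "u * l i ^ m i * (u * lprod m xs) = u * ((l i ^ m i * u) * lprod m xs)" by (simp only: mult.assoc)
    also have "\<dots> = (u * u) * (l i ^ m i * lprod m xs)" by (simp only: u_l_power[symmetric] mult.assoc)
    finally show ?case using Cons by (simp add: \<pi>_hprod \<pi>_hpow lprod_def)
  qed
  then show ?thesis
    by (induction p) (auto simp: eval_JM_def hsum_def ev_def mon_def \<pi>_Sc \<pi>_Pl \<pi>_Sc_Tm simp del: upt_Suc)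
qed

lemma ev_append: "ev (p @ p') = ev p + ev p'" by (simp add: ev_def)

lemma ev_pscale: "ev (pscale a p) = a *h ev p"
  by (induction p) (auto simp: ev_def pscale_def hs.scale_right_distrib)

lemma ev_const: "ev [(1, \<lambda>_. 0)] = u"
proof -
  have "lprod (\<lambda>_. 0) xs = 1" for xs by (induction xs) (auto simp: lprod_def)
  then show ?thesis by (simp add: ev_def mon_def)
qed

text \<open>A polynomial is a list of terms with possible repetitions. This shows that its value
  depends only on the coefficients, which is where symmetry and supersymmetry are expressed.\<close>

lemma ev_pcoeff: "finite M ==> snd ` set p \<subseteq> M ==> ev p = (\<Sum>m\<in>M. pcoeff p m *h mon m)"
proof (induction p)
  case Nil
  then show ?case by (simp add: ev_def)
next
  case (Cons cm p)
  obtain c n where cm: "cm = (c, n)" by (cases cm)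
  have "(\<Sum>m\<in>M. pcoeff (cm # p) m *h mon m) = (\<Sum>m\<in>M. (if n = m then c else 0) *h mon m) + (\<Sum>m\<in>M. pcoeff p m *h mon m)"
    by (simp add: cm pcoeff_Cons hs.scale_left_distrib sum.distrib)
  also have "(\<Sum>m\<in>M. (if n = m then c else 0) *h mon m) = (\<Sum>m\<in>M. if n = m then c *h mon m else 0)"
    by (rule sum.cong) auto
  also have "\<dots> = c *h mon n" using Cons.prems by (simp add: cm)
  also have "(\<Sum>m\<in>M. pcoeff p m *h mon m) = ev p" using Cons by simp
  finally show ?case by (simp add: ev_def cm)
qed

lemma l_X: "k < r ==> l (Suc k) = inverse z *h (u - W.L.X k)"
  using z0 by (simp add: X_l)

lemma l_Y: "k < s ==> l (Suc (r + k)) = inverse z *h (W.Y k - u)"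
  using z0 by (simp add: Y_l)

lemma index_cases:
  assumes "1 \<le> i" "i \<le> r + s"
  obtains (left) k where "i = Suc k" "k < r" | (right) k where "i = Suc (r + k)" "k < s"
proof (cases "i \<le> r")
  case True then show ?thesis using assms left[of "i - 1"] by simp
next
  case False then show ?thesis using assms right[of "i - r - 1"] by simp
qed

lemma l_comm:
  assumes "1 \<le> i" "i \<le> r + s" "1 \<le> j" "j \<le> r + s"
  shows "l i * l j = l j * l i"
proof -
  have LL: "l (Suc a) * l (Suc b) = l (Suc b) * l (Suc a)" if "a < r" "b < r" for a b
    unfolding l_X[OF that(1)] l_X[OF that(2)] using W.L.X_comm[OF that] by (simp add: that left_diff_distrib right_diff_distrib hs.scale_right_diff_distrib algebra_simps)
  have LR: "l (Suc a) * l (Suc (r + b)) = l (Suc (r + b)) * l (Suc a)" if "a < r" "b < s" for a b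
    unfolding l_X[OF that(1)] l_Y[OF that(2)] using W.X_Y[OF that] by (simp add: that left_diff_distrib right_diff_distrib hs.scale_right_diff_distrib algebra_simps)
  have RR: "l (Suc (r + a)) * l (Suc (r + b)) = l (Suc (r + b)) * l (Suc (r + a))" if "a < s" "b < s" for a b
    unfolding l_Y[OF that(1)] l_Y[OF that(2)] using W.Y_comm[OF that] by (simp add: that left_diff_distrib right_diff_distrib hs.scale_right_diff_distrib algebra_simps)
  show ?thesis
    using assms(1,2)
  proof (cases rule: index_cases)
    case (left a)
    note l = this
    show ?thesis using assms(3,4) by (cases rule: index_cases) (use l LL LR in auto)
  next
    case (right a)
    note l = this
    show ?thesis using assms(3,4) by (cases rule: index_cases) (use l LR RR in auto)
  qed
qed

lemma lprod_commute: "(\<And>i. i \<in> set xs ==> t * l i = l i * t) ==> t * lprod m xs = lprod m xs * t"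
proof (induction xs)
  case (Cons i xs)
  have a: "t * l i ^ m i = l i ^ m i * t" using Cons.prems by (intro power_commuting_commutes[symmetric]) simp
  have b: "t * lprod m xs = lprod m xs * t" using Cons by simp
  have "lprod m (i # xs) = l i ^ m i * lprod m xs" by (simp add: lprod_def)
  then show ?case by (simp only: mult.assoc commute_mult_left[OF a] b)
qed (simp add: lprod_def)

lemma lprod_cong: "(\<And>i. i \<in> set xs ==> m i = m' i) ==> lprod m xs = lprod m' xs"
  unfolding lprod_def by (rule arg_cong[where f = prod_list]) auto

lemma lprod_append: "lprod m (xs @ ys) = lprod m xs * lprod m ys" by (simp add: lprod_def)

lemma mon_split:
  assumes "1 \<le> i" "Suc i \<le> r + s"
  shows "mon m = u * (lprod m [1..<i] * ((l i ^ m i * l (Suc i) ^ m (Suc i)) * lprod m [i + 2..<r + s + 1]))"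
proof -
  have "[1..<r + s + 1] = [1..<i] @ [i..<r + s + 1]" using assms upt_append[of 1 i "r + s + 1"] by simp
  also have "[i..<r + s + 1] = [i, Suc i] @ [i + 2..<r + s + 1]"
    using assms by (simp add: upt_conv_Cons del: upt_Suc)
  finally have e: "[1..<r + s + 1] = [1..<i] @ [i, Suc i] @ [i + 2..<r + s + 1]" .
  show ?thesis unfolding mon_def e lprod_append by (simp add: lprod_def mult.assoc del: upt_Suc)
qed

lemma mon_u: "u * mon m = mon m" "mon m * u = mon m"
proof -
  show "u * mon m = mon m" by (simp add: mon_def mult.assoc[symmetric])
  have "u * lprod m [1..<r + s + 1] = lprod m [1..<r + s + 1] * u" by (rule lprod_commute) simp
  then show "mon m * u = mon m" by (simp add: mon_def mult.assoc)
qed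

lemma ev_u: "u * ev p = ev p" "ev p * u = ev p"
  by (induction p) (auto simp: ev_def distrib_left distrib_right mon_u)

lemma l_mon:
  assumes "1 \<le> i" "i \<le> r + s"
  shows "l i ^ k * mon m = mon (m(i := m i + k))"
proof -
  have e: "[1..<r + s + 1] = [1..<i] @ i # [Suc i..<r + s + 1]"
    using assms upt_append[of 1 i "r + s + 1"] by (simp add: upt_conv_Cons del: upt_Suc)
  let ?A = "lprod m [1..<i]" and ?C = "lprod m [Suc i..<r + s + 1]"
  have c: "l i ^ k * ?A = ?A * l i ^ k"
  proof (rule lprod_commute)
    fix j assume "j \<in> set [1..<i]"
    then have "l i * l j = l j * l i" using assms l_comm by simp
    then show "l i ^ k * l j = l j * l i ^ k" by (rule power_commuting_commutes)
  qed
  have m: "mon m' = u * (lprod m' [1..<i] * (l i ^ m' i * lprod m' [Suc i..<r + s + 1]))" for m'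
    unfolding mon_def e lprod_append by (simp add: lprod_def del: upt_Suc)
  have "l i ^ k * mon m = u * (?A * ((l i ^ k * l i ^ m i) * ?C))"
    unfolding m by (simp only: mult.assoc commute_mult_left[OF u_l_power[symmetric]] commute_mult_left[OF c])
  also have "l i ^ k * l i ^ m i = l i ^ (m i + k)" by (simp add: power_add[symmetric] add.commute)
  also have "u * (?A * (l i ^ (m i + k) * ?C)) = mon (m(i := m i + k))"
  proof -
    have "lprod (m(i := m i + k)) [1..<i] = ?A" "lprod (m(i := m i + k)) [Suc i..<r + s + 1] = ?C"
      by (rule lprod_cong; auto simp del: upt_Suc)+
    then show ?thesis unfolding m by (simp del: upt_Suc)
  qed
  finally show ?thesis .
qed

definition pow_sum :: "nat => 'k halg" where
  "pow_sum k = (\<Sum>i\<in>{1..r + s}. psgn r k i *h l i ^ k)"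

lemma ev_pmul_power_sum: "ev (pmul_power_sum r s k p) = pow_sum k * ev p"
proof (induction p)
  case Nil
  then show ?case by (simp add: ev_def pmul_power_sum_def)
next
  case (Cons cm p)
  obtain c m where cm: "cm = (c, m)" by (cases cm)
  have "ev (map (\<lambda>i. (psgn r k i * c, m(i := m i + k))) [1..<r + s + 1]) =
      (\<Sum>i\<leftarrow>[1..<r + s + 1]. (psgn r k i * c) *h mon (m(i := m i + k)))"
    by (simp add: ev_def comp_def del: upt_Suc)
  also have "\<dots> = (\<Sum>i\<in>{1..r + s}. (psgn r k i * c) *h mon (m(i := m i + k)))"
    by (simp add: sum_list_distinct_conv_sum_set atLeastLessThanSuc_atLeastAtMost del: upt_Suc)
  also have "\<dots> = pow_sum k * (c *h mon m)"
    unfolding pow_sum_def sum_distrib_right by (rule sum.cong) (auto simp: l_mon mult.commute)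
  finally have "ev (map (\<lambda>i. (psgn r k i * c, m(i := m i + k))) [1..<r + s + 1]) = pow_sum k * (c *h mon m)" .
  moreover have "pmul_power_sum r s k (cm # p) = map (\<lambda>i. (psgn r k i * c, m(i := m i + k))) [1..<r + s + 1] @ pmul_power_sum r s k p"
    by (simp add: pmul_power_sum_def cm del: upt_Suc)
  moreover have "ev (cm # p) = c *h mon m + ev p" by (simp add: ev_def cm)
  ultimately show ?case using Cons by (simp add: ev_append distrib_left)
qed

text \<open>The ordinary binomial theorem, applied to a vector x fixed by u because the zeroth power
  on the left is 1 and not u.\<close>

lemma binomial_expand:
  assumes "u * x = x" "u * y = y"
  shows "(u + a *h y) ^ n * x = (\<Sum>k\<le>n. (of_nat (n choose k) * a ^ k) *h (y ^ k * x))"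
proof (induction n)
  case 0
  then show ?case by simp
next
  case (Suc n)
  have uk: "u * (y ^ k * x) = y ^ k * x" for k
    using assms by (cases k) (simp_all add: mult.assoc[symmetric])
  have "(u + a *h y) ^ Suc n * x = (u + a *h y) * (\<Sum>k\<le>n. (of_nat (n choose k) * a ^ k) *h (y ^ k * x))"
    using Suc by (simp add: mult.assoc)
  also have "\<dots> = (\<Sum>k\<le>n. (of_nat (n choose k) * a ^ k) *h (y ^ k * x)) + (\<Sum>k\<le>n. (of_nat (n choose k) * a ^ Suc k) *h (y ^ Suc k * x))"
    by (simp add: distrib_right sum_distrib_left uk mult.assoc mult.left_commute mult.commute hs.scale_right_distrib sum.distrib)
  also have "(\<Sum>k\<le>n. (of_nat (n choose k) * a ^ k) *h (y ^ k * x)) = x + (\<Sum>k\<le>n. (of_nat (n choose Suc k) * a ^ Suc k) *h (y ^ Suc k * x))"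
  proof -
    have "(\<Sum>k\<le>n. (of_nat (n choose k) * a ^ k) *h (y ^ k * x)) = (\<Sum>k\<le>Suc n. (of_nat (n choose k) * a ^ k) *h (y ^ k * x))"
      by (simp add: binomial_eq_0)
    also have "\<dots> = x + (\<Sum>k\<le>n. (of_nat (n choose Suc k) * a ^ Suc k) *h (y ^ Suc k * x))"
      by (subst sum.atMost_Suc_shift) simp
    finally show ?thesis .
  qed
  also have "x + (\<Sum>k\<le>n. (of_nat (n choose Suc k) * a ^ Suc k) *h (y ^ Suc k * x)) + (\<Sum>k\<le>n. (of_nat (n choose k) * a ^ Suc k) *h (y ^ Suc k * x))
      = x + (\<Sum>k\<le>n. (of_nat (Suc n choose Suc k) * a ^ Suc k) *h (y ^ Suc k * x))"
    by (simp add: add.assoc sum.distrib[symmetric] hs.scale_left_distrib[symmetric] distrib_right add.commute)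
  also have "\<dots> = (\<Sum>k\<le>Suc n. (of_nat (Suc n choose k) * a ^ k) *h (y ^ k * x))"
    by (subst sum.atMost_Suc_shift) simp
  finally show ?case .
qed

text \<open>Since X = u - z l on the left and Y = u + z l on the right, the binomial coefficients on
  both sides differ by (-1)^k, which is the sign built into the supersymmetric power sums.\<close>

lemma Z_pow_sum:
  assumes "u * x = x"
  shows "W.Z n * x = (\<Sum>k\<le>n. (of_nat (n choose k) * (- z) ^ k) *h (pow_sum k * x))"
proof -
  have X: "W.L.X i ^ n * x = (\<Sum>k\<le>n. (of_nat (n choose k) * (- z) ^ k) *h (l (Suc i) ^ k * x))" if "i < r" for i
    using binomial_expand[OF assms l_u(1)[of "Suc i"], of "- z" n] X_l[OF that] by (simp only: hs.scale_minus_left diff_conv_add_uminus)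
  have Y: "W.Y j ^ n * x = (\<Sum>k\<le>n. (of_nat (n choose k) * z ^ k) *h (l (Suc (r + j)) ^ k * x))" if "j < s" for j
    using binomial_expand[OF assms l_u(1)[of "Suc (r + j)"], of z n] Y_l[OF that] by simp
  have P: "pow_sum k = (\<Sum>i<r. l (Suc i) ^ k) - (\<Sum>j<s. (- 1) ^ k *h l (Suc (r + j)) ^ k)" for k
  proof -
    have "pow_sum k = (\<Sum>i\<in>{1..r}. psgn r k i *h l i ^ k) + (\<Sum>i\<in>{r + 1..r + s}. psgn r k i *h l i ^ k)"
      unfolding pow_sum_def by (subst sum.union_disjoint[symmetric]) (auto intro: sum.cong)
    also have "(\<Sum>i\<in>{1..r}. psgn r k i *h l i ^ k) = (\<Sum>i<r. l (Suc i) ^ k)"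
      by (rule sum.reindex_bij_witness[of _ Suc "\<lambda>i. i - 1"]) (auto simp: psgn_def)
    also have "(\<Sum>i\<in>{r + 1..r + s}. psgn r k i *h l i ^ k) = (\<Sum>j<s. - ((- 1) ^ k *h l (Suc (r + j)) ^ k))"
      by (rule sum.reindex_bij_witness[of _ "\<lambda>j. Suc (r + j)" "\<lambda>i. i - r - 1"]) (auto simp: psgn_def)
    finally show ?thesis by (simp add: sum_negf)
  qed
  have zk: "(- z) ^ k * (- 1) ^ k = z ^ k" for k by (simp add: power_mult_distrib[symmetric])
  have "W.Z n * x = (\<Sum>i<r. W.L.X i ^ n * x) - (\<Sum>j<s. W.Y j ^ n * x)"
    by (simp add: W.Z_def left_diff_distrib sum_distrib_right)
  also have "\<dots> = (\<Sum>k\<le>n. (\<Sum>i<r. (of_nat (n choose k) * (- z) ^ k) *h (l (Suc i) ^ k * x))) -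
      (\<Sum>k\<le>n. (\<Sum>j<s. (of_nat (n choose k) * z ^ k) *h (l (Suc (r + j)) ^ k * x)))"
    by (subst sum.swap, subst (2) sum.swap) (simp add: X Y)
  also have "\<dots> = (\<Sum>k\<le>n. (of_nat (n choose k) * (- z) ^ k) *h (pow_sum k * x))"
    unfolding sum_subtractf[symmetric]
    by (rule sum.cong)
      (simp_all only: P left_diff_distrib sum_distrib_right hs.scale_right_diff_distrib hs.scale_sum_right
        hs.mult_scale_left hs.scale_scale zk mult.assoc)
  finally show ?thesis .
qed

lemma alg_Z_supersymmetric:
  assumes "x \<in> hs.alg (range (\<lambda>p. W.Z (Suc p))) u"
  shows "\<exists>p. supersymmetric r s p \<and> ev p = x"
  using assms
proof induction
  case alg_unit
  then show ?case using supersymmetric_const ev_const by blast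
next
  case (alg_add x y)
  then show ?case using supersymmetric_append ev_append by metis
next
  case (alg_scale x a)
  then show ?case using supersymmetric_pscale ev_pscale by metis
next
  case (alg_gen g x)
  then obtain p n where p: "supersymmetric r s p" "x = ev p" and n: "g = W.Z (Suc n)" by auto
  have "\<exists>p'. supersymmetric r s p' \<and> ev p' = (\<Sum>k\<in>I. c k *h (pow_sum k * x))" if "finite I" for I :: "nat set" and c
    using that
  proof (induction I)
    case empty
    then show ?case using supersymmetric_pscale[OF p(1), of 0] ev_pscale[of 0 p] by (intro exI[of _ "pscale 0 p"]) simp
  next
    case (insert k I)
    then obtain p' where p': "supersymmetric r s p'" "ev p' = (\<Sum>k\<in>I. c k *h (pow_sum k * x))" by blast
    have "supersymmetric r s (pscale (c k) (pmul_power_sum r s k p) @ p')"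
      by (intro supersymmetric_append supersymmetric_pscale supersymmetric_pmul_power_sum r1 s1 p p')
    moreover have "ev (pscale (c k) (pmul_power_sum r s k p) @ p') = (\<Sum>k\<in>insert k I. c k *h (pow_sum k * x))"
      using insert.hyps by (simp add: ev_append ev_pscale ev_pmul_power_sum p'(2) p(2))
    ultimately show ?case by blast
  qed
  note comb = this
  have "u * x = x" using ev_u(1) p(2) by simp
  from Z_pow_sum[OF this, of "Suc n"] show ?case unfolding n using comb[OF finite_atMost] by metis
qed

subsection \<open>Centrality\<close>

text \<open>Averaging over the transposition of the variables i and i + 1 writes 2
  \<open>ev p\<close> as a combination of sums of two exchanged monomials, each of which commutes
  with t; hence the assumption that 2 is invertible.\<close>

lemma ev_commute_swap:
  assumes two: "(2::'k) \<noteq> 0" and i: "1 \<le> i" "Suc i \<le> r + s"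
    and p: "\<And>m. pcoeff p (m \<circ> transpose i (Suc i)) = pcoeff p m"
    and ut: "u * t = t" "t * u = t"
    and tl: "\<And>j. 1 \<le> j ==> j \<le> r + s ==> j \<noteq> i ==> j \<noteq> Suc i ==> t * l j = l j * t"
    and pair: "\<And>a b. t * (l i ^ a * l (Suc i) ^ b + l i ^ b * l (Suc i) ^ a) = (l i ^ a * l (Suc i) ^ b + l i ^ b * l (Suc i) ^ a) * t"
  shows "t * ev p = ev p * t"
proof -
  define sw where "sw m = m \<circ> transpose i (Suc i)" for m :: "nat => nat"
  have sw_sw: "sw (sw m) = m" for m by (simp add: sw_def comp_assoc)
  define M where "M = snd ` set p \<union> sw ` (snd ` set p)"
  have M: "finite M" "snd ` set p \<subseteq> M" by (auto simp: M_def)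
  have swM: "sw m \<in> M" if "m \<in> M" for m using that sw_sw by (auto simp: M_def)
  have e1: "ev p = (\<Sum>m\<in>M. pcoeff p m *h mon m)" by (rule ev_pcoeff[OF M])
  also have "\<dots> = (\<Sum>m\<in>M. pcoeff p m *h mon (sw m))"
    by (rule sum.reindex_bij_witness[of _ sw sw]) (use swM sw_sw p in \<open>auto simp: sw_def\<close>)
  finally have e2: "ev p = (\<Sum>m\<in>M. pcoeff p m *h mon (sw m))" .
  have e: "ev p + ev p = (\<Sum>m\<in>M. pcoeff p m *h (mon m + mon (sw m)))"
    by (subst (1) e1, subst e2) (simp add: sum.distrib[symmetric] hs.scale_right_distrib)
  have c: "t * (mon m + mon (sw m)) = (mon m + mon (sw m)) * t" for m
  proof -
    let ?A = "lprod m [1..<i]" and ?C = "lprod m [i + 2..<r + s + 1]"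
    let ?P = "l i ^ m i * l (Suc i) ^ m (Suc i) + l i ^ m (Suc i) * l (Suc i) ^ m i"
    have "lprod (sw m) [1..<i] = ?A" "lprod (sw m) [i + 2..<r + s + 1] = ?C"
      by (rule lprod_cong; auto simp: sw_def transpose_def simp del: upt_Suc)+
    then have "mon (sw m) = u * (?A * ((l i ^ m (Suc i) * l (Suc i) ^ m i) * ?C))"
      using mon_split[OF i, of "sw m"] by (simp add: sw_def del: upt_Suc)
    then have s: "mon m + mon (sw m) = u * (?A * (?P * ?C))"
      using mon_split[OF i, of m] by (simp add: distrib_left distrib_right del: upt_Suc)
    have A: "t * ?A = ?A * t" by (rule lprod_commute) (use i in \<open>auto intro: tl\<close>)
    have C: "t * ?C = ?C * t" by (rule lprod_commute) (use i in \<open>auto intro: tl simp del: upt_Suc\<close>)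
    have tu: "t * u = u * t" using ut by simp
    show ?thesis unfolding s
      by (simp only: mult.assoc commute_mult_left[OF tu] commute_mult_left[OF A] commute_mult_left[OF pair] C)
  qed
  have "t * (ev p + ev p) = (ev p + ev p) * t"
    unfolding e sum_distrib_left sum_distrib_right by (rule sum.cong) (simp_all add: c)
  then have "(2::'k) *h (t * ev p - ev p * t) = 0"
    by (simp add: distrib_left distrib_right hs.scale_right_diff_distrib hs.scale_left_distrib[of 1 1, simplified])
  then show ?thesis using two by simp
qed

text \<open>For additive Jucys-Murphy elements the error term of \<open>pair_symmetric\<close> is u
  + c y.\<close>

lemma swap_pair:
  assumes t: "t * t = u + c *h t" "u * t = t" "t * u = t"
    and y: "y = t * (x * t) + t" and ux: "u * x = x" "x * u = x" and xy: "x * y = y * x"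
  shows "t * (x ^ a * y ^ b + x ^ b * y ^ a) = (x ^ a * y ^ b + x ^ b * y ^ a) * t"
proof (rule hs.pair_symmetric)
  have "y * t = t * (x * (t * t)) + t * t" unfolding y by (simp only: distrib_right mult.assoc)
  also have "\<dots> = t * x + c *h (t * (x * t)) + (u + c *h t)" by (simp add: t(1) distrib_left ux)
  finally show "y * t = t * x + (u + c *h y)" unfolding y by (simp add: hs.scale_right_distrib add_ac)
  have "t * y = (t * t) * (x * t) + t * t" unfolding y by (simp only: distrib_left mult.assoc)
  also have "\<dots> = x * t + c *h (t * (x * t)) + (u + c *h t)" by (simp add: t(1) distrib_right ux mult.assoc[symmetric])
  finally show "t * y = x * t + (u + c *h y)" unfolding y by (simp add: hs.scale_right_distrib add_ac)
  show "x * y = y * x" by (rule xy)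
  show "(u + c *h y) * x = x * (u + c *h y)" using xy ux by (simp add: distrib_left distrib_right)
qed

lemma EE_l: "EE * l (Suc r) = - (EE * l r)" "l (Suc r) * EE = - (l r * EE)"
proof -
  have r: "r = Suc (r - 1)" using r1 by simp
  have lr: "l r = inverse z *h (u - W.L.X (r - 1))" by (subst r, subst l_X) (use r1 in auto)
  have ly: "l (Suc r) = inverse z *h (W.Y 0 - u)" using l_Y[of 0] s1 by simp
  show "EE * l (Suc r) = - (EE * l r)" "l (Suc r) * EE = - (l r * EE)"
    using W.E_Y0[OF r1 s1] W.Y0_E[OF r1 s1] unfolding lr ly
    by (simp_all add: right_diff_distrib left_diff_distrib hs.scale_minus_right[symmetric])
qed

lemma EE_l_comm: "1 \<le> j ==> j \<le> r + s ==> j \<noteq> r ==> j \<noteq> Suc r ==> EE * l j = l j * EE"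
proof (erule (1) index_cases)
  fix k assume "j \<noteq> r" "j = Suc k" "k < r"
  then show ?thesis using W.E_X[of k] by (simp add: l_X left_diff_distrib right_diff_distrib)
next
  fix k assume k: "j \<noteq> Suc r" "j = Suc (r + k)" "k < s"
  then obtain k' where "k = Suc k'" by (cases k) auto
  then show ?thesis using W.E_Y[of k'] k l_Y[of k] by (simp add: left_diff_distrib right_diff_distrib)
qed

lemma EE_l_power:
  "EE * (l r ^ a * l (Suc r) ^ b) = (- 1) ^ b *h (EE * l r ^ (a + b))"
  "(l r ^ a * l (Suc r) ^ b) * EE = (- 1) ^ b *h (l r ^ (a + b) * EE)"
proof -
  have c: "l r * l (Suc r) = l (Suc r) * l r" using l_comm r1 s1 by simp
  have ca: "l r ^ a * l (Suc r) ^ b = l (Suc r) ^ b * l r ^ a" for a b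
    by (rule power_commuting_commutes, rule power_commuting_commutes[symmetric], rule c[symmetric])
  have 1: "EE * l (Suc r) ^ b = (- 1) ^ b *h (EE * l r ^ b)" for b
  proof (induction b)
    case (Suc b)
    have "EE * l (Suc r) ^ Suc b = - (EE * (l r * l (Suc r) ^ b))" by (simp add: mult.assoc[symmetric] EE_l)
    also have "l r * l (Suc r) ^ b = l (Suc r) ^ b * l r" using ca[of 1 b] by simp
    also have "EE * (l (Suc r) ^ b * l r) = (- 1) ^ b *h (EE * (l r ^ b * l r))" using Suc by (simp add: mult.assoc[symmetric])
    finally show ?case by (simp add: power_commutes)
  qed simp
  have 2: "l (Suc r) ^ b * EE = (- 1) ^ b *h (l r ^ b * EE)" for b
  proof (induction b)
    case (Suc b)
    have "l (Suc r) ^ Suc b * EE = - (l (Suc r) ^ b * (l r * EE))" by (simp add: power_Suc2 mult.assoc EE_l del: power_Suc)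
    also have "l (Suc r) ^ b * (l r * EE) = l r * (l (Suc r) ^ b * EE)" using ca[of 1 b] by (simp add: mult.assoc[symmetric])
    also have "\<dots> = (- 1) ^ b *h (l r * (l r ^ b * EE))" using Suc by simp
    finally show ?case by (simp add: mult.assoc)
  qed simp
  have "EE * (l r ^ a * l (Suc r) ^ b) = (EE * l (Suc r) ^ b) * l r ^ a" by (simp only: ca mult.assoc)
  also have "\<dots> = (- 1) ^ b *h (EE * l r ^ (a + b))" by (simp add: 1 mult.assoc power_add[symmetric] add.commute)
  finally show "EE * (l r ^ a * l (Suc r) ^ b) = (- 1) ^ b *h (EE * l r ^ (a + b))" .
  show "(l r ^ a * l (Suc r) ^ b) * EE = (- 1) ^ b *h (l r ^ (a + b) * EE)"
    by (simp add: 2 mult.assoc[symmetric] power_add) (simp add: mult.assoc 2)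
qed

text \<open>Next to E the elements l_r and - l_(r+1) agree, so a monomial contributes with the sign
  (-1)^b, b being its exponent of the second one. For fixed other exponents and total degree k in
  these two, the coefficients add up to the expression that supersymmetry makes zero for k \<ge> 1;
  the terms with k = 0 commute with E.\<close>

lemma EE_ev:
  assumes p: "supersymmetric r s p"
  shows "EE * ev p = ev p * EE"
proof -
  define N where "N = (\<lambda>m. m(r := 0, Suc r := 0)) ` (snd ` set p)"
  have finN: "finite N" by (simp add: N_def)
  have N0: "n r = 0" "n (Suc r) = 0" if "n \<in> N" for n using that by (auto simp: N_def)
  obtain K where K: "\<And>m. m \<in> snd ` set p ==> m r + m (Suc r) \<le> K"
  proof -
    have "finite ((\<lambda>m. m r + m (Suc r)) ` (snd ` set p))" by simp
    then obtain K where "\<forall>x\<in>(\<lambda>m. m r + m (Suc r)) ` (snd ` set p). x \<le> K" using finite_nat_set_iff_bounded_le by meson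
    then show ?thesis using that by blast
  qed
  \<comment> \<open>Exponents are parametrised by the part away from the wall, the total degree k in
    the two wall variables and the exponent a of the first of them.\<close>
  define F where "F = (\<lambda>(n, k, a). n(r := a, Suc r := k - a) :: nat => nat)"
  define I where "I = (SIGMA n:N. SIGMA k:{..K}. {..k})"
  have finI: "finite I" using finN by (auto simp: I_def)
  have sub: "snd ` set p \<subseteq> F ` I"
  proof
    fix m assume m: "m \<in> snd ` set p"
    have "m = F (m(r := 0, Suc r := 0), m r + m (Suc r), m r)" by (auto simp: F_def fun_eq_iff)
    moreover have "(m(r := 0, Suc r := 0), m r + m (Suc r), m r) \<in> I" using m K by (auto simp: I_def N_def)
    ultimately show "m \<in> F ` I" by blast
  qed
  have inj: "inj_on F I"
  proof (rule inj_onI)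
    fix x y assume xy: "x \<in> I" "y \<in> I" "F x = F y"
    obtain n k a n' k' a' where e: "x = (n, k, a)" "y = (n', k', a')" by (cases x, cases y) auto
    note h = xy[unfolded e]
    from h have f: "(n(r := a, Suc r := k - a)) x = (n'(r := a', Suc r := k' - a')) x" for x by (simp add: F_def)
    have a: "a = a'" "k - a = k' - a'" using f[of r] f[of "Suc r"] by simp_all
    moreover have "a \<le> k" "a' \<le> k'" using h by (auto simp: I_def)
    moreover have "n x = n' x" for x using f[of x] N0[of n] N0[of n'] h by (cases "x = r \<or> x = Suc r") (auto simp: I_def)
    ultimately show "x = y" by (auto simp: e)
  qed
  have ev: "ev p = (\<Sum>n\<in>N. \<Sum>k\<le>K. \<Sum>a\<le>k. pcoeff p (n(r := a, Suc r := k - a)) *h mon (n(r := a, Suc r := k - a)))"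
  proof -
    have "ev p = (\<Sum>m\<in>F ` I. pcoeff p m *h mon m)" by (rule ev_pcoeff) (use finI sub in auto)
    also have "\<dots> = (\<Sum>x\<in>I. pcoeff p (F x) *h mon (F x))" using sum.reindex[OF inj] by (simp add: comp_def)
    also have "\<dots> = (\<Sum>n\<in>N. \<Sum>k\<le>K. \<Sum>a\<le>k. pcoeff p (F (n, k, a)) *h mon (F (n, k, a)))"
      unfolding I_def using finN by (simp add: sum.Sigma split_def)
    finally show ?thesis by (simp add: F_def)
  qed
  have rs: "1 \<le> r" "Suc r \<le> r + s" using r1 s1 by auto
  define W where "W n k = u * (lprod n [1..<r] * (l r ^ k * lprod n [r + 2..<r + s + 1]))" for n k
  have A: "EE * lprod n [1..<r] = lprod n [1..<r] * EE" for n by (rule lprod_commute) (auto intro: EE_l_comm)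
  have C: "EE * lprod n [r + 2..<r + s + 1] = lprod n [r + 2..<r + s + 1] * EE" for n
    by (rule lprod_commute) (auto intro: EE_l_comm simp del: upt_Suc)
  have cu: "EE * u = u * EE" by simp
  have mon: "mon (n(r := a, Suc r := k - a)) = u * (lprod n [1..<r] * ((l r ^ a * l (Suc r) ^ (k - a)) * lprod n [r + 2..<r + s + 1]))" for n a k
  proof -
    have "lprod (n(r := a, Suc r := k - a)) [1..<r] = lprod n [1..<r]"
      "lprod (n(r := a, Suc r := k - a)) [r + 2..<r + s + 1] = lprod n [r + 2..<r + s + 1]"
      by (rule lprod_cong; auto simp del: upt_Suc)+
    then show ?thesis unfolding mon_split[OF rs] by (simp del: upt_Suc)
  qed
  have monL: "EE * mon (n(r := a, Suc r := k - a)) = (- 1) ^ (k - a) *h (EE * W n k)" if "a \<le> k" for n a k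
  proof -
    have "EE * mon (n(r := a, Suc r := k - a)) = u * (lprod n [1..<r] * ((EE * (l r ^ a * l (Suc r) ^ (k - a))) * lprod n [r + 2..<r + s + 1]))"
      unfolding mon by (simp only: mult.assoc commute_mult_left[OF A] commute_mult_left[OF cu])
    also have "\<dots> = (- 1) ^ (k - a) *h (u * (lprod n [1..<r] * ((EE * l r ^ k) * lprod n [r + 2..<r + s + 1])))"
      using that by (simp add: EE_l_power(1) del: upt_Suc)
    also have "u * (lprod n [1..<r] * ((EE * l r ^ k) * lprod n [r + 2..<r + s + 1])) = EE * W n k"
      unfolding W_def by (simp only: mult.assoc commute_mult_left[OF A] commute_mult_left[OF cu])
    finally show ?thesis .
  qed
  have monR: "mon (n(r := a, Suc r := k - a)) * EE = (- 1) ^ (k - a) *h (W n k * EE)" if "a \<le> k" for n a k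
  proof -
    have "mon (n(r := a, Suc r := k - a)) * EE = u * (lprod n [1..<r] * (((l r ^ a * l (Suc r) ^ (k - a)) * EE) * lprod n [r + 2..<r + s + 1]))"
      unfolding mon by (simp only: mult.assoc C)
    also have "\<dots> = (- 1) ^ (k - a) *h (u * (lprod n [1..<r] * ((l r ^ k * EE) * lprod n [r + 2..<r + s + 1])))"
      using that by (simp add: EE_l_power(2) del: upt_Suc)
    also have "u * (lprod n [1..<r] * ((l r ^ k * EE) * lprod n [r + 2..<r + s + 1])) = W n k * EE"
      unfolding W_def by (simp only: mult.assoc C)
    finally show ?thesis .
  qed
  define f where "f n k = (\<Sum>a\<le>k. (- 1) ^ (k - a) * pcoeff p (n(r := a, Suc r := k - a)))" for n k
  have f0: "f n k = 0" if "n \<in> N" "1 \<le> k" for n k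
    using p N0[OF that(1)] that(2) unfolding supersymmetric_def f_def by simp
  have L: "EE * ev p = (\<Sum>n\<in>N. \<Sum>k\<le>K. f n k *h (EE * W n k))"
    unfolding ev sum_distrib_left f_def hs.scale_sum_left
    by (intro sum.cong HOL.refl) (simp add: monL mult.commute)
  have R: "ev p * EE = (\<Sum>n\<in>N. \<Sum>k\<le>K. f n k *h (W n k * EE))"
    unfolding ev sum_distrib_right f_def hs.scale_sum_left
    by (intro sum.cong HOL.refl) (simp add: monR mult.commute)
  have "f n k *h (EE * W n k) = f n k *h (W n k * EE)" if "n \<in> N" for n k
  proof (cases "k = 0")
    case True
    have "EE * W n 0 = W n 0 * EE" unfolding W_def
      by (simp only: power_0 mult_1_left mult.assoc C commute_mult_left[OF A] commute_mult_left[OF cu])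
    then show ?thesis using True by simp
  next
    case False
    then show ?thesis using f0[OF that, of k] by simp
  qed
  then show ?thesis unfolding L R by (intro sum.cong HOL.refl) auto
qed

lemma ev_central:
  assumes two: "(2::'k) \<noteq> 0" and p: "supersymmetric r s p" and b: "b \<in> W.B"
  shows "b * ev p = ev p * b"
proof (rule W.B_commuteI[OF ev_u _ _ EE_ev[OF p] b])
  fix k assume k: "Suc k < r"
  show "gg k * ev p = ev p * gg k"
  proof (rule ev_commute_swap[OF two, of "Suc k"])
    show "pcoeff p (m \<circ> transpose (Suc k) (Suc (Suc k))) = pcoeff p m" for m
      using p permutes_swap_id[of "Suc k" "{1..r}" "Suc (Suc k)"] k unfolding supersymmetric_def by auto
    show "gg k * l j = l j * gg k" if j: "1 \<le> j" "j \<le> r + s" "j \<noteq> Suc k" "j \<noteq> Suc (Suc k)" for j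
      using j(1,2)
    proof (cases rule: index_cases)
      case (left i)
      then show ?thesis using W.L.S_X_comm[OF k, of i] j by (simp add: l_X left_diff_distrib right_diff_distrib k)
    next
      case (right i)
      then show ?thesis using W.g_Y[OF k, of i] by (simp add: l_Y left_diff_distrib right_diff_distrib k)
    qed
    show "gg k * (l (Suc k) ^ a * l (Suc (Suc k)) ^ b + l (Suc k) ^ b * l (Suc (Suc k)) ^ a) =
        (l (Suc k) ^ a * l (Suc (Suc k)) ^ b + l (Suc k) ^ b * l (Suc (Suc k)) ^ a) * gg k" for a b
      by (rule swap_pair[OF W.L.quad[OF k]]) (use k l_left[of k] l_comm[of "Suc k" "Suc (Suc k)"] in auto)
  qed (use k in auto)
next
  fix k assume k: "Suc k < s"
  show "TT k * ev p = ev p * TT k"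
  proof (rule ev_commute_swap[OF two, of "Suc (r + k)"])
    show "pcoeff p (m \<circ> transpose (Suc (r + k)) (Suc (Suc (r + k)))) = pcoeff p m" for m
      using p permutes_swap_id[of "Suc (r + k)" "{r + 1..r + s}" "Suc (Suc (r + k))"] k unfolding supersymmetric_def by auto
    show "TT k * l j = l j * TT k" if j: "1 \<le> j" "j \<le> r + s" "j \<noteq> Suc (r + k)" "j \<noteq> Suc (Suc (r + k))" for j
      using j(1,2)
    proof (cases rule: index_cases)
      case (left i)
      then show ?thesis using W.T_X[OF _ k, of i] by (simp add: l_X left_diff_distrib right_diff_distrib k)
    next
      case (right i)
      then show ?thesis using W.T_Y_comm[OF k, of i] j by (simp add: l_Y left_diff_distrib right_diff_distrib k)
    qed
    show "TT k * (l (Suc (r + k)) ^ a * l (Suc (Suc (r + k))) ^ b + l (Suc (r + k)) ^ b * l (Suc (Suc (r + k))) ^ a) =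
        (l (Suc (r + k)) ^ a * l (Suc (Suc (r + k))) ^ b + l (Suc (r + k)) ^ b * l (Suc (Suc (r + k))) ^ a) * TT k" for a b
      by (rule swap_pair[OF SR.quad[OF k]]) (use k l_right[of "Suc k"] l_comm[of "Suc (r + k)" "Suc (Suc (r + k))"] in auto)
  qed (use k in auto)
qed

theorem in_center_iff_supersymmetric:
  assumes "(2::'k) \<noteq> 0" "W.resolved \<Omega> \<epsilon>" "wf r s x"
  shows "in_center r s q \<rho> x \<longleftrightarrow> (\<exists>p. supersymmetric r s p \<and> heq r s q \<rho> x (eval_JM r s q \<rho> p))"
proof -
  have "heq r s q \<rho> x (eval_JM r s q \<rho> p) \<longleftrightarrow> \<pi> x = ev p" for p
    unfolding \<pi>_eq[symmetric] \<pi>_eval_JM ..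
  then show ?thesis
    using in_center_iff[OF assms(3)] ev_central[OF assms(1)] wf_B[OF assms(3)]
      W.resolved_alg[OF assms(2)] alg_Z_supersymmetric by (metis (no_types, lifting))
qed

end

section \<open>Conditional expectations and nonvanishing of weight idempotents\<close>

context hecke
begin

text \<open>The module induced from the Hecke algebra of rank \<open>n - 1\<close>: the value at \<open>j\<close> is the coefficient of
  the coset representative \<open>S j * \<dots> * S (n - 2)\<close>.\<close>

definition ind :: "nat => (nat => 'b) => nat => 'b" where
  "ind k f j = (if j < k then S (k - 1) * f j else if j = k then f (Suc k) + zq *s f k
     else if j = Suc k then f k else S k * f j)"

definition indV :: "(nat => 'b) set" where
  "indV = {f. \<forall>j. u * f j = f j \<and> (n \<le> j \<longrightarrow> f j = 0)}"

lemma indV_u: "f \<in> indV ==> u * f j = f j" by (simp add: indV_def)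

lemma ind_indV: "Suc k < n ==> f \<in> indV ==> ind k f \<in> indV"
  by (auto simp: indV_def ind_def distrib_left)

lemma ind_quad: "Suc k < n ==> f \<in> indV ==> ind k (ind k f) j = f j + zq *s ind k f j"
  by (auto simp: ind_def SSx indV_u)

lemma SST: assumes "Suc (Suc k) < n" shows "S k * (S (Suc k) * (S k * x)) = S (Suc k) * (S k * (S (Suc k) * x))"
  using arg_cong[OF braid[OF assms], of "\<lambda>y. y * x"] by (simp only: mult.assoc)

lemma ind_comm:
  assumes "Suc l < n" "Suc k < l" "f \<in> indV"
  shows "ind k (ind l f) j = ind l (ind k f) j"
proof -
  have c: "S a * (S b * x) = S b * (S a * x)" if "Suc b < n" "Suc a < b" for a b x
    using arg_cong[OF comm[OF that], of "\<lambda>y. y * x"] by (simp only: mult.assoc)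
  consider "j < k" | "j = k" | "j = Suc k" | "Suc k < j" "j < l" | "j = l" | "j = Suc l" | "Suc l < j"
    by linarith
  then show ?thesis
  proof cases
    case 1
    then show ?thesis using assms c[of "l - 1" "k - 1"] by (auto simp: ind_def)
  next
    case 4
    then show ?thesis using assms c[of "l - 1" k] by (auto simp: ind_def)
  next
    case 7
    then show ?thesis using assms c[of l k] by (auto simp: ind_def)
  qed (use assms in \<open>auto simp: ind_def distrib_left\<close>)
qed

lemma ind_braid:
  assumes "Suc (Suc k) < n" "f \<in> indV"
  shows "ind k (ind (Suc k) (ind k f)) j = ind (Suc k) (ind k (ind (Suc k) f)) j"
proof -
  consider "j < k" | "j = k" | "j = Suc k" | "j = Suc (Suc k)" | "Suc (Suc k) < j" by linarith
  then show ?thesis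
  proof cases
    case 1
    then show ?thesis using assms SST[of "k - 1"] by (auto simp: ind_def)
  next
    case 5
    then show ?thesis using assms SST[of k] by (auto simp: ind_def)
  qed (use assms in \<open>auto simp: ind_def distrib_left SSx indV_u scale_right_distrib algebra_simps\<close>)
qed

end

text \<open>The hook with arm m and leg p, first filled along the row and then down the column, so
  that for p > 0 the box added last has content - p.\<close>

fun hook :: "nat => nat => int list" where
  "hook 0 0 = [0]"
| "hook (Suc m) 0 = int (Suc m) # hook m 0"
| "hook m (Suc p) = - int (Suc p) # hook m p"

lemma set_hook: "set (hook m p) = {- int p..int m}"
proof (induction m p rule: hook.induct)
  case (2 m)
  have "{- int 0..int (Suc m)} = insert (int (Suc m)) {- int 0..int m}" by auto
  then show ?case using 2 by simp
next
  case (3 m p)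
  have "{- int (Suc p)..int m} = insert (- int (Suc p)) {- int p..int m}" by auto
  then show ?case using 3 by simp
qed simp

lemma length_hook: "length (hook m p) = Suc (m + p)"
  by (induction m p rule: hook.induct) auto

lemma hook_takeWhile: "a \<noteq> 0 ==> a \<in> set (hook m p) ==> a - sgn a \<notin> set (takeWhile (\<lambda>x. x \<noteq> a) (hook m p))"
proof (induction m p rule: hook.induct)
  case (2 m)
  then show ?case by (auto simp: set_hook sgn_if split: if_splits)
next
  case (3 m p)
  then show ?case by (auto simp: set_hook sgn_if split: if_splits)
qed auto

lemma addable_hook: "addable (hook m p) a ==> a = int m + 1 \<or> a = - int p - 1 \<or> a = 0"
  using hook_takeWhile[of a m p] set_takeWhileD[of _ "\<lambda>x. x \<noteq> a" "hook m p"]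
  by (cases "a = 0") (auto simp: addable_def set_hook sgn_if split: if_splits)

lemma addable_hook_ends: "addable (hook m p) (int m + 1)" "addable (hook m p) (- int p - 1)"
  by (auto simp: addable_def set_hook)

text \<open>Besides its two ends a hook may admit the inner corner box of content 0; the assumption
  on f removes it from the sum.\<close>

lemma sum_addable_hook:
  fixes f :: "int => 'c::comm_monoid_add"
  assumes "f 0 = 0"
  shows "(\<Sum>a\<in>{a. addable (hook m p) a}. f a) = f (int m + 1) + f (- int p - 1)"
proof -
  have "(\<Sum>a\<in>{a. addable (hook m p) a}. f a) = (\<Sum>a\<in>{int m + 1, - int p - 1}. f a)"
  proof (rule sum.mono_neutral_right)
    show "finite {a. addable (hook m p) a}"
      by (rule finite_subset[of _ "{int m + 1, - int p - 1, 0}"]) (auto dest: addable_hook)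
  qed (use addable_hook addable_hook_ends assms in auto)
  then show ?thesis by simp
qed

text \<open>\<open>ep m\<close> restricts to a conditional expectation from \<open>H (Suc m)\<close>
  to \<open>H m\<close>. The element v commutes with the Hecke algebra and the expectations;
  multiplying by it tests for nonvanishing inside a larger algebra, with v = u for one Hecke algebra
  and v an eigenvector of the other one for their product.\<close>

locale hecke_expect = hecke +
  fixes ep :: "nat => 'b => 'b" and v :: 'b
  assumes ep_add: "m < n ==> ep m (x + y) = ep m x + ep m y"
    and ep_scale: "m < n ==> ep m (a *s x) = a *s ep m x"
    and ep_S_left: "m < n ==> Suc k < m ==> ep m (S k * x) = S k * ep m x"
    and ep_S_right: "m < n ==> Suc k < m ==> ep m (x * S k) = ep m x * S k"
    and ep_u_left: "m < n ==> ep m (u * x) = u * ep m x"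
    and ep_u_right: "m < n ==> ep m (x * u) = ep m x * u"
    and ep_u: "m < n ==> ep m u = u"
    and ep_SS: "Suc m < n ==> ep (Suc m) (S m * (x * S m)) = ep m x"
    and ep_S0: "Suc m < n ==> ep (Suc m) (S m) = 0"
    and v0: "v \<noteq> 0" and uv: "u * v = v" "v * u = v"
    and v_S: "Suc k < n ==> v * S k = S k * v"
    and ep_v: "m < n ==> ep m (v * x) = v * ep m x"
begin

lemma ep_sum: "m < n ==> ep m (sum f I) = (\<Sum>i\<in>I. ep m (f i))"
  using ep_scale[of m 0 u] by (induction I rule: infinite_finite_induct) (auto simp: ep_add)

lemma ep_H_left: "m < n ==> h \<in> H m ==> ep m (h * x) = h * ep m x"
  unfolding H_def
  by (rotate_tac 1, induction rule: alg.induct)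
    (auto simp: ep_add ep_scale ep_u_left ep_S_left distrib_right mult.assoc)

lemma ep_H_right: "m < n ==> h \<in> H m ==> ep m (x * h) = ep m x * h"
  unfolding H_def
proof (rotate_tac 1, induction arbitrary: x rule: alg.induct)
  case (alg_gen g h)
  then obtain k where k: "g = S k" "Suc k < m" by auto
  have "ep m (x * (g * h)) = ep m ((x * S k) * h)" by (simp only: k(1) mult.assoc)
  also have "\<dots> = ep m (x * S k) * h" using alg_gen.IH alg_gen.prems by blast
  also have "\<dots> = ep m x * (g * h)" using alg_gen.prems k by (simp add: ep_S_right mult.assoc)
  finally show ?case .
qed (auto simp: ep_add ep_scale ep_u_right distrib_left)

lemma ep_H: "m < n ==> x \<in> H (Suc m) ==> ep m x \<in> H m"
proof (cases "m = 0")
  case True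
  assume m: "m < n" and x: "x \<in> H (Suc m)"
  from x show ?thesis unfolding H_def
    by (induction rule: alg.induct) (use m True in \<open>auto simp: ep_u ep_add ep_scale alg.alg_unit alg.alg_add alg.alg_scale\<close>)
next
  case False
  assume m: "m < n" and x: "x \<in> H (Suc m)"
  obtain k where k: "m = Suc k" using False by (cases m) auto
  have "x \<in> two_cosets m" using H_two_cosets[of m x] m x False by simp
  then show ?thesis
  proof induction
    case (base h)
    then show ?case using ep_H_left[OF m, of h u] ep_u[OF m] H_u_right[of h] by simp
  next
    case (mid h h')
    have "ep m (h * (S (m - 1) * h')) = h * (ep m (S (m - 1)) * h')"
      using m mid by (simp add: ep_H_left ep_H_right)
    also have "ep m (S (m - 1)) = 0" using ep_S0[of k] m k by simp
    finally show ?case using H_scale[OF H_u, of 0 m] by simp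
  next
    case (add x y)
    then show ?case using m unfolding H_def by (auto simp: ep_add intro: alg.alg_add)
  qed
qed

lemma ep_X: "m < n ==> ep m (X m) = u"
  by (induction m) (simp_all add: ep_u ep_SS X.simps(2))

lemma ep_S_X: "Suc m < n ==> ep (Suc m) (S m * X (Suc m)) = zq *s u"
  using ep_H_left[of "Suc m" "X m" "S m"] H_X[of m "Suc m"] ep_X[of "Suc m"]
  by (simp add: SX ep_add ep_scale ep_S0)

text \<open>One conjugation by S produces, besides the previous value, the term z S X X, whose
  expectation is again z times a Jucys-Murphy element.\<close>

lemma ep_X_X: "m < n ==> ep m (X m * X m) = u + (zq * zq) *s (\<Sum>i<m. X i)"
proof (induction m)
  case 0
  then show ?case by (simp add: ep_u)
next
  case (Suc m)
  have "X (Suc m) * X (Suc m) = S m * (X m * (S m * (S m * (X m * S m))))"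
    by (simp only: X.simps(2) mult.assoc)
  also have "\<dots> = S m * ((X m * X m) * S m) + zq *s (S m * (X m * X (Suc m)))"
    using Suc.prems by (simp add: SSx distrib_left X.simps(2) mult.assoc)
  also have "X m * X (Suc m) = X (Suc m) * X m" using X_comm Suc.prems by simp
  finally have "ep (Suc m) (X (Suc m) * X (Suc m)) = ep m (X m * X m) + zq *s ep (Suc m) ((S m * X (Suc m)) * X m)"
    using Suc.prems ep_SS[of m "X m * X m"] by (simp add: ep_add ep_scale mult.assoc)
  also have "ep (Suc m) ((S m * X (Suc m)) * X m) = zq *s X m"
    using ep_H_right[of "Suc m" "X m" "S m * X (Suc m)"] H_X[of m "Suc m"] ep_S_X[of m] Suc.prems by simp
  finally show ?case using Suc by (simp add: scale_right_distrib add.assoc)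
qed

lemma idem_split:
  assumes "Suc m \<le> n" "\<alpha> \<in> contents m"
  shows "idem m \<alpha> = (\<Sum>a\<in>{a. addable \<alpha> a}. idem (Suc m) (a # \<alpha>))"
proof -
  have d: "decomp m (idem m)" "decomp (Suc m) (idem (Suc m))" using decomp_idem assms by auto
  let ?e = "idem m \<alpha>"
  have H: "?e * u = ?e" using H_u_right decomp_H[OF d(1) assms(2)] by blast
  have "?e = (\<Sum>\<beta>\<in>contents (Suc m). ?e * idem (Suc m) \<beta>)" by (rule decomp_expand_right[OF d(2) H])
  also have "\<dots> = (\<Sum>\<beta>\<in>contents m. \<Sum>a\<in>{a. addable \<beta> a}. ?e * idem (Suc m) (a # \<beta>))" by (rule sum_contents_Suc)
  also have "\<dots> = (\<Sum>\<beta>\<in>contents m. if \<beta> = \<alpha> then \<Sum>a\<in>{a. addable \<alpha> a}. idem (Suc m) (a # \<alpha>) else 0)"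
  proof (rule sum.cong)
    fix \<beta> assume b: "\<beta> \<in> contents m"
    have w: "wt \<beta> (idem (Suc m) (a # \<beta>))" if "addable \<beta> a" for a
    proof -
      have "a # \<beta> \<in> contents (Suc m)" using that b by (simp add: contents_def)
      from decomp_wt[OF d(2) this] show ?thesis by simp
    qed
    show "(\<Sum>a\<in>{a. addable \<beta> a}. ?e * idem (Suc m) (a # \<beta>)) = (if \<beta> = \<alpha> then \<Sum>a\<in>{a. addable \<alpha> a}. idem (Suc m) (a # \<alpha>) else 0)"
    proof (cases "\<beta> = \<alpha>")
      case True
      have "?e * idem (Suc m) (a # \<alpha>) = idem (Suc m) (a # \<alpha>)" if "addable \<alpha> a" for a
        using decomp_proj[OF d(1) _ assms(2)] w[of a] that True by simp
      then show ?thesis using True by simp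
    next
      case False
      have "?e * idem (Suc m) (a # \<beta>) = 0" if "addable \<beta> a" for a
        using decomp_orth[OF d(1) w[OF that] _ assms(2)] b False by (auto simp: contents_def)
      then show ?thesis using False by simp
    qed
  qed simp
  also have "\<dots> = (\<Sum>a\<in>{a. addable \<alpha> a}. idem (Suc m) (a # \<alpha>))" using assms(2) by simp
  finally show ?thesis .
qed

text \<open>The expectation of the idempotent of a # \<alpha> is a scalar c a times that of
  \<alpha>, by multiplicity one. These scalars form a transition distribution for the next box, and
  the expectations of u, X and X^2 are its first three moments. A box whose idempotent is killed by
  v has c a = 0.\<close>

lemma moments:
  assumes m: "m < n" and \<alpha>: "\<alpha> \<in> contents m" and nz: "v * idem m \<alpha> \<noteq> 0"
  obtains c where "\<And>a. addable \<alpha> a ==> v * idem (Suc m) (a # \<alpha>) = 0 ==> c a = 0"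
    "(\<Sum>a\<in>{a. addable \<alpha> a}. c a) = 1"
    "(\<Sum>a\<in>{a. addable \<alpha> a}. c a * qe a) = 1"
    "(\<Sum>a\<in>{a. addable \<alpha> a}. c a * (qe a * qe a)) = 1 + zq * zq * (\<Sum>a\<leftarrow>\<alpha>. qe a)"
proof -
  let ?e = "idem m \<alpha>" and ?f = "\<lambda>a. idem (Suc m) (a # \<alpha>)" and ?A = "{a. addable \<alpha> a}"
  have d: "decomp m (idem m)" "decomp (Suc m) (idem (Suc m))" using decomp_idem m by auto
  have eH: "?e \<in> H m" by (rule decomp_H[OF d(1) \<alpha>])
  have len: "length \<alpha> = m" using \<alpha> by (simp add: contents_def)
  have f: "a # \<alpha> \<in> contents (Suc m)" if "addable \<alpha> a" for a using that \<alpha> by (simp add: contents_def)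
  have Xf: "X m * ?f a = qe a *s ?f a" if "addable \<alpha> a" for a
    using decomp_wt[OF d(2) f[OF that]] len by simp
  have "\<exists>k. ep m (?f a) = k *s ?e" if a: "addable \<alpha> a" for a
  proof -
    have "?f a = ?e * (?f a * ?e)"
      using decomp_proj[OF d(1) _ \<alpha>, of "?f a"] decomp_proj_right[OF d(1) _ \<alpha>, of "?f a"]
        decomp_wt[OF d(2) f[OF a]] decomp_wtR[OF d(2) f[OF a]] by simp
    then have "ep m (?f a) = ?e * ep m (?f a) * ?e"
      using ep_H_left[OF m eH, of "?f a * ?e"] ep_H_right[OF m eH, of "?f a"] by (simp add: mult.assoc)
    moreover have "ep m (?f a) \<in> H m" by (rule ep_H[OF m decomp_H[OF d(2) f[OF a]]])
    ultimately show ?thesis using idem_H_idem[OF _ \<alpha>, of "ep m (?f a)"] m by (metis less_imp_le)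
  qed
  then obtain c where c: "\<And>a. addable \<alpha> a ==> ep m (?f a) = c a *s ?e" by metis
  have es: "?e = (\<Sum>a\<in>?A. ?f a)" using idem_split m \<alpha> by simp
  have e0: "?e \<noteq> 0" using nz by auto
  have eu: "?e * u = ?e" using H_u_right[OF eH] .
  have cancel: "a = b" if "a *s ?e = b *s ?e" for a b using that e0 by simp
  have 1: "(\<Sum>a\<in>?A. c a) *s ?e = 1 *s ?e"
  proof -
    have "(\<Sum>a\<in>?A. c a) *s ?e = ep m ?e" by (subst (2) es) (simp add: ep_sum m c scale_sum_left)
    also have "\<dots> = ?e" using ep_H_left[OF m eH, of u] ep_u[OF m] eu by simp
    finally show ?thesis by simp
  qed
  have 2: "(\<Sum>a\<in>?A. c a * qe a) *s ?e = 1 *s ?e"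
  proof -
    have "(\<Sum>a\<in>?A. c a * qe a) *s ?e = ep m (X m * ?e)"
      by (subst (2) es) (simp add: sum_distrib_left Xf ep_sum ep_scale m c scale_sum_left mult.commute)
    also have "\<dots> = ?e" using ep_H_right[OF m eH, of "X m"] ep_X[OF m] H_u_left[OF _ eH] m by simp
    finally show ?thesis by simp
  qed
  have 3: "(\<Sum>a\<in>?A. c a * (qe a * qe a)) *s ?e = (1 + zq * zq * (\<Sum>a\<leftarrow>\<alpha>. qe a)) *s ?e"
  proof -
    have XX: "X m * (X m * ?f a) = (qe a * qe a) *s ?f a" if "addable \<alpha> a" for a using Xf[OF that] by simp
    have "(\<Sum>a\<in>?A. c a * (qe a * qe a)) *s ?e = ep m (X m * (X m * ?e))"
      by (subst (2) es) (simp add: sum_distrib_left XX ep_sum ep_scale m c scale_sum_left mult.commute)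
    also have "\<dots> = (u + (zq * zq) *s (\<Sum>i<m. X i)) * ?e"
      using ep_H_right[OF m eH, of "X m * X m"] ep_X_X[OF m] by (simp add: mult.assoc)
    also have "\<dots> = ?e + (zq * zq) *s ((\<Sum>i<m. X i) * ?e)" using H_u_left[OF _ eH] m by (simp add: distrib_right)
    also have "(\<Sum>i<m. X i) * ?e = (\<Sum>a\<leftarrow>\<alpha>. qe a) *s ?e"
      using psum_wt[OF decomp_wt[OF d(1) \<alpha>], of 1] len by simp
    finally show ?thesis by (simp add: scale_left_distrib)
  qed
  show ?thesis
  proof (rule that[of c])
    fix a assume a: "addable \<alpha> a" "v * ?f a = 0"
    have "0 = ep m (v * ?f a)" using a(2) ep_scale[OF m, of 0 0] by simp
    also have "\<dots> = c a *s (v * ?e)" using ep_v[OF m] c[OF a(1)] by simp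
    finally show "c a = 0" using nz by simp
  qed (use cancel[OF 1] cancel[OF 2] cancel[OF 3] in auto)
qed

definition nonvan :: "int list => bool" where
  "nonvan \<alpha> \<longleftrightarrow> content_list \<alpha> \<and> v * idem (length \<alpha>) \<alpha> \<noteq> 0"

lemma hook_sum: "(qe 1 - 1) * (\<Sum>a\<leftarrow>hook m p. qe a) = qe (int m + 1) - qe (- int p)"
proof (induction m p rule: hook.induct)
  case (2 m)
  have "qe (int (Suc m) + 1) = qe (int m + 1) * qe 1" using qe_add[of "int m + 1" 1] by (simp add: add.commute)
  then show ?case using 2 by (simp add: distrib_left left_diff_distrib right_diff_distrib algebra_simps)
next
  case (3 m p)
  have "qe (- int p) = qe (- int (Suc p)) * qe 1" using qe_add[of "- int (Suc p)" 1] by simp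
  then show ?case using 3 by (simp add: distrib_left left_diff_distrib right_diff_distrib algebra_simps)
qed simp

lemma nonvan_moments:
  assumes "nonvan \<alpha>" "length \<alpha> < n"
  obtains c where "\<And>a. addable \<alpha> a ==> \<not> nonvan (a # \<alpha>) ==> c a = 0"
    "(\<Sum>a\<in>{a. addable \<alpha> a}. c a) = 1"
    "(\<Sum>a\<in>{a. addable \<alpha> a}. c a * (qe a - 1)) = 0"
    "(\<Sum>a\<in>{a. addable \<alpha> a}. c a * ((qe a - 1) * (qe a - 1))) = zq * zq * (\<Sum>a\<leftarrow>\<alpha>. qe a)"
proof -
  have a: "\<alpha> \<in> contents (length \<alpha>)" "v * idem (length \<alpha>) \<alpha> \<noteq> 0" using assms(1) by (auto simp: nonvan_def contents_def)
  obtain c where c: "\<And>a. addable \<alpha> a ==> v * idem (Suc (length \<alpha>)) (a # \<alpha>) = 0 ==> c a = 0"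
    "(\<Sum>a\<in>{a. addable \<alpha> a}. c a) = 1"
    "(\<Sum>a\<in>{a. addable \<alpha> a}. c a * qe a) = 1"
    "(\<Sum>a\<in>{a. addable \<alpha> a}. c a * (qe a * qe a)) = 1 + zq * zq * (\<Sum>a\<leftarrow>\<alpha>. qe a)"
    using moments[OF assms(2) a] by blast
  show ?thesis
  proof (rule that[of c])
    show "(\<Sum>a\<in>{a. addable \<alpha> a}. c a * (qe a - 1)) = 0"
      using c(2,3) by (simp add: right_diff_distrib sum_subtractf)
    have "(\<Sum>a\<in>{a. addable \<alpha> a}. c a * ((qe a - 1) * (qe a - 1))) =
        (\<Sum>a\<in>{a. addable \<alpha> a}. c a * (qe a * qe a)) - 2 * (\<Sum>a\<in>{a. addable \<alpha> a}. c a * qe a) + (\<Sum>a\<in>{a. addable \<alpha> a}. c a)"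
      unfolding sum_distrib_left sum_subtractf[symmetric] sum.distrib[symmetric]
      by (rule sum.cong) (simp_all add: algebra_simps)
    then show "(\<Sum>a\<in>{a. addable \<alpha> a}. c a * ((qe a - 1) * (qe a - 1))) = zq * zq * (\<Sum>a\<leftarrow>\<alpha>. qe a)"
      using c(2-4) by simp
  qed (use c assms(1) in \<open>auto simp: nonvan_def\<close>)
qed

lemma qe_eq_1: "qe a = 1 \<longleftrightarrow> a = 0" using qe_inj[of a 0] by simp

text \<open>The function qe a - 1 vanishes at the inner corner, so only the two ends enter its
  moments. The first moment is 0 and the second is not, hence neither end can have weight 0.\<close>

lemma nonvan_hook_ext:
  assumes "nonvan (hook m p)" "Suc (m + p) < n"
  shows "nonvan ((int m + 1) # hook m p)" "nonvan ((- int p - 1) # hook m p)"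
proof -
  have l: "length (hook m p) < n" using assms(2) by (simp add: length_hook)
  obtain c where c: "\<And>a. addable (hook m p) a ==> \<not> nonvan (a # hook m p) ==> c a = 0"
    "(\<Sum>a\<in>{a. addable (hook m p) a}. c a * (qe a - 1)) = 0"
    "(\<Sum>a\<in>{a. addable (hook m p) a}. c a * ((qe a - 1) * (qe a - 1))) = zq * zq * (\<Sum>a\<leftarrow>hook m p. qe a)"
    by (rule nonvan_moments[OF assms(1) l]) blast
  let ?a = "int m + 1" and ?b = "- int p - 1"
  have c1: "c ?a * (qe ?a - 1) + c ?b * (qe ?b - 1) = 0" using c(2) by (subst (asm) sum_addable_hook) auto
  have c2: "c ?a * ((qe ?a - 1) * (qe ?a - 1)) + c ?b * ((qe ?b - 1) * (qe ?b - 1)) = zq * zq * (\<Sum>a\<leftarrow>hook m p. qe a)"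
    using c(3) by (subst (asm) sum_addable_hook) auto
  have ne: "qe ?a - 1 \<noteq> 0" "qe ?b - 1 \<noteq> 0" by (simp_all add: qe_eq_1)
  have "zq * zq * (\<Sum>a\<leftarrow>hook m p. qe a) \<noteq> 0"
  proof
    assume "zq * zq * (\<Sum>a\<leftarrow>hook m p. qe a) = 0"
    then have "(\<Sum>a\<leftarrow>hook m p. qe a) = 0" using z0 by simp
    then show False using hook_sum[of m p] by auto
  qed
  then have "c ?a \<noteq> 0" "c ?b \<noteq> 0" using c1 c2 ne by auto
  then show "nonvan (?a # hook m p)" "nonvan (?b # hook m p)" using c(1) addable_hook_ends by blast+
qed

lemma nonvan_hook: "Suc (m + p) \<le> n ==> nonvan (hook m p)"
proof (induction m p rule: hook.induct)
  case 1
  have "(\<Sum>\<alpha>\<in>contents (Suc 0). idem (Suc 0) \<alpha>) = u" using decomp_sum[OF decomp_idem[of "Suc 0"]] 1 by simp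
  then have "idem (Suc 0) [0] = u" by (simp add: contents_1)
  then show ?case using v0 uv by (simp add: nonvan_def addable_def)
next
  case (2 m)
  then show ?case using nonvan_hook_ext(1)[of m 0] by (simp add: add.commute)
next
  case (3 m p)
  have e: "hook m (Suc p) = (- int p - 1) # hook m p" by simp
  show ?case unfolding e using 3 nonvan_hook_ext(2)[of m p] by simp
qed

text \<open>If the corner box completing the 2 by 2 square had weight 0, the two ends alone would
  have to satisfy three moment equations. These are compatible only if q^(2m) = 1.\<close>

lemma nonvan_zero:
  assumes "1 \<le> m" "m + 3 \<le> n"
  shows "nonvan (0 # hook m 1)"
proof (rule ccontr)
  assume no: "\<not> nonvan (0 # hook m 1)"
  have l: "length (hook m 1) < n" using assms(2) by (simp add: length_hook del: One_nat_def)
  have nv: "nonvan (hook m 1)" by (rule nonvan_hook) (use assms in simp)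
  obtain c where c: "\<And>a. addable (hook m 1) a ==> \<not> nonvan (a # hook m 1) ==> c a = 0"
    "(\<Sum>a\<in>{a. addable (hook m 1) a}. c a) = 1"
    "(\<Sum>a\<in>{a. addable (hook m 1) a}. c a * (qe a - 1)) = 0"
    "(\<Sum>a\<in>{a. addable (hook m 1) a}. c a * ((qe a - 1) * (qe a - 1))) = zq * zq * (\<Sum>a\<leftarrow>hook m 1. qe a)"
    by (rule nonvan_moments[OF nv l]) blast
  let ?a = "int m + 1" and ?b = "- 2 :: int"
  have ab: "- int 1 - 1 = ?b" by simp
  define c' where "c' a = (if a = 0 then 0 else c a)" for a
  have "(\<Sum>a\<in>{a. addable (hook m 1) a}. c' a) = (\<Sum>a\<in>{a. addable (hook m 1) a}. c a)"
    by (rule sum.cong) (use c(1)[of 0] no in \<open>auto simp: c'_def\<close>)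
  then have c0: "c ?a + c ?b = 1"
    using c(2) sum_addable_hook[of c' m 1] unfolding ab by (simp add: c'_def del: One_nat_def)
  have c1: "c ?a * (qe ?a - 1) + c ?b * (qe ?b - 1) = 0"
    using c(3) by (subst (asm) sum_addable_hook) (auto simp del: One_nat_def simp: ab)
  have c2: "c ?a * ((qe ?a - 1) * (qe ?a - 1)) + c ?b * ((qe ?b - 1) * (qe ?b - 1)) = zq * zq * (\<Sum>a\<leftarrow>hook m 1. qe a)"
    using c(4) by (subst (asm) sum_addable_hook) (auto simp del: One_nat_def simp: ab)
  define A B x y where "A = qe ?a - 1" and "B = qe ?b - 1" and "x = c ?a" and "y = c ?b"
  have "zq * zq * (\<Sum>a\<leftarrow>hook m 1. qe a) = x * (A * A) + y * (B * B)" using c2 by (simp add: A_def B_def x_def y_def)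
  \<comment> \<open>Newton's identity for two values expresses the second moment through the first
    moment and the total mass.\<close>
  also have "\<dots> = (x * A + y * B) * (A + B) - A * B * (x + y)" by (simp add: algebra_simps)
  also have "\<dots> = - (A * B)" using c0 c1 by (simp add: A_def B_def x_def y_def)
  finally have e: "zq * zq * (\<Sum>a\<leftarrow>hook m 1. qe a) = - (A * B)" .
  \<comment> \<open>In terms of Q = q^2 and P = q^(2m) the comparison with \<open>hook_sum\<close>,
    cleared of denominators, becomes (Q - 1)^2 Q (P - 1) = 0.\<close>
  define Q P where "Q = q ^ 2" and "P = q ^ (2 * m)"
  have Q0: "Q \<noteq> 0" "Q \<noteq> 1" using q0 generic[of 2] by (auto simp: Q_def)
  have qb: "qe ?b * (Q * Q) = 1" using qe_add[of "- 2" 2] qe_add[of 1 1] by (simp add: qe1 Q_def)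
  have qm: "qe (- int 1) * Q = 1" using qe_add[of "- 1" 1] by (simp add: qe1 Q_def)
  have qa: "qe ?a = P * Q" by (simp add: qe_add qe1 Q_def P_def) (simp add: qe_def power_mult)
  have zz: "zq * zq * Q = (Q - 1) * (Q - 1)" using q0 by (simp add: zq_def Q_def power2_eq_square field_simps)
  have "(Q - 1) * (zq * zq * (\<Sum>a\<leftarrow>hook m 1. qe a)) = zq * zq * (qe ?a - qe (- int 1))"
    using hook_sum[of m 1] by (simp add: qe1 Q_def mult.left_commute)
  then have "(Q - 1) * (- (A * B)) = zq * zq * (P * Q - qe (- int 1))" unfolding e qa .
  from arg_cong[OF this, of "\<lambda>x. x * (Q * Q)"]
  have "zq * zq * Q * (Q * (P * Q) - qe (- int 1) * Q) = - (Q - 1) * A * (B * (Q * Q))"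
    by (simp add: algebra_simps)
  moreover have "B * (Q * Q) = 1 - Q * Q" using qb by (simp add: B_def left_diff_distrib)
  moreover have "A = P * Q - 1" by (simp add: A_def qa)
  ultimately have "(Q - 1) * (Q - 1) * (Q * (P * Q) - 1) = - (Q - 1) * (P * Q - 1) * (1 - Q * Q)"
    unfolding zz qm by simp
  then have "(Q - 1) * (Q - 1) * (Q * (P - 1)) = 0" by (simp add: algebra_simps)
  then have "P = 1" using Q0 by simp
  then show False using generic[of "2 * m"] assms(1) by (simp add: P_def)
qed

lemma nonvan_eigen:
  assumes "nonvan (a # \<eta>)" "n = Suc (length \<eta>)"
  shows "\<exists>h\<in>H n. v * h \<noteq> 0 \<and> h * X (n - 1) = qe a *s h"
proof -
  have c: "a # \<eta> \<in> contents n" using assms by (simp add: nonvan_def contents_def)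
  have d: "decomp n (idem n)" by (rule decomp_idem) simp
  show ?thesis using decomp_H[OF d c] decomp_wtR[OF d c] assms by (intro bexI[of _ "idem n (a # \<eta>)"]) (auto simp: nonvan_def)
qed

text \<open>The last box is the foot of a hook for content - p, the box right of the corner added to
  a column for content 1, and the single box or the inner corner of the square for content
  0.\<close>

lemma ex_eigen:
  assumes "(\<exists>p. a = - int p \<and> 1 \<le> p \<and> p + 1 \<le> n) \<or> (a = 1 \<and> 2 \<le> n) \<or> (a = 0 \<and> (n = 1 \<or> 4 \<le> n))"
  shows "\<exists>h\<in>H n. v * h \<noteq> 0 \<and> h * X (n - 1) = qe a *s h"
  using assms
proof (elim disjE exE conjE)
  fix p assume p: "a = - int p" "1 \<le> p" "p + 1 \<le> n"
  obtain k where k: "p = Suc k" using p(2) by (cases p) auto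
  have "nonvan (hook (n - p - 1) p)" by (rule nonvan_hook) (use p in simp)
  then show ?thesis using nonvan_eigen[of a "hook (n - p - 1) k"] p k by (auto simp: length_hook)
next
  assume a: "a = 1" "2 \<le> n"
  have "nonvan ((int 0 + 1) # hook 0 (n - 2))" by (rule nonvan_hook_ext) (use a nonvan_hook[of 0 "n - 2"] in auto)
  then show ?thesis using nonvan_eigen[of a "hook 0 (n - 2)"] a by (auto simp: length_hook)
next
  assume a: "a = 0" "n = 1"
  have "nonvan (hook 0 0)" by (rule nonvan_hook) (use a in simp)
  then show ?thesis using nonvan_eigen[of a "[]"] a by auto
next
  assume a: "a = 0" "4 \<le> n"
  have "nonvan (0 # hook (n - 3) 1)" by (rule nonvan_zero) (use a in auto)
  then show ?thesis using nonvan_eigen[of a "hook (n - 3) 1"] a by (auto simp: length_hook simp del: One_nat_def)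
qed

end

section \<open>Modules over the presented algebra\<close>

fun hact :: "('v => 'v => 'v) => ('k => 'v => 'v) => (gen => 'v => 'v) => 'k hexp => 'v => 'v" where
  "hact pl sc op (Gen g) v = op g v"
| "hact pl sc op (Sc a) v = sc a v"
| "hact pl sc op (Pl x y) v = pl (hact pl sc op x v) (hact pl sc op y v)"
| "hact pl sc op (Tm x y) v = hact pl sc op x (hact pl sc op y v)"

text \<open>Addition and scalar multiplication are parameters, so that functions, ring elements and
  pairs can all serve as vectors; \<open>sc 0 w\<close> plays the part of the zero vector. The
  relations are imposed only on the carrier V.\<close>

locale hmodule =
  fixes r s :: nat and q \<rho> :: "'k::field" and pl :: "'v => 'v => 'v" and sc :: "'k => 'v => 'v"
    and op :: "gen => 'v => 'v" and V :: "'v set"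
  assumes V_pl: "v \<in> V ==> w \<in> V ==> pl v w \<in> V" and V_sc: "v \<in> V ==> sc a v \<in> V"
    and V_op: "v \<in> V ==> op g v \<in> V"
    and pl_assoc: "pl (pl v w) v' = pl v (pl w v')" and pl_comm: "pl v w = pl w v"
    and pl_0: "pl v (sc 0 w) = v" and pl_neg: "pl v (sc (- 1) v) = sc 0 w"
    and sc_pl: "sc a (pl v w) = pl (sc a v) (sc a w)" and sc_add: "pl (sc a v) (sc b v) = sc (a + b) v"
    and sc_mul: "sc a (sc b v) = sc (a * b) v" and sc_1: "sc 1 v = v"
    and op_pl: "v \<in> V ==> w \<in> V ==> op g (pl v w) = pl (op g v) (op g w)"
    and op_sc: "v \<in> V ==> op g (sc a v) = sc a (op g v)"
    and act_rel: "hrel r s q \<rho> x y ==> v \<in> V ==> hact pl sc op x v = hact pl sc op y v"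
begin

abbreviation "act \<equiv> hact pl sc op"

lemma act_V: "v \<in> V ==> act x v \<in> V"
  by (induction x arbitrary: v) (auto intro: V_pl V_sc V_op)

lemma act_sc: "v \<in> V ==> act x (sc a v) = sc a (act x v)"
  by (induction x arbitrary: v) (auto simp: op_sc sc_mul mult.commute sc_pl act_V)

lemma act_pl: "v \<in> V ==> w \<in> V ==> act x (pl v w) = pl (act x v) (act x w)"
proof (induction x arbitrary: v w)
  case (Pl x y)
  have "pl (pl a b) (pl c d) = pl (pl a c) (pl b d)" for a b c d
    by (metis pl_assoc pl_comm)
  then show ?case using Pl by simp
qed (auto simp: op_pl sc_pl act_V)

lemma sc_0: "sc 0 v = sc 0 w"
  using pl_0[of "sc 0 v" w] pl_0[of "sc 0 w" v] pl_comm by metis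

lemma act_eq: "heq r s q \<rho> x y ==> v \<in> V ==> act x v = act y v"
proof (induction arbitrary: v rule: heq.induct)
  case (add_neg x)
  show ?case using pl_neg by simp
next
  case (add_comm x y)
  show ?case by (simp add: pl_comm)
next
  case (trans x y z)
  then show ?case by simp
qed (auto simp: act_rel act_V act_pl act_sc pl_assoc pl_0 sc_add sc_mul sc_1)

end

context presentation
begin

lemma left_idealD:
  assumes "left_ideal r s q \<rho> L"
  shows "x \<in> L ==> wf r s x" "x \<in> L ==> wf r s y ==> \<pi> x = \<pi> y ==> y \<in> L"
    "x \<in> L ==> y \<in> L ==> Pl x y \<in> L" "x \<in> L ==> wf r s a ==> Tm a x \<in> L"
  using assms unfolding left_ideal_def \<pi>_eq by blast+

text \<open>The component e of 1 in L: for x in L the product of x with the other component lies in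
  both left ideals and is therefore zero.\<close>

lemma semisimple_right_unit:
  assumes "semisimple r s q \<rho>" "left_ideal r s q \<rho> L"
  obtains e where "e \<in> L" "\<And>x. x \<in> L ==> \<pi> x * \<pi> e = \<pi> x"
proof -
  note L = left_idealD[OF assms(2)]
  obtain L' where 1: "left_ideal r s q \<rho> L'"
    and sum: "\<And>x. wf r s x ==> \<exists>u\<in>L. \<exists>v\<in>L'. heq r s q \<rho> x (Pl u v)"
    and int: "\<And>x. x \<in> L ==> x \<in> L' ==> heq r s q \<rho> x (Sc 0)"
    using assms unfolding semisimple_def by blast
  note L' = left_idealD[OF 1]
  obtain e v where e: "e \<in> L" and v: "v \<in> L'" and "heq r s q \<rho> (Sc 1) (Pl e v)" using sum[of "Sc 1"] by auto
  then have ev: "u = \<pi> e + \<pi> v" unfolding \<pi>_eq[symmetric] by (simp add: u_def \<pi>_Pl)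
  show ?thesis
  proof (rule that[OF e])
    fix x assume x: "x \<in> L"
    have "\<pi> x * u = \<pi> x * \<pi> e + \<pi> x * \<pi> v" unfolding ev by (rule distrib_left)
    then have xx: "\<pi> x = \<pi> x * \<pi> e + \<pi> x * \<pi> v" by simp
    have y: "Pl x (Tm (Sc (- 1)) (Tm x e)) \<in> L"
      by (intro L(3) L(4) x e) (use L(1)[OF x] in auto)
    have "Tm x v \<in> L"
    proof (rule L(2)[OF y])
      show "wf r s (Tm x v)" using L(1)[OF x] L'(1)[OF v] by simp
      show "\<pi> (Pl x (Tm (Sc (- 1)) (Tm x e))) = \<pi> (Tm x v)"
        using xx by (simp add: \<pi>_Pl \<pi>_Sc_Tm) (simp add: \<pi>_Tm algebra_simps)
    qed
    moreover have "Tm x v \<in> L'" by (rule L'(4)[OF v L(1)[OF x]])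
    ultimately have "\<pi> (Tm x v) = \<pi> (Sc 0)" unfolding \<pi>_eq by (rule int)
    then show "\<pi> x * \<pi> e = \<pi> x" using xx by (simp add: \<pi>_Tm \<pi>_Sc)
  qed
qed

text \<open>In a semisimple algebra the annihilator \<open>I\<close> of \<open>w\<close> and its multiples is generated by a central
  idempotent, so \<open>I\<close> annihilates no nonzero element of \<open>I V\<close>.\<close>

lemma not_semisimpleI:
  assumes "hmodule r s q \<rho> pl sc op V" and w: "w \<in> V" "w \<noteq> sc 0 w"
    and Ew: "\<And>x. wf r s x ==> op E (hact pl sc op x w) = sc 0 w"
    and x: "wf r s x" "v \<in> V" "w = hact pl sc op x (op E v)"
  shows "\<not> semisimple r s q \<rho>"
proof
  assume ss: "semisimple r s q \<rho>"
  interpret M: hmodule r s q \<rho> pl sc op V by fact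
  define I where "I = {c. wf r s c \<and> (\<forall>x. wf r s x \<longrightarrow> M.act c (M.act x w) = sc 0 w)}"
  have act0: "M.act a (sc 0 w) = sc 0 w" for a using M.act_sc[OF w(1), of a 0] M.sc_0 by metis
  have I: "left_ideal r s q \<rho> I"
    unfolding left_ideal_def
  proof (intro conjI ballI allI impI)
    show "Sc 0 \<in> I" using M.sc_0 by (auto simp: I_def)
    show "c' \<in> I" if "c \<in> I" "wf r s c'" "heq r s q \<rho> c c'" for c c'
      using that M.act_eq[OF that(3) M.act_V[OF w(1)]] by (auto simp: I_def)
    show "Pl c c' \<in> I" if "c \<in> I" "c' \<in> I" for c c' using that M.pl_0 by (auto simp: I_def)
  qed (use act0 in \<open>auto simp: I_def\<close>)
  note IL = left_idealD[OF I]
  have IR: "Tm c a \<in> I" if "c \<in> I" "wf r s a" for c a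
  proof -
    have "M.act (Tm c a) (M.act y w) = sc 0 w" if "wf r s y" for y
    proof -
      have "\<forall>x. wf r s x \<longrightarrow> M.act c (M.act x w) = sc 0 w" using \<open>c \<in> I\<close> by (simp add: I_def)
      from this[rule_format, of "Tm a y"] show ?thesis using \<open>wf r s a\<close> that by simp
    qed
    then show ?thesis using that by (auto simp: I_def)
  qed
  obtain e where e: "e \<in> I" "\<And>c. c \<in> I ==> \<pi> c * \<pi> e = \<pi> c" using semisimple_right_unit[OF ss I] by blast
  \<comment> \<open>The right annihilator of I inside I. It is a left ideal with N N = 0, so its
    right unit equals its own square 0 and N vanishes. As c - e c lies in N for c in I, the right
    unit e of I is also a left unit.\<close>
  define N where "N = {y \<in> I. \<forall>c\<in>I. \<pi> c * \<pi> y = 0}"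
  have "left_ideal r s q \<rho> N"
    unfolding left_ideal_def
  proof (intro conjI ballI allI impI)
    show "Sc 0 \<in> N" using I by (auto simp: N_def left_ideal_def \<pi>_Sc)
    show "y' \<in> N" if "y \<in> N" "wf r s y'" "heq r s q \<rho> y y'" for y y'
      using that IL(2)[of y y'] unfolding \<pi>_eq[symmetric] N_def by auto
    show "Pl y y' \<in> N" if "y \<in> N" "y' \<in> N" for y y' using that IL(3) by (auto simp: N_def \<pi>_Pl distrib_left)
    show "Tm a y \<in> N" if "y \<in> N" "wf r s a" for a y
    proof -
      have "\<pi> c * \<pi> (Tm a y) = 0" if "c \<in> I" for c
        using IR[OF that \<open>wf r s a\<close>] \<open>y \<in> N\<close> unfolding N_def by (auto simp: \<pi>_Tm mult.assoc)
      then show ?thesis using that IL(4) by (auto simp: N_def)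
    qed
  qed (use IL(1) in \<open>auto simp: N_def\<close>)
  then obtain n where n: "n \<in> N" "\<And>y. y \<in> N ==> \<pi> y * \<pi> n = \<pi> y" using semisimple_right_unit[OF ss] by blast
  have "\<pi> n * \<pi> n = 0" using n(1) by (auto simp: N_def)
  then have "\<pi> n = 0" using n by simp
  then have N0: "\<pi> y = 0" if "y \<in> N" for y using n(2)[OF that] by simp
  have left: "\<pi> e * \<pi> c = \<pi> c" if c: "c \<in> I" for c
  proof -
    let ?y = "Pl c (Tm (Sc (- 1)) (Tm e c))"
    have y: "\<pi> ?y = \<pi> c - \<pi> e * \<pi> c" by (simp add: \<pi>_Pl \<pi>_Sc_Tm) (simp add: \<pi>_Tm)
    have "?y \<in> I" by (intro IL(3) IL(4) c) (use IL(1)[OF e(1)] in auto)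
    moreover have "\<pi> c' * \<pi> ?y = 0" if "c' \<in> I" for c'
      unfolding y right_diff_distrib using e(2)[OF that] by (simp add: mult.assoc[symmetric])
    ultimately have "?y \<in> N" by (simp add: N_def)
    from N0[OF this] show ?thesis unfolding y by simp
  qed
  \<comment> \<open>E kills the submodule generated by w, so x E lies in I and e x E = x E. Applied
    to v this gives e w = w, whereas e annihilates w.\<close>
  have b: "Tm x Eg \<in> I"
  proof -
    have "M.act (Tm x Eg) (M.act y w) = sc 0 w" if "wf r s y" for y
      using Ew[OF that] act0 by (simp add: Eg_def)
    then show ?thesis using x(1) by (simp add: I_def Eg_def)
  qed
  have "\<pi> (Tm e (Tm x Eg)) = \<pi> (Tm x Eg)" using left[OF b] by (subst \<pi>_Tm)
  then have "M.act (Tm e (Tm x Eg)) v = M.act (Tm x Eg) v" unfolding \<pi>_eq using M.act_eq x(2) by blast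
  then have "M.act e w = w" using x(3) by (simp add: Eg_def)
  moreover have "M.act e (M.act (Sc 1) w) = sc 0 w" using e(1) by (simp add: I_def del: hact.simps)
  ultimately show False using w(2) M.sc_1 by simp
qed

text \<open>Multiplication by u keeps one component of the product and kills the others.\<close>

lemma ex_\<pi>: "\<exists>x. \<pi> x = u * b"
proof (induct b rule: halg.abs_induct)
  case (1 F)
  \<comment> \<open>In the ambient ring 0 y + 0 y = 0 y can be cancelled; the equality is placed
    into a single component to read it off there.\<close>
  have "heq r' s' q' \<rho>' (Tm (Sc 0) y) (Sc 0)" for r' s' q' \<rho>' and y :: "'k hexp"
  proof -
    have "heq r' s' q' \<rho>' (Pl (Tm (Sc 0) y) (Tm (Sc 0) y)) (Tm (Sc 0) y)"
      using heq.trans[OF heq.sym[OF heq.distrib_r] heq.cong_Tm[OF heq.sc_add heq.refl], of r' s' q' \<rho>' 0 y 0] by simp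
    then have "hrelf (\<lambda>p. if p = (r', s', q', \<rho>') then Pl (Tm (Sc 0) y) (Tm (Sc 0) y) else Pl (Sc 0) (Sc 0))
        (\<lambda>p. if p = (r', s', q', \<rho>') then Tm (Sc 0) y else Sc 0)"
      by (auto simp: hrelf_def intro: heq.add_zero)
    then have "abs_halg (\<lambda>p. if p = (r', s', q', \<rho>') then Tm (Sc 0) y else Sc 0) + abs_halg (\<lambda>p. if p = (r', s', q', \<rho>') then Tm (Sc 0) y else Sc 0)
        = abs_halg (\<lambda>p. if p = (r', s', q', \<rho>') then Tm (Sc 0) y else Sc 0)"
      unfolding plus_halg.abs_eq halg.abs_eq_iff by (auto simp: hrelf_def split: if_splits)
    then have "abs_halg (\<lambda>p. if p = (r', s', q', \<rho>') then Tm (Sc 0) y else Sc 0) = 0" by simp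
    then have h: "hrelf (\<lambda>p. if p = (r', s', q', \<rho>') then Tm (Sc 0) y else Sc 0) (\<lambda>_. Sc 0)"
      by (simp add: zero_halg_def halg.abs_eq_iff)
    from h[unfolded hrelf_def, rule_format, of r' s' q' \<rho>'] show ?thesis by simp
  qed
  then have "\<pi> (F (r, s, q, \<rho>)) = u * abs_halg F"
    unfolding \<pi>_def u_def times_halg.abs_eq halg.abs_eq_iff hrelf_def
    by (auto intro: heq.sym heq.mul_one_l)
  then show ?case by blast
qed

lemma u0: "u \<noteq> 0"
proof
  assume "u = 0"
  then have "\<pi> (Sc 1) = \<pi> (Sc 0)" by (simp add: \<pi>_Sc)
  then show False unfolding \<pi>_eq using heq_hev by fastforce
qed

end

subsection \<open>Induction from one of the two Hecke subalgebras\<close>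

text \<open>\<open>\<kappa>\<close> gives the position of a generator inside the block
  \<open>G\<close>, and \<open>None\<close> for generators outside it. The block may be numbered in
  the direction of the presentation or against it, which accounts for the two alternatives in
  \<open>\<kappa>_braid\<close>.\<close>

locale ind_block = presentation r s q \<rho> for r s :: nat and q \<rho> :: "'k::field" +
  fixes G :: "nat => 'k halg" and n :: nat and \<kappa> :: "nat => nat option"
  assumes hecke_G: "hecke hscale u q G n"
    and \<kappa>_Some: "\<kappa> i = Some k ==> validS r s i \<and> Suc k < n \<and> sg i = G k"
    and \<kappa>_ex: "Suc k < n ==> \<exists>i. \<kappa> i = Some k"
    and \<kappa>_braid: "validS r s i ==> validS r s (Suc i) ==> (\<kappa> i = None \<and> \<kappa> (Suc i) = None) \<or>
      (\<exists>k. \<kappa> i = Some k \<and> \<kappa> (Suc i) = Some (Suc k)) \<or> (\<exists>k. \<kappa> i = Some (Suc k) \<and> \<kappa> (Suc i) = Some k)"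
    and \<kappa>_comm: "\<kappa> i = Some k ==> \<kappa> j = Some k' ==> Suc i < j ==> Suc k < k' \<or> Suc k' < k"
    and \<kappa>_mixed: "\<kappa> j = None ==> validS r s j ==> Suc k < n ==> sg j * G k = G k * sg j"
begin

sublocale I: hecke hscale u q G n by (rule hecke_G)

lemma Izq: "I.zq = z" by (simp add: I.zq_def)

text \<open>Block generators act as on the induced module, the others by left multiplication on the
  coefficients, and E by 0. The relations that contain E then hold trivially.\<close>

fun iop :: "gen => (nat => 'k halg) => nat => 'k halg" where
  "iop (S i) f = (case \<kappa> i of Some k => I.ind k f | None => (\<lambda>j. if validS r s i then sg i * f j else 0))"
| "iop E f = (\<lambda>j. 0)"

abbreviation "ipl \<equiv> \<lambda>f g (j::nat). f j + (g j :: 'k halg)"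
abbreviation "isc \<equiv> \<lambda>a f (j::nat). a *h (f j :: 'k halg)"

lemma ind_mixed:
  assumes "\<kappa> i = None" "validS r s i" "Suc k < n"
  shows "I.ind k (\<lambda>j. sg i * f j) j = sg i * I.ind k f j"
proof -
  have c: "G l * (sg i * x) = sg i * (G l * x)" if "Suc l < n" for l x
    using arg_cong[OF \<kappa>_mixed[OF assms(1,2) that], of "\<lambda>y. y * x"] by (simp only: mult.assoc)
  show ?thesis using assms(3) by (auto simp: I.ind_def c distrib_left)
qed

lemma iop_V: "f \<in> I.indV ==> iop g f \<in> I.indV"
proof (cases g)
  case (S i)
  assume f: "f \<in> I.indV"
  show ?thesis
  proof (cases "\<kappa> i")
    case None
    have "u * (sg i * x) = sg i * x" for x by (simp add: mult.assoc[symmetric])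
    then show ?thesis using f S None by (auto simp: I.indV_def)
  next
    case (Some k)
    then show ?thesis using f S \<kappa>_Some[OF Some] I.ind_indV by simp
  qed
qed (auto simp: I.indV_def)

lemma iop_ipl: "iop g (ipl f f') = ipl (iop g f) (iop g f')"
  by (cases g) (auto simp: fun_eq_iff I.ind_def distrib_left hs.scale_right_distrib algebra_simps split: option.splits)

lemma iop_isc: "iop g (isc a f) = isc a (iop g f)"
  by (cases g) (auto simp: fun_eq_iff I.ind_def hs.scale_right_distrib mult.commute split: option.splits)

lemma iop_0: "iop g (\<lambda>j. 0) = (\<lambda>j. 0)"
  by (cases g) (auto simp: fun_eq_iff I.ind_def split: option.splits)

lemma iop_quad:
  assumes "validS r s i" "f \<in> I.indV"
  shows "iop (S i) (iop (S i) f) = (\<lambda>j. f j + z *h iop (S i) f j)"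
proof (cases "\<kappa> i")
  case None
  have "sg i * (sg i * f j) = f j + z *h (sg i * f j)" for j
    using arg_cong[OF sg_quad[OF assms(1)], of "\<lambda>y. y * f j"] I.indV_u[OF assms(2)]
    by (simp add: mult.assoc distrib_right)
  then show ?thesis using None assms(1) by (simp add: fun_eq_iff)
next
  case (Some k)
  then show ?thesis using I.ind_quad[OF _ assms(2), of k] \<kappa>_Some[OF Some] by (simp add: fun_eq_iff Izq)
qed

lemma iop_braid:
  assumes v: "validS r s i" "validS r s (Suc i)" and f: "f \<in> I.indV"
  shows "iop (S i) (iop (S (Suc i)) (iop (S i) f)) = iop (S (Suc i)) (iop (S i) (iop (S (Suc i)) f))"
  using \<kappa>_braid[OF v]
proof (elim disjE exE conjE)
  assume "\<kappa> i = None" "\<kappa> (Suc i) = None"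
  then show ?thesis using v arg_cong[OF sg_braid[OF v], of "\<lambda>y. y * f _"] by (simp add: fun_eq_iff mult.assoc)
next
  fix k assume k: "\<kappa> i = Some k" "\<kappa> (Suc i) = Some (Suc k)"
  then show ?thesis using \<kappa>_Some[OF k(2)] I.ind_braid[OF _ f, of k] by (simp add: fun_eq_iff)
next
  fix k assume k: "\<kappa> i = Some (Suc k)" "\<kappa> (Suc i) = Some k"
  then show ?thesis using \<kappa>_Some[OF k(1)] I.ind_braid[OF _ f, of k] by (simp add: fun_eq_iff)
qed

lemma iop_comm:
  assumes v: "validS r s i" "validS r s j" "Suc i < j" and f: "f \<in> I.indV"
  shows "iop (S i) (iop (S j) f) = iop (S j) (iop (S i) f)"
proof (cases "\<kappa> i"; cases "\<kappa> j")
  assume "\<kappa> i = None" "\<kappa> j = None"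
  then show ?thesis using v arg_cong[OF sg_comm[OF v(1,2)], of "\<lambda>y. y * f _"] by (simp add: fun_eq_iff mult.assoc)
next
  fix k assume "\<kappa> i = None" "\<kappa> j = Some k"
  then show ?thesis using v ind_mixed[of i k f] \<kappa>_Some[of j k] by (simp add: fun_eq_iff)
next
  fix k assume "\<kappa> i = Some k" "\<kappa> j = None"
  then show ?thesis using v ind_mixed[of j k f] \<kappa>_Some[of i k] by (simp add: fun_eq_iff)
next
  fix k l assume k: "\<kappa> i = Some k" "\<kappa> j = Some l"
  then show ?thesis using \<kappa>_comm[OF k v(3)] \<kappa>_Some[OF k(1)] \<kappa>_Some[OF k(2)] I.ind_comm[OF _ _ f, of l k] I.ind_comm[OF _ _ f, of k l]
    by (auto simp: fun_eq_iff)
qed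

sublocale Ind: hmodule r s q \<rho> ipl isc iop I.indV
proof
  fix x y f assume "hrel r s q \<rho> x y" "f \<in> I.indV"
  then show "hact ipl isc iop x f = hact ipl isc iop y f"
  proof (induction rule: hrel.induct)
    case (quad i)
    have "iop (S i) (ipl (iop (S i) f) (isc c f)) = (\<lambda>j. f j + z *h iop (S i) f j + c *h iop (S i) f j)" for c
      unfolding iop_ipl iop_isc iop_quad[OF quad] ..
    then show ?case using q0
      by (simp add: Sg_def fun_eq_iff del: iop.simps) (simp add: hs.scale_right_distrib hs.scale_left_diff_distrib)
  next
    case (braid i)
    then show ?case using iop_braid[of i f] by (simp add: hprod_def Sg_def del: iop.simps)
  next
    case (comm i j)
    then show ?case using iop_comm[of i j f] by (simp add: hprod_def Sg_def del: iop.simps)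
  next
    case (ES j)
    then show ?case using iop_0[of "S j"] by (simp add: Sg_def Eg_def del: iop.simps(1))
  next
    case R8
    show ?case using iop_0[of "S (r - 1)"] iop_0[of "S (r + 1)"] by (simp add: hprod_def Sg_def Eg_def del: iop.simps(1))
  qed (simp_all add: hprod_def Sg_def Eg_def del: iop.simps(1))
next
  show "f \<in> I.indV ==> iop g f \<in> I.indV" for f g by (rule iop_V)
qed (auto simp: iop_ipl iop_isc I.indV_def fun_eq_iff distrib_left hs.scale_right_distrib hs.scale_left_distrib add_ac
      simp del: iop.simps)

abbreviation dlt :: "nat => nat => 'k halg" where "dlt m \<equiv> \<lambda>j. if j = m then u else 0"

lemma dlt_V: "m < n ==> dlt m \<in> I.indV" by (auto simp: I.indV_def)

text \<open>The diagonal matrix entry at coset m of the action on the induced module. For k + 1 < m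
  a block generator k multiplies coordinate m by itself, which makes the entry a bimodule map for
  \<open>H m\<close>, and \<open>G m\<close> connects the cosets m and m + 1.\<close>

definition ep :: "nat => 'k halg => 'k halg" where
  "ep m b = Ind.act (SOME x. \<pi> x = u * b) (dlt m) m"

lemma ep_\<pi>: "m < n ==> \<pi> x = u * b ==> ep m b = Ind.act x (dlt m) m"
  unfolding ep_def
proof -
  assume "m < n" "\<pi> x = u * b"
  then have "\<pi> (SOME x. \<pi> x = u * b) = \<pi> x" using someI[of "\<lambda>x. \<pi> x = u * b" x] by simp
  then show "Ind.act (SOME x. \<pi> x = u * b) (dlt m) m = Ind.act x (dlt m) m"
    using Ind.act_eq[OF _ dlt_V[OF \<open>m < n\<close>]] by (simp only: \<pi>_eq)
qed

lemma act_right: "Ind.act x (\<lambda>j. f j * b) = (\<lambda>j. Ind.act x f j * b)"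
proof (induction x arbitrary: f)
  case (Gen g)
  show ?case by (cases g) (auto simp: fun_eq_iff I.ind_def distrib_right mult.assoc split: option.splits)
next
  case (Tm x y)
  then show ?case by simp
qed (auto simp: fun_eq_iff distrib_right)

lemma ep_gen_left:
  assumes m: "m < n"
  shows "Suc k < m ==> ep m (G k * b) = G k * ep m b"
    "\<kappa> i = None ==> validS r s i ==> ep m (sg i * b) = sg i * ep m b"
proof -
  obtain x where x: "\<pi> x = u * b" using ex_\<pi> by blast
  have c: "\<pi> (Tm (Sg i) x) = u * (sg i * b)" for i
  proof -
    have "\<pi> (Tm (Sg i) x) = sg i * u * b" by (simp add: \<pi>_Tm x sg_def[symmetric] mult.assoc del: sg_u)
    also have "\<dots> = u * sg i * b" by simp
    finally show ?thesis by (simp only: mult.assoc)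
  qed
  show "ep m (G k * b) = G k * ep m b" if k: "Suc k < m"
  proof -
    obtain i where i: "\<kappa> i = Some k" using \<kappa>_ex[of k] k m by auto
    show ?thesis using ep_\<pi>[OF m c[of i]] ep_\<pi>[OF m x] \<kappa>_Some[OF i] i k by (simp add: Sg_def I.ind_def)
  qed
  show "ep m (sg i * b) = sg i * ep m b" if "\<kappa> i = None" "validS r s i"
    using ep_\<pi>[OF m c[of i]] ep_\<pi>[OF m x] that by (simp add: Sg_def)
qed

lemma ep_gen_right:
  assumes m: "m < n"
  shows "Suc k < m ==> ep m (b * G k) = ep m b * G k"
    "\<kappa> i = None ==> validS r s i ==> ep m (b * sg i) = ep m b * sg i"
proof -
  obtain x where x: "\<pi> x = u * b" using ex_\<pi> by blast
  have c: "\<pi> (Tm x (Sg i)) = u * (b * sg i)" for i by (simp add: \<pi>_Tm x sg_def[symmetric] mult.assoc)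
  show "ep m (b * G k) = ep m b * G k" if k: "Suc k < m"
  proof -
    obtain i where i: "\<kappa> i = Some k" using \<kappa>_ex[of k] k m by auto
    have "I.ind k (dlt m) = (\<lambda>j. dlt m j * G k)" using k m by (auto simp: fun_eq_iff I.ind_def)
    then show ?thesis using ep_\<pi>[OF m c[of i]] ep_\<pi>[OF m x] \<kappa>_Some[OF i] i act_right[of x "dlt m" "G k"] by (simp add: Sg_def)
  qed
  show "ep m (b * sg i) = ep m b * sg i" if i: "\<kappa> i = None" "validS r s i"
  proof -
    have "(\<lambda>j. sg i * dlt m j) = (\<lambda>j. dlt m j * sg i)" by (auto simp: fun_eq_iff)
    then show ?thesis using ep_\<pi>[OF m c[of i]] ep_\<pi>[OF m x] i act_right[of x "dlt m" "sg i"] by (simp add: Sg_def)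
  qed
qed

lemma ep_linear:
  assumes m: "m < n"
  shows "ep m (b + c) = ep m b + ep m c" "ep m (a *h b) = a *h ep m b" "ep m u = u"
    "ep m (u * b) = u * ep m b" "ep m (b * u) = ep m b * u"
proof -
  obtain x where x: "\<pi> x = u * b" using ex_\<pi> by blast
  obtain y where y: "\<pi> y = u * c" using ex_\<pi> by blast
  have "\<pi> (Pl x y) = u * (b + c)" by (simp add: \<pi>_Pl x y distrib_left)
  from ep_\<pi>[OF m this] show "ep m (b + c) = ep m b + ep m c" using ep_\<pi>[OF m x] ep_\<pi>[OF m y] by simp
  have "\<pi> (Tm (Sc a) x) = u * (a *h b)" by (simp add: \<pi>_Sc_Tm x)
  from ep_\<pi>[OF m this] show "ep m (a *h b) = a *h ep m b" using ep_\<pi>[OF m x] by simp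
  show "ep m u = u" using ep_\<pi>[OF m, of "Sc 1" u] by (simp add: u_def[symmetric])
  have "u * ep m b = ep m b"
    using ep_\<pi>[OF m x] I.indV_u[OF Ind.act_V[OF dlt_V[OF m]], of x m] by simp
  moreover have "\<pi> x = u * (u * b)" by (simp add: x mult.assoc[symmetric])
  ultimately show "ep m (u * b) = u * ep m b" using ep_\<pi>[OF m x] ep_\<pi>[OF m] by simp
  have "\<pi> x = u * (b * u)" using x \<pi>_u[of x] by (simp add: mult.assoc)
  moreover have "(\<lambda>j. dlt m j * u) = dlt m" by auto
  ultimately show "ep m (b * u) = ep m b * u" using ep_\<pi>[OF m x] ep_\<pi>[OF m, of x "b * u"] fun_cong[OF act_right[of x "dlt m" u], of m] by simp
qed

lemma ep_step:
  assumes m: "Suc m < n"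
  shows "ep (Suc m) (G m * (b * G m)) = ep m b" "ep (Suc m) (G m) = 0"
proof -
  obtain x where x: "\<pi> x = u * b" using ex_\<pi> by blast
  obtain i where i: "\<kappa> i = Some m" using \<kappa>_ex[OF m] by auto
  have sg: "sg i = G m" using \<kappa>_Some[OF i] by simp
  have "\<pi> (Tm (Sg i) (Tm x (Sg i))) = G m * u * (b * G m)" by (simp only: \<pi>_Tm x sg_def[symmetric] sg mult.assoc)
  also have "\<dots> = u * (G m * (b * G m))" using m by simp
  finally have e: "\<pi> (Tm (Sg i) (Tm x (Sg i))) = u * (G m * (b * G m))" .
  have "I.ind m (dlt (Suc m)) = dlt m" by (auto simp: fun_eq_iff I.ind_def)
  then show "ep (Suc m) (G m * (b * G m)) = ep m b"
    using ep_\<pi>[OF m e] ep_\<pi>[OF _ x, of m] m i by (simp add: Sg_def) (simp add: I.ind_def)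
  have "\<pi> (Sg i) = u * G m" using sg m by (simp add: sg_def[symmetric])
  from ep_\<pi>[OF m this] show "ep (Suc m) (G m) = 0" using i by (simp add: Sg_def I.ind_def)
qed

lemma hecke_expect_ep:
  assumes "v \<noteq> 0" "u * v = v" "v * u = v" "\<And>k. Suc k < n ==> v * G k = G k * v"
    "\<And>m x. m < n ==> ep m (v * x) = v * ep m x"
  shows "hecke_expect hscale u q G n ep v"
  by unfold_locales (use assms ep_linear ep_gen_left(1) ep_gen_right(1) ep_step in auto)

end

section \<open>Non-semisimple parameters\<close>

context ind_block
begin

lemma ep_alg_left:
  assumes m: "m < n" and A: "\<And>g. g \<in> A ==> \<exists>i. \<kappa> i = None \<and> validS r s i \<and> g = sg i" and h: "h \<in> hs.alg A u"
  shows "ep m (h * x) = h * ep m x"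
  using h
proof (induction rule: hs.alg.induct)
  case (alg_gen g h)
  then obtain i where "\<kappa> i = None" "validS r s i" "g = sg i" using A by blast
  then show ?case using alg_gen ep_gen_left(2)[OF m, of i "h * x"] by (simp add: mult.assoc)
qed (simp_all add: ep_linear[OF m] distrib_right)

lemma ep_alg_right:
  assumes m: "m < n" and A: "\<And>g. g \<in> A ==> \<exists>i. \<kappa> i = None \<and> validS r s i \<and> g = sg i" and h: "h \<in> hs.alg A u"
  shows "ep m (x * h) = ep m x * h"
  using h
proof (induction arbitrary: x rule: hs.alg.induct)
  case (alg_gen g h)
  then obtain i where i: "\<kappa> i = None" "validS r s i" "g = sg i" using A by blast
  have "ep m (x * (g * h)) = ep m ((x * g) * h)" by (simp only: mult.assoc)
  also have "\<dots> = ep m (x * g) * h" by (rule alg_gen)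
  also have "\<dots> = ep m x * (g * h)" using ep_gen_right(2)[OF m i(1,2), of x] i(3) by (simp add: mult.assoc)
  finally show ?case .
qed (simp_all add: ep_linear[OF m] distrib_left)

end

locale two_inductions = presentation r s q \<rho> for r s :: nat and q \<rho> :: "'k::field"
begin

sublocale LB: ind_block r s q \<rho> "\<lambda>k. sg (Suc k)" r "\<lambda>i. if 0 < i \<and> i < r then Some (i - Suc 0) else None"
proof
  show "sg j * sg (Suc k) = sg (Suc k) * sg j"
    if "(if 0 < j \<and> j < r then Some (j - Suc 0) else None) = None" "validS r s j" "Suc k < r" for j k
    using that sg_comm[of "Suc k" j] by (auto simp: validS_def split: if_splits)
  show "\<exists>i. (if 0 < i \<and> i < r then Some (i - Suc 0) else None) = Some k" if "Suc k < r" for k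
    using that by (intro exI[of _ "Suc k"]) simp
qed (auto simp: validS_def split: if_splits)

lemma Tr_sg: "Suc k < s ==> W.Tr k = sg (r + s - 1 - k)"
proof -
  assume "Suc k < s"
  then have "r + 1 + (s - 2 - k) = r + s - 1 - k" by simp
  then show ?thesis by (simp only: W.Tr_def TT_def)
qed

text \<open>The right block is numbered towards the wall, so that the expectation removes the strand
  next to the wall, as it does on the left.\<close>

sublocale RB: ind_block r s q \<rho> W.Tr s "\<lambda>i. if r < i \<and> i < r + s then Some (r + s - 1 - i) else None"
proof
  fix i k
  show "validS r s i \<and> Suc k < s \<and> sg i = W.Tr k" if "(if r < i \<and> i < r + s then Some (r + s - 1 - i) else None) = Some k"
  proof -
    have "r < i" "i < r + s" "k = r + s - 1 - i" using that by (auto split: if_splits)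
    then have "validS r s i" "Suc k < s" "r + s - 1 - k = i" by (auto simp: validS_def)
    then show ?thesis by (simp only: Tr_sg)
  qed
  show "\<exists>i. (if r < i \<and> i < r + s then Some (r + s - 1 - i) else None) = Some k" if "Suc k < s"
    using that by (intro exI[of _ "r + s - 1 - k"]) auto
  show "sg j * W.Tr k = W.Tr k * sg j"
    if "(if r < j \<and> j < r + s then Some (r + s - 1 - j) else None) = None" "validS r s j" "Suc k < s" for j
    using that sg_comm[of j "r + s - 1 - k"] Tr_sg[OF that(3)] by (auto simp: validS_def split: if_splits)
  show "((if r < i \<and> i < r + s then Some (r + s - 1 - i) else None) = None \<and> (if r < Suc i \<and> Suc i < r + s then Some (r + s - 1 - Suc i) else None) = None) \<or>
    (\<exists>k. (if r < i \<and> i < r + s then Some (r + s - 1 - i) else None) = Some k \<and> (if r < Suc i \<and> Suc i < r + s then Some (r + s - 1 - Suc i) else None) = Some (Suc k)) \<or>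
    (\<exists>k. (if r < i \<and> i < r + s then Some (r + s - 1 - i) else None) = Some (Suc k) \<and> (if r < Suc i \<and> Suc i < r + s then Some (r + s - 1 - Suc i) else None) = Some k)"
    if "validS r s i" "validS r s (Suc i)"
    using that by (auto simp: validS_def)
  show "Suc k < k' \<or> Suc k' < k"
    if "(if r < i \<and> i < r + s then Some (r + s - 1 - i) else None) = Some k" "(if r < j \<and> j < r + s then Some (r + s - 1 - j) else None) = Some k'" "Suc i < j"
    for j k'
    using that by (auto split: if_splits)
qed

sublocale LE: hecke_expect hscale u q "\<lambda>k. sg (Suc k)" r LB.ep u
  by (rule LB.hecke_expect_ep) (auto simp: u0 LB.ep_linear)

sublocale RE: hecke_expect hscale u q W.Tr s RB.ep u
  by (rule RB.hecke_expect_ep) (auto simp: u0 RB.ep_linear)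

definition eL where "eL = LB.ep (r - 1)"
definition eR where "eR = RB.ep (s - 1)"

lemma rs_less: "r - 1 < r" "s - 1 < s" "Suc (r - 1) = r" "Suc (s - 1) = s" using r1 s1 by auto

abbreviation "HL \<equiv> SL.H"
abbreviation "HR \<equiv> W.Rv.H"

lemma HL_comm: "x \<in> HL r ==> y \<in> HR s ==> x * y = y * x"
proof (rule SL.H_commute[where m = r])
  assume y: "y \<in> HR s"
  show "u * y = y" "y * u = y" using W.Rv.H_u_left[OF _ y] W.Rv.H_u_right[OF y] by auto
  show "sg (Suc k) * y = y * sg (Suc k)" if k: "Suc k < r" for k
  proof (rule W.Rv.H_commute[where m = s, symmetric])
    show "W.Tr j * sg (Suc k) = sg (Suc k) * W.Tr j" if "Suc j < s" for j
      using Tr_sg[OF that] sg_comm[of "Suc k" "r + s - 1 - j"] that k by (simp add: validS_def)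
  qed (use y in auto)
qed

lemma gens_R: "g \<in> W.Tr ` {k. Suc k < m} ==> m \<le> s ==> \<exists>i. (if 0 < i \<and> i < r then Some (i - Suc 0) else None) = None \<and> validS r s i \<and> g = sg i"
proof -
  assume "g \<in> W.Tr ` {k. Suc k < m}" "m \<le> s"
  then obtain k where k: "Suc k < m" "g = W.Tr k" by blast
  then have "Suc k < s" using \<open>m \<le> s\<close> by simp
  note k = this k(2)
  show ?thesis by (intro exI[of _ "r + s - 1 - k"]) (use k Tr_sg[OF k(1)] in \<open>auto simp: validS_def\<close>)
qed

lemma gens_L: "g \<in> (\<lambda>k. sg (Suc k)) ` {k. Suc k < m} ==> m \<le> r ==> \<exists>i. (if r < i \<and> i < r + s then Some (r + s - 1 - i) else None) = None \<and> validS r s i \<and> g = sg i"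
proof -
  assume "g \<in> (\<lambda>k. sg (Suc k)) ` {k. Suc k < m}" "m \<le> r"
  then obtain k where k: "Suc k < m" "g = sg (Suc k)" by blast
  then show ?thesis using \<open>m \<le> r\<close> by (intro exI[of _ "Suc k"]) (auto simp: validS_def)
qed

lemma eL_linear: "eL (x + y) = eL x + eL y" "eL (a *h x) = a *h eL x"
  unfolding eL_def using LB.ep_linear(1,2)[OF rs_less(1)] by auto

lemma eR_linear: "eR (x + y) = eR x + eR y" "eR (a *h x) = a *h eR x"
  unfolding eR_def using RB.ep_linear(1,2)[OF rs_less(2)] by auto

lemma e_diff: "eL (x - y) = eL x - eL y" "eR (x - y) = eR x - eR y"
  using eL_linear(1)[of x "(- 1) *h y"] eL_linear(2)[of "- 1" y] eR_linear(1)[of x "(- 1) *h y"] eR_linear(2)[of "- 1" y] by simp_all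

lemma eL_L: "h \<in> HL (r - 1) ==> eL (h * x) = h * eL x" "h \<in> HL (r - 1) ==> eL (x * h) = eL x * h"
  unfolding eL_def using LE.ep_H_left LE.ep_H_right rs_less by auto

lemma eR_R: "h \<in> HR (s - 1) ==> eR (h * x) = h * eR x" "h \<in> HR (s - 1) ==> eR (x * h) = eR x * h"
  unfolding eR_def using RE.ep_H_left RE.ep_H_right rs_less by auto

lemma eL_R: "h \<in> HR s ==> eL (h * x) = h * eL x" "h \<in> HR s ==> eL (x * h) = eL x * h"
  unfolding eL_def W.Rv.H_def
  using LB.ep_alg_left[OF rs_less(1) gens_R[OF _ order.refl]] LB.ep_alg_right[OF rs_less(1) gens_R[OF _ order.refl]] by auto

lemma ep_R_L: "m < s ==> h \<in> HL r ==> RB.ep m (h * x) = h * RB.ep m x"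
  unfolding SL.H_def by (rule RB.ep_alg_left[OF _ gens_L[OF _ order.refl]])

lemma eR_L: "h \<in> HL r ==> eR (h * x) = h * eR x"
  unfolding eR_def by (rule ep_R_L[OF rs_less(2)])

lemma eL_H: "x \<in> HL r ==> eL x \<in> HL (r - 1)" unfolding eL_def using LE.ep_H[OF rs_less(1)] rs_less by simp
lemma eR_H: "x \<in> HR s ==> eR x \<in> HR (s - 1)" unfolding eR_def using RE.ep_H[OF rs_less(2)] rs_less by simp

lemma HL_sub: "x \<in> HL (r - 1) ==> x \<in> HL r" using SL.H_mono[of "r - 1" r] by simp
lemma HR_sub: "x \<in> HR (s - 1) ==> x \<in> HR s" using W.Rv.H_mono[of "s - 1" s] by simp

lemma eR_eL: "x \<in> HL r ==> y \<in> HR s ==> eR (eL (x * y)) = eL x * eR y"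
  using eL_R(2)[of y x] eR_L[OF HL_sub[OF eL_H], of x y] by simp

definition LX where "LX = SL.X (r - 1)"
definition RX where "RX = W.Rv.X (s - 1)"

lemma LX_H: "LX \<in> HL r" and RX_H: "RX \<in> HR s"
  unfolding LX_def RX_def using SL.H_X W.Rv.H_X rs_less by auto

lemma LX_comm: "h \<in> HL (r - 1) ==> h * LX = LX * h" and RX_comm: "h' \<in> HR (s - 1) ==> h' * RX = RX * h'"
  unfolding LX_def RX_def using SL.H_X_commute[OF _ order.refl] W.Rv.H_X_commute[OF _ order.refl] rs_less by auto

lemma eL_values: "eL u = u" "eL LX = u" "2 \<le> r ==> eL (sg (r - 1)) = 0" "2 \<le> r ==> eL (sg (r - 1) * LX) = z *h u"
proof -
  show "eL u = u" "eL LX = u" unfolding eL_def LX_def using LE.ep_u LE.ep_X rs_less by auto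
  assume r: "2 \<le> r"
  have e: "Suc (r - 2) = r - 1" using r by simp
  have l: "Suc (r - 2) < r" using r by simp
  show "eL (sg (r - 1)) = 0" using LE.ep_S0[OF l] unfolding e eL_def .
  show "eL (sg (r - 1) * LX) = z *h u" using LE.ep_S_X[OF l] unfolding e eL_def LX_def by (simp add: SL.zq_def)
qed

lemma eR_values: "eR u = u" "eR RX = u" "2 \<le> s ==> eR (sg (r + 1)) = 0" "2 \<le> s ==> eR (sg (r + 1) * RX) = z *h u"
proof -
  show "eR u = u" "eR RX = u" unfolding eR_def RX_def using RE.ep_u RE.ep_X rs_less by auto
  assume s: "2 \<le> s"
  have e: "Suc (s - 2) = s - 1" using s by simp
  have l: "Suc (s - 2) < s" using s by simp
  have "r + s - 1 - (s - 2) = r + 1" using s by simp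
  then have T: "W.Tr (s - 2) = sg (r + 1)" using Tr_sg[OF l] by simp
  show "eR (sg (r + 1)) = 0" using RE.ep_S0[OF l] unfolding e T eR_def .
  show "eR (sg (r + 1) * RX) = z *h u" using RE.ep_S_X[OF l] unfolding e T eR_def RX_def by (simp add: SR.zq_def)
qed

definition prods where "prods m m' = {h * h' |h h'. h \<in> HL m \<and> h' \<in> HR m'}"
text \<open>The product of the two regular representations, realised by products inside the
  presented algebra; \<open>HH'\<close> is its part on the strands away from the wall.\<close>

definition HH where "HH = hs.span (prods r s)"
definition HH' where "HH' = hs.span (prods (r - 1) (s - 1))"

lemma HH_prod: "h \<in> HL r ==> h' \<in> HR s ==> h * h' \<in> HH"
  unfolding HH_def prods_def by (rule hs.span_base) auto

lemma HH'_sub: "x \<in> HH' ==> x \<in> HH"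
proof -
  have "prods (r - 1) (s - 1) \<subseteq> prods r s" unfolding prods_def using HL_sub HR_sub by blast
  then show "x \<in> HH' ==> x \<in> HH" unfolding HH_def HH'_def using hs.span_mono by blast
qed

lemma HH_u: "x \<in> HH ==> u * x = x"
  unfolding HH_def
proof (induction rule: hs.span_induct_alt)
  case (step c x y)
  then obtain h h' where h: "h \<in> HL r" "x = h * h'" unfolding prods_def by blast
  have "u * x = x" using SL.H_u_left[OF _ h(1)] by (simp add: h(2) mult.assoc[symmetric])
  then show ?case using step by (simp add: distrib_left)
qed simp

lemma HH_left: "k \<in> HL r \<or> k \<in> HR s ==> x \<in> HH ==> k * x \<in> HH"
  unfolding HH_def
proof (rotate_tac 1, induction rule: hs.span_induct_alt)
  case (step c x y)
  then obtain h h' where h: "h \<in> HL r" "h' \<in> HR s" "x = h * h'" unfolding prods_def by blast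
  have "k * x \<in> HH" using step(3)
  proof
    assume "k \<in> HL r"
    then have "(k * h) * h' \<in> HH" using h by (intro HH_prod SL.H_mult) auto
    then show ?thesis by (simp add: h(3) mult.assoc)
  next
    assume k: "k \<in> HR s"
    then have "h * (k * h') \<in> HH" using h by (intro HH_prod W.Rv.H_mult) auto
    moreover have "k * (h * h') = h * (k * h')" by (rule commute_mult_left[OF HL_comm[OF h(1) k, symmetric]])
    ultimately show ?thesis by (simp add: h(3))
  qed
  then show ?case using step(2)[OF step(3)] unfolding HH_def by (simp add: distrib_left hs.span_add hs.span_scale)
qed (simp add: hs.span_zero)

lemma sg_HL: "1 \<le> i ==> i < m ==> m \<le> r ==> sg i \<in> HL m"
  using SL.H_S[of "i - 1" m] by simp

lemma sg_HR: "i < r + s ==> r + s < i + m ==> m \<le> s ==> sg i \<in> HR m"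
proof -
  assume i: "i < r + s" "r + s < i + m" "m \<le> s"
  have "r + s - 1 - (r + s - 1 - i) = i" "Suc (r + s - 1 - i) < s" "Suc (r + s - 1 - i) < m" using i by auto
  then show ?thesis using W.Rv.H_S[of "r + s - 1 - i" m] Tr_sg[of "r + s - 1 - i"] i by simp
qed

lemma sg_H: "validS r s i ==> sg i \<in> HL r \<or> sg i \<in> HR s"
  using sg_HL[of i r] sg_HR[of i s] by (cases "i < r") (auto simp: validS_def)

text \<open>The factor \<open>\<theta>\<close> is forced: twisting the expectations by \<open>LX * RX\<close> turns their values on \<open>u\<close> and on
  the generators next to the wall into those required of \<open>E\<close>.\<close>

definition \<theta> where "\<theta> = (\<rho> / z) *h (LX * RX - inverse (\<rho> * \<rho>) *h u)"
definition Eop where "Eop x = eR (eL (x * \<theta>))"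

lemma Eop_linear: "Eop (x + y) = Eop x + Eop y" "Eop (a *h x) = a *h Eop x"
  by (simp_all add: Eop_def distrib_right eL_linear eR_linear)

lemma Eop_0: "Eop 0 = 0" using Eop_linear(2)[of 0 0] by simp

lemma Eop_left: "h \<in> HL (r - 1) \<or> h \<in> HR (s - 1) ==> Eop (h * x) = h * Eop x"
  unfolding Eop_def using eL_L(1) eR_L HL_sub eL_R(1) HR_sub eR_R(1) by (auto simp: mult.assoc)

text \<open>Inner factors commute with \<open>LX\<close> and \<open>RX\<close> and leave both
  expectations, so everything is reduced to the four values of the expectations at k and k'.\<close>

lemma Eop_prod:
  assumes k: "k \<in> HL r" "k' \<in> HR s" and y: "y \<in> HH'"
  shows "Eop (k * (k' * y)) = (\<rho> / z) *h ((eL (k * LX) * eR (k' * RX) - inverse (\<rho> * \<rho>) *h (eL k * eR k')) * y)"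
  using y unfolding HH'_def
proof (induction rule: hs.span_induct_alt)
  case base
  then show ?case by (simp add: Eop_0)
next
  case (step c x y)
  then obtain h h' where h: "h \<in> HL (r - 1)" "h' \<in> HR (s - 1)" "x = h * h'" unfolding prods_def by blast
  note hr = HL_sub[OF h(1)] and hs = HR_sub[OF h(2)]
  have kh: "k' * h = h * k'" by (rule HL_comm[OF hr k(2), symmetric])
  have main: "eR (eL ((k1 * h) * (k2 * h'))) = (eL k1 * eR k2) * (h * h')" if "k1 \<in> HL r" "k2 \<in> HR s" for k1 k2
  proof -
    have "eR (eL ((k1 * h) * (k2 * h'))) = eL (k1 * h) * eR (k2 * h')"
      by (rule eR_eL) (use that hr hs in \<open>auto intro: SL.H_mult W.Rv.H_mult\<close>)
    also have "\<dots> = eL k1 * ((h * eR k2) * h')" by (simp add: eL_L(2)[OF h(1)] eR_R(2)[OF h(2)] mult.assoc)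
    also have "h * eR k2 = eR k2 * h" using HL_comm[OF hr HR_sub[OF eR_H[OF that(2)]]] .
    finally show ?thesis by (simp only: mult.assoc)
  qed
  have e1: "k * (k' * x) = (k * h) * (k' * h')" unfolding h(3) by (simp only: mult.assoc commute_mult_left[OF kh])
  have kX: "k' * h' \<in> HR s" using k hs by (intro W.Rv.H_mult) auto
  have "(k * (k' * x)) * (LX * RX) = (k * h) * (((k' * h') * LX) * RX)" unfolding e1 by (simp only: mult.assoc)
  also have "(k' * h') * LX = LX * (k' * h')" using HL_comm[OF LX_H kX] by simp
  also have "(k * h) * (LX * (k' * h') * RX) = (k * (h * LX)) * (k' * (h' * RX))" by (simp only: mult.assoc)
  also have "\<dots> = ((k * LX) * h) * ((k' * RX) * h')" unfolding LX_comm[OF h(1)] RX_comm[OF h(2)] by (simp only: mult.assoc)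
  finally have e2: "(k * (k' * x)) * (LX * RX) = ((k * LX) * h) * ((k' * RX) * h')" .
  have kL: "k * LX \<in> HL r" "k' * RX \<in> HR s" using k LX_H RX_H by (auto intro: SL.H_mult W.Rv.H_mult)
  have e3: "(k * (k' * x)) * u = (k * h) * (k' * h')" unfolding e1 using W.Rv.H_u_right[OF kX] by (simp add: mult.assoc)
  have "(k * (k' * x)) * \<theta> = (\<rho> / z) *h ((k * (k' * x)) * (LX * RX) - inverse (\<rho> * \<rho>) *h ((k * (k' * x)) * u))"
    unfolding \<theta>_def by (simp only: hs.mult_scale_right right_diff_distrib)
  then have "Eop (k * (k' * x)) = (\<rho> / z) *h (eR (eL (((k * LX) * h) * ((k' * RX) * h'))) - inverse (\<rho> * \<rho>) *h eR (eL ((k * h) * (k' * h'))))"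
    unfolding Eop_def e2 e3 by (simp only: eL_linear eR_linear e_diff)
  also have "\<dots> = (\<rho> / z) *h ((eL (k * LX) * eR (k' * RX) - inverse (\<rho> * \<rho>) *h (eL k * eR k')) * x)"
    unfolding main[OF kL] main[OF k] h(3) left_diff_distrib hs.mult_scale_left ..
  finally show ?case using step(2) by (simp add: distrib_left Eop_linear hs.scale_right_distrib mult.left_commute)
qed

lemma HH'_u: "x \<in> HH' ==> u * x = x" using HH_u[OF HH'_sub] .

lemma u_HL: "u \<in> HL r" and u_HR: "u \<in> HR s" by (rule SL.H_u W.Rv.H_u)+

lemma uLX: "u * LX = LX" and uRX: "u * RX = RX"
  using SL.H_u_left[OF _ LX_H] W.Rv.H_u_left[OF _ RX_H] by auto

lemma Eop_E: "y \<in> HH' ==> Eop y = delta q \<rho> *h y"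
proof -
  assume y: "y \<in> HH'"
  have "(\<rho> / z) *h (y - inverse (\<rho> * \<rho>) *h y) = (\<rho> / z * (1 - inverse (\<rho> * \<rho>))) *h y"
    by (simp add: hs.scale_left_diff_distrib hs.scale_right_diff_distrib right_diff_distrib)
  also have "\<rho> / z * (1 - inverse (\<rho> * \<rho>)) = delta q \<rho>"
  proof -
    have "\<rho> * (1 - inverse (\<rho> * \<rho>)) = \<rho> - inverse \<rho>" using rho0 by (simp add: right_diff_distrib)
    then show ?thesis by (simp add: delta_def)
  qed
  finally show ?thesis using Eop_prod[OF u_HL u_HR y] HH'_u[OF y]
    by (simp add: uLX uRX eL_values eR_values left_diff_distrib)
qed

lemma Eop_sg: "y \<in> HH' ==> 2 \<le> r ==> Eop (sg (r - 1) * y) = \<rho> *h y"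
  "y \<in> HH' ==> 2 \<le> s ==> Eop (sg (r + 1) * y) = \<rho> *h y"
  "y \<in> HH' ==> 2 \<le> r ==> 2 \<le> s ==> Eop (sg (r - 1) * (sg (r + 1) * y)) = (z * \<rho>) *h y"
proof -
  assume y: "y \<in> HH'"
  have L: "sg (r - 1) \<in> HL r" if "2 \<le> r" using sg_HL[of "r - 1" r] that by auto
  have R: "sg (r + 1) \<in> HR s" if "2 \<le> s" using sg_HR[of "r + 1" s] that by auto
  show "Eop (sg (r - 1) * y) = \<rho> *h y" if r: "2 \<le> r"
    using Eop_prod[OF L[OF r] u_HR y] HH'_u[OF y] z0
    by (simp add: uRX eL_values r eR_values left_diff_distrib del: One_nat_def)
  show "Eop (sg (r + 1) * y) = \<rho> *h y" if s: "2 \<le> s"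
  proof -
    have "u * (sg (r + 1) * y) = sg (r + 1) * y" by (simp add: mult.assoc[symmetric])
    then show ?thesis using Eop_prod[OF u_HL R[OF s] y] HH'_u[OF y] z0
      by (simp add: uLX eR_values s eL_values left_diff_distrib del: One_nat_def add_Suc_right Suc_eq_plus1)
  qed
  show "Eop (sg (r - 1) * (sg (r + 1) * y)) = (z * \<rho>) *h y" if rs: "2 \<le> r" "2 \<le> s"
  proof -
    have t: "a / t * (t * t) = t * a" if "t \<noteq> 0" for a t :: 'k using that by simp
    have "((z *h u) * (z *h u) - c *h (0 * 0)) * y = (z * z) *h y" for c using HH'_u[OF y] by simp
    then show ?thesis unfolding Eop_prod[OF L[OF rs(1)] R[OF rs(2)] y] eL_values(3,4)[OF rs(1)] eR_values(3,4)[OF rs(2)]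
      by (simp only: hs.scale_scale t[OF z0])
  qed
qed

lemma Eop_HH': "x \<in> HH ==> Eop x \<in> HH'"
  unfolding HH_def
proof (induction rule: hs.span_induct_alt)
  case base
  then show ?case by (simp add: Eop_0 HH'_def hs.span_zero)
next
  case (step c x y)
  then obtain h h' where h: "h \<in> HL r" "h' \<in> HR s" "x = h * h'" unfolding prods_def by blast
  have P: "eR (eL (k * k')) \<in> HH'" if "k \<in> HL r" "k' \<in> HR s" for k k'
    unfolding eR_eL[OF that] HH'_def prods_def by (rule hs.span_base) (use that eL_H eR_H in blast)
  have "x * (LX * RX) = h * ((h' * LX) * RX)" unfolding h(3) by (simp only: mult.assoc)
  also have "h' * LX = LX * h'" using HL_comm[OF LX_H h(2)] by simp
  finally have e: "x * (LX * RX) = (h * LX) * (h' * RX)" by (simp only: mult.assoc)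
  have "x * u = h * h'" using W.Rv.H_u_right[OF h(2)] by (simp add: h(3) mult.assoc)
  then have "x * \<theta> = (\<rho> / z) *h ((h * LX) * (h' * RX) - inverse (\<rho> * \<rho>) *h (h * h'))"
    unfolding \<theta>_def by (simp only: hs.mult_scale_right right_diff_distrib e)
  then have "Eop x = (\<rho> / z) *h (eR (eL ((h * LX) * (h' * RX))) - inverse (\<rho> * \<rho>) *h eR (eL (h * h')))"
    unfolding Eop_def by (simp only: eL_linear eR_linear e_diff)
  also have "\<dots> \<in> HH'"
    using P[OF h(1,2)] P[of "h * LX" "h' * RX"] h LX_H RX_H unfolding HH'_def
    by (intro hs.span_scale hs.span_diff) (auto intro: SL.H_mult W.Rv.H_mult)
  finally show ?case using step(2) unfolding HH'_def by (simp add: Eop_linear hs.span_add hs.span_scale)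
qed

fun mop :: "gen => 'k halg => 'k halg" where
  "mop (S i) x = (if validS r s i then sg i * x else 0)"
| "mop E x = Eop x"

sublocale M: hmodule r s q \<rho> "(+)" hscale mop HH
proof
  show "mop g v \<in> HH" if "v \<in> HH" for g v
    using that sg_H HH_left HH'_sub[OF Eop_HH'] by (cases g) (auto simp: HH_def hs.span_zero)
  show "mop g (v + w) = mop g v + mop g w" for g v w
    by (cases g) (auto simp: distrib_left Eop_linear)
  show "mop g (a *h v) = a *h mop g v" for g a v
    by (cases g) (auto simp: Eop_linear)
  fix x y v assume "hrel r s q \<rho> x y" "v \<in> HH"
  then show "hact (+) hscale mop x v = hact (+) hscale mop y v"
  proof (induction rule: hrel.induct)
    case (quad i)
    have "sg i * (sg i * v) = v + z *h (sg i * v)"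
      using arg_cong[OF sg_quad[OF quad(1)], of "\<lambda>y. y * v"] HH_u[OF quad(2)] by (simp add: mult.assoc distrib_right)
    then show ?case using quad q0
      by (simp add: Sg_def distrib_left hs.scale_right_distrib hs.scale_left_diff_distrib algebra_simps)
  next
    case (braid i)
    then show ?case using arg_cong[OF sg_braid[of i], of "\<lambda>y. y * v"] by (simp add: hprod_def Sg_def mult.assoc)
  next
    case (comm i j)
    then show ?case using arg_cong[OF sg_comm[of i j], of "\<lambda>y. y * v"] by (simp add: Sg_def mult.assoc)
  next
    case Esq
    then show ?case using Eop_E[OF Eop_HH'] by (simp add: Eg_def)
  next
    case (ES j)
    have "sg j \<in> HL (r - 1) \<or> sg j \<in> HR (s - 1)"
    proof (cases "j < r")
      case True
      have "sg j \<in> HL (r - 1)" by (rule sg_HL) (use ES True in \<open>auto simp: validS_def\<close>)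
      then show ?thesis ..
    next
      case False
      have "sg j \<in> HR (s - 1)" by (rule sg_HR) (use ES False in \<open>auto simp: validS_def\<close>)
      then show ?thesis ..
    qed
    then show ?case using Eop_left[of "sg j" v] ES by (simp add: Eg_def Sg_def)
  next
    case ESE1
    then have "2 \<le> r" by (auto simp: validS_def)
    then show ?case using Eop_sg(1)[OF Eop_HH'[OF ESE1(2)]] ESE1(1) by (simp add: hprod_def Sg_def Eg_def)
  next
    case ESE2
    then have "2 \<le> s" by (auto simp: validS_def)
    then show ?case using Eop_sg(2)[OF Eop_HH'[OF ESE2(2)]] ESE2(1) by (simp add: hprod_def Sg_def Eg_def)
  next
    case R7
    then have rs: "2 \<le> r" "2 \<le> s" by (auto simp: validS_def)
    \<comment> \<open>Both sides of the relation act as 0: on \<open>HH'\<close> the product E S^-1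
      S E contracts to z \<rho> - z \<rho>.\<close>
    have 0: "Eop (sg (r - 1) * (sg (r + 1) * y) + (inverse q - q) *h (sg (r + 1) * y)) = 0" if "y \<in> HH'" for y
      unfolding Eop_linear using Eop_sg(2,3)[OF that] rs by (simp add: hs.scale_left_diff_distrib[symmetric] hs.scale_left_distrib[symmetric] left_diff_distrib del: One_nat_def)
    have "sg (r - 1) * v \<in> HH" "sg (r + 1) * v \<in> HH" using HH_left[OF sg_H] R7 by auto
    from 0[OF Eop_HH'[OF this(1)]] 0[OF Eop_HH'[OF this(2)]] show ?case
      using R7(1,2) by (simp add: hprod_def Sg_def Eg_def Sinv_def)
  next
    case R8
    then have rs: "2 \<le> r" "2 \<le> s" by (auto simp: validS_def)
    have 0: "Eop (sg (r - 1) * (sg (r + 1) * y) + (inverse q - q) *h (sg (r + 1) * y)) = 0" if "y \<in> HH'" for y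
      unfolding Eop_linear using Eop_sg(2,3)[OF that] rs by (simp add: hs.scale_left_diff_distrib[symmetric] hs.scale_left_distrib[symmetric] left_diff_distrib del: One_nat_def)
    from 0[OF Eop_HH'[OF R8(3)]] show ?case using R8(1,2) by (simp add: hprod_def Sg_def Eg_def Sinv_def)
  qed
qed (auto simp: HH_def hs.span_add hs.span_scale hs.scale_right_distrib hs.scale_left_distrib add_ac)

lemma ex_act:
  "h \<in> HL r ==> \<exists>x. wf r s x \<and> (\<forall>y\<in>HH. M.act x y = h * y)"
  "h \<in> HR s ==> \<exists>x. wf r s x \<and> (\<forall>y\<in>HH. M.act x y = h * y)"
proof -
  have *: "\<exists>x. wf r s x \<and> (\<forall>y\<in>HH. M.act x y = h * y)" if h: "h \<in> hs.alg A u" and A: "\<And>g. g \<in> A ==> \<exists>i. validS r s i \<and> g = sg i" for A h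
    using h
  proof (induction rule: hs.alg.induct)
    case alg_unit
    then show ?case using HH_u by (intro exI[of _ "Sc 1"]) simp
  next
    case (alg_add x y)
    then obtain x' y' where "wf r s x'" "\<forall>w\<in>HH. M.act x' w = x * w" "wf r s y'" "\<forall>w\<in>HH. M.act y' w = y * w" by auto
    then show ?case by (intro exI[of _ "Pl x' y'"]) (simp add: distrib_right)
  next
    case (alg_scale x a)
    then obtain x' where "wf r s x'" "\<forall>w\<in>HH. M.act x' w = x * w" by auto
    then show ?case by (intro exI[of _ "Tm (Sc a) x'"]) simp
  next
    case (alg_gen g x)
    then obtain x' where "wf r s x'" "\<forall>w\<in>HH. M.act x' w = x * w" by auto
    moreover obtain i where "validS r s i" "g = sg i" using A alg_gen by blast
    ultimately show ?case by (intro exI[of _ "Tm (Sg i) x'"]) (simp add: Sg_def mult.assoc)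
  qed
  show "\<exists>x. wf r s x \<and> (\<forall>y\<in>HH. M.act x y = h * y)" if "h \<in> HL r"
    using that unfolding SL.H_def by (rule *) (use gens_L in blast)
  show "\<exists>x. wf r s x \<and> (\<forall>y\<in>HH. M.act x y = h * y)" if "h \<in> HR s"
    using that unfolding W.Rv.H_def by (rule *) (use gens_R in blast)
qed

text \<open>By the eigenvalue condition w1 w2 is annihilated by \<theta> on the right. This property
  is stable under the action and forces E to act by 0, while w1 w2 itself is obtained from a vector
  in the image of E.\<close>

lemma not_semisimple_eigen:
  assumes rs: "2 \<le> r \<or> 2 \<le> s" and w: "w1 \<in> HL r" "w2 \<in> HR s" "w1 * w2 \<noteq> 0"
    and e: "w1 * LX = c1 *h w1" "w2 * RX = c2 *h w2" "c1 * c2 * (\<rho> * \<rho>) = 1"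
  shows "\<not> semisimple r s q \<rho>"
proof -
  let ?w = "w1 * w2"
  have wHH: "?w \<in> HH" by (rule HH_prod[OF w(1,2)])
  have "?w * (LX * RX) = w1 * ((w2 * LX) * RX)" by (simp only: mult.assoc)
  also have "w2 * LX = LX * w2" using HL_comm[OF LX_H w(2)] by simp
  also have "w1 * (LX * w2 * RX) = (w1 * LX) * (w2 * RX)" by (simp only: mult.assoc)
  also have "\<dots> = (c1 * c2) *h ?w" unfolding e(1,2) by simp
  also have "c1 * c2 = inverse (\<rho> * \<rho>)" using e(3) rho0 by (simp add: field_simps)
  finally have "?w * (LX * RX) = inverse (\<rho> * \<rho>) *h ?w" .
  moreover have "?w * u = ?w" using W.Rv.H_u_right[OF w(2)] by (simp add: mult.assoc)
  ultimately have w\<theta>: "?w * \<theta> = 0" unfolding \<theta>_def by (simp only: hs.mult_scale_right right_diff_distrib) simp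
  \<comment> \<open>The generators S act from the left, and E v is an expectation of v \<theta>,
    which is 0.\<close>
  have K: "M.act x v * \<theta> = 0" if "v * \<theta> = 0" for x v
    using that
  proof (induction x arbitrary: v)
    case (Gen g)
    then show ?case using eL_linear(2)[of 0 0] eR_linear(2)[of 0 0] by (cases g) (auto simp: mult.assoc Eop_def)
  qed (auto simp: distrib_right)
  have E0: "mop E (M.act x ?w) = 0 *h ?w" for x
    using K[OF w\<theta>, of x] eL_linear(2)[of 0 0] eR_linear(2)[of 0 0] by (simp add: Eop_def)
  have u': "u \<in> HH'" unfolding HH'_def prods_def
    by (rule hs.span_base) (use SL.H_u[of "r - 1"] W.Rv.H_u[of "s - 1"] uu in force)
  \<comment> \<open>As \<delta> may vanish, u is reached through a generator next to the wall: E
    sends \<rho>^-1 S to u.\<close>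
  obtain t where t: "t \<in> HH" "Eop t = u"
  proof (cases "2 \<le> r")
    case True
    have v: "validS r s (r - 1)" using True by (auto simp: validS_def)
    have "sg (r - 1) * u \<in> HH" by (rule HH_left[OF sg_H[OF v] HH'_sub[OF u']])
    then have "inverse \<rho> *h (sg (r - 1) * u) \<in> HH" unfolding HH_def by (rule hs.span_scale)
    moreover have "Eop (inverse \<rho> *h (sg (r - 1) * u)) = u" using Eop_sg(1)[OF u' True] rho0 by (simp add: Eop_linear del: sg_u)
    ultimately show ?thesis by (rule that)
  next
    case False
    then have s: "2 \<le> s" using rs by simp
    have v: "validS r s (r + 1)" using s by (auto simp: validS_def)
    have "sg (r + 1) * u \<in> HH" by (rule HH_left[OF sg_H[OF v] HH'_sub[OF u']])
    then have "inverse \<rho> *h (sg (r + 1) * u) \<in> HH" unfolding HH_def by (rule hs.span_scale)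
    moreover have "Eop (inverse \<rho> *h (sg (r + 1) * u)) = u" using Eop_sg(2)[OF u' s] rho0 by (simp add: Eop_linear del: sg_u)
    ultimately show ?thesis by (rule that)
  qed
  obtain x1 where x1: "wf r s x1" "\<forall>y\<in>HH. M.act x1 y = w1 * y" using ex_act(1)[OF w(1)] by blast
  obtain x2 where x2: "wf r s x2" "\<forall>y\<in>HH. M.act x2 y = w2 * y" using ex_act(2)[OF w(2)] by blast
  have uHH: "u \<in> HH" by (rule HH'_sub[OF u'])
  have w2: "w2 \<in> HH" using HH_prod[OF u_HL w(2)] W.Rv.H_u_left[OF _ w(2)] by simp
  have "M.act (Tm x1 x2) (mop E t) = ?w" using x1 x2 t uHH w2 W.Rv.H_u_right[OF w(2)] by simp
  moreover have "wf r s (Tm x1 x2)" using x1 x2 by simp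
  ultimately show ?thesis
    by (intro not_semisimpleI[OF M.hmodule_axioms wHH _ E0, of "Tm x1 x2" t]) (use w(3) t(1) in auto)
qed

text \<open>The contents that \<open>ex_eigen\<close> realises at the last box of a tableau with n
  boxes.\<close>

definition last_content :: "nat => int => bool" where
  "last_content n a \<longleftrightarrow> (\<exists>p. a = - int p \<and> 1 \<le> p \<and> p + 1 \<le> n) \<or> (a = 1 \<and> 2 \<le> n) \<or> (a = 0 \<and> (n = 1 \<or> 4 \<le> n))"

lemma not_semisimple_contents:
  assumes rs: "2 \<le> r \<or> 2 \<le> s" and ab: "last_content r a" "last_content s b"
    and \<rho>: "\<rho> * \<rho> * power_int (q ^ 2) (a + b) = 1"
  shows "\<not> semisimple r s q \<rho>"
proof -
  obtain w1 where w1: "w1 \<in> HL r" "u * w1 \<noteq> 0" "w1 * LX = SL.qe a *h w1"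
    using LE.ex_eigen[OF ab(1)[unfolded last_content_def]] unfolding LX_def by blast
  have uw: "u * w1 = w1" "w1 * u = w1" using SL.H_u_left[OF _ w1(1)] SL.H_u_right[OF w1(1)] by auto
  \<comment> \<open>Taking w1 for the test element v guarantees that the eigenvector found on the
    right has a nonzero product with w1.\<close>
  have "hecke_expect hscale u q W.Tr s RB.ep w1"
  proof (rule RB.hecke_expect_ep)
    show "w1 \<noteq> 0" using w1(2) by auto
    show "w1 * W.Tr k = W.Tr k * w1" if "Suc k < s" for k by (rule HL_comm[OF w1(1) W.Rv.H_S[OF that order.refl]])
    show "RB.ep m (w1 * x) = w1 * RB.ep m x" if "m < s" for m x by (rule ep_R_L[OF that w1(1)])
  qed (use uw in auto)
  then obtain w2 where w2: "w2 \<in> HR s" "w1 * w2 \<noteq> 0" "w2 * RX = SL.qe b *h w2"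
    using hecke_expect.ex_eigen[of hscale u q W.Tr s RB.ep w1 b] ab(2)[unfolded last_content_def] unfolding RX_def by blast
  have "SL.qe a * SL.qe b * (\<rho> * \<rho>) = 1"
    using \<rho> SL.qe_add[of a b] unfolding SL.qe_def by (simp add: mult.commute)
  then show ?thesis using not_semisimple_eigen[OF rs w1(1) w2(1,2) w1(3) w2(3)] by blast
qed

end

context presentation
begin

text \<open>The second axis is a submodule killed by \<open>E\<close> which is generated by vectors in the image of \<open>E\<close>.\<close>

fun op2 :: "gen => 'k \<times> 'k => 'k \<times> 'k" where
  "op2 (S i) v = (q * fst v, - inverse q * snd v)"
| "op2 E v = (delta q \<rho> * fst v, fst v)"

abbreviation "pl2 \<equiv> \<lambda>v w. (fst v + fst w, snd v + snd w :: 'k)"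
abbreviation "sc2 \<equiv> \<lambda>c v. (c * fst v, c * snd v :: 'k)"

lemma hmodule_op2:
  assumes near: "\<And>j. validS r s j ==> (j + 1 = r \<or> j = r + 1) \<and> \<rho> = q * delta q \<rho>"
  shows "hmodule r s q \<rho> pl2 sc2 op2 UNIV"
proof
  fix x y :: "'k hexp" and v assume "hrel r s q \<rho> x y"
  then show "hact pl2 sc2 op2 x v = hact pl2 sc2 op2 y v"
  proof (induction rule: hrel.induct)
    case (quad i)
    then show ?case using q0 by (simp add: Sg_def algebra_simps)
  next
    case (ES j)
    then show ?case using near[of j] by simp
  next
    case ESE1
    then have "\<rho> = q * delta q \<rho>" using near by blast
    then have "\<rho> * (delta q \<rho> * c) = delta q \<rho> * (q * (delta q \<rho> * c))" "\<rho> * c = q * (delta q \<rho> * c)" for c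
      by (simp_all add: mult_ac)
    then show ?case by (simp add: hprod_def Sg_def Eg_def)
  next
    case ESE2
    then have "\<rho> = q * delta q \<rho>" using near by blast
    then have "\<rho> * (delta q \<rho> * c) = delta q \<rho> * (q * (delta q \<rho> * c))" "\<rho> * c = q * (delta q \<rho> * c)" for c
      by (simp_all add: mult_ac)
    then show ?case by (simp add: hprod_def Sg_def Eg_def)
  qed (simp_all add: hprod_def Sg_def Eg_def)
next
  show "op2 g (pl2 v w) = pl2 (op2 g v) (op2 g w)" for g v w by (cases g) (auto simp: distrib_left)
  show "op2 g (sc2 a v) = sc2 a (op2 g v)" for g a v by (cases g) (auto simp: mult.left_commute)
qed (auto simp: algebra_simps)

lemma not_semisimple_op2:
  assumes "\<And>j. validS r s j ==> (j + 1 = r \<or> j = r + 1) \<and> \<rho> = q * delta q \<rho>"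
    and "delta q \<rho> \<noteq> 0 ==> validS r s i"
  shows "\<not> semisimple r s q \<rho>"
proof -
  interpret M: hmodule r s q \<rho> pl2 sc2 op2 UNIV by (rule hmodule_op2[OF assms(1)])
  have K: "fst (M.act x v) = 0" if "fst v = 0" for x v using that
  proof (induction x arbitrary: v)
    case (Gen g)
    then show ?case by (cases g) auto
  qed auto
  have E0: "op2 E (M.act x (0, 1)) = sc2 0 (0, 1)" for x using K[of "(0, 1)" x] by simp
  have q4: "q + inverse q \<noteq> 0"
  proof
    assume "q + inverse q = 0"
    then have "inverse q = - q" by (simp add: add_eq_0_iff)
    then have "q * q = - 1" using q0 by (metis minus_mult_right minus_minus right_inverse)
    then have "q ^ 4 = 1" by (simp add: power4_eq_xxxx mult.assoc)
    then show False using generic[of 4] by simp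
  qed
  have "\<exists>x. wf r s x \<and> (0, 1) = M.act x (op2 E (1, 0))"
  proof (cases "delta q \<rho> = 0")
    case True
    then show ?thesis by (intro exI[of _ "Sc 1"]) simp
  next
    case False
    show ?thesis
    proof (intro exI conjI)
      \<comment> \<open>E sends (1, 0) to (\<delta>, 1). As S has the eigenvalues q and - q^-1 on
        the axes, q - S removes the first coordinate and multiplies the second by q + q^-1.\<close>
      show "wf r s (Tm (Sc (inverse (q + inverse q))) (Pl (Sc q) (Tm (Sc (- 1)) (Sg i))))"
        using assms(2)[OF False] by (simp add: Sg_def)
      show "(0, 1) = M.act (Tm (Sc (inverse (q + inverse q))) (Pl (Sc q) (Tm (Sc (- 1)) (Sg i)))) (op2 E (1, 0))"
        using q4 by (simp add: Sg_def)
    qed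
  qed
  then obtain x where x: "wf r s x" "(0, 1) = M.act x (op2 E (1, 0))" by blast
  show ?thesis by (rule not_semisimpleI[OF M.hmodule_axioms _ _ _ x(1) _ x(2)]) (use E0 in auto)
qed

text \<open>For \<rho> = q^N the eigenvalue condition asks for last contents with sum - N. No such
  pair exists for (1, 1) with N = 0 in the form required, where E is not reached by a generator next
  to the wall, nor for (2, 2) with N = 1; these two use the module \<open>op2\<close>.\<close>

theorem not_semisimple_power:
  assumes \<rho>: "\<rho> = q ^ N" and N: "N + 2 \<le> r + s"
    and exc: "\<not> (N = 0 \<and> ((r = 1 \<and> (s = 2 \<or> s = 3)) \<or> (s = 1 \<and> (r = 2 \<or> r = 3))))"
  shows "\<not> semisimple r s q \<rho>"
proof -
  interpret A: two_inductions r s q \<rho> by unfold_locales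
  have *: "\<not> semisimple r s q \<rho>" if "2 \<le> r \<or> 2 \<le> s" "A.last_content r a" "A.last_content s b" "a + b = - int N" for a b
  proof (rule A.not_semisimple_contents[OF that(1-3)])
    have "power_int (q ^ 2) (a + b) = inverse ((q ^ 2) ^ N)" by (simp add: that(4) power_int_minus)
    moreover have "\<rho> * \<rho> = (q ^ 2) ^ N" by (simp add: \<rho> power_mult[symmetric] power_add[symmetric] mult_2)
    ultimately show "\<rho> * \<rho> * power_int (q ^ 2) (a + b) = 1" using q0 by simp
  qed
  note lc = A.last_content_def
  consider (one) "r = 1" "s = 1" | (left) "r = 1" "2 \<le> s" | (right) "2 \<le> r" "s = 1" | (both) "2 \<le> r" "2 \<le> s"
    using r1 s1 by linarith
  then show ?thesis
  proof cases
    case one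
    have "delta q \<rho> = 0" using N one by (simp add: \<rho> delta_def)
    then show ?thesis using one by (intro not_semisimple_op2[where i = 0]) (auto simp: validS_def)
  next
    case left
    then show ?thesis
      by (intro *[of 0 "- int N"]) (use N exc in \<open>auto simp: lc\<close>)
  next
    case right
    then show ?thesis
      by (intro *[of "- int N" 0]) (use N exc in \<open>auto simp: lc\<close>)
  next
    case both
    \<comment> \<open>Two boxes end in content 1 or -1, so for r = s = 2 the sums have even parity
      and - 1 is out of reach. If one side has three boxes, its content - 2 goes with the content 1
      of the other side.\<close>
    consider "N = 0" | "N = 1" "3 \<le> s" | "N = 1" "3 \<le> r" | "N = 1" "r = 2" "s = 2" | "2 \<le> N" using both by linarith
    then show ?thesis
    proof cases
      case 1
      have "A.last_content s (- 1)" unfolding lc using both by (intro disjI1 exI[of _ 1]) auto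
      then show ?thesis using both 1 by (intro *[of 1 "- 1"]) (auto simp: lc)
    next
      case 2
      have "A.last_content s (- 2)" unfolding lc using 2 by (intro disjI1 exI[of _ 2]) auto
      then show ?thesis using both 2 by (intro *[of 1 "- 2"]) (auto simp: lc)
    next
      case 3
      have "A.last_content r (- 2)" unfolding lc using 3 by (intro disjI1 exI[of _ 2]) auto
      then show ?thesis using both 3 by (intro *[of "- 2" 1]) (auto simp: lc)
    next
      case 4
      have "delta q \<rho> = 1" using 4 z0 by (simp add: \<rho> delta_def)
      then show ?thesis using 4 by (intro not_semisimple_op2[where i = 1]) (auto simp: validS_def \<rho>)
    next
      case 5
      \<comment> \<open>N is split into two positive parts, at most r - 1 and at most s - 1, the
        lengths of the legs of two hooks.\<close>
      define p where "p = (if N \<le> r then N - 1 else r - 1)"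
      have p: "1 \<le> p" "p + 1 \<le> r" "1 \<le> N - p" "N - p + 1 \<le> s" "p \<le> N" using 5 both N by (auto simp: p_def)
      have "A.last_content r (- int p)" "A.last_content s (- int (N - p))" unfolding lc using p by blast+
      then show ?thesis using both p by (intro *[of "- int p" "- int (N - p)"]) (auto simp: of_nat_diff)
    qed
  qed
qed

end

section \<open>The centre\<close>

lemma Fract_power: "Fract a 1 ^ n = Fract (a ^ n) (1 :: 'a::idom)"
  by (induction n) (simp_all add: One_fract_def)

lemma inj_of_nat_fract: "inj (of_nat :: nat => 'a::{idom,ring_char_0} fract)"
proof (rule injI)
  fix m n :: nat
  have f: "(of_nat k :: 'a fract) = Fract (of_nat k) 1" for k
    by (induction k) (simp_all add: Zero_fract_def One_fract_def)
  assume "(of_nat m :: 'a fract) = of_nat n"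
  then show "m = n" unfolding f by (simp add: eq_fract)
qed

lemma qC_generic: "0 < m ==> qC ^ m \<noteq> 1"
proof
  assume m: "0 < m" and "qC ^ m = 1"
  then have "[:0, 1:] ^ m = (1 :: complex poly)" by (simp add: qC_def Fract_power One_fract_def eq_fract)
  then have "degree ([:0, 1:] ^ m :: complex poly) = 0" by simp
  then show False using m by (simp add: degree_power_eq)
qed

lemma qCC_generic: "0 < m ==> qCC ^ m \<noteq> 1"
proof
  assume m: "0 < m" and "qCC ^ m = 1"
  then have "[:[:0, 1:]:] ^ m = (1 :: complex poly poly)" by (simp add: qCC_def Fract_power One_fract_def eq_fract)
  then have "[:[:0, 1:] ^ m:] = (1 :: complex poly poly)" by (simp add: poly_const_pow)
  then have "[:0, 1:] ^ m = (1 :: complex poly)" by (simp add: one_pCons)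
  then have "degree ([:0, 1:] ^ m :: complex poly) = 0" by simp
  then show False using m by (simp add: degree_power_eq)
qed

lemma qC_nz: "qC \<noteq> 0" and qCC_nz: "qCC \<noteq> 0" and rhoCC_nz: "rhoCC \<noteq> 0"
  by (simp_all add: qC_def qCC_def rhoCC_def Zero_fract_def eq_fract)

text \<open>The other factor does not involve the indeterminate \<rho>, so the degree in \<rho> of
  the product would have to be 2 and 0 at once.\<close>

lemma rhoCC_generic: "rhoCC * rhoCC * power_int (qCC ^ 2) m \<noteq> 1"
proof
  assume h: "rhoCC * rhoCC * power_int (qCC ^ 2) m = 1"
  have d: "degree ([:0, 1:] * [:0, 1:] :: complex poly poly) = 2" by (simp add: degree_mult_eq)
  have q: "(qCC ^ 2) ^ k = Fract [:([:0, 1:] ^ 2) ^ k:] 1" for k by (simp add: qCC_def Fract_power poly_const_pow)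
  have c: "[:0, 1:] * [:0, 1:] = ([:a:] :: complex poly poly) ==> False" for a using d by (metis degree_pCons_0 zero_neq_numeral)
  show False
  proof (cases "0 \<le> m")
    case True
    then obtain k where "m = int k" using nonneg_int_cases by blast
    then have "([:0, 1:] * [:0, 1:]) * [:([:0, 1:] ^ 2) ^ k:] = (1 :: complex poly poly)"
      using h by (simp add: q rhoCC_def One_fract_def eq_fract)
    from arg_cong[OF this, of degree] show False by (simp add: degree_mult_eq)
  next
    case False
    then obtain k where k: "m = - int k" by (metis le_cases nonpos_int_cases)
    have "rhoCC * rhoCC = (qCC ^ 2) ^ k" using h qCC_nz by (simp add: k power_int_minus field_simps)
    then have "[:0, 1:] * [:0, 1:] = ([:([:0, 1:] ^ 2) ^ k:] :: complex poly poly)"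
      by (simp add: q rhoCC_def eq_fract del: mult_pCons_left mult_pCons_right)
    then show False by (rule c)
  qed
qed

theorem mainTheorem20:
  fixes r s :: nat
  assumes "1 \<le> r" and "1 \<le> s"
  shows
    "(\<forall>N::nat. semisimple r s qC (qC ^ N) \<longrightarrow>
       (\<forall>x :: complex poly fract hexp. wf r s x \<longrightarrow>
          (in_center r s qC (qC ^ N) x \<longleftrightarrow>
           (\<exists>p. supersymmetric r s p \<and> heq r s qC (qC ^ N) x (eval_JM r s qC (qC ^ N) p)))))
   \<and> (\<forall>x :: complex poly poly fract hexp. wf r s x \<longrightarrow>
          (in_center r s qCC rhoCC x \<longleftrightarrow>
           (\<exists>p. supersymmetric r s p \<and> heq r s qCC rhoCC x (eval_JM r s qCC rhoCC p))))"
proof (intro conjI allI impI)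
  fix N :: nat and x :: "complex poly fract hexp"
  assume ss: "semisimple r s qC (qC ^ N)" and x: "wf r s x"
  interpret presentation r s qC "qC ^ N"
    by unfold_locales (use assms qC_nz qC_generic in auto)
  have inj: "inj (of_nat :: nat \<Rightarrow> complex poly fract)" by (rule inj_of_nat_fract)
  have two: "(2 :: complex poly fract) \<noteq> 0" using injD[OF inj, of 2 0] by auto
  have "\<exists>\<Omega> \<epsilon>. W.resolved \<Omega> \<epsilon>"
  \<comment> \<open>In this range semisimplicity leaves only the exceptional pairs with N = 0;
    beyond it the parameters are generic.\<close>
  proof (cases "N + 2 \<le> r + s")
    case True
    then have exc: "N = 0 \<and> ((r = 1 \<and> (s = 2 \<or> s = 3)) \<or> (s = 1 \<and> (r = 2 \<or> r = 3)))"
      using not_semisimple_power[OF HOL.refl] ss by blast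
    then have "qC ^ N * qC ^ N = 1" by simp
    then show ?thesis using W.exceptional_right[OF inj] W.exceptional_left[OF inj] exc by blast
  next
    case False
    have "qC ^ N * qC ^ N * power_int (qC ^ 2) m \<noteq> 1" if "\<bar>m\<bar> < int r + int s - 1" for m
    proof
      assume h: "qC ^ N * qC ^ N * power_int (qC ^ 2) m = 1"
      have "qC ^ N * qC ^ N = power_int (qC ^ 2) (int N)" by (simp add: power_mult[symmetric] power_add[symmetric] mult_2)
      \<comment> \<open>The forbidden equation reads q^(2(N + m)) = 1, that is m = - N, but |m| < r
        + s - 1 \<le> N.\<close>
      then have "power_int (qC ^ 2) (int N + m) = power_int (qC ^ 2) 0" using h qC_nz by (simp add: power_int_add)
      then have "int N + m = 0"
        using power_int_generic_inj[of "qC ^ 2" "int N + m" 0] qC_nz qC_generic by (simp add: power_mult[symmetric])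
      then show False using that False by linarith
    qed
    then show ?thesis using generic_resolved[OF inj W.walled_axioms] by blast
  qed
  then show "in_center r s qC (qC ^ N) x \<longleftrightarrow> (\<exists>p. supersymmetric r s p \<and> heq r s qC (qC ^ N) x (eval_JM r s qC (qC ^ N) p))"
    using in_center_iff_supersymmetric[OF two _ x] by blast
next
  fix x :: "complex poly poly fract hexp"
  assume x: "wf r s x"
  interpret presentation r s qCC rhoCC
    by unfold_locales (use assms qCC_nz qCC_generic rhoCC_nz in auto)
  have inj: "inj (of_nat :: nat \<Rightarrow> complex poly poly fract)" by (rule inj_of_nat_fract)
  have two: "(2 :: complex poly poly fract) \<noteq> 0" using injD[OF inj, of 2 0] by auto
  have "\<exists>\<Omega> \<epsilon>. W.resolved \<Omega> \<epsilon>" using generic_resolved[OF inj W.walled_axioms] rhoCC_generic by blast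
  then show "in_center r s qCC rhoCC x \<longleftrightarrow> (\<exists>p. supersymmetric r s p \<and> heq r s qCC rhoCC x (eval_JM r s qCC rhoCC p))"
    using in_center_iff_supersymmetric[OF two _ x] by blast
qed

end
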